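(* Let $n\geq 7$. Let $\delta$ be a $3$-cycle of the complete graph $K_n$ and let $G_n^{(1)}$ be the graph obtained from $K_n$ by the $\Delta Y$-move on $\delta$. Let $\delta'$ be another $3$-cycle of $K_n$ which shares exactly one vertex with $\delta$ (so $\delta'$ is still a $3$-cycle of $G_n^{(1)}$), and let $G_n^{(2)}$ be the graph obtained from $G_n^{(1)}$ by the $\Delta Y$-move on $\delta'$. Then $\mathrm{cr}(G_n^{(2)})<\mathrm{cr}(G_n^{(1)})$.
   Context: A drawing of a graph is a continuous map from the graph (viewed as a topological 1-complex) to the plane $\mathbb{R}^2$ whose only multiple points are finitely many transversal double points (crossings), none at images of vertices. The crossing number $\mathrm{cr}(G)$ of a graph $G$ is the minimum number of crossings over all drawings of $G$. A $\Delta Y$-move on a $3$-cycle with vertices $v_1,v_2,v_3$ of a graph removes the three edges $v_1v_2$, $v_2v_3$, $v_3v_1$, adds a new vertex $v$, and adds the three edges $vv_1$, $vv_2$, $vv_3$. *)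

theory Defs
  imports "HOL-Analysis.Analysis"
begin

record 'a ugraph =
  vertices :: "'a set"
  edges :: "'a set set"

definition complete_graph :: "'a set \<Rightarrow> 'a ugraph" where
  "complete_graph V = \<lparr>vertices = V, edges = {e. e \<subseteq> V \<and> card e = 2}\<rparr>"

text \<open>A 3-cycle of a simple graph is determined by its set of vertices.\<close>

definition three_cycle :: "'a ugraph \<Rightarrow> 'a set \<Rightarrow> bool" where
  "three_cycle G T \<longleftrightarrow>
     T \<subseteq> vertices G \<and> card T = 3 \<and> (\<forall>e. e \<subseteq> T \<and> card e = 2 \<longrightarrow> e \<in> edges G)"

text \<open>The added vertex \<open>v\<close> is a parameter; it is meant to satisfy \<open>v \<notin> vertices G\<close>.\<close>

definition delta_Y :: "'a set \<Rightarrow> 'a \<Rightarrow> 'a ugraph \<Rightarrow> 'a ugraph" where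
  "delta_Y T v G =
     \<lparr>vertices = insert v (vertices G),
      edges = (edges G - {e. e \<subseteq> T \<and> card e = 2}) \<union> {{v, t} | t. t \<in> T}\<rparr>"

lemma three_cycle_delta_Y:
  assumes "three_cycle G T'" and "card (T \<inter> T') = 1"
  shows "three_cycle (delta_Y T v G) T'"
proof -
  have "\<not> e \<subseteq> T" if "e \<subseteq> T'" "card e = 2" for e
  proof
    assume "e \<subseteq> T"
    with that have "e \<subseteq> T \<inter> T'" by blast
    moreover have "finite (T \<inter> T')" using assms(2) by (intro card_ge_0_finite) simp
    ultimately have "card e \<le> card (T \<inter> T')" by (intro card_mono)
    with that assms(2) show False by simp
  qed
  with assms(1) show ?thesis
    unfolding three_cycle_def delta_Y_def ugraph.simps by blast
qed

text \<open>
  The graph as a topological 1-complex, in barycentric coordinates: the points whose support is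
  a vertex or an edge, with the subspace topology from the product topology on
  \<open>'a \<Rightarrow> real\<close>.  For a finite graph this is the usual topology of the complex.
\<close>

definition realization :: "'a ugraph \<Rightarrow> ('a \<Rightarrow> real) set" where
  "realization G =
     {x. (\<forall>v. 0 \<le> x v) \<and>
         {v. x v \<noteq> 0} \<in> (\<lambda>v. {v}) ` vertices G \<union> edges G \<and>
         (\<Sum>v | x v \<noteq> 0. x v) = 1}"

definition vertex_point :: "'a \<Rightarrow> 'a \<Rightarrow> real" where
  "vertex_point v = indicat_real {v}"

text \<open>The plane is the type \<^typ>\<open>complex\<close>.\<close>

definition multiple_points :: "'a ugraph \<Rightarrow> (('a \<Rightarrow> real) \<Rightarrow> complex) \<Rightarrow> complex set" where
  "multiple_points G f =
     {z. \<exists>x\<in>realization G. \<exists>y\<in>realization G. x \<noteq> y \<and> f x = z \<and> f y = z}"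

text \<open>
  Drawings are merely continuous, so transversality is meant topologically: some neighbourhood
  \<open>U\<close> of \<open>z\<close> is homeomorphic to the plane in such a way that the branch of the drawing through
  one preimage becomes the real axis and the branch through the other the imaginary axis.
  The branches \<open>A\<close>, \<open>B\<close> have to be open in the complex: otherwise two branches that merely
  touch at \<open>z\<close> could be cut at \<open>z\<close> and reassembled into the two axes.
\<close>

definition transversal_double_point ::
    "'a ugraph \<Rightarrow> (('a \<Rightarrow> real) \<Rightarrow> complex) \<Rightarrow> complex \<Rightarrow> bool" where
  "transversal_double_point G f z \<longleftrightarrow>
     (\<exists>x y. x \<noteq> y \<and> {u \<in> realization G. f u = z} = {x, y} \<and>
       (\<exists>U A B h k.
          open U \<and> z \<in> U \<and>
          openin (top_of_set (realization G)) A \<and> x \<in> A \<and>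
          openin (top_of_set (realization G)) B \<and> y \<in> B \<and>
          A \<inter> B = {} \<and> {u \<in> realization G. f u \<in> U} = A \<union> B \<and>
          homeomorphism U UNIV h k \<and> h z = 0 \<and>
          h ` f ` A = {w. Im w = 0} \<and> h ` f ` B = {w. Re w = 0}))"

definition is_drawing :: "'a ugraph \<Rightarrow> (('a \<Rightarrow> real) \<Rightarrow> complex) \<Rightarrow> bool" where
  "is_drawing G f \<longleftrightarrow>
     continuous_on (realization G) f \<and>
     finite (multiple_points G f) \<and>
     (\<forall>z\<in>multiple_points G f. transversal_double_point G f z) \<and>
     (\<forall>v\<in>vertices G. f (vertex_point v) \<notin> multiple_points G f)"

definition crossing_number :: "'a ugraph \<Rightarrow> nat" where
  "crossing_number G = (LEAST k. \<exists>f. is_drawing G f \<and> card (multiple_points G f) = k)"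

end

theory Submission
  imports Defs
begin

text \<open>
  Suppose the second move does not lower the crossing number, and fix a drawing of \<open>G1\<close> with the least
  number of crossings, made straight near vertices and crossings.  A triangle with one vertex in
  \<open>\<delta>\<close> and two outside can be turned into a star inside the drawing: put the new vertex on the edge
  \<open>vp\<close> close to \<open>v\<close>, keep \<open>vp\<close>, reroute \<open>vq\<close> along a small circle around \<open>v\<close>, and delete \<open>pq\<close>.
  By symmetry of \<open>G1\<close> the result is a drawing of \<open>G2\<close>, so minimality forces the number of crossings
  on \<open>pq\<close> to be at most the number of edges at \<open>v\<close> in either sector between \<open>vp\<close> and \<open>vq\<close>, and
  forbids crossings of \<open>vp\<close> with \<open>vq\<close>.  Together with the Jordan curve theorem for uncrossed cycles,
  these inequalities on the cyclic orders around the vertices are contradictory.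
\<close>

section \<open>Rotation systems around a Y\<close>

text \<open>List \<open>W\<close> in the order in which the edges leave some \<open>s\<close> in
  \<open>D\<close>, cut at the edge \<open>su\<close>. The corner inequality bounds the crossings
  between the i-th and the j-th vertex by j - i - 1, so consecutive vertices span an uncrossed
  Hamiltonian path of \<open>W\<close> and chords over one vertex are crossed at most once. A
  triangle on three consecutive vertices x, y, z then has every other vertex on one side, and for
  one of the first three choices of y the edge \<open>ys\<close> turns out to be alone in its sector
  between \<open>yx\<close> and \<open>yz\<close>. Since \<open>D\<close> hangs together through
  \<open>u\<close>, such a y is a cut vertex of the graph of uncrossed edges. Hence it has the same
  position in the lists of all elements of \<open>D\<close>, up to reversal, and it can serve only
  one \<open>s\<close>. Three elements of \<open>D\<close> in three admissible positions means three
  consecutive positions, and this forces two crossings on an edge that admits one. The number 7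
  enters as \<open>4 \<le> card W\<close>. For exactly four outer vertices one more configuration
  has to be excluded; there a pigeonhole argument works, because each outer vertex would need an
  uncrossed edge to an element of \<open>D\<close> of its own.\<close>

definition sepr :: "real \<Rightarrow> real \<Rightarrow> real \<Rightarrow> real \<Rightarrow> bool" where
  "sepr p q x y \<longleftrightarrow>
     ((p < x \<and> x < q) \<or> (q < x \<and> x < p)) \<noteq> ((p < y \<and> y < q) \<or> (q < y \<and> y < p))"

fun path_edges :: "'a list \<Rightarrow> 'a set set" where
  "path_edges (x # y # zs) = insert {x, y} (path_edges (y # zs))"
| "path_edges _ = {}"

definition cycle_edges :: "'a list \<Rightarrow> 'a set set" where
  "cycle_edges vs = insert {last vs, hd vs} (path_edges vs)"

definition Y_edges :: "'a set \<Rightarrow> 'a set \<Rightarrow> 'a \<Rightarrow> 'a set set" where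
  "Y_edges D W u = {{x, y} | x y. x \<in> W \<and> y \<in> W \<and> x \<noteq> y} \<union> {{s, x} | s x. s \<in> D \<and> x \<in> W}
     \<union> {{u, s} | s. s \<in> D}"

lemma sepr_commute: "sepr p q x y = sepr q p x y" "sepr p q x y = sepr p q y x"
  unfolding sepr_def by auto

lemma sepr_trans: "\<not> sepr p q x y \<Longrightarrow> \<not> sepr p q y z \<Longrightarrow> \<not> sepr p q x z"
  unfolding sepr_def by auto

text \<open>With real numbers as the points of a circle that has been cut open,
  \<open>sepr p q x y\<close> says that the chords \<open>pq\<close> and \<open>xy\<close> cross. Of
  the three ways to split four distinct points into two pairs, exactly one gives crossing
  chords.\<close>

lemma sepr_four:
  assumes "distinct [p, q, x, y]"
  shows "sepr p q x y \<or> sepr p x q y \<or> sepr p y q x"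
    "sepr p q x y \<Longrightarrow> \<not> sepr p x q y" "sepr p q x y \<Longrightarrow> \<not> sepr p y q x"
    "sepr p q x y \<longleftrightarrow> sepr x y p q"
  using assms unfolding sepr_def distinct.simps list.set by (smt (verit) insert_iff)+

text \<open>
  \<open>r e\<close> is the number of crossings on \<open>e\<close> and \<open>ang v w\<close> the direction in which the edge \<open>vw\<close> leaves \<open>v\<close>.
  For the edge set \<open>C\<close> of a cycle, \<open>gs C v w\<close> says that \<open>vw\<close> starts at \<open>v\<close> into the inside of the closed
  curve \<open>C\<close>, and \<open>vin C v\<close> that \<open>v\<close> itself lies inside.  The assumptions \<open>corner\<close> and \<open>nocross\<close> are the
  consequences of minimality.
\<close>

locale rotation_drawing =
  fixes D W :: "'a set" and u :: 'a
    and r :: "'a set \<Rightarrow> nat" and cross :: "'a set \<Rightarrow> 'a set \<Rightarrow> bool"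
    and ang :: "'a \<Rightarrow> 'a \<Rightarrow> real"
    and gs :: "'a set set \<Rightarrow> 'a \<Rightarrow> 'a \<Rightarrow> bool" and vin :: "'a set set \<Rightarrow> 'a \<Rightarrow> bool"
    and E :: "'a set set" and is_cycle :: "'a list \<Rightarrow> bool"
    and sep :: "'a \<Rightarrow> 'a \<Rightarrow> 'a \<Rightarrow> 'a \<Rightarrow> 'a \<Rightarrow> bool"
  defines "E \<equiv> Y_edges D W u"
    and "is_cycle \<equiv> \<lambda>vs. 3 \<le> length vs \<and> distinct vs \<and> cycle_edges vs \<subseteq> E \<and>
           (\<forall>e\<in>cycle_edges vs. \<forall>f\<in>cycle_edges vs. \<not> cross e f)"
    and "sep \<equiv> \<lambda>v p q x y. sepr (ang v p) (ang v q) (ang v x) (ang v y)"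
  assumes D3: "card D = 3" and finW: "finite W" and W4: "4 \<le> card W"
    and disj: "D \<inter> W = {}" and uD: "u \<notin> D" and uW: "u \<notin> W"
    and cross_sym: "cross e f \<Longrightarrow> cross f e"
    and cross_irrefl: "\<not> cross e e"
    and cross_r: "cross e f \<Longrightarrow> 1 \<le> r e"
    and cross_r2: "cross e f \<Longrightarrow> cross e g \<Longrightarrow> f \<noteq> g \<Longrightarrow> 2 \<le> r e"
    and ang_inj: "{v, x} \<in> E \<Longrightarrow> {v, y} \<in> E \<Longrightarrow> ang v x = ang v y \<Longrightarrow> x = y"
    and ang_range: "0 \<le> ang v x" "ang v x < 2 * pi"
    and corner: "\<And>v p q w s x y. s \<in> D \<Longrightarrow> x \<in> W \<Longrightarrow> y \<in> W \<Longrightarrow> x \<noteq> y \<Longrightarrow> {v, p, q} = {s, x, y} \<Longrightarrow>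
        {v, w} \<in> E \<Longrightarrow> w \<noteq> p \<Longrightarrow> w \<noteq> q \<Longrightarrow>
        r {p, q} \<le> card {e. {v, e} \<in> E \<and> e \<noteq> p \<and> e \<noteq> q \<and> sep v p q e w}"
    and nocross: "\<And>v p q s x y. s \<in> D \<Longrightarrow> x \<in> W \<Longrightarrow> y \<in> W \<Longrightarrow> x \<noteq> y \<Longrightarrow> {v, p, q} = {s, x, y} \<Longrightarrow>
        \<not> cross {v, p} {v, q}"
    and gs_vin: "is_cycle vs \<Longrightarrow> v \<notin> set vs \<Longrightarrow> {v, w} \<in> E \<Longrightarrow>
        gs (cycle_edges vs) v w = vin (cycle_edges vs) v"
    and gs_sector: "is_cycle (v # p # vs) \<Longrightarrow> {v, x} \<in> E \<Longrightarrow> {v, y} \<in> E \<Longrightarrow>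
        x \<noteq> p \<Longrightarrow> y \<noteq> p \<Longrightarrow> x \<noteq> last (p # vs) \<Longrightarrow> y \<noteq> last (p # vs) \<Longrightarrow>
        (gs (cycle_edges (v # p # vs)) v x = gs (cycle_edges (v # p # vs)) v y)
          \<longleftrightarrow> \<not> sep v p (last (p # vs)) x y"
    and gs_nocross: "is_cycle vs \<Longrightarrow> {v, w} \<in> E \<Longrightarrow> {v, w} \<notin> cycle_edges vs \<Longrightarrow>
        \<forall>f\<in>cycle_edges vs. \<not> cross {v, w} f \<Longrightarrow>
        gs (cycle_edges vs) v w = gs (cycle_edges vs) w v"
    and gs_onecross: "is_cycle vs \<Longrightarrow> {v, w} \<in> E \<Longrightarrow> {v, w} \<notin> cycle_edges vs \<Longrightarrow>
        f \<in> cycle_edges vs \<Longrightarrow> cross {v, w} f \<Longrightarrow> r f \<le> 1 \<Longrightarrow>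
        \<forall>g\<in>cycle_edges vs. g \<noteq> f \<longrightarrow> \<not> cross {v, w} g \<Longrightarrow>
        gs (cycle_edges vs) v w \<noteq> gs (cycle_edges vs) w v"
begin

lemma finD: "finite D"
  using D3 by (simp add: card_ge_0_finite)

lemma edge_iff:
  "x \<in> W \<Longrightarrow> y \<in> W \<Longrightarrow> {x, y} \<in> E \<longleftrightarrow> x \<noteq> y"
  "s \<in> D \<Longrightarrow> x \<in> W \<Longrightarrow> {s, x} \<in> E" "s \<in> D \<Longrightarrow> x \<in> W \<Longrightarrow> {x, s} \<in> E"
  "s \<in> D \<Longrightarrow> {u, s} \<in> E" "s \<in> D \<Longrightarrow> {s, u} \<in> E"
  using disj uD uW unfolding E_def Y_edges_def by (auto simp: doubleton_eq_iff)

lemma nbr_W: "x \<in> W \<Longrightarrow> {x, y} \<in> E \<longleftrightarrow> y \<in> W - {x} \<or> y \<in> D"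
  using disj uD uW unfolding E_def Y_edges_def by (auto simp: doubleton_eq_iff)

lemma nbr_D: "s \<in> D \<Longrightarrow> {s, y} \<in> E \<longleftrightarrow> y \<in> W \<or> y = u"
  using disj uD uW unfolding E_def Y_edges_def by (auto simp: doubleton_eq_iff)

lemma cross_r': "cross e f \<Longrightarrow> 1 \<le> r f"
  using cross_sym cross_r by blast

lemma r0_nocross: "r e = 0 \<Longrightarrow> \<not> cross e f" "r e = 0 \<Longrightarrow> \<not> cross f e"
  using cross_r cross_r' by force+

lemma sep_sym: "sep v p q x y \<longleftrightarrow> sep v q p x y" "sep v p q x y \<longleftrightarrow> sep v p q y x"
  unfolding sep_def using sepr_commute by auto

lemma sep_trans: "\<not> sep v p q x y \<Longrightarrow> \<not> sep v p q y z \<Longrightarrow> \<not> sep v p q x z"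
  unfolding sep_def by (rule sepr_trans)

lemma ang_neq: "{v, x} \<in> E \<Longrightarrow> {v, y} \<in> E \<Longrightarrow> x \<noteq> y \<Longrightarrow> ang v x \<noteq> ang v y"
  using ang_inj by blast

lemma cycle_crossed:
  assumes "is_cycle vs" "{v, w} \<in> E" "{v, w} \<notin> cycle_edges vs"
    and "gs (cycle_edges vs) v w \<noteq> gs (cycle_edges vs) w v"
  obtains f where "f \<in> cycle_edges vs" "cross {v, w} f"
  using gs_nocross[OF assms(1-3)] assms(4) by blast

lemma tri_cycle:
  assumes "distinct [x, y, z]" "{x, y} \<in> E" "{y, z} \<in> E" "{x, z} \<in> E"
    "\<not> cross {x, y} {y, z}" "\<not> cross {y, z} {x, z}" "\<not> cross {x, y} {x, z}"
  shows "is_cycle [x, y, z]" "cycle_edges [x, y, z] = {{x, y}, {y, z}, {x, z}}"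
proof -
  show ce: "cycle_edges [x, y, z] = {{x, y}, {y, z}, {x, z}}"
    unfolding cycle_edges_def by (auto simp: insert_commute)
  have "\<not> cross {y, z} {x, y}" "\<not> cross {x, z} {y, z}" "\<not> cross {x, z} {x, y}"
    using assms cross_sym by blast+
  then show "is_cycle [x, y, z]" unfolding is_cycle_def ce using assms cross_irrefl by simp
qed

lemma path_edges_vertices: "e \<in> path_edges vs \<Longrightarrow> e \<subseteq> set vs"
  by (induction vs rule: path_edges.induct) auto

lemma cycle_edges_vertices: "vs \<noteq> [] \<Longrightarrow> e \<in> cycle_edges vs \<Longrightarrow> e \<subseteq> set vs"
  unfolding cycle_edges_def using path_edges_vertices by fastforce

text \<open>An edge that does not cross the closed curve stays on one side of it, so near
  \<open>w\<close> it is on the side of its other end \<open>v\<close>. The vertex \<open>w\<close>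
  itself may lie on the cycle.\<close>

lemma gs_away:
  assumes "is_cycle vs" "v \<notin> set vs" "{v, w} \<in> E"
    and "\<And>f. f \<in> cycle_edges vs \<Longrightarrow> \<not> cross {v, w} f"
  shows "gs (cycle_edges vs) w v = vin (cycle_edges vs) v"
proof -
  have "vs \<noteq> []" using assms(1) unfolding is_cycle_def by auto
  then have "{v, w} \<notin> cycle_edges vs" using cycle_edges_vertices assms(2) by blast
  then show ?thesis using gs_nocross[OF assms(1,3)] gs_vin[OF assms(1-3)] assms(4) by blast
qed

lemma vin_eq:
  assumes "is_cycle vs" "v \<notin> set vs" "w \<notin> set vs" "{v, w} \<in> E"
    and "\<And>f. f \<in> cycle_edges vs \<Longrightarrow> \<not> cross {v, w} f"
  shows "vin (cycle_edges vs) v = vin (cycle_edges vs) w"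
  using gs_away[OF assms(1,2,4,5)] gs_vin[OF assms(1,3), of v] assms(4) by (simp add: insert_commute)

lemma uncrossed_vin:
  assumes "is_cycle vs" "\<And>e. e \<in> cycle_edges vs \<Longrightarrow> r e = 0"
    and "v \<notin> set vs" "w \<notin> set vs" "{v, w} \<in> E"
  shows "vin (cycle_edges vs) v = vin (cycle_edges vs) w"
  using vin_eq[OF assms(1,3-5)] assms(2) r0_nocross by blast

section \<open>Triangles of \<open>W\<close> with two uncrossed sides\<close>

definition tri :: "'a \<Rightarrow> 'a \<Rightarrow> 'a \<Rightarrow> bool" where
  "tri x y z \<longleftrightarrow> x \<in> W \<and> y \<in> W \<and> z \<in> W \<and> distinct [x, y, z] \<and>
     r {x, y} = 0 \<and> r {y, z} = 0 \<and> r {x, z} \<le> 1"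

text \<open>An edge that leaves a corner \<open>v\<close> on the side of the triangle opposite to
  its other end must cross the triangle, and only \<open>xz\<close> can be crossed. All vertices off
  the triangle will be seen to lie on one side, so these are the edges that start into the empty
  side. The definition does not have to decide whether that side is the inside or the
  outside.\<close>

definition inn :: "'a \<Rightarrow> 'a \<Rightarrow> 'a \<Rightarrow> 'a \<Rightarrow> 'a set" where
  "inn x y z v = {w. {v, w} \<in> E \<and> w \<notin> {x, y, z} \<and>
     gs {{x, y}, {y, z}, {x, z}} v w \<noteq> vin {{x, y}, {y, z}, {x, z}} w}"

lemma tri_rev: "tri x y z \<longleftrightarrow> tri z y x"
  unfolding tri_def by (auto simp: insert_commute)

lemma inn_rev: "inn x y z v = inn z y x v"
proof -
  have "{{x, y}, {y, z}, {x, z}} = {{z, y}, {y, x}, {z, x}}" by (auto simp: insert_commute)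
  then show ?thesis unfolding inn_def by auto
qed

lemma tri_is_cycle:
  assumes "tri x y z"
  shows "is_cycle [x, y, z]" "cycle_edges [x, y, z] = {{x, y}, {y, z}, {x, z}}"
  using assms tri_cycle[of x y z] unfolding tri_def by (simp_all add: edge_iff r0_nocross)

lemma cycle_edges_rotate3:
  "cycle_edges [y, z, x] = cycle_edges [x, y, z]" "cycle_edges [y, x, z] = cycle_edges [x, y, z]"
  unfolding cycle_edges_def by (auto simp: insert_commute)

lemma is_cycle_rotate3:
  "is_cycle [x, y, z] \<Longrightarrow> is_cycle [y, z, x]" "is_cycle [x, y, z] \<Longrightarrow> is_cycle [y, x, z]"
  unfolding is_cycle_def cycle_edges_rotate3 by auto

text \<open>Only \<open>xz\<close> can be crossed, and only once, while no single edge disconnects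
  the graph off the triangle: two elements of \<open>D\<close> are joined both through
  \<open>u\<close> and through a fourth element of \<open>W\<close>, and every vertex outside
  \<open>D\<close> is adjacent to at least two elements of \<open>D\<close>. The fourth element is
  where \<open>4 \<le> card W\<close> enters.\<close>

lemma tri_vin:
  assumes t: "tri x y z" and v: "v \<in> W \<union> D \<union> {u} - {x, y, z}" "w \<in> W \<union> D \<union> {u} - {x, y, z}"
  shows "vin {{x, y}, {y, z}, {x, z}} v = vin {{x, y}, {y, z}, {x, z}} w"
proof -
  let ?T = "{{x, y}, {y, z}, {x, z}}"
  note tc = tri_is_cycle[OF t]
  have xyz: "x \<in> W" "y \<in> W" "z \<in> W" "distinct [x, y, z]" "r {x,y} = 0" "r {y,z} = 0" "r {x,z} \<le> 1"
    using t unfolding tri_def by auto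
  have crs: "cross {p, q} {x, z}"
    if "{p, q} \<in> E" "p \<notin> {x,y,z}" "q \<notin> {x,y,z}" "vin ?T p \<noteq> vin ?T q" for p q
  proof (rule ccontr)
    assume "\<not> cross {p, q} {x, z}"
    then have "\<And>f. f \<in> cycle_edges [x, y, z] \<Longrightarrow> \<not> cross {p, q} f"
      using tc(2) xyz r0_nocross by auto
    from vin_eq[OF tc(1) _ _ that(1) this] that tc(2) show False by simp
  qed
  \<comment> \<open>Two different edges joining the two sides would both have to cross
    \<open>xz\<close>.\<close>
  have two: False
    if "{p, q} \<in> E" "p \<notin> {x,y,z}" "q \<notin> {x,y,z}" "vin ?T p \<noteq> vin ?T q"
      "{p', q'} \<in> E" "p' \<notin> {x,y,z}" "q' \<notin> {x,y,z}" "vin ?T p' \<noteq> vin ?T q'" "{p,q} \<noteq> {p',q'}" for p q p' q'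
    using cross_r2[OF cross_sym[OF crs[OF that(1-4)]] cross_sym[OF crs[OF that(5-8)]] that(9)] xyz(7) by simp
  obtain a b c where abc: "D = {a, b, c}" "distinct [a, b, c]"
    using D3 by (auto simp: card_3_iff)
  have nW: "s \<notin> {x,y,z}" if "s \<in> D" for s using that xyz disj by auto
  have un: "u \<notin> {x,y,z}" using xyz uW by auto
  have center: "vin ?T s = vin ?T d" if "s \<in> D" "d \<in> D" for s d
  proof (rule ccontr)
    assume ne: "vin ?T s \<noteq> vin ?T d"
    have "card {x,y,z} < card W" using W4 xyz by auto
    then obtain w where w: "w \<in> W" "w \<notin> {x,y,z}"
      using xyz(1-3) by (metis card_mono finW not_less finite.emptyI finite_insert subsetI)
    \<comment> \<open>Whichever side \<open>u\<close> is on, one of \<open>s\<close> and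
      \<open>d\<close> is on the other; the same holds for \<open>w\<close>.\<close>
    obtain s1 where s1: "s1 \<in> {s, d}" "vin ?T u \<noteq> vin ?T s1" using ne by blast
    obtain s2 where s2: "s2 \<in> {s, d}" "vin ?T w \<noteq> vin ?T s2" using ne by blast
    have sD: "s1 \<in> D" "s2 \<in> D" using s1(1) s2(1) that by auto
    have "u \<noteq> w" "u \<noteq> s2" using w(1) sD uW uD by auto
    then have "{u, s1} \<noteq> {w, s2}" by (auto simp: doubleton_eq_iff)
    then show False
      by (rule two[OF edge_iff(4)[OF sD(1)] un nW[OF sD(1)] s1(2) edge_iff(3)[OF sD(2) w(1)] w(2) nW[OF sD(2)] s2(2)])
  qed
  have main: "vin ?T p = vin ?T a" if "p \<in> W \<union> D \<union> {u} - {x, y, z}" for p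
  proof (cases "p \<in> D")
    case True then show ?thesis using center[of p a] abc(1) by blast
  next
    case False
    then have e: "{p, a} \<in> E" "{p, b} \<in> E" using that abc by (auto simp: edge_iff)
    show ?thesis
    proof (rule ccontr)
      assume "vin ?T p \<noteq> vin ?T a"
      moreover from this have "vin ?T p \<noteq> vin ?T b" using center[of a b] abc(1) by blast
      moreover have "{p, a} \<noteq> {p, b}" using abc by (auto simp: doubleton_eq_iff)
      moreover have "p \<notin> {x,y,z}" "a \<notin> {x,y,z}" "b \<notin> {x,y,z}" using that nW abc by auto
      ultimately show False using two[of p a p b] e by blast
    qed
  qed
  show ?thesis using main[OF v(1)] main[OF v(2)] by simp
qed

lemma sep_refl: "\<not> sep v p q x x"
  unfolding sep_def sepr_def by simp

lemma sep_four:
  assumes "{v, p} \<in> E" "{v, q} \<in> E" "{v, x} \<in> E" "{v, y} \<in> E" "distinct [p, q, x, y]"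
  shows "sep v p q x y \<or> sep v p x q y \<or> sep v p y q x"
    "sep v p q x y \<Longrightarrow> \<not> sep v p x q y" "sep v p q x y \<Longrightarrow> \<not> sep v p y q x"
    "sep v p q x y \<longleftrightarrow> sep v x y p q"
proof -
  have "distinct [ang v p, ang v q, ang v x, ang v y]"
    using assms ang_neq[of v] by (metis distinct.simps(2) distinct_singleton list.set_intros set_ConsD)
  from sepr_four[OF this] show "sep v p q x y \<or> sep v p x q y \<or> sep v p y q x"
    "sep v p q x y \<Longrightarrow> \<not> sep v p x q y" "sep v p q x y \<Longrightarrow> \<not> sep v p y q x"
    "sep v p q x y \<longleftrightarrow> sep v x y p q" unfolding sep_def by blast+
qed

lemma inn_cross:
  assumes t: "tri x y z" and v: "v \<in> {x, y, z}" and w: "w \<in> inn x y z v"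
  shows "cross {v, w} {x, z}"
proof (rule ccontr)
  assume "\<not> cross {v, w} {x, z}"
  moreover have "r {x, y} = 0" "r {y, z} = 0" using t unfolding tri_def by auto
  ultimately have "\<And>f. f \<in> cycle_edges [x, y, z] \<Longrightarrow> \<not> cross {w, v} f"
    using tri_is_cycle(2)[OF t] r0_nocross by (auto simp: insert_commute)
  moreover have "w \<notin> set [x, y, z]" "{w, v} \<in> E" using w unfolding inn_def by (auto simp: insert_commute)
  ultimately have "gs {{x, y}, {y, z}, {x, z}} v w = vin {{x, y}, {y, z}, {x, z}} w"
    using gs_away[OF tri_is_cycle(1)[OF t]] tri_is_cycle(2)[OF t] by metis
  then show False using w unfolding inn_def by auto
qed

text \<open>Two such edges would both cross \<open>xz\<close>, which admits one crossing. So at most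
  one edge starts into the empty side, counted over all three corners together.\<close>

lemma inn_unique:
  assumes t: "tri x y z" and v: "v \<in> {x, y, z}" "v' \<in> {x, y, z}"
    and w: "w \<in> inn x y z v" "w' \<in> inn x y z v'"
  shows "v = v' \<and> w = w'"
proof -
  have "r {x, z} \<le> 1" using t unfolding tri_def by auto
  then have "{v, w} = {v', w'}"
    using cross_r2[OF cross_sym[OF inn_cross[OF t v(1) w(1)]] cross_sym[OF inn_cross[OF t v(2) w(2)]]] by force
  moreover have "w \<notin> {x,y,z}" "w' \<notin> {x,y,z}" using w unfolding inn_def by auto
  ultimately show ?thesis using v by (auto simp: doubleton_eq_iff)
qed

lemma E_vertices: "{v, w} \<in> E \<Longrightarrow> w \<in> W \<union> D \<union> {u}"
  unfolding E_def Y_edges_def by (auto simp: doubleton_eq_iff)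

lemma E_irrefl: "{v, w} \<in> E \<Longrightarrow> v \<noteq> w"
  using disj uD uW unfolding E_def Y_edges_def by (auto simp: doubleton_eq_iff)

text \<open>As \<open>w\<close> and \<open>w'\<close> lie on the same side of the triangle, their
  edges start on different sides exactly if one of them starts on the wrong side. In this way
  \<open>inn\<close> determines the rotation at a corner.\<close>

lemma tri_sector_aux:
  assumes t: "tri x y z" and c: "is_cycle [v, p, q]" "cycle_edges [v, p, q] = {{x, y}, {y, z}, {x, z}}"
    and vpq: "{v, p, q} = {x, y, z}"
    and w: "{v, w} \<in> E" "w \<noteq> p" "w \<noteq> q" "{v, w'} \<in> E" "w' \<noteq> p" "w' \<noteq> q"
  shows "sep v p q w w' \<longleftrightarrow> (w \<in> inn x y z v) \<noteq> (w' \<in> inn x y z v)"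
proof -
  have n: "w \<notin> {x,y,z}" "w' \<notin> {x,y,z}" using w vpq E_irrefl by (metis insert_iff singletonD)+
  then have "vin {{x, y}, {y, z}, {x, z}} w = vin {{x, y}, {y, z}, {x, z}} w'"
    using tri_vin[OF t] E_vertices w(1,4) by blast
  then show ?thesis
    using gs_sector[OF c(1) w(1) w(4) w(2) w(5)] w(3,6) c(2) n w(1,4) unfolding inn_def by auto
qed

lemma tri_sector:
  assumes t: "tri x y z"
  shows "{y, w} \<in> E \<Longrightarrow> w \<noteq> x \<Longrightarrow> w \<noteq> z \<Longrightarrow> {y, w'} \<in> E \<Longrightarrow> w' \<noteq> x \<Longrightarrow> w' \<noteq> z \<Longrightarrow>
      sep y x z w w' \<longleftrightarrow> (w \<in> inn x y z y) \<noteq> (w' \<in> inn x y z y)"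
    and "{x, w} \<in> E \<Longrightarrow> w \<noteq> y \<Longrightarrow> w \<noteq> z \<Longrightarrow> {x, w'} \<in> E \<Longrightarrow> w' \<noteq> y \<Longrightarrow> w' \<noteq> z \<Longrightarrow>
      sep x y z w w' \<longleftrightarrow> (w \<in> inn x y z x) \<noteq> (w' \<in> inn x y z x)"
    and "{z, w} \<in> E \<Longrightarrow> w \<noteq> y \<Longrightarrow> w \<noteq> x \<Longrightarrow> {z, w'} \<in> E \<Longrightarrow> w' \<noteq> y \<Longrightarrow> w' \<noteq> x \<Longrightarrow>
      sep z y x w w' \<longleftrightarrow> (w \<in> inn x y z z) \<noteq> (w' \<in> inn x y z z)"
proof -
  have c: "is_cycle [y, x, z]" "is_cycle [x, y, z]" "is_cycle [z, y, x]"
    using tri_is_cycle(1)[OF t] tri_is_cycle(1)[of z y x] t tri_rev is_cycle_rotate3 by blast+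
  have e: "cycle_edges [x, y, z] = {{x, y}, {y, z}, {x, z}}" "cycle_edges [y, x, z] = {{x, y}, {y, z}, {x, z}}"
     "cycle_edges [z, y, x] = {{x, y}, {y, z}, {x, z}}"
    unfolding cycle_edges_def by (auto simp: insert_commute)
  show "{y, w} \<in> E \<Longrightarrow> w \<noteq> x \<Longrightarrow> w \<noteq> z \<Longrightarrow> {y, w'} \<in> E \<Longrightarrow> w' \<noteq> x \<Longrightarrow> w' \<noteq> z \<Longrightarrow>
      sep y x z w w' \<longleftrightarrow> (w \<in> inn x y z y) \<noteq> (w' \<in> inn x y z y)"
    by (rule tri_sector_aux[OF t c(1) e(2)]) auto
  show "{x, w} \<in> E \<Longrightarrow> w \<noteq> y \<Longrightarrow> w \<noteq> z \<Longrightarrow> {x, w'} \<in> E \<Longrightarrow> w' \<noteq> y \<Longrightarrow> w' \<noteq> z \<Longrightarrow>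
      sep x y z w w' \<longleftrightarrow> (w \<in> inn x y z x) \<noteq> (w' \<in> inn x y z x)"
    by (rule tri_sector_aux[OF t c(2) e(1)]) auto
  show "{z, w} \<in> E \<Longrightarrow> w \<noteq> y \<Longrightarrow> w \<noteq> x \<Longrightarrow> {z, w'} \<in> E \<Longrightarrow> w' \<noteq> y \<Longrightarrow> w' \<noteq> x \<Longrightarrow>
      sep z y x w w' \<longleftrightarrow> (w \<in> inn x y z z) \<noteq> (w' \<in> inn x y z z)"
    by (rule tri_sector_aux[OF t c(3) e(3)]) auto
qed

text \<open>The edge \<open>ys\<close> starts into the empty side of the triangle and uses up the
  one crossing that \<open>xz\<close> admits. Therefore \<open>s\<close> is alone in its sector
  between \<open>yx\<close> and \<open>yz\<close>. The whole contradiction rests on where the three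
  elements of \<open>D\<close> can be owned in this sense.\<close>

definition own :: "'a \<Rightarrow> 'a \<Rightarrow> 'a \<Rightarrow> 'a \<Rightarrow> bool" where
  "own s x y z \<longleftrightarrow> tri x y z \<and> s \<in> D \<and> s \<in> inn x y z y"

lemma own_rev: "own s x y z \<longleftrightarrow> own s z y x"
  unfolding own_def using tri_rev inn_rev by metis

lemma own_sep:
  assumes "own s x y z" "{y, e} \<in> E" "e \<notin> {x, z, s}"
  shows "sep y x z s e"
proof -
  have t: "tri x y z" and s: "s \<in> D" "s \<in> inn x y z y" using assms unfolding own_def by auto
  have "e \<notin> inn x y z y" using inn_unique[OF t, of y y s e] s assms(3) by auto
  moreover have "{y, s} \<in> E" "s \<notin> {x,y,z}" using s unfolding inn_def by auto
  ultimately show ?thesis using tri_sector(1)[OF t, of s e] s assms(2,3) by auto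
qed

text \<open>The forced crossing of \<open>xz\<close> is spent on \<open>ys\<close>, so no edge at
  \<open>z\<close> starts into the empty side, and \<open>zx\<close> and \<open>zy\<close> are
  consecutive there.\<close>

lemma own_side:
  assumes "own s x y z" "{z, e} \<in> E" "{z, e'} \<in> E" "e \<notin> {x, y}" "e' \<notin> {x, y}"
  shows "\<not> sep z y x e e'"
proof -
  have t: "tri x y z" and s: "s \<in> inn x y z y" using assms unfolding own_def by auto
  have "y \<noteq> z" using t unfolding tri_def by auto
  then have "e \<notin> inn x y z z" "e' \<notin> inn x y z z" using inn_unique[OF t, of y z s] s by auto
  then show ?thesis using tri_sector(3)[OF t, of e e'] assms by auto
qed

text \<open>Nothing lies between \<open>yx\<close> and \<open>ys\<close> at \<open>y\<close>,
  because \<open>ys\<close> is alone between \<open>yx\<close> and \<open>yz\<close>. The bound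
  \<open>corner\<close> for the edge opposite to \<open>y\<close> is therefore zero.\<close>

lemma own_uncrossed: assumes "own s x y z" shows "r {s, x} = 0" "r {s, z} = 0"
proof -
  have gen: "r {s, x} = 0" if o: "own s x y z" for x z
  proof -
    have t: "tri x y z" and s: "s \<in> D" using o unfolding own_def by auto
    have xyz: "x \<in> W" "y \<in> W" "z \<in> W" "distinct [x,y,z]" using t unfolding tri_def by auto
    then have d: "s \<notin> {x,y,z}" using s disj by auto
    have "r {x, s} \<le> card {e. {y, e} \<in> E \<and> e \<noteq> x \<and> e \<noteq> s \<and> sep y x s e z}"
      by (rule corner[of s x y]) (use s xyz d in \<open>auto simp: edge_iff\<close>)
    also have "{e. {y, e} \<in> E \<and> e \<noteq> x \<and> e \<noteq> s \<and> sep y x s e z} = {}"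
    proof -
      have False if e: "{y, e} \<in> E" "e \<noteq> x" "e \<noteq> s" "sep y x s e z" for e
      proof -
        have "e \<noteq> z" using e(4) sep_refl by blast
        then have "sep y x z s e" using own_sep[OF o e(1)] e by auto
        then have "\<not> sep y x s z e"
          by (rule sep_four(2)[rotated 5]) (use s xyz d e \<open>e \<noteq> z\<close> in \<open>auto simp: edge_iff\<close>)
        then show False using e(4) sep_sym by blast
      qed
      then show ?thesis by blast
    qed
    finally show ?thesis by (simp add: insert_commute)
  qed
  show "r {s, x} = 0" "r {s, z} = 0" using gen[OF assms] gen[of z x] assms own_rev by blast+
qed

text \<open>If all three alternatives fail, the rotation at \<open>x2\<close> is determined:
  \<open>s\<close> and \<open>x3\<close> separate \<open>x1\<close> from \<open>x4\<close>. In the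
  triangle \<open>s x2 x3\<close> the edges from \<open>x2\<close> to \<open>x1\<close> and
  \<open>x4\<close> then start on different sides, whereas those from \<open>s\<close> start on the
  same side. Only a crossing of \<open>x2x4\<close> with \<open>sx3\<close> can account for this.
  Seen from the triangle \<open>x2 x3 x4\<close>, that crossing makes the edge from
  \<open>x3\<close> to \<open>s\<close> start on the wrong side, which is the third
  alternative.\<close>

lemma quad_cases:
  assumes s: "s \<in> D" and t1: "tri x1 x2 x3" and t2: "tri x2 x3 x4" and ne: "x1 \<noteq> x4"
    and con: "\<not> sep s x2 x3 x1 x4"
  shows "s \<in> inn x1 x2 x3 x2 \<or> x4 \<in> inn x1 x2 x3 x2 \<or> s \<in> inn x2 x3 x4 x3"
proof (rule ccontr)
  assume "\<not> ?thesis"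
  then have n: "s \<notin> inn x1 x2 x3 x2" "x4 \<notin> inn x1 x2 x3 x2" "s \<notin> inn x2 x3 x4 x3" by auto
  have W: "x1 \<in> W" "x2 \<in> W" "x3 \<in> W" "x4 \<in> W" and dist: "distinct [x1, x2, x3, x4]"
    and r: "r {x1,x2} = 0" "r {x2,x3} = 0" "r {x3,x4} = 0" "r {x2,x4} \<le> 1"
    using t1 t2 ne unfolding tri_def by auto
  have sn: "s \<notin> W" using s disj by auto
  then have sx: "s \<noteq> x1" "s \<noteq> x2" "s \<noteq> x3" "s \<noteq> x4" using W by auto
  have ed: "{x2,x1} \<in> E" "{x2,x3} \<in> E" "{x2,x4} \<in> E" "{x2,s} \<in> E" "{s,x2} \<in> E" "{s,x3} \<in> E" "{s,x1} \<in> E" "{s,x4} \<in> E"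
    "{x3,s} \<in> E" "{x1,s} \<in> E" "{x4,s} \<in> E" "{x4,x2} \<in> E" "{x1,x2} \<in> E"
    using W dist s by (auto simp: edge_iff)
  have a: "\<not> sep x2 x1 x3 s x4" using tri_sector(1)[OF t1, of s x4] n ed dist sx by auto
  have "s \<notin> inn x2 x3 x4 x2"
  proof
    assume "s \<in> inn x2 x3 x4 x2"
    from inn_cross[OF t2 _ this] have "cross {x2, s} {x2, x4}" by auto
    moreover have "\<not> cross {x2, s} {x2, x4}" by (rule nocross[of s x2 x4]) (use s W dist in auto)
    ultimately show False by simp
  qed
  moreover have "x1 \<notin> inn x2 x3 x4 x2"
    using inn_cross[OF t2, of x2 x1] r0_nocross[of "{x2,x1}"] r(1) by (auto simp: insert_commute)
  ultimately have b: "\<not> sep x2 x3 x4 s x1" using tri_sector(2)[OF t2, of s x1] ed dist sx by auto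
  \<comment> \<open>Four edges at \<open>x2\<close> can be paired off in three ways, and
    \<open>a\<close> and \<open>b\<close> exclude two of them.\<close>
  have c: "sep x2 s x3 x1 x4"
    using sep_four(1)[of x2 s x3 x1 x4] ed dist sx a b sep_sym
      sep_four(4)[of x2 s x4 x3 x1] sep_four(4)[of x2 s x1 x3 x4]
    by (metis distinct_length_2_or_more distinct_singleton)
  let ?C = "cycle_edges [s, x2, x3]"
  have nc: "\<not> cross {s, p} {s, q}" if "p \<in> W" "q \<in> W" "p \<noteq> q" for p q
    by (rule nocross[of s p q]) (use s that in auto)
  have cy: "is_cycle [s, x2, x3]" and ce: "?C = {{s, x2}, {x2, x3}, {s, x3}}"
    using tri_cycle[of s x2 x3] ed r0_nocross r(2) nc[of x2 x3] W dist sx by auto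
  have cy2: "is_cycle [x2, s, x3]" and ce2: "cycle_edges [x2, s, x3] = ?C"
    by (rule is_cycle_rotate3(2)[OF cy], rule cycle_edges_rotate3(2))
  have "gs ?C x2 x1 \<noteq> gs ?C x2 x4"
    using gs_sector[OF cy2, of x1 x4] ed dist sx c ce2 by auto
  moreover have "gs ?C s x1 = gs ?C s x4"
    using gs_sector[OF cy, of x1 x4] ed dist sx con by auto
  moreover have "gs ?C s p = vin ?C p" if "p \<in> {x1, x4}" for p
  proof (rule gs_away[OF cy])
    show "p \<notin> set [s, x2, x3]" "{p, s} \<in> E" using that dist sx ed by auto
    fix f assume "f \<in> ?C"
    then show "\<not> cross {p, s} f" using that nc[of p x2] nc[of p x3] r0_nocross(2)[OF r(2)] dist W
      unfolding ce by (auto simp: insert_commute)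
  qed
  moreover have "gs ?C x2 x1 = vin ?C x1"
    by (rule gs_away[OF cy]) (use dist sx ed r0_nocross(1)[OF r(1)] in auto)
  moreover have "gs ?C x4 x2 = vin ?C x4"
    by (rule gs_vin[OF cy]) (use dist sx ed in auto)
  ultimately have "gs ?C x2 x4 \<noteq> gs ?C x4 x2" by auto
  moreover have "{x2, x4} \<notin> ?C" unfolding ce using dist sx by (auto simp: doubleton_eq_iff)
  ultimately obtain f where f: "f \<in> ?C" "cross {x2, x4} f"
    using cycle_crossed[OF cy ed(3)] by blast
  have "\<not> cross {x2, x4} {s, x2}"
    using nocross[of s x2 x4 x2 x4 s] s W dist by (auto simp: insert_commute)
  then have cr: "cross {x2, x4} {s, x3}" using f r0_nocross(2)[OF r(2)] unfolding ce by auto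
  note tc = tri_is_cycle[OF t2]
  \<comment> \<open>Apart from its end \<open>x3\<close>, the edge \<open>sx3\<close> meets this
    triangle only in the single crossing with \<open>x2x4\<close>, so its two ends start on
    different sides.\<close>
  have "gs (cycle_edges [x2,x3,x4]) s x3 \<noteq> gs (cycle_edges [x2,x3,x4]) x3 s"
  proof (rule gs_onecross[OF tc(1), where f = "{x2,x4}"])
    show "\<forall>g\<in>cycle_edges [x2, x3, x4]. g \<noteq> {x2, x4} \<longrightarrow> \<not> cross {s, x3} g"
      using tc(2) r0_nocross(2) r by auto
    show "{s, x3} \<notin> cycle_edges [x2, x3, x4]" using sx tc(2) by (auto simp: doubleton_eq_iff)
  qed (use ed tc(2) cross_sym[OF cr] r in auto)
  moreover have "gs (cycle_edges [x2,x3,x4]) s x3 = vin (cycle_edges [x2,x3,x4]) s"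
    by (rule gs_vin[OF tc(1)]) (use ed sx in auto)
  ultimately have "s \<in> inn x2 x3 x4 x3" unfolding inn_def tc(2) using ed sx by auto
  then show False using n by simp
qed

section \<open>Uncrossed paths in \<open>W\<close> and their cut vertices\<close>

definition urel :: "'a \<Rightarrow> ('a \<times> 'a) set" where
  "urel y = {(p, q). p \<in> W - {y} \<and> q \<in> W - {y} \<and> p \<noteq> q \<and> r {p, q} = 0}"

lemma path_edges_append:
  "xs \<noteq> [] \<Longrightarrow> path_edges (xs @ [y]) = insert {last xs, y} (path_edges xs)"
  by (induction xs rule: path_edges.induct) auto

lemma path_edges_take: "path_edges (take n xs) \<subseteq> path_edges xs"
proof (induction xs arbitrary: n rule: path_edges.induct)
  case (1 x y zs)
  show ?case
  proof (cases n)
    case (Suc k)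
    then show ?thesis using 1[of k] by (cases k) auto
  qed simp
qed (auto simp: take_Cons split: nat.splits)

lemma urel_path:
  assumes "(p, q) \<in> (urel y)\<^sup>*" "p \<in> W - {y}"
  shows "\<exists>vs. vs \<noteq> [] \<and> hd vs = p \<and> last vs = q \<and> distinct vs \<and> set vs \<subseteq> W - {y} \<and>
     (\<forall>e\<in>path_edges vs. e \<in> E \<and> r e = 0)"
  using assms
proof (induction rule: rtrancl_induct)
  case base
  then show ?case by (intro exI[of _ "[p]"]) auto
next
  case (step q q')
  then obtain vs where vs: "vs \<noteq> []" "hd vs = p" "last vs = q" "distinct vs" "set vs \<subseteq> W - {y}"
     "\<forall>e\<in>path_edges vs. e \<in> E \<and> r e = 0" by blast
  have q: "q \<in> W - {y}" "q' \<in> W - {y}" "q \<noteq> q'" "r {q, q'} = 0" using step unfolding urel_def by auto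
  \<comment> \<open>If the new endpoint is already on the path, the path is truncated there, which
    keeps it simple.\<close>
  show ?case
  proof (cases "q' \<in> set vs")
    case True
    then obtain i where i: "i < length vs" "vs ! i = q'" by (auto simp: in_set_conv_nth)
    let ?t = "take (Suc i) vs"
    have "last ?t = q'" using i by (simp add: take_Suc_conv_app_nth)
    moreover have "?t \<noteq> []" "hd ?t = p" "distinct ?t" using vs by (auto simp: hd_take)
    moreover have "set ?t \<subseteq> W - {y}" using vs(5) set_take_subset by fast
    moreover have "\<forall>e\<in>path_edges ?t. e \<in> E \<and> r e = 0" using vs(6) path_edges_take by blast
    ultimately show ?thesis by blast
  next
    case False
    have "\<forall>e\<in>path_edges (vs @ [q']). e \<in> E \<and> r e = 0"
      using vs q by (auto simp: path_edges_append edge_iff)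
    then show ?thesis using vs q False by (intro exI[of _ "vs @ [q']"]) auto
  qed
qed

lemma urel_sym: "(p, q) \<in> (urel y)\<^sup>* \<Longrightarrow> (q, p) \<in> (urel y)\<^sup>*"
proof -
  have "sym (urel y)" unfolding urel_def sym_def by (auto simp: insert_commute)
  then show "(p, q) \<in> (urel y)\<^sup>* \<Longrightarrow> (q, p) \<in> (urel y)\<^sup>*" using sym_rtrancl symD by fast
qed

text \<open>An uncrossed cycle in \<open>W\<close> cannot separate two vertices of \<open>D\<close>, since these are joined through \<open>u\<close>.\<close>

lemma urel_sep:
  assumes y: "y \<in> W" and pq: "p \<in> W" "q \<in> W" "p \<noteq> q" "p \<noteq> y" "q \<noteq> y" "r {y, p} = 0" "r {y, q} = 0"
    and con: "(p, q) \<in> (urel y)\<^sup>*" and st: "s \<in> D" "t \<in> D"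
  shows "\<not> sep y p q s t"
proof -
  obtain vs where vs: "vs \<noteq> []" "hd vs = p" "last vs = q" "distinct vs" "set vs \<subseteq> W - {y}"
     "\<forall>e\<in>path_edges vs. e \<in> E \<and> r e = 0" using urel_path[OF con] pq by blast
  obtain ws where ws: "vs = p # ws" using vs(1,2) by (cases vs) auto
  have "ws \<noteq> []" using ws vs(3) pq(3) by auto
  let ?C = "cycle_edges (y # p # ws)"
  have ce: "e \<in> ?C \<Longrightarrow> e \<in> E \<and> r e = 0" for e
    using vs ws pq y unfolding cycle_edges_def by (auto simp: edge_iff insert_commute)
  have cy: "is_cycle (y # p # ws)" unfolding is_cycle_def
    using vs ws \<open>ws \<noteq> []\<close> ce r0_nocross by (cases ws) auto
  have sub: "set (y # p # ws) \<subseteq> W" using vs ws y by auto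
  have out: "v \<notin> set (y # p # ws)" if "v \<in> D \<union> {u}" for v using that sub disj uW by blast
  have "vin ?C v = vin ?C u" if "v \<in> D" for v
    using uncrossed_vin[OF cy _ out out, of v u] ce that by (auto simp: edge_iff)
  moreover have "gs ?C y v = vin ?C v" if "v \<in> D" for v
    by (rule gs_away[OF cy out]) (use that y ce r0_nocross in \<open>auto simp: edge_iff\<close>)
  ultimately have "gs ?C y s = gs ?C y t" using st by simp
  moreover have "last (p # ws) = q" using ws vs by simp
  moreover have "s \<noteq> p" "s \<noteq> q" "t \<noteq> p" "t \<noteq> q" using st pq disj by auto
  ultimately show ?thesis using gs_sector[OF cy, of s t] st y by (simp add: edge_iff)
qed

lemma other_D: assumes "s \<in> D" obtains t t' where "t \<in> D" "t' \<in> D" "D = {s, t, t'}" "distinct [s, t, t']"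
proof -
  have "card (D - {s}) = 2" using D3 assms finD by simp
  then obtain t t' where "D - {s} = {t, t'}" "t \<noteq> t'" by (auto simp: card_2_iff)
  then show ?thesis using that[of t t'] assms by auto
qed

text \<open>A connection from \<open>x\<close> to \<open>z\<close> that avoids \<open>y\<close>
  would close up to an uncrossed cycle through \<open>y\<close>. Such a cycle cannot separate two
  elements of \<open>D\<close>, but \<open>s\<close> is alone between \<open>yx\<close> and
  \<open>yz\<close>. So \<open>y\<close> is a cut vertex of the graph of uncrossed edges on
  \<open>W\<close>.\<close>

lemma own_cut:
  assumes o: "own s x y z"
  shows "(x, z) \<notin> (urel y)\<^sup>*"
proof
  assume c: "(x, z) \<in> (urel y)\<^sup>*"
  have s: "s \<in> D" and t: "tri x y z" using o unfolding own_def by auto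
  obtain t' where t': "t' \<in> D" "t' \<noteq> s" using other_D[OF s] by (metis distinct_length_2_or_more)
  have "x \<in> W" "y \<in> W" "z \<in> W" "distinct [x,y,z]" "r {x,y} = 0" "r {y,z} = 0"
    using t unfolding tri_def by auto
  note W = this
  have "\<not> sep y x z s t'"
    by (rule urel_sep[OF W(2,1,3) _ _ _ _ _ c s t'(1)]) (use W in \<open>auto simp: insert_commute\<close>)
  moreover have "sep y x z s t'"
    by (rule own_sep[OF o]) (use W t' disj in \<open>auto simp: edge_iff\<close>)
  ultimately show False by simp
qed

text \<open>A Hamiltonian path in the graph of uncrossed edges on \<open>W\<close>. Deleting one
  vertex leaves at most two connected pieces: what comes before it and what comes after it.\<close>

definition ulist :: "'a list \<Rightarrow> bool" where
  "ulist xs \<longleftrightarrow> distinct xs \<and> set xs = W \<and> (\<forall>i. Suc i < length xs \<longrightarrow> r {xs ! i, xs ! Suc i} = 0)"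

lemma ulist_segment:
  assumes "ulist xs" "i \<le> j" "j < length xs" "k < length xs" "k < i \<or> j < k"
  shows "(xs ! i, xs ! j) \<in> (urel (xs ! k))\<^sup>*"
  using assms(2,3,5)
proof (induction j)
  case 0 then show ?case by simp
next
  case (Suc j)
  show ?case
  proof (cases "i = Suc j")
    case False
    then have IH: "(xs ! i, xs ! j) \<in> (urel (xs ! k))\<^sup>*" using Suc by auto
    have "xs ! j \<noteq> xs ! Suc j" "xs ! j \<noteq> xs ! k" "xs ! Suc j \<noteq> xs ! k"
      using assms Suc.prems False unfolding ulist_def by (auto simp: nth_eq_iff_index_eq)
    then have "(xs ! j, xs ! Suc j) \<in> urel (xs ! k)"
      using assms Suc.prems unfolding ulist_def urel_def by auto
    then show ?thesis using IH by auto
  qed simp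
qed

lemma ulist_side:
  assumes u: "ulist xs" and k: "k < length xs" and ij: "i < length xs" "j < length xs"
    and side: "i < k \<longleftrightarrow> j < k" "i \<noteq> k" "j \<noteq> k"
  shows "(xs ! i, xs ! j) \<in> (urel (xs ! k))\<^sup>*"
proof (cases "i \<le> j")
  case True then show ?thesis using ulist_segment[OF u True ij(2) k] side by linarith
next
  case False
  then have "(xs ! j, xs ! i) \<in> (urel (xs ! k))\<^sup>*"
    using ulist_segment[OF u _ ij(1) k, of j] side by linarith
  then show ?thesis by (rule urel_sym)
qed

text \<open>Since \<open>y\<close> is a cut vertex, \<open>x\<close> and \<open>z\<close> lie on
  different sides of \<open>y\<close> along the path \<open>xs\<close>, and so do \<open>x'\<close>
  and \<open>z'\<close>. Ends on the same side are joined by an uncrossed path avoiding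
  \<open>y\<close>, so no two elements of \<open>D\<close> are separated by them at
  \<open>y\<close>. The rest is a statement on cyclic orders: \<open>s\<close> is alone in one
  sector, \<open>t\<close> alone in the other, and a third element \<open>c\<close> of
  \<open>D\<close> lies in neither.\<close>

lemma own_unique:
  assumes os: "own s x y z" and ot: "own t x' y z'" and ul: "ulist xs"
  shows "s = t"
proof (rule ccontr)
  assume st: "s \<noteq> t"
  have sD: "s \<in> D" "t \<in> D" and tr: "tri x y z" "tri x' y z'" using os ot unfolding own_def by auto
  have W: "x \<in> W" "y \<in> W" "z \<in> W" "x' \<in> W" "z' \<in> W" "distinct [x,y,z]" "distinct [x',y,z']"
    and r: "r {y,x} = 0" "r {y,z} = 0" "r {y,x'} = 0" "r {y,z'} = 0"
    using tr unfolding tri_def by (auto simp: insert_commute)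
  obtain c where c: "c \<in> D" "c \<noteq> s" "c \<noteq> t" using other_D[OF sD(1)]
    by (metis distinct_length_2_or_more)
  have len: "length xs = card W" "set xs = W" using ul distinct_card[of xs] unfolding ulist_def by auto
  have idx: "\<exists>i<length xs. xs ! i = v" if "v \<in> W" for v using that len(2) by (metis in_set_conv_nth)
  obtain k where k: "k < length xs" "xs ! k = y" using idx W by blast
  obtain i j where i: "i < length xs" "xs ! i = x" and j: "j < length xs" "xs ! j = z" using idx W by blast
  obtain i' j' where i': "i' < length xs" "xs ! i' = x'" and j': "j' < length xs" "xs ! j' = z'" using idx W by blast
  have nk: "i \<noteq> k" "j \<noteq> k" "i' \<noteq> k" "j' \<noteq> k" using i j i' j' k W by auto
  have con: "(xs ! m, xs ! n) \<in> (urel y)\<^sup>*" if "m < length xs" "n < length xs" "m < k \<longleftrightarrow> n < k" "m \<noteq> k" "n \<noteq> k" for m n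
    using ulist_side[OF ul k(1) that] k by simp
  have sides: "(i < k) \<noteq> (j < k)" "(i' < k) \<noteq> (j' < k)"
    using con[of i j] con[of i' j'] own_cut[OF os] own_cut[OF ot] i j i' j' nk by auto
  have yd: "{y, d} \<in> E" if "d \<in> D" for d using that W edge_iff by blast
  have nD: "d \<noteq> x" "d \<noteq> z" "d \<noteq> x'" "d \<noteq> z'" if "d \<in> D" for d using that W disj by auto
  have yW: "{y, w} \<in> E" if "w \<in> W" "w \<noteq> y" for w using that W edge_iff by blast
  \<comment> \<open>Here \<open>p\<close> and \<open>q\<close> are the ends on one side of
    \<open>y\<close>, and \<open>p'\<close> and \<open>q'\<close> those on the other; either pair
    may coincide.\<close>
  have main: False
    if sd: "p = q \<or> (\<forall>d\<in>D. \<forall>d'\<in>D. \<not> sep y p q d d')" "p' = q' \<or> (\<forall>d\<in>D. \<forall>d'\<in>D. \<not> sep y p' q' d d')"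
      and o1: "own s p y p'" and o2: "own t q y q'"
      and W': "p \<in> W" "p' \<in> W" "q \<in> W" "q' \<in> W" "distinct [p, y, p']" "distinct [q, y, q']" "p \<noteq> q'" "p' \<noteq> q" for p q p' q'
  proof -
    have nD': "d \<noteq> p" "d \<noteq> q" "d \<noteq> p'" "d \<noteq> q'" if "d \<in> D" for d using that W' disj by auto
    have s1: "sep y p p' s e" if "{y, e} \<in> E" "e \<notin> {p, p', s}" for e using own_sep[OF o1] that by blast
    have s2: "sep y q q' t e" if "{y, e} \<in> E" "e \<notin> {q, q', t}" for e using own_sep[OF o2] that by blast
    have a: "sep y p p' s t" "sep y p p' s c" "sep y q q' t s" "sep y q q' t c"
      using s1 s2 yd sD c st nD' by auto
    have b: "q = p \<or> sep y p p' s q" "q' = p' \<or> sep y p p' s q'" "q = p \<or> sep y q q' t p" "q' = p' \<or> sep y q q' t p'"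
      using s1[of q] s1[of q'] s2[of p] s2[of p'] yW W' nD' sD by auto
    have d: "q = p \<or> (\<not> sep y p q s t \<and> \<not> sep y p q s c)" "q' = p' \<or> (\<not> sep y p' q' s t \<and> \<not> sep y p' q' s c)"
      using sd sD c by auto
    have inj: "ang y e \<noteq> ang y e'" if "{y, e} \<in> E" "{y, e'} \<in> E" "e \<noteq> e'" for e e' using ang_neq that by blast
    define P Q P' Q' S T C where "P = ang y p" and "Q = ang y q" and "P' = ang y p'" and "Q' = ang y q'"
      and "S = ang y s" and "T = ang y t" and "C = ang y c"
    note df = this
    have ds: "distinct [P, P', S, T, C]" "distinct [Q, Q', S, T, C]" "P \<noteq> Q'" "P' \<noteq> Q"
      unfolding df using inj yd yW sD c st W' nD' by (auto simp: nD'[symmetric])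
    have a': "sepr P P' S T" "sepr P P' S C" "sepr Q Q' T S" "sepr Q Q' T C"
      using a unfolding sep_def df by auto
    show False
    proof (cases "q = p"; cases "q' = p'")
      assume "q = p" "q' = p'"
      then have "Q = P" "Q' = P'" unfolding df by auto
      then show False using a' unfolding sepr_def by blast
    next
      assume e: "q = p" "q' \<noteq> p'"
      then have "Q = P" unfolding df by auto
      moreover have "sepr P P' S Q'" "sepr Q Q' T P'" "\<not> sepr P' Q' S T" "\<not> sepr P' Q' S C"
        using b d e unfolding sep_def df by auto
      moreover have "P' \<noteq> Q'" unfolding df using inj[of p' q'] yW W' e by auto
      ultimately show False using a' ds unfolding sepr_def by (smt (verit) distinct_length_2_or_more)
    next
      assume e: "q \<noteq> p" "q' = p'"
      then have "Q' = P'" unfolding df by auto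
      moreover have "sepr P P' S Q" "sepr Q Q' T P" "\<not> sepr P Q S T" "\<not> sepr P Q S C"
        using b d e unfolding sep_def df by auto
      moreover have "P \<noteq> Q" unfolding df using inj[of p q] yW W' e by auto
      ultimately show False using a' ds unfolding sepr_def by (smt (verit) distinct_length_2_or_more)
    next
      assume e: "q \<noteq> p" "q' \<noteq> p'"
      have "sepr P P' S Q" "sepr Q Q' T P" "\<not> sepr P Q S T" "\<not> sepr P Q S C"
          "sepr P P' S Q'" "sepr Q Q' T P'" "\<not> sepr P' Q' S T" "\<not> sepr P' Q' S C"
        using b d e unfolding sep_def df by auto
      moreover have "P \<noteq> Q" "P' \<noteq> Q'" unfolding df using inj[of p q] inj[of p' q'] yW W' e by auto
      ultimately show False using a' ds unfolding sepr_def by (smt (verit) distinct_length_2_or_more)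
    qed
  qed
  have ns: "v = w \<or> (\<forall>d\<in>D. \<forall>d'\<in>D. \<not> sep y v w d d')"
    if "(v, w) \<in> (urel y)\<^sup>*" "v \<in> {x, z}" "w \<in> {x', z'}" for v w
    using urel_sep[OF W(2), of v w] that W r by auto
  \<comment> \<open>If the ends of the second triangle occur in the opposite direction along
    \<open>xs\<close>, it is read backwards by \<open>own_rev\<close>.\<close>
  show False
  proof (cases "i < k \<longleftrightarrow> i' < k")
    case True
    then have "(j < k) \<longleftrightarrow> (j' < k)" using sides by blast
    have "x \<noteq> z'" "z \<noteq> x'" using sides True i j i' j' len ul unfolding ulist_def
      by (metis nth_eq_iff_index_eq)+
    then show False
      using main[OF ns[OF con[of i i', unfolded i i']] ns[OF con[of j j', unfolded j j']] os ot]
        True \<open>(j < k) \<longleftrightarrow> (j' < k)\<close> i j i' j' nk W by auto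
  next
    case False
    then have "(i < k) \<longleftrightarrow> (j' < k)" "(j < k) \<longleftrightarrow> (i' < k)" using sides by blast+
    note f = this
    have "x \<noteq> x'" "z \<noteq> z'" using sides False i j i' j' len ul unfolding ulist_def
      by (metis nth_eq_iff_index_eq)+
    then show False
      using main[OF ns[OF con[of i j', unfolded i j']] ns[OF con[of j i', unfolded j i']] os ot[unfolded own_rev[of t x']]]
        f i j i' j' nk W by auto
  qed
qed

end

section \<open>Consecutive edges in a rotation\<close>

context rotation_drawing
begin

lemma distinct_ang: "distinct xs \<Longrightarrow> \<forall>x\<in>set xs. {v, x} \<in> E \<Longrightarrow> distinct (map (ang v) xs)"
  unfolding distinct_map inj_on_def using ang_inj by blast

text \<open>The edges \<open>vp\<close> and \<open>vq\<close> are consecutive at \<open>v\<close>.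
  Formulated without naming the empty one of the two sectors, the notion is insensitive to
  orientation.\<close>

definition contig :: "'a \<Rightarrow> 'a \<Rightarrow> 'a \<Rightarrow> bool" where
  "contig v p q \<longleftrightarrow> (\<forall>e e'. {v, e} \<in> E \<longrightarrow> {v, e'} \<in> E \<longrightarrow> e \<notin> {p, q} \<longrightarrow> e' \<notin> {p, q} \<longrightarrow> \<not> sep v p q e e')"

text \<open>If \<open>m\<close> is next to \<open>p\<close> and next to \<open>q\<close>, then
  \<open>p\<close>, \<open>m\<close>, \<open>q\<close> are consecutive, and all further points lie
  in the arc between \<open>p\<close> and \<open>q\<close> that does not contain
  \<open>m\<close>.\<close>

lemma sepr_middle:
  assumes "distinct [m, p, q, e, e']" "\<not> sepr m p q e" "\<not> sepr m p e e'" "\<not> sepr m q p e" "\<not> sepr m q e e'"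
  shows "\<not> sepr p q e e'"
  using assms unfolding sepr_def by (smt (verit) distinct_length_2_or_more)

text \<open>The edges to \<open>p\<close>, \<open>m\<close>, \<open>q\<close> are consecutive at
  \<open>v\<close>, so the sector away from \<open>w\<close> contains at most the edge to
  \<open>m\<close>, and \<open>corner\<close> gives the bound one.\<close>

lemma corner_one:
  assumes adm: "s \<in> D" "x \<in> W" "y \<in> W" "x \<noteq> y" "{v, p, q} = {s, x, y}"
    and m: "{v, m} \<in> E" "{v, p} \<in> E" "{v, q} \<in> E" "distinct [m, p, q]"
    and w: "{v, w} \<in> E" "w \<notin> {m, p, q}"
    and c: "contig v m p" "contig v m q"
  shows "r {p, q} \<le> 1"
proof -
  have "r {p, q} \<le> card {e. {v, e} \<in> E \<and> e \<noteq> p \<and> e \<noteq> q \<and> sep v p q e w}"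
    by (rule corner[OF adm]) (use w in auto)
  also have "\<dots> \<le> card {m}"
  proof (rule card_mono)
    show "{e. {v, e} \<in> E \<and> e \<noteq> p \<and> e \<noteq> q \<and> sep v p q e w} \<subseteq> {m}"
    proof
      fix e assume "e \<in> {e. {v, e} \<in> E \<and> e \<noteq> p \<and> e \<noteq> q \<and> sep v p q e w}"
      then have e: "{v, e} \<in> E" "e \<noteq> p" "e \<noteq> q" "sep v p q e w" by auto
      then have "e \<noteq> w" using sep_refl by blast
      show "e \<in> {m}"
      proof (rule ccontr)
        assume "e \<notin> {m}"
        then have "distinct [ang v m, ang v p, ang v q, ang v e, ang v w]"
          using distinct_ang[of "[m, p, q, e, w]" v] m w e \<open>e \<noteq> w\<close> by auto
        moreover have "\<not> sep v m p q e" "\<not> sep v m p e w" "\<not> sep v m q p e" "\<not> sep v m q e w"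
          using c m w e \<open>e \<notin> {m}\<close> unfolding contig_def by auto
        ultimately show False using sepr_middle e(4) unfolding sep_def by blast
      qed
    qed
  qed simp
  finally show ?thesis by simp
qed

text \<open>Turning from \<open>p\<close> away from \<open>w\<close>, this is the first point of
  \<open>F\<close> that is met. It is found as the point that, together with \<open>p\<close>, cuts
  off the fewest points of \<open>F\<close> from \<open>w\<close>.\<close>

lemma sepr_first:
  assumes "finite F" "F \<noteq> {}" "p \<notin> F" "w \<notin> F" "p \<noteq> w"
  shows "\<exists>s\<in>F. \<forall>d\<in>F - {s}. \<not> sepr p s d w"
proof -
  let ?A = "\<lambda>s. {d \<in> F - {s}. sepr p s d w}"
  obtain s where s: "s \<in> F" "\<forall>t\<in>F. card (?A s) \<le> card (?A t)"
    using ex_is_arg_min_if_finite[OF assms(1,2), of "\<lambda>s. card (?A s)"] unfolding is_arg_min_linorder by blast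
  have "d \<notin> ?A s" for d
  proof
    assume d: "d \<in> ?A s"
    \<comment> \<open>A point cut off by \<open>s\<close> cuts off strictly fewer points
      itself.\<close>
    have "?A d \<subset> ?A s"
    proof
      show "?A d \<subseteq> ?A s"
      proof
        fix e assume e: "e \<in> ?A d"
        have "e \<noteq> s" using e d assms s(1) unfolding sepr_def by (smt (verit) DiffE mem_Collect_eq singletonI)
        moreover have "sepr p s e w" using e d assms s(1) \<open>e \<noteq> s\<close> unfolding sepr_def
          by (smt (verit) DiffE mem_Collect_eq singletonI)
        ultimately show "e \<in> ?A s" using e by auto
      qed
      show "?A d \<noteq> ?A s" using d by blast
    qed
    then have "card (?A d) < card (?A s)" using assms(1) by (simp add: psubset_card_mono)
    then show False using s(2) d by (metis (no_types, lifting) DiffD1 mem_Collect_eq not_less)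
  qed
  then show ?thesis using s(1) by blast
qed

text \<open>Let \<open>s\<close> be the first element of \<open>D\<close> met when turning from
  \<open>p\<close> away from \<open>w\<close>. By \<open>o\<close> no vertex of \<open>W\<close>
  comes in between, so \<open>vp\<close> and \<open>vs\<close> are consecutive and the bound
  \<open>corner\<close> for \<open>sp\<close> is zero.\<close>

lemma corner_first:
  assumes v: "v \<in> W" "p \<in> W" "w \<in> W" "distinct [v, p, w]"
    and o: "\<And>e d. e \<in> W \<Longrightarrow> d \<in> D \<Longrightarrow> e \<noteq> v \<Longrightarrow> e \<noteq> p \<Longrightarrow> e \<noteq> w \<Longrightarrow> \<not> sep v p d e w"
  shows "\<exists>s\<in>D. r {s, p} = 0"
proof -
  have ed: "{v, d} \<in> E" if "d \<in> D" for d using that v edge_iff by blast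
  have ne: "ang v d \<noteq> ang v e" if "d \<in> D" "e \<in> {p, w}" for d e
    by (rule ang_neq[OF ed[OF that(1)]]) (use that v disj in \<open>auto simp: edge_iff\<close>)
  have "\<exists>s\<in>ang v ` D. \<forall>d\<in>ang v ` D - {s}. \<not> sepr (ang v p) s d (ang v w)"
  proof (rule sepr_first)
    show "finite (ang v ` D)" "ang v ` D \<noteq> {}" using finD D3 by auto
    show "ang v p \<notin> ang v ` D" "ang v w \<notin> ang v ` D" using ne by (metis imageE insertCI)+
    show "ang v p \<noteq> ang v w" by (rule ang_neq) (use v in \<open>auto simp: edge_iff\<close>)
  qed
  then obtain s where s0: "s \<in> D" "\<forall>d\<in>ang v ` D - {ang v s}. \<not> sepr (ang v p) (ang v s) d (ang v w)" by blast
  have s: "s \<in> D" "\<And>d. d \<in> D \<Longrightarrow> d \<noteq> s \<Longrightarrow> \<not> sep v p s d w"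
    using s0 ang_neq[OF ed ed[OF s0(1)]] unfolding sep_def by auto
  have "r {p, s} \<le> card {e. {v, e} \<in> E \<and> e \<noteq> p \<and> e \<noteq> s \<and> sep v p s e w}"
    by (rule corner[of s v p]) (use s v disj in \<open>auto simp: edge_iff\<close>)
  also have "{e. {v, e} \<in> E \<and> e \<noteq> p \<and> e \<noteq> s \<and> sep v p s e w} = {}"
  proof -
    have False if e: "{v, e} \<in> E" "e \<noteq> p" "e \<noteq> s" "sep v p s e w" for e
    proof -
      have "e \<noteq> w" using e(4) sep_refl by blast
      then show False using e nbr_W[OF v(1), of e] s(2)[of e] o[of e s] s(1) by blast
    qed
    then show ?thesis by blast
  qed
  finally show ?thesis using s(1) by (auto simp: insert_commute)
qed

text \<open>Take \<open>t\<close> in \<open>D\<close> other than \<open>s\<close>. If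
  \<open>t\<close> and \<open>o1\<close> are on different sides of the triangle
  \<open>s y q\<close>, both \<open>to1\<close> and \<open>to2\<close> must cross \<open>sq\<close>,
  which is one crossing too many. Otherwise \<open>yt\<close> starts opposite to \<open>yo1\<close>,
  hence on the wrong side, and must cross \<open>sq\<close>. There are two such \<open>t\<close>, so
  \<open>sq\<close> has two crossings in this case as well.\<close>

lemma fan_contra:
  assumes W: "y \<in> W" "q \<in> W" "o1 \<in> W" "o2 \<in> W" "distinct [y, q, o1, o2]" and s: "s \<in> D"
    and r: "r {s, y} = 0" "r {y, q} = 0" "r {s, q} \<le> 1"
    and sp: "\<And>t. t \<in> D \<Longrightarrow> t \<noteq> s \<Longrightarrow> sep y s q t o1"
    and nc: "\<not> cross {y, o1} {s, q}"
    and vv: "is_cycle [y, s, q] \<Longrightarrow> cycle_edges [y, s, q] = {{s, y}, {y, q}, {s, q}} \<Longrightarrow>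
       vin {{s, y}, {y, q}, {s, q}} o1 = vin {{s, y}, {y, q}, {s, q}} o2"
  shows False
proof -
  let ?C = "{{s, y}, {y, q}, {s, q}}"
  obtain t t' where t: "t \<in> D" "t' \<in> D" "D = {s, t, t'}" "distinct [s, t, t']" using other_D[OF s] .
  have sW: "d \<notin> W" if "d \<in> D" for d using that disj by auto
  have dd: "d \<noteq> y" "d \<noteq> q" "d \<noteq> o1" "d \<noteq> o2" if "d \<in> D" for d using sW[OF that] W by auto
  have "is_cycle [s, y, q]" "cycle_edges [s, y, q] = ?C"
    using tri_cycle[of s y q] W s r r0_nocross dd[OF s] by (auto simp: edge_iff)
  then have cy: "is_cycle [y, s, q]" and ce: "cycle_edges [y, s, q] = ?C"
    using is_cycle_rotate3(2) cycle_edges_rotate3(2)[of y s q] by metis+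
  note v = vv[OF cy ce]
  have crs: "cross {t, p} {s, q}" if "t \<in> D" "t \<noteq> s" "p \<in> W" "p \<noteq> q" "gs ?C p t \<noteq> vin ?C t" for t p
  proof (rule ccontr)
    assume "\<not> cross {t, p} {s, q}"
    then have "\<And>f. f \<in> cycle_edges [y, s, q] \<Longrightarrow> \<not> cross {t, p} f" unfolding ce using r0_nocross r by auto
    from gs_away[OF cy _ _ this] that dd[OF that(1)] show False unfolding ce by (auto simp: edge_iff)
  qed
  have g1: "gs ?C y o1 = vin ?C o1"
    using gs_away[OF cy, of o1 y] W dd[OF s] nc r0_nocross r unfolding ce by (auto simp: edge_iff insert_commute)
  have gv: "gs ?C p t = vin ?C p" if "p \<in> {o1, o2}" "t \<in> D" for p t
    using gs_vin[OF cy, of p t] that W dd[OF s] unfolding ce by (auto simp: edge_iff)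
  have "cross {t, y} {s, q}" if tt: "t \<in> D" "t \<noteq> s" for t
  proof (cases "vin ?C t = vin ?C o1")
    case True
    have "gs ?C y t \<noteq> gs ?C y o1"
      using gs_sector[OF cy, of t o1] sp[OF tt] tt W dd[OF tt(1)] dd[OF s] unfolding ce by (auto simp: edge_iff)
    then show ?thesis using crs[OF tt, of y] True g1 W by auto
  next
    case False
    then have "cross {t, o1} {s, q}" "cross {t, o2} {s, q}"
      using crs[OF tt, of o1] crs[OF tt, of o2] gv tt v W by auto
    then have "2 \<le> r {s, q}" using cross_r2[of "{s,q}" "{t,o1}" "{t,o2}"] cross_sym W by (auto simp: doubleton_eq_iff)
    then show ?thesis using r by simp
  qed
  then have "cross {t, y} {s, q}" "cross {t', y} {s, q}" using t by auto
  moreover have "{t, y} \<noteq> {t', y}" using t dd by (auto simp: doubleton_eq_iff)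
  ultimately have "2 \<le> r {s, q}" using cross_r2 cross_sym by blast
  then show False using r by simp
qed

section \<open>The exceptional configuration of four outer vertices\<close>

definition RR :: "'a \<Rightarrow> 'a \<Rightarrow> 'a \<Rightarrow> 'a \<Rightarrow> bool" where
  "RR x1 x2 x3 x4 \<longleftrightarrow> W = {x1, x2, x3, x4} \<and> distinct [x1, x2, x3, x4] \<and> tri x1 x2 x3 \<and> tri x2 x3 x4 \<and>
     x4 \<in> inn x1 x2 x3 x2 \<and> x1 \<in> inn x2 x3 x4 x3"

lemma RR_rev: "RR x1 x2 x3 x4 \<Longrightarrow> RR x4 x3 x2 x1"
  unfolding RR_def using tri_rev inn_rev by auto

text \<open>The diagonals \<open>x1x3\<close> and \<open>x2x4\<close> cross each other and nothing
  else. At \<open>x2\<close> the edge to \<open>x4\<close> therefore is alone between those to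
  \<open>x1\<close> and \<open>x3\<close>, with all of \<open>D\<close> in the other sector. The
  facts at the opposite end follow from \<open>RR_rev\<close>.\<close>

lemma RR_facts:
  assumes "RR x1 x2 x3 x4"
  shows "x1 \<in> W" "x2 \<in> W" "x3 \<in> W" "x4 \<in> W" "distinct [x1, x2, x3, x4]" "W = {x1, x2, x3, x4}"
    "r {x1, x2} = 0" "r {x2, x3} = 0" "r {x3, x4} = 0"
    "\<And>e. cross e {x1, x3} \<Longrightarrow> e = {x2, x4}"
    "\<And>d. d \<in> D \<Longrightarrow> sep x2 x1 x3 x4 d" "contig x1 x2 x3" "contig x2 x3 x4"
    "\<And>d. d \<in> D \<Longrightarrow> d \<noteq> x1 \<and> d \<noteq> x2 \<and> d \<noteq> x3 \<and> d \<noteq> x4"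
proof -
  have t1: "tri x1 x2 x3" and t2: "tri x2 x3 x4" and i1: "x4 \<in> inn x1 x2 x3 x2"
    using assms unfolding RR_def by auto
  show WW: "x1 \<in> W" "x2 \<in> W" "x3 \<in> W" "x4 \<in> W" and d: "distinct [x1, x2, x3, x4]" and W: "W = {x1, x2, x3, x4}"
    and r: "r {x1, x2} = 0" "r {x2, x3} = 0" "r {x3, x4} = 0"
    using assms unfolding RR_def tri_def by auto
  have cr: "cross {x2, x4} {x1, x3}" using inn_cross[OF t1 _ i1] by auto
  have "r {x1, x3} \<le> 1" using t1 unfolding tri_def by auto
  then show "e = {x2, x4}" if "cross e {x1, x3}" for e
    using cross_r2[of "{x1,x3}" "{x2,x4}" e] cr that cross_sym by fastforce
  show dd: "d \<noteq> x1 \<and> d \<noteq> x2 \<and> d \<noteq> x3 \<and> d \<noteq> x4" if "d \<in> D" for d using that WW disj by auto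
  have no: "e \<notin> inn x1 x2 x3 x2" if "e \<noteq> x4" for e using inn_unique[OF t1, of x2 x2 e x4] i1 that by auto
  show s: "sep x2 x1 x3 x4 e" if "e \<in> D" for e
    using tri_sector(1)[OF t1, of x4 e] i1 no[of e] dd[OF that] d that WW by (auto simp: edge_iff)
  have no1: "e \<notin> inn x1 x2 x3 x1" for e using inn_unique[OF t1, of x1 x2 e x4] i1 d by auto
  show "contig x1 x2 x3" unfolding contig_def using tri_sector(2)[OF t1] no1 by auto
  show "contig x2 x3 x4" unfolding contig_def
  proof (intro allI impI)
    fix e e' assume e: "{x2, e} \<in> E" "{x2, e'} \<in> E" "e \<notin> {x3, x4}" "e' \<notin> {x3, x4}"
    have *: "\<not> sep x2 x3 x4 f x1" if f: "{x2, f} \<in> E" "f \<notin> {x3, x4}" for f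
    proof (cases "f = x1")
      case False
      then have "f \<in> D" using f W nbr_W[OF WW(2)] by auto
      from s[OF this] have "\<not> sep x2 x3 x4 x1 f"
        using sep_four(2)[of x2 x3 x1 x4 f] WW d dd[OF \<open>f \<in> D\<close>] f False sep_sym by (auto simp: edge_iff)
      then show ?thesis using sep_sym by blast
    qed (simp add: sep_refl)
    show "\<not> sep x2 x3 x4 e e'" using *[OF e(1,3)] *[OF e(2,4)] sep_trans sep_sym by metis
  qed
qed

lemma uncrossed_gs:
  assumes "is_cycle vs" "\<And>e. e \<in> cycle_edges vs \<Longrightarrow> r e = 0" "w \<notin> set vs" "{v, w} \<in> E"
  shows "gs (cycle_edges vs) v w = vin (cycle_edges vs) w"
  using gs_away[OF assms(1,3), of v] assms(2,4) r0_nocross by (auto simp: insert_commute)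

text \<open>Up to reflection, the assumptions leave only the cyclic order \<open>o1\<close>,
  \<open>s\<close>, \<open>t\<close>, \<open>q\<close>, \<open>o2\<close>.\<close>

lemma sepr_order:
  assumes "distinct [o1, q, o2, s, t]" "sepr o1 q o2 s" "sepr o1 q o2 t" "\<not> sepr o1 s q t" "\<not> sepr o1 s o2 t"
  shows "sepr s q t o1"
  using assms unfolding sepr_def by (smt (verit) distinct_length_2_or_more)

text \<open>Every other neighbour of \<open>p\<close> is \<open>y\<close> or adjacent to
  \<open>y\<close>, and no edge crosses the triangle \<open>p q s\<close>, so all of them lie on one
  side of it.\<close>

lemma uncrossed_triangle_contig:
  assumes W: "W = {p, q, y, z}" "distinct [p, q, y, z]" and s: "s \<in> D" and r: "r {p, q} = 0" "r {s, p} = 0" "r {s, q} = 0"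
  shows "contig p q s"
proof -
  have d: "s \<noteq> p" "s \<noteq> q" "s \<noteq> y" "s \<noteq> z" using s W disj by auto
  have cy: "is_cycle [p, q, s]" and ce: "cycle_edges [p, q, s] = {{p, q}, {q, s}, {p, s}}"
    using tri_cycle[of p q s] W s r r0_nocross d by (auto simp: edge_iff insert_commute)
  have z: "\<And>e. e \<in> cycle_edges [p, q, s] \<Longrightarrow> r e = 0" unfolding ce using r by (auto simp: insert_commute)
  have v: "vin (cycle_edges [p, q, s]) e = vin (cycle_edges [p, q, s]) y" if "{p, e} \<in> E" "e \<notin> {q, s}" for e
  proof (cases "e = y")
    case False
    then have "{e, y} \<in> E" using nbr_W[of p e] that W by (auto simp: edge_iff)
    moreover have "e \<notin> set [p,q,s]" using that E_irrefl by auto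
    moreover have "y \<notin> set [p,q,s]" using W d by auto
    ultimately show ?thesis using uncrossed_vin[OF cy z] by metis
  qed simp
  have g: "gs (cycle_edges [p, q, s]) p e = vin (cycle_edges [p, q, s]) e" if "{p, e} \<in> E" "e \<notin> {q, s}" for e
    by (rule uncrossed_gs[OF cy z]) (use that E_irrefl in auto)
  show ?thesis unfolding contig_def
    using gs_sector[OF cy] v g by auto
qed

text \<open>The uncrossed cycle \<open>x2 x1 s x3\<close> would separate \<open>x4\<close> from
  another element \<open>t\<close> of \<open>D\<close>, because \<open>x4\<close> is alone in its
  sector at \<open>x2\<close>. But \<open>x4\<close> and \<open>t\<close> are adjacent.\<close>

lemma RR_13: assumes R: "RR x1 x2 x3 x4" and s: "s \<in> D" "r {s, x1} = 0" "r {s, x3} = 0" shows False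
proof -
  note f = RR_facts[OF R]
  obtain t where t: "t \<in> D" "t \<noteq> s" using other_D[OF s(1)] by (metis distinct_length_2_or_more)
  have ce: "cycle_edges [x2, x1, s, x3] = {{x2,x1}, {x1,s}, {s,x3}, {x3,x2}}" unfolding cycle_edges_def by auto
  have z: "\<And>e. e \<in> cycle_edges [x2, x1, s, x3] \<Longrightarrow> r e = 0" unfolding ce using f(7-9) s by (auto simp: insert_commute)
  have cy: "is_cycle [x2, x1, s, x3]" unfolding is_cycle_def
    using z r0_nocross f(1-5) f(14)[OF s(1)] s(1) by (auto simp: ce edge_iff)
  have o: "x4 \<notin> set [x2, x1, s, x3]" "t \<notin> set [x2, x1, s, x3]" using f(5) f(14)[OF s(1)] f(14)[OF t(1)] t by auto
  have "gs (cycle_edges [x2, x1, s, x3]) x2 x4 = gs (cycle_edges [x2, x1, s, x3]) x2 t"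
    using uncrossed_gs[OF cy z o(1), of x2] uncrossed_gs[OF cy z o(2), of x2] uncrossed_vin[OF cy z o] f(1-5) t
    by (auto simp: edge_iff)
  then show False
    using gs_sector[OF cy, of x4 t] f(11)[OF t(1)] f(1-5) f(14)[OF t(1)] t by (auto simp: edge_iff)
qed

text \<open>The triangle \<open>x1 x2 s\<close> is uncrossed, so at \<open>x1\<close> the edge to
  \<open>x2\<close> lies between those to \<open>s\<close> and \<open>x3\<close>, and
  \<open>sx3\<close> is crossed at most once. At \<open>x2\<close> the edge to \<open>s\<close>
  comes right after the edge to \<open>x1\<close>, so the other elements of \<open>D\<close> lie
  between \<open>s\<close> and \<open>x3\<close>, as \<open>fan_contra\<close> requires.\<close>

lemma RR_12: assumes R: "RR x1 x2 x3 x4" and s: "s \<in> D" "r {s, x1} = 0" "r {s, x2} = 0" shows False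
proof -
  note f = RR_facts[OF R]
  note f' = RR_facts[OF RR_rev[OF R]]
  note d = f(14)[OF s(1)]
  have c1: "contig x1 x2 s" by (rule uncrossed_triangle_contig[of _ _ x3 x4]) (use f s in auto)
  have c2: "contig x2 x1 s" by (rule uncrossed_triangle_contig[of _ _ x3 x4]) (use f s in \<open>auto simp: insert_commute\<close>)
  have "r {s, x3} \<le> 1"
    by (rule corner_one[of s x1 x3 x1 s x3 x2 x4]) (use f s d c1 in \<open>auto simp: edge_iff\<close>)
  moreover have sp: "sep x2 s x3 t x1" if t: "t \<in> D" "t \<noteq> s" for t
  proof -
    note dt = f(14)[OF t(1)]
    have "distinct [ang x2 x1, ang x2 x3, ang x2 x4, ang x2 s, ang x2 t]"
      using distinct_ang[of "[x1, x3, x4, s, t]" x2] f(1-5) s(1) t d dt by (auto simp: edge_iff)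
    moreover have "\<not> sep x2 x1 s x3 t" "\<not> sep x2 x1 s x4 t" using c2 f(1-5) d dt t unfolding contig_def by (auto simp: edge_iff)
    ultimately show ?thesis using f(11)[OF s(1)] f(11)[OF t(1)] sepr_order unfolding sep_def by blast
  qed
  \<comment> \<open>Neither \<open>x2x1\<close> nor \<open>x2x4\<close> meets this triangle again,
    and both start on the same side of it at \<open>x2\<close>.\<close>
  moreover have "vin C x1 = vin C x4" if cy: "is_cycle [x2, s, x3]" "cycle_edges [x2, s, x3] = C" "C = {{s, x2}, {x2, x3}, {s, x3}}" for C
  proof -
    have "gs C x2 x1 = vin C x1" using gs_away[OF cy(1), of x1 x2] cy(2) f(1-9) d r0_nocross by (auto simp: edge_iff)
    moreover have "gs C x2 x4 = vin C x4"
      using gs_away[OF cy(1), of x4 x2] cy(2,3) f(1-5) d f'(10)[of "{s,x3}"] f'(10)[of "{s,x2}"] r0_nocross(2)[OF f(8)] cross_sym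
      by (auto simp: edge_iff insert_commute doubleton_eq_iff)
    moreover have "\<not> sep x2 s x3 x1 x4"
      using sep_four(2)[of x2 x3 x1 s x4] f(11)[OF s(1)] sep_sym f(1-5) d s(1) by (auto simp: edge_iff)
    ultimately show ?thesis using gs_sector[OF cy(1), of x1 x4] cy(2) f(1-5) d by (auto simp: edge_iff)
  qed
  ultimately show False
    using fan_contra[of x2 x3 x1 x4 s] f(1-9) s r0_nocross(1)[OF f(7)] by (auto simp: insert_commute)
qed

text \<open>Here the uncrossed triangle is \<open>x2 x3 s\<close>. At \<open>x2\<close> the edge to
  \<open>x3\<close> lies between those to \<open>s\<close> and \<open>x4\<close>, which bounds the
  crossings of \<open>sx4\<close>, and the fan is taken at \<open>x3\<close>.\<close>

lemma RR_23: assumes R: "RR x1 x2 x3 x4" and s: "s \<in> D" "r {s, x2} = 0" "r {s, x3} = 0" shows False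
proof -
  note f = RR_facts[OF R]
  note f' = RR_facts[OF RR_rev[OF R]]
  note d = f(14)[OF s(1)]
  have c1: "contig x2 x3 s" by (rule uncrossed_triangle_contig[of _ _ x1 x4]) (use f s in auto)
  have c2: "contig x3 x2 s" by (rule uncrossed_triangle_contig[of _ _ x1 x4]) (use f s in \<open>auto simp: insert_commute\<close>)
  have "r {s, x4} \<le> 1"
    by (rule corner_one[of s x2 x4 x2 s x4 x3 x1]) (use f s d c1 in \<open>auto simp: edge_iff\<close>)
  moreover have sp: "sep x3 s x4 t x2" if t: "t \<in> D" "t \<noteq> s" for t
  proof -
    note dt = f(14)[OF t(1)]
    have "distinct [ang x3 x2, ang x3 x4, ang x3 x1, ang x3 s, ang x3 t]"
      using distinct_ang[of "[x2, x4, x1, s, t]" x3] f(1-5) s(1) t d dt by (auto simp: edge_iff)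
    moreover have "\<not> sep x3 x2 s x4 t" "\<not> sep x3 x2 s x1 t" using c2 f(1-5) d dt t unfolding contig_def by (auto simp: edge_iff)
    moreover have "sep x3 x2 x4 x1 e" if "e \<in> D" for e using f'(11)[OF that] sep_sym by blast
    ultimately show ?thesis using s t sepr_order unfolding sep_def by blast
  qed
  moreover have "vin C x2 = vin C x1" if cy: "is_cycle [x3, s, x4]" "cycle_edges [x3, s, x4] = C" for C
    using vin_eq[OF cy(1), of x2 x1] cy(2) f(1-9) d r0_nocross by (auto simp: edge_iff insert_commute)
  ultimately show False
    using fan_contra[of x3 x4 x2 x1 s] f(1-9) s r0_nocross(1)[OF f(8)] by (auto simp: insert_commute)
qed

text \<open>The pentagon \<open>x1 x2 x3 x4 s\<close> is uncrossed, and each of the diagonals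
  \<open>x1x3\<close> and \<open>x2x4\<close> stays on one side of it. They carry the separations
  known at \<open>x3\<close> and \<open>x2\<close> over to \<open>x1\<close> and \<open>x4\<close>.
  At \<open>x4\<close> only \<open>x1\<close> is then left between \<open>s\<close> and
  \<open>x2\<close>, so \<open>sx2\<close> is crossed at most once, and the fan is taken at
  \<open>x1\<close>.\<close>

lemma RR_14: assumes R: "RR x1 x2 x3 x4" and s: "s \<in> D" "r {s, x1} = 0" "r {s, x4} = 0" shows False
proof -
  note f = RR_facts[OF R]
  note f' = RR_facts[OF RR_rev[OF R]]
  note d = f(14)[OF s(1)]
  let ?C = "{{x1,x2}, {x2,x3}, {x3,x4}, {x4,s}, {s,x1}}"
  have ce: "cycle_edges [x1, x2, x3, x4, s] = ?C" "cycle_edges [x3, x2, x1, s, x4] = ?C"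
      "cycle_edges [x4, x3, x2, x1, s] = ?C" "cycle_edges [x2, x1, s, x4, x3] = ?C"
    unfolding cycle_edges_def by (auto simp: insert_commute)
  have z: "\<And>e. e \<in> ?C \<Longrightarrow> r e = 0" using f(7-9) s by (auto simp: insert_commute)
  have sub: "?C \<subseteq> E" using f(1-5) s(1) by (auto simp: edge_iff)
  have ii: "\<forall>e\<in>?C. \<forall>f\<in>?C. \<not> cross e f" using z r0_nocross by blast
  have cy: "is_cycle [x1, x2, x3, x4, s]" "is_cycle [x3, x2, x1, s, x4]" "is_cycle [x4, x3, x2, x1, s]" "is_cycle [x2, x1, s, x4, x3]"
    unfolding is_cycle_def ce using ii sub f(5) d by auto
  have z1: "\<And>e. e \<in> cycle_edges [x1, x2, x3, x4, s] \<Longrightarrow> r e = 0" using z ce(1) by auto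
  have vt: "gs ?C p t = vin ?C t" if "t \<in> D" "t \<noteq> s" "p \<in> W" for p t
    using uncrossed_gs[OF cy(1) z1, of t p] that f(14)[OF that(1)] unfolding ce by (auto simp: edge_iff)
  have ch: "gs ?C x1 x3 = gs ?C x3 x1" "gs ?C x2 x4 = gs ?C x4 x2"
    using gs_nocross[OF cy(1)] f(1-5) d z r0_nocross unfolding ce by (auto simp: edge_iff doubleton_eq_iff)
  have a: "sep x1 s x2 t x3" "sep x4 x3 s x2 t" if t: "t \<in> D" "t \<noteq> s" for t
  proof -
    note dt = f(14)[OF t(1)]
    have "gs ?C x3 x1 \<noteq> gs ?C x3 t"
      using gs_sector[OF cy(2), of x1 t] f'(11)[OF t(1)] sep_sym f(1-5) d dt t unfolding ce by (auto simp: edge_iff)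
    then have "gs ?C x1 x3 \<noteq> gs ?C x1 t" using vt t f(1-4) ch by auto
    then show "sep x1 s x2 t x3"
      using gs_sector[OF cy(1), of x3 t] sep_sym f(1-5) d dt t unfolding ce by (auto simp: edge_iff)
    have "gs ?C x2 x4 \<noteq> gs ?C x2 t"
      using gs_sector[OF cy(4), of x4 t] f(11)[OF t(1)] sep_sym f(1-5) d dt t unfolding ce by (auto simp: edge_iff)
    then have "gs ?C x4 x2 \<noteq> gs ?C x4 t" using vt t f(1-4) ch by auto
    then show "sep x4 x3 s x2 t"
      using gs_sector[OF cy(3), of x2 t] sep_sym f(1-5) d dt t unfolding ce by (auto simp: edge_iff)
  qed
  have "r {s, x2} \<le> card {e. {x4, e} \<in> E \<and> e \<noteq> s \<and> e \<noteq> x2 \<and> sep x4 s x2 e x3}"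
    by (rule corner[of s x2 x4]) (use s f(1-5) d in \<open>auto simp: edge_iff\<close>)
  also have "\<dots> \<le> card {x1}"
  proof (rule card_mono)
    show "{e. {x4, e} \<in> E \<and> e \<noteq> s \<and> e \<noteq> x2 \<and> sep x4 s x2 e x3} \<subseteq> {x1}"
    proof
      fix e assume "e \<in> {e. {x4, e} \<in> E \<and> e \<noteq> s \<and> e \<noteq> x2 \<and> sep x4 s x2 e x3}"
      then have e: "{x4, e} \<in> E" "e \<noteq> s" "e \<noteq> x2" "sep x4 s x2 e x3" by auto
      have "e \<notin> D"
      proof
        assume eD: "e \<in> D"
        have "\<not> sep x4 s x2 x3 e"
          using sep_four(2)[of x4 s x3 x2 e] a(2)[OF eD e(2)] sep_sym f(1-5) d f(14)[OF eD] s(1) eD e(2) by (auto simp: edge_iff)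
        then show False using e(4) sep_sym by blast
      qed
      moreover have "e \<noteq> x3" using e(4) sep_refl by blast
      ultimately show "e \<in> {x1}" using e nbr_W[OF f(4)] f(6) by auto
    qed
  qed simp
  finally have "r {s, x2} \<le> 1" by simp
  moreover have "vin C x3 = vin C x4" if cy: "is_cycle [x1, s, x2]" "cycle_edges [x1, s, x2] = C" for C
    using vin_eq[OF cy(1), of x3 x4] cy(2) f(1-9) d r0_nocross by (auto simp: edge_iff)
  moreover have "\<not> cross {x1, x3} {s, x2}" using f(10)[of "{s,x2}"] cross_sym d f(5) by (auto simp: doubleton_eq_iff)
  ultimately show False
    using fan_contra[of x1 x2 x3 x4 s] f(1-9) s a(1) by (auto simp: insert_commute)
qed

text \<open>Each of the four vertices has an uncrossed edge to some element of \<open>D\<close>. By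
  the four cases above and their mirror images no element of \<open>D\<close> serves two of them, so
  \<open>D\<close> would have four elements.\<close>

lemma not_RR: "\<not> RR x1 x2 x3 x4"
proof
  assume R: "RR x1 x2 x3 x4"
  note R' = RR_rev[OF R]
  have ex: "(\<exists>s\<in>D. r {s, x3} = 0) \<and> (\<exists>s\<in>D. r {s, x1} = 0)" if R: "RR x1 x2 x3 x4" for x1 x2 x3 x4
  proof -
    note f = RR_facts[OF R]
    have "\<not> sep x2 x3 d x1 x4 \<and> \<not> sep x2 x1 d x3 x4" if "d \<in> D" for d
      using sep_four(2)[of x2 x1 x3 x4 d] sep_four(3)[of x2 x1 x3 x4 d] sep_four(4)[of x2 x3 d x1 x4] f(11)[OF that] f(14)[OF that] sep_sym f(1-5) that by (auto simp: edge_iff)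
    note n = this
    show ?thesis
      using corner_first[of x2 x3 x4] corner_first[of x2 x1 x4] f(1-6) n by auto
  qed
  obtain s1 s3 where s13: "s1 \<in> D" "r {s1, x1} = 0" "s3 \<in> D" "r {s3, x3} = 0" using ex[OF R] by blast
  obtain s2 s4 where s24: "s2 \<in> D" "r {s2, x2} = 0" "s4 \<in> D" "r {s4, x4} = 0" using ex[OF R'] by blast
  have "s1 \<noteq> s2" using RR_12[OF R] s13 s24 by auto
  moreover have "s3 \<noteq> s4" using RR_12[OF R'] s13 s24 by auto
  moreover have "s2 \<noteq> s3" using RR_23[OF R] s13 s24 by auto
  moreover have "s1 \<noteq> s3" using RR_13[OF R] s13 s24 by auto
  moreover have "s2 \<noteq> s4" using RR_13[OF R'] s13 s24 by auto
  moreover have "s1 \<noteq> s4" using RR_14[OF R] s13 s24 by auto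
  ultimately have "card {s1, s2, s3, s4} = 4" by auto
  moreover have "card {s1, s2, s3, s4} \<le> card D" by (rule card_mono) (use finD s13 s24 in auto)
  ultimately show False using D3 by simp
qed

section \<open>The orders of \<open>W\<close> around the vertices of \<open>D\<close> and their
  alignment\<close>

definition lst :: "'a \<Rightarrow> 'a list \<Rightarrow> bool" where
  "lst s xs \<longleftrightarrow> ulist xs \<and> (\<forall>i. i + 2 < length xs \<longrightarrow> r {xs ! i, xs ! (i + 2)} \<le> 1) \<and>
     (\<forall>i. i + 3 < length xs \<longrightarrow> \<not> sep s (xs ! (i + 1)) (xs ! (i + 2)) (xs ! i) (xs ! (i + 3)))"

text \<open>Cut vertices determine the order of \<open>W\<close> only up to reversal, so the
  properties in \<open>lst\<close> must survive it.\<close>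

lemma lst_rev: assumes "lst s xs" shows "lst s (rev xs)"
proof -
  let ?n = "length xs"
  have "r {rev xs ! i, rev xs ! Suc i} = 0" if "Suc i < ?n" for i
  proof -
    have "rev xs ! i = xs ! Suc (?n - Suc (Suc i))" "rev xs ! Suc i = xs ! (?n - Suc (Suc i))"
      using that by (auto simp: rev_nth Suc_diff_Suc)
    then show ?thesis using assms that unfolding lst_def ulist_def by (auto simp: insert_commute)
  qed
  moreover have "r {rev xs ! i, rev xs ! (i + 2)} \<le> 1" if "i + 2 < ?n" for i
  proof -
    have "rev xs ! i = xs ! (?n - (i + 3) + 2)" "rev xs ! (i + 2) = xs ! (?n - (i + 3))"
      using that by (auto simp: rev_nth intro!: arg_cong[where f = "nth xs"])
    moreover have "?n - (i + 3) + 2 < ?n" using that by simp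
    ultimately show ?thesis using assms unfolding lst_def by (metis insert_commute)
  qed
  moreover have "\<not> sep s (rev xs ! (i + 1)) (rev xs ! (i + 2)) (rev xs ! i) (rev xs ! (i + 3))" if "i + 3 < ?n" for i
  proof -
    have "rev xs ! i = xs ! (?n - (i + 4) + 3)" "rev xs ! (i + 1) = xs ! (?n - (i + 4) + 2)"
        "rev xs ! (i + 2) = xs ! (?n - (i + 4) + 1)" "rev xs ! (i + 3) = xs ! (?n - (i + 4))"
      using that by (auto simp: rev_nth intro!: arg_cong[where f = "nth xs"])
    moreover have "?n - (i + 4) + 3 < ?n" using that by simp
    ultimately show ?thesis using assms sep_sym unfolding lst_def by metis
  qed
  ultimately show ?thesis using assms unfolding lst_def ulist_def by auto
qed

text \<open>\<open>W\<close> is listed by direction around \<open>s\<close>, beginning after the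
  edge to \<open>u\<close>. The sector between the i-th and the j-th vertex that avoids
  \<open>u\<close> contains only the edges to the j - i - 1 vertices listed between them. With
  \<open>u\<close> as the vertex \<open>w\<close>, \<open>corner\<close> turns this number into a
  bound on crossings.\<close>

lemma exists_lst: assumes s: "s \<in> D" shows "\<exists>xs. lst s xs"
proof -
  \<comment> \<open>The angle counted from the direction of \<open>u\<close>, up to a constant:
    directions before that of \<open>u\<close> are moved one full turn ahead.\<close>
  define key where "key w = (if ang s u < ang s w then ang s w else ang s w + 2 * pi)" for w
  have su: "{s, u} \<in> E" and sW: "\<And>w. w \<in> W \<Longrightarrow> {s, w} \<in> E" using s edge_iff by auto
  have au: "ang s w \<noteq> ang s u" if "w \<in> W" for w using ang_neq[OF sW[OF that] su] that uW by auto
  have aw: "ang s w \<noteq> ang s w'" if "w \<in> W" "w' \<in> W" "w \<noteq> w'" for w w' using ang_neq[OF sW sW] that by auto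
  have key_less: "key w \<noteq> key w'" if "w \<in> W" "w' \<in> W" "w \<noteq> w'" for w w'
    using aw[OF that] ang_range[of s w] ang_range[of s w'] unfolding key_def by auto
  then have inj: "inj_on key W" unfolding inj_on_def by blast
  have key_sep: "sep s x y e u \<longleftrightarrow> (key x < key e \<and> key e < key y) \<or> (key y < key e \<and> key e < key x)"
    if "x \<in> W" "y \<in> W" "e \<in> W" "distinct [x, y, e]" for x y e
    using au[OF that(1)] au[OF that(2)] au[OF that(3)] aw[of x y] aw[of x e] aw[of y e] that
      ang_range[of s x] ang_range[of s y] ang_range[of s e]
    unfolding sep_def sepr_def key_def by auto
  define ks where "ks = sorted_list_of_set (key ` W)"
  define xs where "xs = map (the_inv_into W key) ks"
  have ks: "set ks = key ` W" "sorted_wrt (<) ks" "distinct ks" unfolding ks_def using finW by auto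
  have kx: "map key xs = ks" unfolding xs_def map_map using ks(1) f_the_inv_into_f[OF inj] by (intro map_idI) auto
  have setx: "set xs = W" unfolding xs_def using ks the_inv_into_onto[OF inj] by simp
  have disx: "distinct xs" using kx ks(3) distinct_map[of key xs] by simp
  have mono: "key (xs ! i) < key (xs ! j) \<longleftrightarrow> i < j" if "i < length xs" "j < length xs" for i j
  proof -
    have "key (xs ! i) = ks ! i" "key (xs ! j) = ks ! j" "length ks = length xs" using kx that by auto
    then show ?thesis using ks(2) that unfolding sorted_wrt_iff_nth_less
      by (metis linorder_neqE_nat order_less_asym order_less_irrefl)
  qed
  have inW: "xs ! i \<in> W" if "i < length xs" for i using that setx by auto
  have neq: "xs ! i \<noteq> xs ! j" if "i < length xs" "j < length xs" "i \<noteq> j" for i j using that disx by (simp add: nth_eq_iff_index_eq)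
  have bet: "sep s (xs ! i) (xs ! j) (xs ! k) u \<longleftrightarrow> i < k \<and> k < j"
    if "i < length xs" "j < length xs" "k < length xs" "i < j" "k \<noteq> i" "k \<noteq> j" for i j k
    using key_sep[of "xs ! i" "xs ! j" "xs ! k"] inW neq mono that by auto
  have rb: "r {xs ! i, xs ! j} \<le> j - i - 1" if ij: "i < j" "j < length xs" for i j
  proof -
    have "r {xs ! i, xs ! j} \<le> card {e. {s, e} \<in> E \<and> e \<noteq> xs ! i \<and> e \<noteq> xs ! j \<and> sep s (xs ! i) (xs ! j) e u}"
      by (rule corner[OF s, of "xs ! i" "xs ! j"]) (use ij inW neq su uW in auto)
    also have "\<dots> \<le> card ((!) xs ` {i<..<j})"
    proof (rule card_mono)
      show "{e. {s, e} \<in> E \<and> e \<noteq> xs ! i \<and> e \<noteq> xs ! j \<and> sep s (xs ! i) (xs ! j) e u} \<subseteq> (!) xs ` {i<..<j}"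
      proof
        fix e assume "e \<in> {e. {s, e} \<in> E \<and> e \<noteq> xs ! i \<and> e \<noteq> xs ! j \<and> sep s (xs ! i) (xs ! j) e u}"
        then have e: "{s, e} \<in> E" "e \<noteq> xs ! i" "e \<noteq> xs ! j" "sep s (xs ! i) (xs ! j) e u" by auto
        then have "e \<in> W" using nbr_D[OF s] sep_refl by blast
        then obtain k where "k < length xs" "e = xs ! k" using setx by (metis in_set_conv_nth)
        moreover from this have "k \<noteq> i" "k \<noteq> j" using e by auto
        ultimately have "i < k \<and> k < j" using bet[of i j k] e ij by auto
        then show "e \<in> (!) xs ` {i<..<j}" using \<open>e = xs ! k\<close> by auto
      qed
    qed simp
    also have "\<dots> \<le> card {i<..<j}" by (rule card_image_le) simp
    finally show ?thesis by simp
  qed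
  have "ulist xs" unfolding ulist_def using disx setx rb[of _ "Suc _"] by fastforce
  moreover have "r {xs ! i, xs ! (i + 2)} \<le> 1" if "i + 2 < length xs" for i using rb[of i "i + 2"] that by simp
  moreover have "\<not> sep s (xs ! (i + 1)) (xs ! (i + 2)) (xs ! i) (xs ! (i + 3))" if "i + 3 < length xs" for i
  proof -
    \<comment> \<open>Neither outer vertex lies between the two middle ones when \<open>u\<close>
      serves as the point of reference.\<close>
    have "\<not> sep s (xs ! (i + 1)) (xs ! (i + 2)) (xs ! i) u" "\<not> sep s (xs ! (i + 1)) (xs ! (i + 2)) (xs ! (i + 3)) u"
      using bet[of "i + 1" "i + 2" i] bet[of "i + 1" "i + 2" "i + 3"] that by auto
    then show ?thesis using sep_trans sep_sym by blast
  qed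
  ultimately show ?thesis unfolding lst_def by blast
qed

lemma lst_length: "lst s xs \<Longrightarrow> length xs = card W"
  unfolding lst_def ulist_def using distinct_card by metis

lemma lst_tri: assumes "lst s xs" "i + 2 < length xs" shows "tri (xs ! i) (xs ! (i + 1)) (xs ! (i + 2))"
proof -
  have "distinct xs" "set xs = W" "r {xs ! i, xs ! Suc i} = 0" "r {xs ! Suc i, xs ! Suc (Suc i)} = 0" "r {xs ! i, xs ! (i + 2)} \<le> 1"
    using assms unfolding lst_def ulist_def by auto
  then show ?thesis unfolding tri_def using assms(2) by (auto simp: nth_eq_iff_index_eq)
qed

text \<open>If none of the first three inner vertices owns \<open>s\<close>,
  \<open>quad_cases\<close> leaves only its middle alternative. For five or more vertices this makes
  the chord from index 1 to index 3 cross both the chord from 0 to 2 and the chord from 2 to 4,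
  although it is crossed at most once. For four vertices it leads to the configuration
  \<open>RR\<close>. The bound three matters: it equals the size of \<open>D\<close>.\<close>

lemma own_exists:
  assumes s: "s \<in> D" and l: "lst s xs"
  shows "\<exists>i<3. i + 2 < length xs \<and> own s (xs ! i) (xs ! (i + 1)) (xs ! (i + 2))"
proof (rule ccontr)
  assume n: "\<not> ?thesis"
  have len: "length xs = card W" using lst_length[OF l] .
  have t: "tri (xs ! i) (xs ! (i + 1)) (xs ! (i + 2))" if "i + 2 < length xs" for i using lst_tri[OF l that] .
  have no: "s \<notin> inn (xs ! i) (xs ! (i + 1)) (xs ! (i + 2)) (xs ! (i + 1))" if "i < 3" "i + 2 < length xs" for i
    using n that t s unfolding own_def by blast
  have dis: "distinct xs" "set xs = W" using l unfolding lst_def ulist_def by auto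
  \<comment> \<open>The two remaining outcomes of \<open>quad_cases\<close> would make an inner
    vertex own \<open>s\<close>.\<close>
  have st: "xs ! (i + 3) \<in> inn (xs ! i) (xs ! (i + 1)) (xs ! (i + 2)) (xs ! (i + 1))" if "i < 2" "i + 3 < length xs" for i
  proof -
    have "\<not> sep s (xs ! (i + 1)) (xs ! (i + 2)) (xs ! i) (xs ! (i + 3))" using l that unfolding lst_def by blast
    moreover have "xs ! i \<noteq> xs ! (i + 3)" using dis that by (simp add: nth_eq_iff_index_eq)
    moreover have "tri (xs ! (i + 1)) (xs ! (i + 2)) (xs ! (i + 3))" using t[of "i + 1"] that by (simp add: numeral_eq_Suc)
    moreover have "s \<notin> inn (xs ! (i + 1)) (xs ! (i + 2)) (xs ! (i + 3)) (xs ! (i + 2))" using no[of "i + 1"] that by (simp add: numeral_eq_Suc)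
    ultimately show ?thesis using quad_cases[OF s t[of i]] no[of i] that by auto
  qed
  have l4: "3 < length xs" using W4 len by simp
  show False
  proof (cases "length xs = 4")
    case True
    have e: "xs ! 3 \<in> inn (xs ! 0) (xs ! 1) (xs ! 2) (xs ! 1)" using st[of 0] l4 by (simp add: numeral_eq_Suc)
    have t0: "tri (xs ! 0) (xs ! 1) (xs ! 2)" "tri (xs ! 1) (xs ! 2) (xs ! 3)" using t[of 0] t[of 1] l4 by (auto simp: numeral_eq_Suc)
    have "\<not> sep s (xs ! 1) (xs ! 2) (xs ! 0) (xs ! 3)" using l l4 unfolding lst_def by (metis add_0)
    \<comment> \<open>The condition is symmetric under reversal, so \<open>quad_cases\<close> also
      applies to the list read backwards and yields the second half of \<open>RR\<close>.\<close>
    then have "\<not> sep s (xs ! 2) (xs ! 1) (xs ! 3) (xs ! 0)" using sep_sym by blast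
    moreover have d: "distinct [xs ! 0, xs ! 1, xs ! 2, xs ! 3]"
    proof -
      have "0 < length xs" "1 < length xs" "2 < length xs" using l4 by auto
      then show ?thesis using dis(1) l4 by (simp add: nth_eq_iff_index_eq)
    qed
    moreover have "tri (xs ! 3) (xs ! 2) (xs ! 1)" "tri (xs ! 2) (xs ! 1) (xs ! 0)" using t0 tri_rev by blast+
    moreover have "s \<notin> inn (xs ! 0) (xs ! 1) (xs ! 2) (xs ! 1)" "s \<notin> inn (xs ! 1) (xs ! 2) (xs ! 3) (xs ! 2)"
      using no[of 0] no[of 1] l4 by (auto simp: numeral_eq_Suc)
    ultimately have f: "xs ! 0 \<in> inn (xs ! 1) (xs ! 2) (xs ! 3) (xs ! 2)"
      using quad_cases[OF s, of "xs ! 3" "xs ! 2" "xs ! 1" "xs ! 0"] inn_rev by auto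
    have "set xs = {xs ! 0, xs ! 1, xs ! 2, xs ! 3}"
      using True unfolding set_conv_nth by (auto simp: less_Suc_eq numeral_eq_Suc)
    then have "RR (xs ! 0) (xs ! 1) (xs ! 2) (xs ! 3)" unfolding RR_def using e f t0 d dis by auto
    then show False using not_RR by blast
  next
    case False
    then have l5: "4 < length xs" using l4 by simp
    have t1: "tri (xs ! 0) (xs ! 1) (xs ! 2)" "tri (xs ! 1) (xs ! 2) (xs ! 3)" using t[of 0] t[of 1] l5 by (auto simp: numeral_eq_Suc)
    have "xs ! 3 \<in> inn (xs ! 0) (xs ! 1) (xs ! 2) (xs ! 1)" "xs ! 4 \<in> inn (xs ! 1) (xs ! 2) (xs ! 3) (xs ! 2)"
      using st[of 0] st[of 1] l5 by (auto simp: numeral_eq_Suc)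
    then have "cross {xs ! 1, xs ! 3} {xs ! 0, xs ! 2}" "cross {xs ! 2, xs ! 4} {xs ! 1, xs ! 3}"
      using inn_cross[OF t1(1)] inn_cross[OF t1(2)] by auto
    moreover have "{xs ! 0, xs ! 2} \<noteq> {xs ! 2, xs ! 4}"
    proof -
      have "0 < length xs" "2 < length xs" using l5 by auto
      then show ?thesis using dis(1) l5 by (simp add: doubleton_eq_iff nth_eq_iff_index_eq)
    qed
    ultimately have "2 \<le> r {xs ! 1, xs ! 3}" using cross_r2 cross_sym by blast
    then show False using t1(2) unfolding tri_def by auto
  qed
qed

text \<open>Deleting the owner leaves exactly two components of the uncrossed graph, namely the two
  ends of \<open>xs\<close>. Any other Hamiltonian path of uncrossed edges must run through one
  component before this vertex and through the other one after it.\<close>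

lemma cut_position:
  assumes o: "own s (xs ! i) (xs ! (i + 1)) (xs ! (i + 2))" and l: "ulist xs" "ulist ys" and i: "i + 2 < length xs"
    and j: "j < length ys" "ys ! j = xs ! (i + 1)"
  shows "set (take j ys) = set (take (i + 1) xs) \<or> set (take j ys) = set (drop (i + 2) xs)"
proof -
  let ?y = "xs ! (i + 1)"
  have dx: "distinct xs" "set xs = W" and dy: "distinct ys" "set ys = W" using l unfolding ulist_def by auto
  have cut: "(xs ! i, xs ! (i + 2)) \<notin> (urel ?y)\<^sup>*" using own_cut[OF o] .
  have split: "set xs = insert ?y (set (take (i + 1) xs) \<union> set (drop (i + 2) xs))"
    using id_take_nth_drop[of "i + 1" xs] i by (metis Suc_eq_plus1 Un_insert_right add_2_eq_Suc' add_Suc_right list.simps(15) numeral_2_eq_2 set_append One_nat_def add.right_neutral Suc_lessD)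
  have ysplit: "set ys = insert ?y (set (take j ys) \<union> set (drop (Suc j) ys))"
    using id_take_nth_drop[of j ys] j by (metis Un_insert_right list.simps(15) set_append)
  have ydis: "?y \<notin> set (take j ys)" "?y \<notin> set (drop (Suc j) ys)" "set (take j ys) \<inter> set (drop (Suc j) ys) = {}"
    using id_take_nth_drop[OF j(1)] dy(1) j(2) by (metis disjoint_insert(1) distinct.simps(2) distinct_append list.simps(15) not_distinct_conv_prefix)+
  have xdis: "?y \<notin> set (take (i + 1) xs)" "?y \<notin> set (drop (i + 2) xs)" "set (take (i + 1) xs) \<inter> set (drop (i + 2) xs) = {}"
    using id_take_nth_drop[of "i + 1" xs] dx(1) i by (metis Suc_eq_plus1 Suc_lessD add_2_eq_Suc' disjoint_insert(1) distinct.simps(2) distinct_append list.simps(15) not_distinct_conv_prefix)+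
  have conA: "(a, xs ! i) \<in> (urel ?y)\<^sup>*" if "a \<in> set (take (i + 1) xs)" for a
  proof -
    obtain k where k: "k < i + 1" "k < length xs" "a = xs ! k" using \<open>a \<in> set (take (i + 1) xs)\<close> by (auto simp: in_set_conv_nth)
    then show ?thesis using ulist_side[OF l(1), of "i + 1" k i] i by auto
  qed
  have conB: "(xs ! (i + 2), b) \<in> (urel ?y)\<^sup>*" if "b \<in> set (drop (i + 2) xs)" for b
  proof -
    obtain k where "k < length (drop (i + 2) xs)" "drop (i + 2) xs ! k = b"
      using \<open>b \<in> set (drop (i + 2) xs)\<close> unfolding in_set_conv_nth by blast
    then have k: "i + 2 + k < length xs" "b = xs ! (i + 2 + k)" by auto
    then show ?thesis using ulist_side[OF l(1), of "i + 1" "i + 2" "i + 2 + k"] i by auto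
  qed
  have noAB: "(a, b) \<notin> (urel ?y)\<^sup>*" if "a \<in> set (take (i + 1) xs)" "b \<in> set (drop (i + 2) xs)" for a b
  proof
    assume "(a, b) \<in> (urel ?y)\<^sup>*"
    then have "(xs ! i, xs ! (i + 2)) \<in> (urel ?y)\<^sup>*"
      using urel_sym[OF conA[OF that(1)]] urel_sym[OF conB[OF that(2)]] by (meson rtrancl_trans)
    then show False using cut by simp
  qed
  have con1: "(a, b) \<in> (urel ?y)\<^sup>*" if "a \<in> set (take j ys)" "b \<in> set (take j ys)" for a b
  proof -
    obtain k k' where k: "k < j" "a = ys ! k" "k' < j" "b = ys ! k'"
      using \<open>a \<in> set (take j ys)\<close> \<open>b \<in> set (take j ys)\<close> by (auto simp: in_set_conv_nth)
    then show ?thesis using ulist_side[OF l(2) j(1), of k k'] j by auto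
  qed
  have con2: "(a, b) \<in> (urel ?y)\<^sup>*" if "a \<in> set (drop (Suc j) ys)" "b \<in> set (drop (Suc j) ys)" for a b
  proof -
    obtain k k' where "k < length (drop (Suc j) ys)" "drop (Suc j) ys ! k = a" "k' < length (drop (Suc j) ys)" "drop (Suc j) ys ! k' = b"
      using \<open>a \<in> set (drop (Suc j) ys)\<close> \<open>b \<in> set (drop (Suc j) ys)\<close> unfolding in_set_conv_nth by blast
    then have k: "Suc j + k < length ys" "a = ys ! (Suc j + k)" "Suc j + k' < length ys" "b = ys ! (Suc j + k')" by auto
    then show ?thesis using ulist_side[OF l(2) j(1), of "Suc j + k" "Suc j + k'"] j by auto
  qed
  let ?A = "set (take (i + 1) xs)" and ?B = "set (drop (i + 2) xs)" and ?P = "set (take j ys)" and ?Q = "set (drop (Suc j) ys)"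
  have ne: "xs ! i \<in> ?A" "xs ! (i + 2) \<in> ?B" using i
    by (auto simp: take_Suc_conv_app_nth Cons_nth_drop_Suc[of "Suc (Suc i)" xs, symmetric])
  have "insert ?y (?A \<union> ?B) = insert ?y (?P \<union> ?Q)"
    using split[symmetric] ysplit[symmetric] dx(2) dy(2) by simp
  then have U: "?A \<union> ?B = ?P \<union> ?Q" using ydis(1,2) xdis(1,2) by (metis Un_iff insert_ident)
  \<comment> \<open>Each end of \<open>ys\<close> is connected, so it cannot meet both
    components.\<close>
  have "\<not> (\<exists>a\<in>?P \<inter> ?A. \<exists>b\<in>?P \<inter> ?B. True)" "\<not> (\<exists>a\<in>?Q \<inter> ?A. \<exists>b\<in>?Q \<inter> ?B. True)"
    using con1 con2 noAB by blast+
  then show ?thesis using U ne ydis(3) xdis(3) by blast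
qed

lemma take_nth_mem: "distinct zs \<Longrightarrow> p < length zs \<Longrightarrow> q \<le> length zs \<Longrightarrow> zs ! p \<in> set (take q zs) \<longleftrightarrow> p < q"
  by (auto simp: in_set_conv_nth nth_eq_iff_index_eq)

lemma drop_nth_mem: assumes a: "distinct zs" "p < length zs" shows "zs ! p \<in> set (drop q zs) \<longleftrightarrow> q \<le> p"
proof
  show "q \<le> p" if "zs ! p \<in> set (drop q zs)"
  proof -
    obtain k where "k < length (drop q zs)" "drop q zs ! k = zs ! p"
      using \<open>zs ! p \<in> set (drop q zs)\<close> unfolding in_set_conv_nth by blast
    then show ?thesis using a nth_eq_iff_index_eq[OF a(1), of "q + k" p] by auto
  qed
  show "zs ! p \<in> set (drop q zs)" if "q \<le> p"
    unfolding in_set_conv_nth using that a by (intro exI[of _ "p - q"]) auto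
qed

lemma card_take: "distinct zs \<Longrightarrow> q \<le> length zs \<Longrightarrow> card (set (take q zs)) = q"
  by (simp add: distinct_card)

text \<open>By \<open>cut_position\<close> the vertex has in \<open>xs\<close> either the same
  position or the mirrored one. The vertex at position \<open>p\<close>, with equal sets before it
  in both lists, fixes the direction: in the mirrored case it would lie on the wrong side of the
  owner.\<close>

lemma cut_aligned:
  assumes l: "ulist xs" "ulist zs" and p: "p < length xs" "zs ! p = xs ! p" "set (take p zs) = set (take p xs)"
    and o: "own t (zs ! j) (zs ! (j + 1)) (zs ! (j + 2))" and j: "j + 2 < length zs"
  shows "xs ! (j + 1) = zs ! (j + 1)"
proof -
  have dx: "distinct xs" "set xs = W" and dz: "distinct zs" "set zs = W" using l unfolding ulist_def by auto
  have len: "length xs = length zs" using distinct_card[OF dx(1)] distinct_card[OF dz(1)] dx dz by simp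
  have "zs ! (j + 1) \<in> set xs" using dx(2) dz(2) j nth_mem[of "j + 1" zs] by simp
  then obtain k where k: "k < length xs" "xs ! k = zs ! (j + 1)" by (metis in_set_conv_nth)
  have "k < p \<longleftrightarrow> j + 1 < p"
    using take_nth_mem[OF dx(1) k(1), of p] take_nth_mem[OF dz(1), of "j + 1" p] p j k len by auto
  moreover have "k = p \<longleftrightarrow> j + 1 = p"
    using nth_eq_iff_index_eq[OF dx(1) k(1) p(1)] nth_eq_iff_index_eq[OF dz(1), of "j + 1" p] p j k len by auto
  ultimately have kp: "p < k \<longleftrightarrow> p < j + 1" by linarith
  show ?thesis
  proof (cases "j + 1 = p")
    case True then show ?thesis using p by simp
  next
    case False
    from cut_position[OF o l(2,1) j k]
    have "set (take k xs) = set (take (j + 1) zs)"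
    proof
      assume "set (take k xs) = set (drop (j + 2) zs)"
      then show ?thesis
        using take_nth_mem[OF dx(1) p(1), of k] drop_nth_mem[OF dz(1), of p "j + 2"] p len k kp False by auto
    qed
    then have "k = j + 1" using card_take[OF dx(1), of k] card_take[OF dz(1), of "j + 1"] k j len by auto
    then show ?thesis using k by simp
  qed
qed

text \<open>Either \<open>ys\<close> or its reverse will do. The vertices before the owner in
  \<open>ys\<close> are those before it or those after it in \<open>xs\<close>, and reversal
  exchanges the two cases.\<close>

lemma lst_orient:
  assumes o: "own s (xs ! i) (xs ! (i + 1)) (xs ! (i + 2))" and l: "ulist xs" "lst t ys" and i: "i + 2 < length xs"
  shows "\<exists>zs. lst t zs \<and> zs ! (i + 1) = xs ! (i + 1) \<and> set (take (i + 1) zs) = set (take (i + 1) xs)"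
proof -
  have ly: "ulist ys" using l unfolding lst_def by auto
  have dx: "distinct xs" "set xs = W" and dy: "distinct ys" "set ys = W" using l ly unfolding ulist_def by auto
  have len: "length xs = length ys" using distinct_card[OF dx(1)] distinct_card[OF dy(1)] dx dy by simp
  have "xs ! (i + 1) \<in> set ys" using dx(2) dy(2) i nth_mem[of "i + 1" xs] by simp
  then obtain j where j: "j < length ys" "ys ! j = xs ! (i + 1)" by (metis in_set_conv_nth)
  from cut_position[OF o l(1) ly i j] show ?thesis
  proof
    assume a: "set (take j ys) = set (take (i + 1) xs)"
    then have "j = i + 1" using card_take[OF dx(1), of "i + 1"] card_take[OF dy(1), of j] i j by auto
    then show ?thesis using a j l by auto
  next
    assume a: "set (take j ys) = set (drop (i + 2) xs)"
    have "card (set (drop (i + 2) xs)) = length xs - (i + 2)" using dx(1) by (simp add: distinct_card)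
    then have jl: "j = length xs - (i + 2)" using a card_take[OF dy(1), of j] j by auto
    have "rev ys ! (i + 1) = ys ! j" using jl i len by (simp add: rev_nth)
    moreover have "set (take (i + 1) (rev ys)) = set (drop (Suc j) ys)"
    proof -
      have "length ys - (i + 1) = Suc j" using jl i len by simp
      then show ?thesis by (simp add: take_rev del: One_nat_def)
    qed
    moreover have "set (drop (Suc j) ys) = set (take (i + 1) xs)"
    proof -
      have "v \<in> set (drop (Suc j) ys) \<longleftrightarrow> v \<in> set (take (i + 1) xs)" if "v \<in> W" for v
      proof -
        have "v \<in> set ys" "v \<in> set xs" using that dx(2) dy(2) by auto
        then obtain m n where m: "m < length ys" "ys ! m = v" and n: "n < length xs" "xs ! n = v"
          unfolding in_set_conv_nth by blast
        have "m < j \<longleftrightarrow> i + 2 \<le> n"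
          using take_nth_mem[OF dy(1) m(1), of j] drop_nth_mem[OF dx(1) n(1), of "i + 2"] a m n j by auto
        moreover have "m = j \<longleftrightarrow> n = i + 1"
          using nth_eq_iff_index_eq[OF dy(1) m(1) j(1)] nth_eq_iff_index_eq[OF dx(1) n(1), of "i + 1"] j m n i by auto
        ultimately have "Suc j \<le> m \<longleftrightarrow> n < i + 1" by linarith
        then show ?thesis
          using take_nth_mem[OF dx(1) n(1), of "i + 1"] drop_nth_mem[OF dy(1) m(1), of "Suc j"] m n i by auto
      qed
      then show ?thesis using dx dy set_drop_subset[of "Suc j" ys] set_take_subset[of "i + 1" xs] by blast
    qed
    ultimately show ?thesis using lst_rev[OF l(2)] j by auto
  qed
qed

text \<open>Two estimates for \<open>cx2\<close> collide. At \<open>x4\<close> the edge to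
  \<open>x3\<close> lies between those to \<open>c\<close> and \<open>x2\<close>, so
  \<open>corner_one\<close> allows a single crossing. But the triangle \<open>c x2 x3\<close> has
  \<open>x1\<close> on one side and both \<open>b\<close> and \<open>x4\<close> on the other, and
  the edges \<open>bx1\<close> and \<open>x4x1\<close> can pass only through
  \<open>cx2\<close>.\<close>

lemma three_owners:
  assumes oa: "own a x1 x2 x3" and ob: "own b x2 x3 x4" and oc: "own c x3 x4 x5"
    and d: "distinct [a, b, c]" and ne: "x1 \<noteq> x4"
  shows False
proof -
  have D: "a \<in> D" "b \<in> D" "c \<in> D" and ta: "tri x1 x2 x3" and tb: "tri x2 x3 x4" and tc: "tri x3 x4 x5"
    using oa ob oc unfolding own_def by auto
  have W: "x1 \<in> W" "x2 \<in> W" "x3 \<in> W" "x4 \<in> W" "x5 \<in> W" and dx: "distinct [x1, x2, x3, x4]" "distinct [x3, x4, x5]"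
    and r: "r {x1, x2} = 0" "r {x2, x3} = 0" "r {x3, x4} = 0"
    using ta tb tc ne unfolding tri_def by auto
  have dD: "s \<noteq> x1 \<and> s \<noteq> x2 \<and> s \<noteq> x3 \<and> s \<noteq> x4 \<and> s \<noteq> x5" if "s \<in> D" for s using that W disj by auto
  note nn = dD[OF D(1)] dD[OF D(2)] dD[OF D(3)]
  have rb: "r {b, x2} = 0" "r {b, x4} = 0" and rc: "r {c, x3} = 0" using own_uncrossed ob oc by auto
  have c1: "contig x4 x3 c" unfolding contig_def
  proof (intro allI impI)
    fix e e' assume e: "{x4, e} \<in> E" "{x4, e'} \<in> E" "e \<notin> {x3, c}" "e' \<notin> {x3, c}"
    have *: "\<not> sep x4 x3 c f x5" if f: "{x4, f} \<in> E" "f \<notin> {x3, c}" for f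
    proof (cases "f = x5")
      case False
      then have "sep x4 x3 x5 c f" using own_sep[OF oc f(1)] f by auto
      then have "\<not> sep x4 x3 c x5 f" using sep_four(2)[of x4 x3 x5 c f] W dx nn f False D by (auto simp: edge_iff)
      then show ?thesis using sep_sym by blast
    qed (simp add: sep_refl)
    show "\<not> sep x4 x3 c e e'" using *[OF e(1,3)] *[OF e(2,4)] sep_trans sep_sym by metis
  qed
  have c2: "contig x4 x3 x2" unfolding contig_def using own_side[OF ob] by auto
  have up: "r {c, x2} \<le> 1"
    by (rule corner_one[OF D(3) W(2) W(4), of x4 c x2 x3 a]) (use W dx nn D d c1 c2 in \<open>auto simp: edge_iff\<close>)
  \<comment> \<open>This quadrilateral is uncrossed and has \<open>a\<close> and \<open>c\<close> on
    the same side, since they are joined through \<open>u\<close>.\<close>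
  let ?C = "{{x2, b}, {b, x4}, {x4, x3}, {x3, x2}}"
  have ceb: "cycle_edges [x2, b, x4, x3] = ?C" unfolding cycle_edges_def by auto
  have z: "\<And>e. e \<in> cycle_edges [x2, b, x4, x3] \<Longrightarrow> r e = 0" unfolding ceb using r rb by (auto simp: insert_commute)
  have cyb: "is_cycle [x2, b, x4, x3]" unfolding is_cycle_def
    using z r0_nocross W dx nn D by (auto simp: ceb edge_iff)
  have "vin ?C a = vin ?C u" "vin ?C c = vin ?C u"
    using uncrossed_vin[OF cyb z, of a u] uncrossed_vin[OF cyb z, of c u] nn d D W uW uD unfolding ceb by (auto simp: edge_iff)
  moreover have "gs ?C x2 a = vin ?C a" "gs ?C x2 c = vin ?C c"
    using uncrossed_gs[OF cyb z, of a x2] uncrossed_gs[OF cyb z, of c x2] nn d D W unfolding ceb by (auto simp: edge_iff)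
  ultimately have s1: "\<not> sep x2 b x3 a c"
    using gs_sector[OF cyb, of a c] nn d D W unfolding ceb by (auto simp: edge_iff)
  have s2: "sep x2 x1 x3 a b" "sep x2 x1 x3 a c"
    using own_sep[OF oa, of b] own_sep[OF oa, of c] nn d D W by (auto simp: edge_iff)
  have "distinct [ang x2 x1, ang x2 x3, ang x2 a, ang x2 b, ang x2 c]"
    using distinct_ang[of "[x1, x3, a, b, c]" x2] nn d D W dx by (auto simp: edge_iff)
  \<comment> \<open>Up to reflection, the cyclic order at \<open>x2\<close> is now
    \<open>x1\<close>, \<open>a\<close>, \<open>x3\<close>, \<open>b\<close>,
    \<open>c\<close>.\<close>
  then have s3: "sep x2 c x3 x1 b"
    using s1 s2 unfolding sep_def sepr_def by (smt (verit) distinct_length_2_or_more)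
  let ?K = "{{c, x2}, {x2, x3}, {c, x3}}"
  have "is_cycle [c, x2, x3]" "cycle_edges [c, x2, x3] = ?K"
    using tri_cycle[of c x2 x3] W dx nn D r rc r0_nocross by (auto simp: edge_iff)
  then have cy: "is_cycle [x2, c, x3]" and ce: "cycle_edges [x2, c, x3] = ?K"
    using is_cycle_rotate3(2) cycle_edges_rotate3(2)[of x2 c x3] by metis+
  have g: "gs ?K x2 x1 = vin ?K x1" "gs ?K x2 b = vin ?K b"
    using gs_away[OF cy, of x1 x2] gs_away[OF cy, of b x2] r(1) rb(1) r0_nocross W dx nn D d unfolding ce by (auto simp: edge_iff)
  have "gs ?K x2 x1 \<noteq> gs ?K x2 b"
    using gs_sector[OF cy, of x1 b] s3 W dx nn D d unfolding ce by (auto simp: edge_iff)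
  then have v: "vin ?K x1 \<noteq> vin ?K b" using g by simp
  have v4: "vin ?K x4 = vin ?K b"
    using vin_eq[OF cy, of b x4] rb(2) r0_nocross W dx nn D d unfolding ce by (auto simp: edge_iff)
  have crs: "cross {p, x1} {c, x2}" if "{p, x1} \<in> E" "p \<notin> {x2, c, x3}" "vin ?K p = vin ?K b" for p
  proof (rule ccontr)
    assume "\<not> cross {p, x1} {c, x2}"
    then have "\<And>f. f \<in> cycle_edges [x2, c, x3] \<Longrightarrow> \<not> cross {p, x1} f" unfolding ce using r0_nocross r(2) rc by auto
    from vin_eq[OF cy _ _ that(1) this] that v nn dx show False unfolding ce by auto
  qed
  have "cross {b, x1} {c, x2}" "cross {x4, x1} {c, x2}"
    using crs[of b] crs[of x4] v4 W dx nn D d by (auto simp: edge_iff)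
  moreover have "{b, x1} \<noteq> {x4, x1}" using nn by (auto simp: doubleton_eq_iff)
  ultimately have "2 \<le> r {c, x2}" using cross_r2 cross_sym by blast
  then show False using up by simp
qed

text \<open>The owner found for one element of \<open>D\<close> serves to align the lists of all
  three. In aligned lists an owner has the same position everywhere, and by
  \<open>own_unique\<close> equal positions mean equal elements of \<open>D\<close>. So the three
  owners stand in three consecutive places, which \<open>three_owners\<close> excludes.\<close>

theorem contradiction: False
proof -
  obtain a where a: "a \<in> D" using D3 by (metis card.empty equals0I zero_neq_numeral)
  obtain xs where xs: "lst a xs" using exists_lst[OF a] ..
  obtain i where i: "i < 3" "i + 2 < length xs" "own a (xs ! i) (xs ! (i + 1)) (xs ! (i + 2))"
    using own_exists[OF a xs] by auto
  have ux: "ulist xs" using xs unfolding lst_def by auto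
  define p where "p = i + 1"
  have "\<exists>zs. lst t zs \<and> zs ! p = xs ! p \<and> set (take p zs) = set (take p xs)" if t: "t \<in> D" for t
    using exists_lst[OF t] lst_orient[OF i(3) ux _ i(2)] unfolding p_def by blast
  then obtain Z where Z: "\<And>t. t \<in> D \<Longrightarrow> lst t (Z t)" "\<And>t. t \<in> D \<Longrightarrow> Z t ! p = xs ! p"
     "\<And>t. t \<in> D \<Longrightarrow> set (take p (Z t)) = set (take p xs)" by metis
  have "\<exists>j<3. j + 2 < length (Z t) \<and> own t (Z t ! j) (Z t ! (j + 1)) (Z t ! (j + 2))" if t: "t \<in> D" for t
    using own_exists[OF t Z(1)[OF t]] .
  then obtain q where q: "\<And>t. t \<in> D \<Longrightarrow> q t < (3::nat)" "\<And>t. t \<in> D \<Longrightarrow> q t + 2 < length (Z t)"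
     "\<And>t. t \<in> D \<Longrightarrow> own t (Z t ! q t) (Z t ! (q t + 1)) (Z t ! (q t + 2))" by metis
  have uZ: "ulist (Z t)" if "t \<in> D" for t using Z(1)[OF that] unfolding lst_def by auto
  have len: "length (Z t) = card W" "length xs = card W" if "t \<in> D" for t using lst_length Z xs that by auto
  have agree: "Z s ! (q t + 1) = Z t ! (q t + 1)" if "s \<in> D" "t \<in> D" for s t
  proof (rule cut_aligned[OF uZ[OF that(1)] uZ[OF that(2)], of p])
    show "p < length (Z s)" using len that i(2) unfolding p_def by simp
    show "Z t ! p = Z s ! p" "set (take p (Z t)) = set (take p (Z s))" using Z(2,3) that by simp_all
    show "own t (Z t ! q t) (Z t ! (q t + 1)) (Z t ! (q t + 2))" "q t + 2 < length (Z t)" using q(2,3) that by simp_all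
  qed
  have inj: "inj_on q D"
  proof (rule inj_onI)
    fix s t assume st: "s \<in> D" "t \<in> D" "q s = q t"
    then have "Z s ! (q s + 1) = Z t ! (q t + 1)" using agree[OF st(1,2)] by metis
    then show "s = t" using own_unique[OF q(3)[OF st(1)] _ ux] q(3)[OF st(2)] by metis
  qed
  have "q ` D \<subseteq> {..<3}" using q by auto
  moreover have "card (q ` D) = 3" using inj D3 card_image by metis
  \<comment> \<open>Three different indices below three are 0, 1 and 2. Index 2 occurs only in lists
    of length at least five, so four outer vertices need no separate treatment here.\<close>
  ultimately have qD: "q ` D = {..<3}" by (metis card_lessThan card_subset_eq finite_lessThan)
  have ex: "\<exists>s\<in>D. q s = k" if "k < 3" for k
  proof -
    have "k \<in> q ` D" using that qD by simp
    then show ?thesis by auto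
  qed
  obtain s0 s1 s2 where s: "s0 \<in> D" "q s0 = 0" "s1 \<in> D" "q s1 = 1" "s2 \<in> D" "q s2 = 2"
    using ex[of 0] ex[of 1] ex[of 2] by auto
  have ag: "Z s0 ! 2 = Z s1 ! 2" "Z s1 ! 1 = Z s0 ! 1" "Z s1 ! 3 = Z s2 ! 3" "Z s2 ! 2 = Z s1 ! 2" "Z s0 ! 3 = Z s2 ! 3"
    using agree[of s0 s1] agree[of s1 s0] agree[of s1 s2] agree[of s2 s1] agree[of s0 s2] s by (auto simp: numeral_eq_Suc)
  have "own s0 (Z s0 ! 0) (Z s0 ! 1) (Z s1 ! 2)" using q(3)[OF s(1)] s ag by (simp add: numeral_eq_Suc)
  moreover have "own s1 (Z s0 ! 1) (Z s1 ! 2) (Z s2 ! 3)" using q(3)[OF s(3)] s ag by (simp add: numeral_eq_Suc)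
  moreover have "own s2 (Z s1 ! 2) (Z s2 ! 3) (Z s2 ! 4)" using q(3)[OF s(5)] s ag by (simp add: numeral_eq_Suc)
  moreover have "Z s0 ! 0 \<noteq> Z s2 ! 3"
  proof -
    have "3 < length (Z s0)" using q(2)[OF s(5)] s len by auto
    then have "Z s0 ! 0 \<noteq> Z s0 ! 3" using uZ[OF s(1)] unfolding ulist_def
      by (metis nth_eq_iff_index_eq zero_less_numeral less_trans zero_neq_numeral)
    then show ?thesis using ag by simp
  qed
  moreover have "distinct [s0, s1, s2]" using s by auto
  ultimately show False using three_owners by blast
qed

end

section \<open>Arc drawings\<close>

text \<open>An edge is recorded by the point set that it covers. Orientation and parametrization
  disappear, and surgeries become operations on sets.\<close>

definition arc_image :: "complex set \<Rightarrow> complex \<Rightarrow> complex \<Rightarrow> bool" where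
  "arc_image S a b \<longleftrightarrow> (\<exists>g. arc g \<and> path_image g = S \<and> pathstart g = a \<and> pathfinish g = b)"

lemma arc_image_sym: "arc_image S a b \<Longrightarrow> arc_image S b a"
  unfolding arc_image_def by (metis arc_reversepath path_image_reversepath pathfinish_reversepath pathstart_reversepath)

lemma arc_image_ends:
  assumes "arc_image S a b" shows "a \<in> S" "b \<in> S" "a \<noteq> b" "compact S" "connected S"
proof -
  obtain g where g: "arc g" "path_image g = S" "pathstart g = a" "pathfinish g = b"
    using assms unfolding arc_image_def by blast
  show "a \<in> S" "b \<in> S" using g pathstart_in_path_image pathfinish_in_path_image by blast+
  show "a \<noteq> b" using g arc_distinct_ends by blast
  show "compact S" "connected S" using g arc_imp_path compact_path_image connected_path_image by blast+
qed

lemma arc_image_segment: "a \<noteq> b \<Longrightarrow> arc_image (closed_segment a b) a b"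
  unfolding arc_image_def by (metis arc_linepath path_image_linepath pathfinish_linepath pathstart_linepath)

lemma arc_image_join:
  assumes "arc_image S a z" "arc_image T z b" "S \<inter> T \<subseteq> {z}"
  shows "arc_image (S \<union> T) a b"
proof -
  obtain g h where g: "arc g" "path_image g = S" "pathstart g = a" "pathfinish g = z"
    and h: "arc h" "path_image h = T" "pathstart h = z" "pathfinish h = b"
    using assms unfolding arc_image_def by blast
  then have "arc (g +++ h)" using assms(3) by (intro arc_join) auto
  then show ?thesis unfolding arc_image_def
    using g h by (intro exI[of _ "g +++ h"]) (simp add: path_image_join)
qed

lemma arc_image_split:
  assumes "arc_image S a b" "z \<in> S" "z \<noteq> a" "z \<noteq> b"
  shows "\<exists>S1 S2. arc_image S1 a z \<and> arc_image S2 z b \<and> S1 \<union> S2 = S \<and> S1 \<inter> S2 = {z}"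
proof -
  obtain g where g: "arc g" "path_image g = S" "pathstart g = a" "pathfinish g = b"
    using assms unfolding arc_image_def by blast
  obtain t where t: "t \<in> {0..1}" "g t = z" using assms(2) g unfolding path_image_def by auto
  have inj: "inj_on g {0..1}" using g(1) unfolding arc_def by auto
  have t01: "0 < t" "t < 1"
    using t assms(3,4) g(3,4) unfolding pathstart_def pathfinish_def by (auto simp: less_le)
  have a1: "arc (subpath 0 t g)" "arc (subpath t 1 g)" using g(1) t t01 by (auto intro!: arc_subpath_arc)
  have p1: "path_image (subpath 0 t g) = g ` {0..t}" "path_image (subpath t 1 g) = g ` {t..1}"
    using t01 by (auto simp: path_image_subpath)
  have "g ` {0..t} \<union> g ` {t..1} = S" using g(2) t01 unfolding path_image_def
    by (metis image_Un ivl_disj_un_two_touch(4) less_imp_le)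
  moreover have "g ` {0..t} \<inter> g ` {t..1} = {z}"
  proof -
    have "g ` {0..t} \<inter> g ` {t..1} = g ` ({0..t} \<inter> {t..1})"
      by (rule inj_on_image_Int[OF inj, symmetric]) (use t01 in auto)
    also have "{0..t} \<inter> {t..1} = {t}" using t01 by auto
    finally show ?thesis using t by simp
  qed
  moreover have "arc_image (g ` {0..t}) a z" "arc_image (g ` {t..1}) z b"
    unfolding arc_image_def using a1 p1 g(3,4) t
    by (metis pathfinish_subpath pathstart_subpath pathstart_def pathfinish_def)+
  ultimately show ?thesis by blast
qed

lemma arc_image_open_connected:
  assumes "arc_image S a b" shows "connected (S - {a, b})"
proof -
  obtain g where g: "arc g" "path_image g = S" "pathstart g = a" "pathfinish g = b"
    using assms unfolding arc_image_def by blast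
  have inj: "inj_on g {0..1}" and c: "continuous_on {0..1} g" using g(1) unfolding arc_def path_def by auto
  have "S - {a, b} = g ` {0..1} - g ` {0, 1}" using g unfolding path_image_def pathstart_def pathfinish_def by auto
  also have "\<dots> = g ` ({0..1} - {0, 1})" by (rule inj_on_image_set_diff[OF inj, symmetric]) auto
  also have "{0..1} - {0, 1} = {0<..<(1::real)}" by auto
  finally have "S - {a, b} = g ` {0<..<1}" .
  moreover have "connected (g ` {0<..<1})"
    by (rule connected_continuous_image) (auto intro: continuous_on_subset[OF c])
  ultimately show ?thesis by simp
qed

lemma arc_image_connected_subset:
  assumes "arc_image S1 a z" "arc_image S2 z b" "S1 \<inter> S2 = {z}" and C: "connected C" "C \<subseteq> S1 \<union> S2 - {z}"
  shows "C \<subseteq> S1 \<or> C \<subseteq> S2"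
proof (rule ccontr)
  assume n: "\<not> ?thesis"
  have "closed S1" "closed S2" using arc_image_ends(4)[OF assms(1)] arc_image_ends(4)[OF assms(2)] compact_imp_closed by auto
  moreover have "S1 \<inter> C \<noteq> {}" "S2 \<inter> C \<noteq> {}" "S1 \<inter> S2 \<inter> C = {}" "C \<subseteq> S1 \<union> S2" using n C(2) assms(3) by blast+
  ultimately show False using C(1) unfolding connected_closed by blast
qed

text \<open>\<open>c\<close> is the last point of the arc on the disk of radius
  \<open>\<epsilon>\<close> and \<open>T\<close> is what follows. An arc can return to a small
  circle infinitely often, so the last exit is the only usable one, and whatever happens before it
  is discarded. The discarded part stays within \<open>\<eta>\<close> of \<open>a\<close>.\<close>

lemma arc_image_exit:
  assumes S: "arc_image S a b" and \<eta>: "0 < \<eta>"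
  shows "\<exists>e0>0. \<forall>\<epsilon>. 0 < \<epsilon> \<longrightarrow> \<epsilon> < e0 \<longrightarrow> (\<exists>c T. dist a c = \<epsilon> \<and> c \<in> S \<and> arc_image T c b \<and> T \<subseteq> S \<and>
     T \<inter> cball a \<epsilon> = {c} \<and> S - cball a \<eta> \<subseteq> T)"
proof -
  obtain g where g: "arc g" "path_image g = S" "pathstart g = a" "pathfinish g = b"
    using assms unfolding arc_image_def by blast
  have inj: "inj_on g {0..1}" and cg: "continuous_on {0..1} g" using g(1) unfolding arc_def path_def by auto
  have g01: "g 0 = a" "g 1 = b" using g unfolding pathstart_def pathfinish_def by auto
  obtain d where d: "d > 0" "\<And>t. t \<in> {0..1} \<Longrightarrow> dist t 0 < d \<Longrightarrow> dist (g t) (g 0) < \<eta>"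
    using cg \<eta> unfolding continuous_on_iff by (metis atLeastAtMost_iff order_refl zero_le_one)
  \<comment> \<open>Up to \<open>t0\<close> the arc stays within \<open>\<eta>\<close> of
    \<open>a\<close>; from \<open>t0\<close> on it keeps a positive distance \<open>e1\<close> from
    \<open>a\<close>. A radius below \<open>e1\<close> puts the last visit before
    \<open>t0\<close>.\<close>
  define t0 where "t0 = min (d / 2) (1 / 2)"
  have t0: "0 < t0" "t0 < 1" "t0 < d" using d unfolding t0_def by auto
  have near: "g t \<in> ball a \<eta>" if "0 \<le> t" "t \<le> t0" for t
    using d(2)[of t] that t0 g01 by (auto simp: dist_commute)
  have K: "compact (g ` {t0..1})" using t0 by (intro compact_continuous_image continuous_on_subset[OF cg]) auto
  have "a \<notin> g ` {t0..1}" using inj g01(1) t0 unfolding inj_on_def by force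
  then obtain e1 where e1: "e1 > 0" "\<And>t. t \<in> {t0..1} \<Longrightarrow> e1 \<le> dist a (g t)"
    using separate_point_closed[OF compact_imp_closed[OF K], of a] by auto
  define e0 where "e0 = min e1 \<eta>"
  show ?thesis
  proof (intro exI[of _ e0] conjI allI impI)
    show "0 < e0" using e1 \<eta> unfolding e0_def by simp
    fix \<epsilon> assume \<epsilon>: "0 < \<epsilon>" "\<epsilon> < e0"
    define T where "T = {t \<in> {0..1}. dist a (g t) \<le> \<epsilon>}"
    have cd: "continuous_on {0..1} (\<lambda>t. dist a (g t))" by (intro continuous_intros cg)
    have "closed ({0..1} \<inter> (\<lambda>t. dist a (g t)) -` {..\<epsilon>})"
      by (rule continuous_closed_preimage[OF cd]) auto
    then have "compact ({0..1} \<inter> ({0..1} \<inter> (\<lambda>t. dist a (g t)) -` {..\<epsilon>}))" by (rule compact_Int_closed[OF compact_Icc])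
    moreover have "{0..1} \<inter> ({0..1} \<inter> (\<lambda>t. dist a (g t)) -` {..\<epsilon>}) = T" unfolding T_def by auto
    ultimately have "compact T" by simp
    moreover have "0 \<in> T" unfolding T_def using \<epsilon> g01 by simp
    ultimately obtain \<tau> where \<tau>: "\<tau> \<in> T" "\<And>t. t \<in> T \<Longrightarrow> t \<le> \<tau>" using compact_attains_sup[of T] by blast
    have \<tau>01: "0 \<le> \<tau>" "\<tau> \<le> 1" "dist a (g \<tau>) \<le> \<epsilon>" using \<tau>(1) unfolding T_def by auto
    have lt: "\<tau> < t0"
    proof (rule ccontr)
      assume "\<not> \<tau> < t0"
      then show False using e1(2)[of \<tau>] \<tau>01 \<epsilon> unfolding e0_def by auto
    qed
    \<comment> \<open>The last visit takes place on the circle itself: otherwise the intermediate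
      value theorem would produce a later one.\<close>
    have "\<exists>t\<ge>\<tau>. t \<le> 1 \<and> dist a (g t) = \<epsilon>"
      by (rule IVT') (use \<tau>01 e1(2)[of 1] t0 \<epsilon> in \<open>auto simp: e0_def intro: continuous_on_subset[OF cd]\<close>)
    then obtain t where t: "\<tau> \<le> t" "t \<le> 1" "dist a (g t) = \<epsilon>" by blast
    then have "t \<in> T" unfolding T_def using \<tau>01 by auto
    then have eq: "dist a (g \<tau>) = \<epsilon>" using \<tau>(2)[of t] t by auto
    let ?S = "g ` {\<tau>..1}"
    have "arc (subpath \<tau> 1 g)" using g(1) \<tau>01 lt t0 by (intro arc_subpath_arc) auto
    moreover have "path_image (subpath \<tau> 1 g) = ?S" using \<tau>01 by (simp add: path_image_subpath)
    ultimately have "arc_image ?S (g \<tau>) b" unfolding arc_image_def using g01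
      by (metis pathfinish_subpath pathstart_subpath)
    moreover have "g \<tau> \<in> S" "?S \<subseteq> S" using g(2) \<tau>01 unfolding path_image_def by auto
    moreover have "?S \<inter> cball a \<epsilon> = {g \<tau>}"
    proof -
      have *: "s = \<tau>" if "s \<in> {\<tau>..1}" "g s \<in> cball a \<epsilon>" for s
        using \<tau>(2)[of s] that \<tau>01 unfolding T_def by force
      have "g \<tau> \<in> ?S" "g \<tau> \<in> cball a \<epsilon>" using eq \<tau>01 by auto
      then show ?thesis using * by blast
    qed
    moreover have "S - cball a \<eta> \<subseteq> ?S"
    proof
      fix x assume x: "x \<in> S - cball a \<eta>"
      then obtain s where s: "s \<in> {0..1}" "x = g s" using g(2) unfolding path_image_def by auto
      then have "\<not> s \<le> t0" using near[of s] x by auto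
      then show "x \<in> ?S" using s lt by auto
    qed
    ultimately show "\<exists>c T. dist a c = \<epsilon> \<and> c \<in> S \<and> arc_image T c b \<and> T \<subseteq> S \<and>
       T \<inter> cball a \<epsilon> = {c} \<and> S - cball a \<eta> \<subseteq> T" using eq by blast
  qed
qed

definition crossings :: "'a set \<Rightarrow> 'a set set \<Rightarrow> ('a \<Rightarrow> complex) \<Rightarrow> ('a set \<Rightarrow> complex set) \<Rightarrow> complex set" where
  "crossings V E pos A = {z. z \<notin> pos ` V \<and> (\<exists>e\<in>E. \<exists>f\<in>E. e \<noteq> f \<and> z \<in> A e \<and> z \<in> A f)}"

text \<open>Transversality is not required: edges may merely touch.  A drawing with the least number of
  crossings for given positions of the vertices can be made transversal afterwards.\<close>

definition arc_drawing :: "'a set \<Rightarrow> 'a set set \<Rightarrow> ('a \<Rightarrow> complex) \<Rightarrow> ('a set \<Rightarrow> complex set) \<Rightarrow> bool" where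
  "arc_drawing V E pos A \<longleftrightarrow> finite V \<and> (\<forall>e\<in>E. e \<subseteq> V \<and> card e = 2) \<and> inj_on pos V \<and>
     (\<forall>v w. {v, w} \<in> E \<longrightarrow> arc_image (A {v, w}) (pos v) (pos w)) \<and>
     (\<forall>e\<in>E. \<forall>v\<in>V. pos v \<in> A e \<longrightarrow> v \<in> e) \<and> finite (crossings V E pos A) \<and>
     (\<forall>e\<in>E. \<forall>f\<in>E. \<forall>g\<in>E. e \<noteq> f \<longrightarrow> f \<noteq> g \<longrightarrow> e \<noteq> g \<longrightarrow> A e \<inter> A f \<inter> A g \<subseteq> pos ` V)"

lemma arc_drawingD:
  assumes "arc_drawing V E pos A"
  shows "finite V" "\<And>e. e \<in> E \<Longrightarrow> e \<subseteq> V" "\<And>e. e \<in> E \<Longrightarrow> card e = 2" "inj_on pos V"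
    "\<And>v w. {v, w} \<in> E \<Longrightarrow> arc_image (A {v, w}) (pos v) (pos w)"
    "\<And>e v. e \<in> E \<Longrightarrow> v \<in> V \<Longrightarrow> pos v \<in> A e \<Longrightarrow> v \<in> e" "finite (crossings V E pos A)"
    "\<And>e f g. e \<in> E \<Longrightarrow> f \<in> E \<Longrightarrow> g \<in> E \<Longrightarrow> e \<noteq> f \<Longrightarrow> f \<noteq> g \<Longrightarrow> e \<noteq> g \<Longrightarrow> A e \<inter> A f \<inter> A g \<subseteq> pos ` V"
    "finite E"
  using assms unfolding arc_drawing_def by (auto intro: finite_subset[of E "Pow V"])

lemma arc_drawing_edge:
  assumes "arc_drawing V E pos A" "{v, w} \<in> E"
  shows "v \<in> V" "w \<in> V" "v \<noteq> w" "pos v \<noteq> pos w" "pos v \<in> A {v, w}" "pos w \<in> A {v, w}"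
proof -
  show "v \<in> V" "w \<in> V" using arc_drawingD(2)[OF assms(1,2)] by auto
  show "pos v \<noteq> pos w" "pos v \<in> A {v, w}" "pos w \<in> A {v, w}" using arc_image_ends[OF arc_drawingD(5)[OF assms]] by auto
  then show "v \<noteq> w" by auto
qed

lemma arc_drawing_edgeE:
  assumes "arc_drawing V E pos A" "e \<in> E" obtains v w where "e = {v, w}" "v \<noteq> w"
  using arc_drawingD(3)[OF assms] by (auto simp: card_2_iff)

lemma arc_drawing_closed: "arc_drawing V E pos A \<Longrightarrow> e \<in> E \<Longrightarrow> closed (A e)"
  by (metis arc_drawing_edgeE arc_drawingD(5) arc_image_ends(4) compact_imp_closed)

section \<open>Straightening near vertices and crossings\<close>

definition star_at :: "'a set set \<Rightarrow> ('a \<Rightarrow> complex) \<Rightarrow> ('a set \<Rightarrow> complex set) \<Rightarrow> 'a \<Rightarrow> real \<Rightarrow> ('a \<Rightarrow> complex) \<Rightarrow> bool" where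
  "star_at E pos A v \<epsilon> d \<longleftrightarrow> 0 < \<epsilon> \<and>
     (\<forall>w. {v, w} \<in> E \<longrightarrow> norm (d w) = 1 \<and> A {v, w} \<inter> cball (pos v) \<epsilon> = {pos v + of_real t * d w | t. 0 \<le> t \<and> t \<le> \<epsilon>}) \<and>
     (\<forall>e\<in>E. v \<notin> e \<longrightarrow> A e \<inter> cball (pos v) \<epsilon> = {})"

text \<open>\<open>Im (d1 * cnj d2)\<close> is the determinant of the two directions, up to sign.
  Being nonzero, it says that near \<open>z\<close> the drawing consists of two lines crossing
  transversally.\<close>

definition tame_at :: "'a set \<Rightarrow> 'a set set \<Rightarrow> ('a \<Rightarrow> complex) \<Rightarrow> ('a set \<Rightarrow> complex set) \<Rightarrow> complex \<Rightarrow> real \<Rightarrow> bool" where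
  "tame_at V E pos A z \<epsilon> \<longleftrightarrow> 0 < \<epsilon> \<and> pos ` V \<inter> ball z \<epsilon> = {} \<and> (\<exists>e\<in>E. \<exists>f\<in>E. \<exists>d1 d2. e \<noteq> f \<and> Im (d1 * cnj d2) \<noteq> 0 \<and>
     A e \<inter> ball z \<epsilon> = range (\<lambda>t. z + of_real t * d1) \<inter> ball z \<epsilon> \<and>
     A f \<inter> ball z \<epsilon> = range (\<lambda>t. z + of_real t * d2) \<inter> ball z \<epsilon> \<and>
     (\<forall>g\<in>E - {e, f}. A g \<inter> ball z \<epsilon> = {}))"

lemma finite_avoid:
  fixes p :: complex
  assumes "finite \<C>" "\<And>C. C \<in> \<C> \<Longrightarrow> closed C" "\<And>C. C \<in> \<C> \<Longrightarrow> p \<notin> C" "0 < \<eta>"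
  shows "\<exists>\<epsilon>>0. \<epsilon> \<le> \<eta> \<and> (\<forall>C\<in>\<C>. C \<inter> cball p \<epsilon> = {})"
proof -
  have "closed (\<Union>\<C>)" "p \<notin> \<Union>\<C>" using assms by auto
  then obtain d where d: "d > 0" "\<And>x. x \<in> \<Union>\<C> \<Longrightarrow> d \<le> dist p x" using separate_point_closed by metis
  show ?thesis
  proof (intro exI[of _ "min (d / 2) \<eta>"] conjI ballI)
    fix C assume "C \<in> \<C>"
    then have "x \<notin> cball p (min (d / 2) \<eta>)" if "x \<in> C" for x using d(2)[of x] d(1) that by force
    then show "C \<inter> cball p (min (d / 2) \<eta>) = {}" by blast
  qed (use d assms in auto)
qed

lemma radius_inter:
  fixes p c c' :: complex
  assumes "dist p c = \<epsilon>" "dist p c' = \<epsilon>" "c \<noteq> c'" "0 < \<epsilon>"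
  shows "closed_segment p c \<inter> closed_segment p c' = {p}"
proof -
  have "z = p" if z: "z \<in> closed_segment p c" "z \<in> closed_segment p c'" for z
  proof (rule ccontr)
    assume "z \<noteq> p"
    obtain s where s: "0 \<le> s" "s \<le> 1" "z = p + s *\<^sub>R (c - p)" using z(1) by (auto simp: closed_segment_def algebra_simps)
    obtain t where t: "0 \<le> t" "t \<le> 1" "z = p + t *\<^sub>R (c' - p)" using z(2) by (auto simp: closed_segment_def algebra_simps)
    have n: "norm (c - p) = \<epsilon>" "norm (c' - p) = \<epsilon>" using assms by (auto simp: dist_norm norm_minus_commute)
    have "dist p z = s * \<epsilon>" unfolding s(3) dist_norm using s(1) n by simp
    moreover have "dist p z = t * \<epsilon>" unfolding t(3) dist_norm using t(1) n by simp
    ultimately have "s = t" using assms by simp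
    then have "s *\<^sub>R (c - p) = s *\<^sub>R (c' - p)" using s(3) t(3) by (metis add_left_cancel)
    then have "s = 0" using assms by simp
    then show False using s \<open>z \<noteq> p\<close> by simp
  qed
  then show ?thesis by auto
qed

text \<open>In a disk around \<open>v\<close> without crossings, other vertices or edges not at
  \<open>v\<close>, each edge at \<open>v\<close> is replaced by the radius to its last exit point
  from a smaller disk, followed by the rest of the edge. Different edges have different exit points,
  since a common one would be a crossing; so the radii meet only at \<open>v\<close>.\<close>

lemma star_step:
  assumes dr: "arc_drawing V E pos A" and v: "v \<in> V" and \<eta>: "0 < \<eta>"
  shows "\<exists>A' \<epsilon> d. arc_drawing V E pos A' \<and> crossings V E pos A' \<subseteq> crossings V E pos A \<and> star_at E pos A' v \<epsilon> d \<and>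
     (\<forall>e\<in>E. A' e - cball (pos v) \<eta> = A e - cball (pos v) \<eta>)"
proof -
  note D = arc_drawingD[OF dr]
  let ?X = "crossings V E pos A" and ?p = "pos v"
  \<comment> \<open>Everything that the disk around \<open>v\<close> has to avoid.\<close>
  define \<C> where "\<C> = A ` {e \<in> E. v \<notin> e} \<union> {?X, pos ` (V - {v})}"
  have "finite \<C>" unfolding \<C>_def using D(9) by auto
  moreover have "closed C" if "C \<in> \<C>" for C
    using that arc_drawing_closed[OF dr] D(1,7) unfolding \<C>_def by (auto simp: finite_imp_closed)
  moreover have "?p \<notin> C" if "C \<in> \<C>" for C
    using that D(6)[OF _ v] D(4) v unfolding \<C>_def crossings_def by (auto simp: inj_on_def)
  ultimately obtain \<eta>1 where e1: "0 < \<eta>1" "\<eta>1 \<le> \<eta>" "\<And>C. C \<in> \<C> \<Longrightarrow> C \<inter> cball ?p \<eta>1 = {}"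
    using finite_avoid[of \<C> ?p \<eta>] \<eta> by metis
  have away: "A e \<inter> cball ?p \<eta>1 = {}" if "e \<in> E" "v \<notin> e" for e using e1(3)[of "A e"] that unfolding \<C>_def by auto
  have awayX: "?X \<inter> cball ?p \<eta>1 = {}" using e1(3) unfolding \<C>_def by auto
  have awayV: "pos x \<notin> cball ?p \<eta>1" if "x \<in> V" "x \<noteq> v" for x using e1(3)[of "pos ` (V - {v})"] that unfolding \<C>_def by auto
  let ?N = "{w. {v, w} \<in> E}"
  have finN: "finite ?N" by (rule finite_subset[OF _ D(1)]) (use D(2) in auto)
  have "\<exists>e0>0. \<forall>\<epsilon>. 0 < \<epsilon> \<longrightarrow> \<epsilon> < e0 \<longrightarrow> (\<exists>c T. dist ?p c = \<epsilon> \<and> c \<in> A {v, w} \<and> arc_image T c (pos w) \<and> T \<subseteq> A {v, w} \<and>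
     T \<inter> cball ?p \<epsilon> = {c} \<and> A {v, w} - cball ?p \<eta>1 \<subseteq> T)" if "w \<in> ?N" for w
    using arc_image_exit[OF D(5) e1(1)] that by blast
  then obtain e0 where e0: "\<And>w. w \<in> ?N \<Longrightarrow> 0 < e0 w" "\<And>w \<epsilon>. w \<in> ?N \<Longrightarrow> 0 < \<epsilon> \<Longrightarrow> \<epsilon> < e0 w \<Longrightarrow>
     (\<exists>c T. dist ?p c = \<epsilon> \<and> c \<in> A {v, w} \<and> arc_image T c (pos w) \<and> T \<subseteq> A {v, w} \<and>
     T \<inter> cball ?p \<epsilon> = {c} \<and> A {v, w} - cball ?p \<eta>1 \<subseteq> T)" by metis
  \<comment> \<open>A common bound for all edges at \<open>v\<close>. Inserting
    \<open>\<eta>1\<close> keeps the radius inside the chosen disk and gives a minimum even if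
    \<open>v\<close> is isolated.\<close>
  define m where "m = Min (insert \<eta>1 (e0 ` ?N))"
  define \<epsilon> where "\<epsilon> = m / 2"
  have m0: "0 < m" unfolding m_def using finN e0(1) e1(1) by simp
  have mle: "m \<le> x" if "x \<in> insert \<eta>1 (e0 ` ?N)" for x unfolding m_def using finN that by (intro Min_le) auto
  have half: "0 < \<epsilon>" "\<epsilon> < m" using m0 unfolding \<epsilon>_def by auto
  have \<epsilon>N: "\<epsilon> < e0 w" if "w \<in> ?N" for w
  proof -
    have "m \<le> e0 w" by (rule mle) (use that in blast)
    then show ?thesis using half by simp
  qed
  have "m \<le> \<eta>1" by (rule mle) simp
  then have \<epsilon>: "0 < \<epsilon>" "\<epsilon> < \<eta>1" using half by auto
  have "\<forall>w\<in>?N. \<exists>c T. dist ?p c = \<epsilon> \<and> c \<in> A {v, w} \<and> arc_image T c (pos w) \<and> T \<subseteq> A {v, w} \<and>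
     T \<inter> cball ?p \<epsilon> = {c} \<and> A {v, w} - cball ?p \<eta>1 \<subseteq> T" using e0(2) \<epsilon>(1) \<epsilon>N by blast
  then obtain c T where cT: "\<And>w. w \<in> ?N \<Longrightarrow> dist ?p (c w) = \<epsilon> \<and> c w \<in> A {v, w} \<and> arc_image (T w) (c w) (pos w) \<and> T w \<subseteq> A {v, w} \<and>
     T w \<inter> cball ?p \<epsilon> = {c w} \<and> A {v, w} - cball ?p \<eta>1 \<subseteq> T w" by metis
  let ?B = "cball ?p \<epsilon>"
  have Bsub: "?B \<subseteq> cball ?p \<eta>1" using \<epsilon> by auto
  define A' where "A' e = (if v \<in> e then (\<Union>w\<in>e - {v}. closed_segment ?p (c w) \<union> T w) else A e)" for e
  have vw: "v \<noteq> w" if "w \<in> ?N" for w using arc_drawing_edge[OF dr] that by auto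
  have A'v: "A' {v, w} = closed_segment ?p (c w) \<union> T w" if "w \<in> ?N" for w
  proof -
    have "{v, w} - {v} = {w}" using vw[OF that] by auto
    then show ?thesis unfolding A'_def by auto
  qed
  have A'n: "A' e = A e" if "v \<notin> e" for e using that unfolding A'_def by simp
  have edge: "(\<exists>w\<in>?N. e = {v, w}) \<or> v \<notin> e" if "e \<in> E" for e
  proof -
    obtain x y where "e = {x, y}" using arc_drawing_edgeE[OF dr \<open>e \<in> E\<close>] .
    then have "v = x \<and> y \<in> ?N \<and> e = {v, y} \<or> v = y \<and> x \<in> ?N \<and> e = {v, x} \<or> v \<notin> e"
      using that by (auto simp: insert_commute)
    then show ?thesis by blast
  qed
  have segB: "closed_segment ?p (c w) \<subseteq> ?B" if "w \<in> ?N" for w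
  proof -
    have "c w \<in> ?B" "?p \<in> ?B" using cT[OF that] \<epsilon> by auto
    then show ?thesis using closed_segment_subset convex_cball by blast
  qed
  have inB: "A' {v, w} \<inter> ?B = closed_segment ?p (c w)" if "w \<in> ?N" for w
  proof -
    have "T w \<inter> ?B = {c w}" using cT[OF that] by blast
    moreover have "closed_segment ?p (c w) \<inter> ?B = closed_segment ?p (c w)" using segB[OF that] by blast
    moreover have "insert (c w) (closed_segment ?p (c w)) = closed_segment ?p (c w)" by auto
    ultimately show ?thesis unfolding A'v[OF that] by (simp add: Int_Un_distrib2)
  qed
  have outB: "A' e - ?B \<subseteq> A e" if "e \<in> E" for e
  proof (cases "v \<in> e")
    case True
    then obtain w where w: "w \<in> ?N" "e = {v, w}" using edge[OF \<open>e \<in> E\<close>] by blast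
    have "T w \<subseteq> A e" using cT[OF w(1)] w(2) by simp
    then show ?thesis unfolding w(2) A'v[OF w(1)] using segB[OF w(1)] w(2) by blast
  qed (use A'n in auto)
  have notB: "A' e \<inter> ?B = {}" if "e \<in> E" "v \<notin> e" for e using away[OF that] A'n[OF that(2)] Bsub by auto
  have cne: "c w \<noteq> c w'" if "w \<in> ?N" "w' \<in> ?N" "w \<noteq> w'" for w w'
  proof
    assume eq: "c w = c w'"
    have "c w \<notin> pos ` V"
    proof
      assume "c w \<in> pos ` V"
      then obtain x where x: "x \<in> V" "c w = pos x" by auto
      then have "pos x \<in> cball ?p \<eta>1" using cT[OF that(1)] \<epsilon> by auto
      then have "x = v" using awayV x by blast
      then show False using x cT[OF that(1)] \<epsilon> by auto
    qed
    moreover have "{v, w} \<noteq> {v, w'}" using that(3) by (auto simp: doubleton_eq_iff)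
    moreover have "{v, w} \<in> E" "{v, w'} \<in> E" "c w \<in> A {v, w}" "c w \<in> A {v, w'}"
      using that cT[OF that(1)] cT[OF that(2)] eq by auto
    ultimately have "c w \<in> ?X" unfolding crossings_def
      by (intro CollectI conjI bexI[of _ "{v, w}"] bexI[of _ "{v, w'}"])
    moreover have "c w \<in> cball ?p \<eta>1" using cT[OF that(1)] \<epsilon> by simp
    ultimately show False using awayX by blast
  qed
  have meetB: "z = ?p" if "e \<in> E" "f \<in> E" "e \<noteq> f" "z \<in> A' e" "z \<in> A' f" "z \<in> ?B" for e f z
  proof -
    have vef: "v \<in> e" "v \<in> f" using notB[OF that(1)] notB[OF that(2)] that by blast+
    obtain w where w1: "w \<in> ?N" "e = {v, w}" using edge[OF \<open>e \<in> E\<close>] vef by blast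
    obtain w' where w2: "w' \<in> ?N" "f = {v, w'}" using edge[OF \<open>f \<in> E\<close>] vef by blast
    note w = w1 w2
    then have "w \<noteq> w'" using that by auto
    then have "closed_segment ?p (c w) \<inter> closed_segment ?p (c w') = {?p}"
      using radius_inter[of ?p "c w" \<epsilon> "c w'"] cT[OF w(1)] cT[OF w(3)] cne[OF w(1,3)] \<epsilon> by auto
    moreover have "z \<in> closed_segment ?p (c w)" "z \<in> closed_segment ?p (c w')"
      using inB[OF w(1)] inB[OF w(3)] that(4-6) unfolding w(2,4) by blast+
    ultimately show ?thesis by blast
  qed
  have cross: "crossings V E pos A' \<subseteq> ?X"
  proof
    fix z assume "z \<in> crossings V E pos A'"
    then obtain e f where ef: "z \<notin> pos ` V" "e \<in> E" "f \<in> E" "e \<noteq> f" "z \<in> A' e" "z \<in> A' f" unfolding crossings_def by auto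
    then have "z \<notin> ?B" using meetB[of e f z] v by auto
    then show "z \<in> ?X" using ef outB unfolding crossings_def by blast
  qed
  have arcs: "arc_image (A' {x, y}) (pos x) (pos y)" if xy: "{x, y} \<in> E" for x y
  proof -
    have *: "arc_image (A' {v, w}) (pos v) (pos w)" if w: "w \<in> ?N" for w
    proof -
      have "?p \<noteq> c w" using cT[OF w] \<epsilon> by auto
      then show ?thesis unfolding A'v[OF w]
        by (rule arc_image_join[OF arc_image_segment]) (use cT[OF w] segB[OF w] in auto)
    qed
    show ?thesis
    proof (cases "v \<in> {x, y}")
      case True
      then consider "x = v" | "y = v" by auto
      then show ?thesis
      proof cases
        case 1 then show ?thesis using * xy by auto
      next
        case 2
        then have "{x, y} = {v, x}" by auto
        then have "arc_image (A' {x, y}) (pos v) (pos x)" using *[of x] xy by simp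
        then show ?thesis using 2 arc_image_sym by simp
      qed
    next
      case False then show ?thesis using A'n D(5)[OF xy] by metis
    qed
  qed
  have "arc_drawing V E pos A'" unfolding arc_drawing_def
  proof (intro conjI ballI allI impI)
    fix e x assume ex: "e \<in> E" "x \<in> V" "pos x \<in> A' e"
    show "x \<in> e"
    proof (cases "pos x \<in> ?B")
      case True
      then have "x = v" using awayV[of x] ex Bsub by blast
      moreover have "v \<in> e" using notB[OF ex(1)] True ex(3) by blast
      ultimately show ?thesis by simp
    next
      case False then show ?thesis using outB[OF ex(1)] ex D(6) by blast
    qed
  next
    fix e f g assume efg: "e \<in> E" "f \<in> E" "g \<in> E" "e \<noteq> f" "f \<noteq> g" "e \<noteq> g"
    show "A' e \<inter> A' f \<inter> A' g \<subseteq> pos ` V"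
    proof
      fix z assume z: "z \<in> A' e \<inter> A' f \<inter> A' g"
      show "z \<in> pos ` V"
      proof (cases "z \<in> ?B")
        case True then show ?thesis using meetB[of e f z] efg z v by auto
      next
        case False then show ?thesis using outB efg z D(8)[of e f g] by blast
      qed
    qed
  qed (use D arcs finite_subset[OF cross D(7)] in auto)
  moreover have "star_at E pos A' v \<epsilon> (\<lambda>w. (c w - ?p) / of_real \<epsilon>)" unfolding star_at_def
  proof (intro conjI allI impI ballI)
    fix w assume "{v, w} \<in> E"
    then have w: "w \<in> ?N" by simp
    have n: "norm (c w - ?p) = \<epsilon>" using cT[OF w] by (simp add: dist_norm norm_minus_commute)
    then show "norm ((c w - ?p) / of_real \<epsilon>) = 1" using \<epsilon> by (simp add: norm_divide)
    have "closed_segment ?p (c w) = {?p + of_real t * ((c w - ?p) / of_real \<epsilon>) | t. 0 \<le> t \<and> t \<le> \<epsilon>}"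
    proof (intro set_eqI iffI)
      fix z assume "z \<in> closed_segment ?p (c w)"
      then obtain s where s: "0 \<le> s" "s \<le> 1" "z = ?p + s *\<^sub>R (c w - ?p)" by (auto simp: closed_segment_def algebra_simps)
      then show "z \<in> {?p + of_real t * ((c w - ?p) / of_real \<epsilon>) | t. 0 \<le> t \<and> t \<le> \<epsilon>}"
        using \<epsilon> by (intro CollectI exI[of _ "s * \<epsilon>"]) (auto simp: scaleR_conv_of_real mult_left_le_one_le)
    next
      fix z assume "z \<in> {?p + of_real t * ((c w - ?p) / of_real \<epsilon>) | t. 0 \<le> t \<and> t \<le> \<epsilon>}"
      then obtain t where t: "0 \<le> t" "t \<le> \<epsilon>" "z = ?p + of_real t * ((c w - ?p) / of_real \<epsilon>)" by auto
      have "z = (1 - t / \<epsilon>) *\<^sub>R ?p + (t / \<epsilon>) *\<^sub>R c w"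
        unfolding t(3) using \<epsilon> by (simp add: scaleR_conv_of_real field_simps)
      then show "z \<in> closed_segment ?p (c w)" unfolding closed_segment_def using t \<epsilon>
        by (intro CollectI exI[of _ "t / \<epsilon>"]) auto
    qed
    then show "A' {v, w} \<inter> ?B = {?p + of_real t * ((c w - ?p) / of_real \<epsilon>) | t. 0 \<le> t \<and> t \<le> \<epsilon>}" using inB[OF w] by simp
  qed (use \<epsilon> notB in auto)
  moreover have "A' e - cball ?p \<eta> = A e - cball ?p \<eta>" if "e \<in> E" for e
  proof
    show "A' e - cball ?p \<eta> \<subseteq> A e - cball ?p \<eta>" using outB[OF that] \<epsilon> e1 by auto
    show "A e - cball ?p \<eta> \<subseteq> A' e - cball ?p \<eta>"
    proof (cases "v \<in> e")
      case True
      then obtain w where w: "w \<in> ?N" "e = {v, w}" using edge[OF \<open>e \<in> E\<close>] by blast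
      have "cball ?p \<eta>1 \<subseteq> cball ?p \<eta>" using e1 by auto
      then show ?thesis using cT[OF w(1)] A'v[OF w(1)] w by auto
    qed (use A'n in auto)
  qed
  ultimately show ?thesis using cross by blast
qed

text \<open>Stewart's theorem for the triangle with corners 0, \<open>x\<close> and
  \<open>y\<close>.\<close>

lemma chord_norm:
  fixes x y :: complex
  shows "(norm ((1 - t) *\<^sub>R x + t *\<^sub>R y))\<^sup>2 = (1 - t) * (norm x)\<^sup>2 + t * (norm y)\<^sup>2 - t * (1 - t) * (norm (y - x))\<^sup>2"
  unfolding power2_norm_eq_inner inner_simps by (simp add: inner_commute algebra_simps power2_eq_square)

lemma chord_dist:
  fixes z c1 c2 :: complex
  assumes "dist z c1 = \<epsilon>" "dist z c2 = \<epsilon>"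
  shows "(dist z ((1 - t) *\<^sub>R c1 + t *\<^sub>R c2))\<^sup>2 = \<epsilon>\<^sup>2 - t * (1 - t) * (norm (c2 - c1))\<^sup>2"
proof -
  have "(1 - t) *\<^sub>R c1 + t *\<^sub>R c2 - z = (1 - t) *\<^sub>R (c1 - z) + t *\<^sub>R (c2 - z)" by (simp add: algebra_simps)
  moreover have "norm (c1 - z) = \<epsilon>" "norm (c2 - z) = \<epsilon>" using assms by (auto simp: dist_norm norm_minus_commute)
  ultimately show ?thesis using chord_norm[of t "c1 - z" "c2 - z"]
    by (simp add: dist_norm norm_minus_commute algebra_simps)
qed

lemma chord_in_ball:
  fixes z c1 c2 :: complex
  assumes d: "dist z c1 = \<epsilon>" "dist z c2 = \<epsilon>" "c1 \<noteq> c2" "0 < \<epsilon>"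
  shows "(1 - t) *\<^sub>R c1 + t *\<^sub>R c2 \<in> ball z \<epsilon> \<longleftrightarrow> 0 < t \<and> t < 1"
    "(1 - t) *\<^sub>R c1 + t *\<^sub>R c2 \<in> cball z \<epsilon> \<longleftrightarrow> 0 \<le> t \<and> t \<le> 1"
proof -
  let ?w = "(1 - t) *\<^sub>R c1 + t *\<^sub>R c2"
  have p: "0 < (norm (c2 - c1))\<^sup>2" using d by simp
  have "dist z ?w < \<epsilon> \<longleftrightarrow> (dist z ?w)\<^sup>2 < \<epsilon>\<^sup>2" "dist z ?w \<le> \<epsilon> \<longleftrightarrow> (dist z ?w)\<^sup>2 \<le> \<epsilon>\<^sup>2"
    using d(4) by (auto simp: abs_le_square_iff[symmetric] power_strict_mono intro: power2_less_imp_less)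
  moreover have "(dist z ?w)\<^sup>2 < \<epsilon>\<^sup>2 \<longleftrightarrow> 0 < t * (1 - t)" "(dist z ?w)\<^sup>2 \<le> \<epsilon>\<^sup>2 \<longleftrightarrow> 0 \<le> t * (1 - t)"
    unfolding chord_dist[OF d(1,2)] using p by (auto simp: zero_less_mult_iff zero_le_mult_iff mult_less_0_iff mult_le_0_iff)
  ultimately show "?w \<in> ball z \<epsilon> \<longleftrightarrow> 0 < t \<and> t < 1" "?w \<in> cball z \<epsilon> \<longleftrightarrow> 0 \<le> t \<and> t \<le> 1"
    by (auto simp: zero_less_mult_iff zero_le_mult_iff)
qed

lemma segment_line:
  fixes c1 c2 x :: complex
  assumes "x = (1 - s) *\<^sub>R c1 + s *\<^sub>R c2"
  shows "x + of_real t * (c2 - c1) = (1 - (s + t)) *\<^sub>R c1 + (s + t) *\<^sub>R c2"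
  unfolding assms by (simp add: scaleR_conv_of_real algebra_simps)

lemma chord_line:
  fixes z c1 c2 x :: complex
  assumes d: "dist z c1 = \<epsilon>" "dist z c2 = \<epsilon>" "c1 \<noteq> c2" "0 < \<epsilon>" and x: "x \<in> closed_segment c1 c2"
  shows "closed_segment c1 c2 \<inter> ball z \<epsilon> = range (\<lambda>t. x + of_real t * (c2 - c1)) \<inter> ball z \<epsilon>"
proof -
  obtain s where s: "x = (1 - s) *\<^sub>R c1 + s *\<^sub>R c2" using x unfolding closed_segment_def by blast
  show ?thesis
  proof (intro set_eqI iffI)
    fix w assume "w \<in> closed_segment c1 c2 \<inter> ball z \<epsilon>"
    then obtain t where t: "w = (1 - t) *\<^sub>R c1 + t *\<^sub>R c2" and w: "w \<in> ball z \<epsilon>" unfolding closed_segment_def by blast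
    have "w = x + of_real (t - s) * (c2 - c1)" unfolding segment_line[OF s] t by simp
    then show "w \<in> range (\<lambda>t. x + of_real t * (c2 - c1)) \<inter> ball z \<epsilon>" using w by blast
  next
    fix w assume "w \<in> range (\<lambda>t. x + of_real t * (c2 - c1)) \<inter> ball z \<epsilon>"
    then obtain t where t: "w = x + of_real t * (c2 - c1)" and w: "w \<in> ball z \<epsilon>" by blast
    have w2: "w = (1 - (s + t)) *\<^sub>R c1 + (s + t) *\<^sub>R c2" unfolding t segment_line[OF s] ..
    then have "0 < s + t" "s + t < 1" using chord_in_ball(1)[OF d] w by auto
    then show "w \<in> closed_segment c1 c2 \<inter> ball z \<epsilon>" unfolding closed_segment_def using w w2
      by (intro IntI CollectI exI[of _ "s + t"]) auto
  qed
qed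

text \<open>Parallel chords with a common point would lie on one line, but a line meets the circle
  in at most two points and the four ends are distinct. So the chords are not parallel, and their
  common point is unique and interior to the disk.\<close>

lemma chord_cross:
  fixes z c1 c2 c3 c4 x :: complex
  assumes d: "dist z c1 = \<epsilon>" "dist z c2 = \<epsilon>" "dist z c3 = \<epsilon>" "dist z c4 = \<epsilon>" "0 < \<epsilon>" "distinct [c1, c2, c3, c4]"
    and x: "x \<in> closed_segment c1 c2" "x \<in> closed_segment c3 c4"
  shows "Im ((c2 - c1) * cnj (c4 - c3)) \<noteq> 0" "x \<in> ball z \<epsilon>"
    "closed_segment c1 c2 \<inter> closed_segment c3 c4 = {x}"
proof -
  have ne: "c1 \<noteq> c2" "c3 \<noteq> c4" using d by auto
  obtain s where s: "x = (1 - s) *\<^sub>R c1 + s *\<^sub>R c2" "0 \<le> s" "s \<le> 1" using x(1) unfolding closed_segment_def by blast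
  obtain r where r: "x = (1 - r) *\<^sub>R c3 + r *\<^sub>R c4" "0 \<le> r" "r \<le> 1" using x(2) unfolding closed_segment_def by blast
  show im: "Im ((c2 - c1) * cnj (c4 - c3)) \<noteq> 0"
  proof
    assume 0: "Im ((c2 - c1) * cnj (c4 - c3)) = 0"
    \<comment> \<open>The factor between the two directions, which are parallel by
      assumption.\<close>
    define k where "k = Re ((c4 - c3) * cnj (c2 - c1)) / (norm (c2 - c1))\<^sup>2"
    have n: "of_real ((norm (c2 - c1))\<^sup>2) = (c2 - c1) * cnj (c2 - c1)" by (rule complex_norm_square)
    have "(c4 - c3) * cnj (c2 - c1) \<in> \<real>" using 0 by (simp add: complex_is_Real_iff algebra_simps)
    then have "(c4 - c3) * cnj (c2 - c1) = of_real (Re ((c4 - c3) * cnj (c2 - c1)))" by (metis of_real_Re)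
    then have "(c4 - c3) * cnj (c2 - c1) = of_real k * ((c2 - c1) * cnj (c2 - c1))"
      unfolding k_def n[symmetric] using ne by simp
    then have k: "c4 - c3 = of_real k * (c2 - c1)" using ne by simp
    have "x = c3 + of_real r * (c4 - c3)" using r(1) by (simp add: scaleR_conv_of_real algebra_simps)
    then have "c3 = x + of_real (- r * k) * (c2 - c1)" unfolding k by (simp add: mult.assoc)
    then have c3: "c3 = (1 - (s - r * k)) *\<^sub>R c1 + (s - r * k) *\<^sub>R c2" using segment_line[OF s(1), of "- r * k"] by simp
    let ?t = "s - r * k"
    have "(dist z c3)\<^sup>2 = \<epsilon>\<^sup>2 - ?t * (1 - ?t) * (norm (c2 - c1))\<^sup>2" by (subst c3, rule chord_dist[OF d(1,2)])
    then have "?t = 0 \<or> ?t = 1" using d(3) ne by auto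
    then show False using c3 d(6) by auto
  qed
  have "s \<noteq> 0 \<and> s \<noteq> 1"
  proof (rule ccontr)
    assume "\<not> (s \<noteq> 0 \<and> s \<noteq> 1)"
    then have x12: "x = c1 \<or> x = c2" using s by auto
    then have "dist z x = \<epsilon>" using d by auto
    then have "x \<notin> ball z \<epsilon>" "x \<in> cball z \<epsilon>" by auto
    then have "r = 0 \<or> r = 1" using chord_in_ball[OF d(3,4) ne(2) d(5), of r] r by auto
    then show False using x12 r d(6) by auto
  qed
  then show "x \<in> ball z \<epsilon>" using chord_in_ball(1)[OF d(1,2) ne(1) d(5), of s] s by auto
  have "y = x" if y: "y \<in> closed_segment c1 c2" "y \<in> closed_segment c3 c4" for y
  proof -
    obtain s' where s': "y = (1 - s') *\<^sub>R c1 + s' *\<^sub>R c2" using y(1) unfolding closed_segment_def by blast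
    obtain r' where r': "y = (1 - r') *\<^sub>R c3 + r' *\<^sub>R c4" using y(2) unfolding closed_segment_def by blast
    have lin: "p + of_real a * (q - p) = (1 - a) *\<^sub>R p + a *\<^sub>R q" for p q :: complex and a
      by (simp add: scaleR_conv_of_real algebra_simps)
    have "y - x = (c1 + of_real s' * (c2 - c1)) - (c1 + of_real s * (c2 - c1))" unfolding lin s'[symmetric] s(1)[symmetric] ..
    also have "\<dots> = of_real (s' - s) * (c2 - c1)" by (simp add: left_diff_distrib)
    finally have e1: "y - x = of_real (s' - s) * (c2 - c1)" .
    have "y - x = (c3 + of_real r' * (c4 - c3)) - (c3 + of_real r * (c4 - c3))" unfolding lin r'[symmetric] r(1)[symmetric] ..
    also have "\<dots> = of_real (r' - r) * (c4 - c3)" by (simp add: left_diff_distrib)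
    finally have "y - x = of_real (r' - r) * (c4 - c3)" .
    then have "of_real (s' - s) * (c2 - c1) = of_real (r' - r) * (c4 - c3)" using e1 by simp
    then have "of_real (s' - s) * ((c2 - c1) * cnj (c4 - c3)) = of_real (r' - r) * ((c4 - c3) * cnj (c4 - c3))"
      by (simp add: mult.assoc[symmetric])
    then have "Im (of_real (s' - s) * ((c2 - c1) * cnj (c4 - c3))) = Im (of_real (r' - r) * ((c4 - c3) * cnj (c4 - c3)))" by (rule arg_cong)
    also have "\<dots> = 0" by (simp add: algebra_simps)
    finally have "(s' - s) * Im ((c2 - c1) * cnj (c4 - c3)) = 0" by (simp add: algebra_simps)
    then have "s' = s" using im by simp
    then show ?thesis using s s' by simp
  qed
  then show "closed_segment c1 c2 \<inter> closed_segment c3 c4 = {x}" using x by blast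
qed

lemma tame_atI:
  assumes "0 < \<epsilon>" "pos ` V \<inter> ball z \<epsilon> = {}" "e \<in> E" "f \<in> E" "e \<noteq> f" "Im (d1 * cnj d2) \<noteq> 0"
     "A e \<inter> ball z \<epsilon> = range (\<lambda>t. z + of_real t * d1) \<inter> ball z \<epsilon>"
     "A f \<inter> ball z \<epsilon> = range (\<lambda>t. z + of_real t * d2) \<inter> ball z \<epsilon>" "\<forall>g\<in>E - {e, f}. A g \<inter> ball z \<epsilon> = {}"
  shows "tame_at V E pos A z \<epsilon>"
  unfolding tame_at_def using assms
  by (intro conjI bexI[of _ e] bexI[of _ f] exI[of _ d1] exI[of _ d2])

lemma tame_atE:
  assumes "tame_at V E pos A z \<epsilon>"
  obtains e f d1 d2 where "0 < \<epsilon>" "pos ` V \<inter> ball z \<epsilon> = {}" "e \<in> E" "f \<in> E" "e \<noteq> f" "Im (d1 * cnj d2) \<noteq> 0"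
     "A e \<inter> ball z \<epsilon> = range (\<lambda>t. z + of_real t * d1) \<inter> ball z \<epsilon>"
     "A f \<inter> ball z \<epsilon> = range (\<lambda>t. z + of_real t * d2) \<inter> ball z \<epsilon>" "\<forall>g\<in>E - {e, f}. A g \<inter> ball z \<epsilon> = {}"
  using assms unfolding tame_at_def by (elim conjE bexE exE) (rule that; assumption)

lemma tame_at_mono:
  assumes "tame_at V E pos A z \<epsilon>" "0 < \<epsilon>'" "\<epsilon>' \<le> \<epsilon>"
  shows "tame_at V E pos A z \<epsilon>'"
proof -
  have b: "ball z \<epsilon>' = ball z \<epsilon> \<inter> ball z \<epsilon>'" using assms(3) by auto
  have *: "S \<inter> ball z \<epsilon>' = T \<inter> ball z \<epsilon>'" if "S \<inter> ball z \<epsilon> = T \<inter> ball z \<epsilon>" for S T using that b by blast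
  have **: "S \<inter> ball z \<epsilon>' = {}" if "S \<inter> ball z \<epsilon> = {}" for S using that b by blast
  from assms(1) show ?thesis
  proof (rule tame_atE)
    fix e f d1 d2
    assume h: "0 < \<epsilon>" "pos ` V \<inter> ball z \<epsilon> = {}" "e \<in> E" "f \<in> E" "e \<noteq> f" "Im (d1 * cnj d2) \<noteq> 0"
       "A e \<inter> ball z \<epsilon> = range (\<lambda>t. z + of_real t * d1) \<inter> ball z \<epsilon>"
       "A f \<inter> ball z \<epsilon> = range (\<lambda>t. z + of_real t * d2) \<inter> ball z \<epsilon>" "\<forall>g\<in>E - {e, f}. A g \<inter> ball z \<epsilon> = {}"
    have "\<forall>g\<in>E - {e, f}. A g \<inter> ball z \<epsilon>' = {}" using h(9) ** by blast
    then show "tame_at V E pos A z \<epsilon>'" by (rule tame_atI[OF assms(2) **[OF h(2)] h(3-6) *[OF h(7)] *[OF h(8)]])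
  qed
qed

lemma tame_at_cong:
  assumes t: "tame_at V E pos A z \<epsilon>" and c: "\<And>e. e \<in> E \<Longrightarrow> A' e \<inter> ball z \<epsilon> = A e \<inter> ball z \<epsilon>"
  shows "tame_at V E pos A' z \<epsilon>"
  using t
proof (rule tame_atE)
  fix e f d1 d2
  assume h: "0 < \<epsilon>" "pos ` V \<inter> ball z \<epsilon> = {}" "e \<in> E" "f \<in> E" "e \<noteq> f" "Im (d1 * cnj d2) \<noteq> 0"
     "A e \<inter> ball z \<epsilon> = range (\<lambda>t. z + of_real t * d1) \<inter> ball z \<epsilon>"
     "A f \<inter> ball z \<epsilon> = range (\<lambda>t. z + of_real t * d2) \<inter> ball z \<epsilon>" "\<forall>g\<in>E - {e, f}. A g \<inter> ball z \<epsilon> = {}"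
  have "\<forall>g\<in>E - {e, f}. A' g \<inter> ball z \<epsilon> = {}" using h(9) c by simp
  then show "tame_at V E pos A' z \<epsilon>"
    using tame_atI[OF h(1-6), of A'] h(7,8) c[OF h(3)] c[OF h(4)] by simp
qed

text \<open>Inside a small disk each of the two edges through \<open>z\<close> is replaced by the
  chord between its last exit points in both directions. The four ends are distinct, because the
  edges meet only at \<open>z\<close> there. Two chords meet at most once and then transversally, so
  the crossing either becomes tame or, as in the case of a mere contact, may disappear.\<close>

lemma chord_step:
  assumes dr: "arc_drawing V E pos A" and z: "z \<in> crossings V E pos A" and \<eta>: "0 < \<eta>"
  shows "\<exists>A' X. arc_drawing V E pos A' \<and> crossings V E pos A' \<subseteq> (crossings V E pos A - {z}) \<union> X \<and>
     (X = {} \<or> (\<exists>x \<epsilon>. X = {x} \<and> x \<in> ball z \<eta> \<and> tame_at V E pos A' x \<epsilon>)) \<and>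
     (\<forall>e\<in>E. A' e - cball z \<eta> = A e - cball z \<eta>)"
proof -
  note D = arc_drawingD[OF dr]
  let ?X = "crossings V E pos A"
  obtain e f where ef: "z \<notin> pos ` V" "e \<in> E" "f \<in> E" "e \<noteq> f" "z \<in> A e" "z \<in> A f" using z unfolding crossings_def by auto
  obtain p q where pq: "e = {p, q}" "p \<noteq> q" using arc_drawing_edgeE[OF dr ef(2)] .
  obtain p' q' where pq': "f = {p', q'}" "p' \<noteq> q'" using arc_drawing_edgeE[OF dr ef(3)] .
  define \<C> where "\<C> = A ` (E - {e, f}) \<union> {?X - {z}, pos ` V}"
  have "finite \<C>" unfolding \<C>_def using D(9) by auto
  moreover have "closed C" if "C \<in> \<C>" for C
    using that arc_drawing_closed[OF dr] D(1,7) unfolding \<C>_def by (auto simp: finite_imp_closed)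
  moreover have "z \<notin> C" if "C \<in> \<C>" for C
    using that D(8)[OF ef(2,3)] ef unfolding \<C>_def by auto
  ultimately obtain \<eta>1 where e1: "0 < \<eta>1" "\<eta>1 \<le> \<eta>" "\<And>C. C \<in> \<C> \<Longrightarrow> C \<inter> cball z \<eta>1 = {}"
    using finite_avoid[of \<C> z \<eta>] \<eta> by metis
  have away: "A g \<inter> cball z \<eta>1 = {}" if "g \<in> E" "g \<noteq> e" "g \<noteq> f" for g using e1(3)[of "A g"] that unfolding \<C>_def by auto
  have awayX: "(?X - {z}) \<inter> cball z \<eta>1 = {}" and awayV: "pos ` V \<inter> cball z \<eta>1 = {}" using e1(3) unfolding \<C>_def by auto
  have ends: "p \<in> V" "q \<in> V" "p' \<in> V" "q' \<in> V" using D(2) ef pq pq' by auto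
  have arcs: "arc_image (A e) (pos p) (pos q)" "arc_image (A f) (pos p') (pos q')" using D(5) ef pq pq' by auto
  have zn: "z \<noteq> pos p" "z \<noteq> pos q" "z \<noteq> pos p'" "z \<noteq> pos q'" using ef(1) ends by auto
  obtain S1 S2 where S: "arc_image S1 (pos p) z" "arc_image S2 z (pos q)" "S1 \<union> S2 = A e" "S1 \<inter> S2 = {z}"
    using arc_image_split[OF arcs(1) ef(5) zn(1,2)] by blast
  obtain S3 S4 where S': "arc_image S3 (pos p') z" "arc_image S4 z (pos q')" "S3 \<union> S4 = A f" "S3 \<inter> S4 = {z}"
    using arc_image_split[OF arcs(2) ef(6) zn(3,4)] by blast
  from arc_image_exit[OF arc_image_sym[OF S(1)] e1(1)] obtain a1 where a1: "a1 > 0" "\<And>\<epsilon>. 0 < \<epsilon> \<Longrightarrow> \<epsilon> < a1 \<Longrightarrow> (\<exists>c T. dist z c = \<epsilon> \<and> c \<in> S1 \<and> arc_image T c (pos p) \<and> T \<subseteq> S1 \<and>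
     T \<inter> cball z \<epsilon> = {c} \<and> S1 - cball z \<eta>1 \<subseteq> T)" by blast
  from arc_image_exit[OF S(2) e1(1)] obtain a2 where a2: "a2 > 0" "\<And>\<epsilon>. 0 < \<epsilon> \<Longrightarrow> \<epsilon> < a2 \<Longrightarrow> (\<exists>c T. dist z c = \<epsilon> \<and> c \<in> S2 \<and> arc_image T c (pos q) \<and> T \<subseteq> S2 \<and>
     T \<inter> cball z \<epsilon> = {c} \<and> S2 - cball z \<eta>1 \<subseteq> T)" by blast
  from arc_image_exit[OF arc_image_sym[OF S'(1)] e1(1)] obtain a3 where a3: "a3 > 0" "\<And>\<epsilon>. 0 < \<epsilon> \<Longrightarrow> \<epsilon> < a3 \<Longrightarrow> (\<exists>c T. dist z c = \<epsilon> \<and> c \<in> S3 \<and> arc_image T c (pos p') \<and> T \<subseteq> S3 \<and>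
     T \<inter> cball z \<epsilon> = {c} \<and> S3 - cball z \<eta>1 \<subseteq> T)" by blast
  from arc_image_exit[OF S'(2) e1(1)] obtain a4 where a4: "a4 > 0" "\<And>\<epsilon>. 0 < \<epsilon> \<Longrightarrow> \<epsilon> < a4 \<Longrightarrow> (\<exists>c T. dist z c = \<epsilon> \<and> c \<in> S4 \<and> arc_image T c (pos q') \<and> T \<subseteq> S4 \<and>
     T \<inter> cball z \<epsilon> = {c} \<and> S4 - cball z \<eta>1 \<subseteq> T)" by blast
  define \<epsilon> where "\<epsilon> = min \<eta>1 (min (min a1 a2) (min a3 a4)) / 2"
  have \<epsilon>: "0 < \<epsilon>" "\<epsilon> < \<eta>1" "\<epsilon> < a1" "\<epsilon> < a2" "\<epsilon> < a3" "\<epsilon> < a4"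
    unfolding \<epsilon>_def using e1 a1(1) a2(1) a3(1) a4(1) by auto
  obtain c1 T1 where t1: "dist z c1 = \<epsilon>" "c1 \<in> S1" "arc_image T1 c1 (pos p)" "T1 \<subseteq> S1" "T1 \<inter> cball z \<epsilon> = {c1}" "S1 - cball z \<eta>1 \<subseteq> T1"
    using a1(2)[OF \<epsilon>(1,3)] by blast
  obtain c2 T2 where t2: "dist z c2 = \<epsilon>" "c2 \<in> S2" "arc_image T2 c2 (pos q)" "T2 \<subseteq> S2" "T2 \<inter> cball z \<epsilon> = {c2}" "S2 - cball z \<eta>1 \<subseteq> T2"
    using a2(2)[OF \<epsilon>(1,4)] by blast
  obtain c3 T3 where t3: "dist z c3 = \<epsilon>" "c3 \<in> S3" "arc_image T3 c3 (pos p')" "T3 \<subseteq> S3" "T3 \<inter> cball z \<epsilon> = {c3}" "S3 - cball z \<eta>1 \<subseteq> T3"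
    using a3(2)[OF \<epsilon>(1,5)] by blast
  obtain c4 T4 where t4: "dist z c4 = \<epsilon>" "c4 \<in> S4" "arc_image T4 c4 (pos q')" "T4 \<subseteq> S4" "T4 \<inter> cball z \<epsilon> = {c4}" "S4 - cball z \<eta>1 \<subseteq> T4"
    using a4(2)[OF \<epsilon>(1,6)] by blast
  let ?B = "cball z \<epsilon>"
  have Bsub: "?B \<subseteq> cball z \<eta>1" "?B \<subseteq> cball z \<eta>" using \<epsilon> e1 by auto
  have cz: "c1 \<noteq> z" "c2 \<noteq> z" "c3 \<noteq> z" "c4 \<noteq> z" using t1(1) t2(1) t3(1) t4(1) \<epsilon> by auto
  have only: "w = z" if "w \<in> A e" "w \<in> A f" "w \<in> cball z \<eta>1" for w
  proof (rule ccontr)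
    assume "w \<noteq> z"
    have "w \<notin> pos ` V" using awayV that by auto
    then have "w \<in> ?X" unfolding crossings_def using that(1,2) ef(2-4)
      by (intro CollectI conjI bexI[of _ e] bexI[of _ f])
    then have "w \<in> ?X - {z}" using \<open>w \<noteq> z\<close> by blast
    then show False using awayX that by auto
  qed
  have cin: "c1 \<in> ?B" "c2 \<in> ?B" "c3 \<in> ?B" "c4 \<in> ?B" using t1(1) t2(1) t3(1) t4(1) by auto
  have cA: "c1 \<in> A e" "c2 \<in> A e" "c3 \<in> A f" "c4 \<in> A f" using t1(2) t2(2) t3(2) t4(2) S(3) S'(3) by auto
  have "c1 \<noteq> c2" using t1(2) t2(2) S(4) cz by blast
  moreover have "c3 \<noteq> c4" using t3(2) t4(2) S'(4) cz by blast
  moreover have "c1 \<noteq> c3" "c1 \<noteq> c4" "c2 \<noteq> c3" "c2 \<noteq> c4" using only cA cin Bsub cz by blast+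
  ultimately have dist: "distinct [c1, c2, c3, c4]" by auto
  have seg: "closed_segment c1 c2 \<subseteq> ?B" "closed_segment c3 c4 \<subseteq> ?B"
    by (rule closed_segment_subset[OF cin(1,2) convex_cball], rule closed_segment_subset[OF cin(3,4) convex_cball])
  have T12: "T1 \<inter> T2 = {}"
  proof -
    have "z \<notin> T1" using t1(5) cz \<epsilon> by auto
    moreover have "T1 \<inter> T2 \<subseteq> {z}" using Int_mono[OF t1(4) t2(4)] S(4) by simp
    ultimately show ?thesis by blast
  qed
  have T34: "T3 \<inter> T4 = {}"
  proof -
    have "z \<notin> T3" using t3(5) cz \<epsilon> by auto
    moreover have "T3 \<inter> T4 \<subseteq> {z}" using Int_mono[OF t3(4) t4(4)] S'(4) by simp
    ultimately show ?thesis by blast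
  qed
  define Ae where "Ae = T1 \<union> closed_segment c1 c2 \<union> T2"
  define Af where "Af = T3 \<union> closed_segment c3 c4 \<union> T4"
  have arcE: "arc_image Ae (pos p) (pos q)" unfolding Ae_def
  proof (rule arc_image_join[OF arc_image_join[OF arc_image_sym[OF t1(3)] arc_image_segment] t2(3)])
    show "c1 \<noteq> c2" using dist by auto
    show "T1 \<inter> closed_segment c1 c2 \<subseteq> {c1}" using t1(5) seg by blast
    show "(T1 \<union> closed_segment c1 c2) \<inter> T2 \<subseteq> {c2}" using t2(5) seg T12 by blast
  qed
  have arcF: "arc_image Af (pos p') (pos q')" unfolding Af_def
  proof (rule arc_image_join[OF arc_image_join[OF arc_image_sym[OF t3(3)] arc_image_segment] t4(3)])
    show "c3 \<noteq> c4" using dist by auto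
    show "T3 \<inter> closed_segment c3 c4 \<subseteq> {c3}" using t3(5) seg by blast
    show "(T3 \<union> closed_segment c3 c4) \<inter> T4 \<subseteq> {c4}" using t4(5) seg T34 by blast
  qed
  define A' where "A' = A(e := Ae, f := Af)"
  have A'e: "A' e = Ae" "A' f = Af" and A'g: "\<And>g. g \<noteq> e \<Longrightarrow> g \<noteq> f \<Longrightarrow> A' g = A g" unfolding A'_def using ef(4) by auto
  have inB: "A' e \<inter> ?B = closed_segment c1 c2" "A' f \<inter> ?B = closed_segment c3 c4"
  proof -
    have "closed_segment c1 c2 \<inter> ?B = closed_segment c1 c2" "closed_segment c3 c4 \<inter> ?B = closed_segment c3 c4"
      using seg by (simp_all add: Int_absorb2)
    then show "A' e \<inter> ?B = closed_segment c1 c2" "A' f \<inter> ?B = closed_segment c3 c4"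
      unfolding A'e Ae_def Af_def Int_Un_distrib2 t1(5) t2(5) t3(5) t4(5) by auto
  qed
  have notB: "A' g \<inter> ?B = {}" if "g \<in> E" "g \<noteq> e" "g \<noteq> f" for g using away[OF that] A'g that Bsub by auto
  have outB: "A' g - ?B \<subseteq> A g" for g
  proof (cases "g = e \<or> g = f")
    case True
    then show ?thesis using seg t1(4) t2(4) t3(4) t4(4) S(3) S'(3) unfolding A'_def Ae_def Af_def by auto
  qed (use A'g in auto)
  define X where "X = closed_segment c1 c2 \<inter> closed_segment c3 c4"
  have meetB: "w \<in> X" if "g \<in> E" "h \<in> E" "g \<noteq> h" "w \<in> A' g" "w \<in> A' h" "w \<in> ?B" for g h w
  proof -
    have "g \<in> {e, f}" "h \<in> {e, f}" using notB that by blast+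
    then show ?thesis unfolding X_def using that inB by blast
  qed
  have cross: "crossings V E pos A' \<subseteq> (?X - {z}) \<union> X"
  proof
    fix w assume "w \<in> crossings V E pos A'"
    then obtain g h where gh: "w \<notin> pos ` V" "g \<in> E" "h \<in> E" "g \<noteq> h" "w \<in> A' g" "w \<in> A' h" unfolding crossings_def by auto
    show "w \<in> (?X - {z}) \<union> X"
    proof (cases "w \<in> ?B")
      case True then show ?thesis using meetB gh by blast
    next
      case False
      then have wA: "w \<in> A g" "w \<in> A h" using outB[of g] outB[of h] gh(5,6) by blast+
      have "w \<noteq> z" using False \<epsilon>(1) by auto
      moreover have "w \<in> ?X" unfolding crossings_def using gh(1-4) wA
        by (intro CollectI conjI bexI[of _ g] bexI[of _ h])
      ultimately show ?thesis by blast
    qed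
  qed
  have X1: "X = {} \<or> (\<exists>x. X = {x} \<and> x \<in> ball z \<epsilon> \<and> Im ((c2 - c1) * cnj (c4 - c3)) \<noteq> 0)"
    unfolding X_def using chord_cross[OF t1(1) t2(1) t3(1) t4(1) \<epsilon>(1) dist] by blast
  then have finX: "finite X" by auto
  have dr': "arc_drawing V E pos A'" unfolding arc_drawing_def
  proof (intro conjI ballI allI impI)
    fix v w assume vw: "{v, w} \<in> E"
    show "arc_image (A' {v, w}) (pos v) (pos w)"
    proof (cases "{v, w} = e \<or> {v, w} = f")
      case True
      have sy: "arc_image (A' g) (pos v) (pos w)" if "arc_image (A' g) (pos x) (pos y)" "g = {x, y}" "{v, w} = g" for g x y
        using that arc_image_sym by (auto simp: doubleton_eq_iff)
      from True show ?thesis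
      proof
        assume g: "{v, w} = e"
        show ?thesis using sy[OF _ pq(1) g] arcE A'e(1) g by simp
      next
        assume g: "{v, w} = f"
        show ?thesis using sy[OF _ pq'(1) g] arcF A'e(2) g by simp
      qed
    next
      case False then show ?thesis using A'g D(5)[OF vw] by auto
    qed
  next
    fix g v assume gv: "g \<in> E" "v \<in> V" "pos v \<in> A' g"
    then have "pos v \<notin> ?B" using awayV Bsub(1) by blast
    then show "v \<in> g" using outB[of g] gv D(6) by blast
  next
    fix g h k assume ghk: "g \<in> E" "h \<in> E" "k \<in> E" "g \<noteq> h" "h \<noteq> k" "g \<noteq> k"
    show "A' g \<inter> A' h \<inter> A' k \<subseteq> pos ` V"
    proof
      fix w assume w: "w \<in> A' g \<inter> A' h \<inter> A' k"
      have "w \<notin> ?B"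
      proof
        assume "w \<in> ?B"
        then have "g \<in> {e, f}" "h \<in> {e, f}" "k \<in> {e, f}" using notB ghk w by blast+
        then show False using ghk by auto
      qed
      then show "w \<in> pos ` V" using outB w D(8)[OF ghk] by blast
    qed
  qed (use D finite_subset[OF cross] finX in auto)
  have tame: "\<exists>x d. X = {x} \<and> x \<in> ball z \<eta> \<and> tame_at V E pos A' x d" if "X \<noteq> {}"
  proof -
    obtain x where x: "X = {x}" "x \<in> ball z \<epsilon>" "Im ((c2 - c1) * cnj (c4 - c3)) \<noteq> 0" using X1 \<open>X \<noteq> {}\<close> by blast
    obtain d where d: "d > 0" "ball x d \<subseteq> ball z \<epsilon>" using x(2) by (metis open_ball open_contains_ball)
    have xs: "x \<in> closed_segment c1 c2" "x \<in> closed_segment c3 c4" using x(1) unfolding X_def by auto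
    have "A' e \<inter> ball z \<epsilon> = closed_segment c1 c2 \<inter> ball z \<epsilon>" "A' f \<inter> ball z \<epsilon> = closed_segment c3 c4 \<inter> ball z \<epsilon>"
      using inB ball_subset_cball by blast+
    then have "A' e \<inter> ball z \<epsilon> = range (\<lambda>t. x + of_real t * (c2 - c1)) \<inter> ball z \<epsilon>"
        "A' f \<inter> ball z \<epsilon> = range (\<lambda>t. x + of_real t * (c4 - c3)) \<inter> ball z \<epsilon>"
      using chord_line[OF t1(1) t2(1) _ \<epsilon>(1) xs(1)] chord_line[OF t3(1) t4(1) _ \<epsilon>(1) xs(2)] dist by auto
    then have "A' e \<inter> ball x d = range (\<lambda>t. x + of_real t * (c2 - c1)) \<inter> ball x d"
        "A' f \<inter> ball x d = range (\<lambda>t. x + of_real t * (c4 - c3)) \<inter> ball x d" using d(2) by blast+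
    moreover have "\<forall>g\<in>E - {e, f}. A' g \<inter> ball x d = {}" using notB d(2) ball_subset_cball by blast
    moreover have "pos ` V \<inter> ball x d = {}" using awayV d(2) Bsub ball_subset_cball by blast
    ultimately have "tame_at V E pos A' x d" using tame_atI[of d pos V x e E f "c2 - c1" "c4 - c3" A'] ef(2-4) x(3) d(1) by simp
    moreover have "x \<in> ball z \<eta>" using x(2) \<epsilon> e1 by auto
    ultimately show ?thesis using x by blast
  qed
  have "A' g - cball z \<eta> = A g - cball z \<eta>" for g
  proof
    show "A' g - cball z \<eta> \<subseteq> A g - cball z \<eta>" using outB[of g] Bsub by blast
    have "cball z \<eta>1 \<subseteq> cball z \<eta>" using e1 by auto
    then have "A e - cball z \<eta> \<subseteq> Ae" "A f - cball z \<eta> \<subseteq> Af"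
      unfolding Ae_def Af_def S(3)[symmetric] S'(3)[symmetric] using t1(6) t2(6) t3(6) t4(6) by blast+
    then show "A g - cball z \<eta> \<subseteq> A' g - cball z \<eta>" using A'e A'g by (cases "g = e \<or> g = f") auto
  qed
  then show ?thesis using dr' cross tame by blast
qed

lemma star_at_mono:
  assumes s: "star_at E pos A v \<epsilon> d" and e: "0 < \<epsilon>'" "\<epsilon>' \<le> \<epsilon>"
  shows "star_at E pos A v \<epsilon>' d"
  unfolding star_at_def
proof (intro conjI allI impI ballI)
  fix w assume w: "{v, w} \<in> E"
  then have n: "norm (d w) = 1" and a: "A {v, w} \<inter> cball (pos v) \<epsilon> = {pos v + of_real t * d w | t. 0 \<le> t \<and> t \<le> \<epsilon>}"
    using s unfolding star_at_def by auto
  show "norm (d w) = 1" by fact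
  have "cball (pos v) \<epsilon>' \<subseteq> cball (pos v) \<epsilon>" using e by auto
  then have "A {v, w} \<inter> cball (pos v) \<epsilon>' = {pos v + of_real t * d w | t. 0 \<le> t \<and> t \<le> \<epsilon>} \<inter> cball (pos v) \<epsilon>'" using a by blast
  also have "\<dots> = {pos v + of_real t * d w | t. 0 \<le> t \<and> t \<le> \<epsilon>'}"
    using n e by (auto simp: dist_norm norm_mult)
  finally show "A {v, w} \<inter> cball (pos v) \<epsilon>' = {pos v + of_real t * d w | t. 0 \<le> t \<and> t \<le> \<epsilon>'}" .
next
  fix e' assume "e' \<in> E" "v \<notin> e'"
  then have "A e' \<inter> cball (pos v) \<epsilon> = {}" using s unfolding star_at_def by auto
  moreover have "cball (pos v) \<epsilon>' \<subseteq> cball (pos v) \<epsilon>" using e by auto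
  ultimately show "A e' \<inter> cball (pos v) \<epsilon>' = {}" by blast
qed (use e in auto)

lemma star_at_cong:
  assumes "star_at E pos A v \<epsilon> d" "\<And>e. e \<in> E \<Longrightarrow> A' e \<inter> cball (pos v) \<epsilon> = A e \<inter> cball (pos v) \<epsilon>"
  shows "star_at E pos A' v \<epsilon> d"
  using assms unfolding star_at_def by simp

text \<open>Induction on the number of crossings that are not yet tame. Straightening one of them
  does not increase the number of crossings, so by minimality the number is unchanged and the new
  drawing is again minimal. The disk is chosen away from the tame crossings, which therefore remain
  tame.\<close>

lemma tame_normal:
  assumes "arc_drawing V E pos A" "\<And>A'. arc_drawing V E pos A' \<Longrightarrow> card (crossings V E pos A) \<le> card (crossings V E pos A')"
  shows "\<exists>A'. arc_drawing V E pos A' \<and> card (crossings V E pos A') = card (crossings V E pos A) \<and>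
     (\<forall>z\<in>crossings V E pos A'. \<exists>\<epsilon>. tame_at V E pos A' z \<epsilon>)"
  using assms
proof (induction "card {z \<in> crossings V E pos A. \<not> (\<exists>\<epsilon>. tame_at V E pos A z \<epsilon>)}" arbitrary: A rule: less_induct)
  case (less A)
  let ?X = "crossings V E pos A"
  let ?U = "\<lambda>A. {z \<in> crossings V E pos A. \<not> (\<exists>\<epsilon>. tame_at V E pos A z \<epsilon>)}"
  have fin: "finite ?X" using arc_drawingD(7)[OF less.prems(1)] .
  show ?case
  proof (cases "?U A = {}")
    case True then show ?thesis using less.prems(1) by blast
  next
    case False
    then obtain z where z: "z \<in> ?X" "\<not> (\<exists>\<epsilon>. tame_at V E pos A z \<epsilon>)" by blast
    define T where "T = {w \<in> ?X. \<exists>\<epsilon>. tame_at V E pos A w \<epsilon>}"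
    have "\<forall>w\<in>T. \<exists>\<epsilon>>0. \<epsilon> < dist z w \<and> tame_at V E pos A w \<epsilon>"
    proof
      fix w assume "w \<in> T"
      then obtain \<epsilon> where e: "tame_at V E pos A w \<epsilon>" unfolding T_def by blast
      have "w \<noteq> z" using z(2) e by auto
      moreover have "0 < \<epsilon>" using e unfolding tame_at_def by simp
      moreover from calculation have "0 < dist z w" by simp
      ultimately have "0 < min \<epsilon> (dist z w / 2)" "min \<epsilon> (dist z w / 2) < dist z w" by (simp_all add: min_less_iff_disj)
      then show "\<exists>\<epsilon>>0. \<epsilon> < dist z w \<and> tame_at V E pos A w \<epsilon>"
        using tame_at_mono[OF e, of "min \<epsilon> (dist z w / 2)"] min.cobounded1[of \<epsilon> "dist z w / 2"] by blast
    qed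
    then obtain \<rho> where \<rho>: "\<And>w. w \<in> T \<Longrightarrow> 0 < \<rho> w \<and> \<rho> w < dist z w \<and> tame_at V E pos A w (\<rho> w)" by metis
    have "finite T" unfolding T_def using fin by simp
    then have "\<exists>\<epsilon>>0. \<epsilon> \<le> 1 \<and> (\<forall>C\<in>(\<lambda>w. cball w (\<rho> w)) ` T. C \<inter> cball z \<epsilon> = {})"
    proof (intro finite_avoid)
      fix C assume "C \<in> (\<lambda>w. cball w (\<rho> w)) ` T"
      then obtain w where "w \<in> T" "C = cball w (\<rho> w)" by blast
      then show "closed C" "z \<notin> C" using \<rho>[of w] by (auto simp: dist_commute)
    qed auto
    then obtain \<eta> where \<eta>: "0 < \<eta>" "\<And>w. w \<in> T \<Longrightarrow> cball w (\<rho> w) \<inter> cball z \<eta> = {}" by blast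
    obtain A' X where A': "arc_drawing V E pos A'" "crossings V E pos A' \<subseteq> (?X - {z}) \<union> X"
      "X = {} \<or> (\<exists>x \<epsilon>. X = {x} \<and> x \<in> ball z \<eta> \<and> tame_at V E pos A' x \<epsilon>)"
      "\<forall>e\<in>E. A' e - cball z \<eta> = A e - cball z \<eta>"
      using chord_step[OF less.prems(1) z(1) \<eta>(1)] by (elim exE conjE) (rule that; assumption)
    have finX: "finite X" "card X \<le> 1" using A'(3) by auto
    have "card (crossings V E pos A') \<le> card ((?X - {z}) \<union> X)" using A'(2) fin finX by (intro card_mono) auto
    also have "\<dots> \<le> card (?X - {z}) + card X" by (rule card_Un_le)
    also have "\<dots> \<le> card ?X" using card_Suc_Diff1[OF fin z(1)] finX(2) by linarith
    finally have "card (crossings V E pos A') \<le> card ?X" .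
    then have eq: "card (crossings V E pos A') = card ?X" using less.prems(2)[OF A'(1)] by simp
    have Xt: "\<exists>\<epsilon>. tame_at V E pos A' x \<epsilon>" if "x \<in> X" for x using A'(3) that by auto
    have pres: "\<exists>\<epsilon>. tame_at V E pos A' w \<epsilon>" if w: "w \<in> T" for w
    proof -
      have "A' e \<inter> ball w (\<rho> w) = A e \<inter> ball w (\<rho> w)" if "e \<in> E" for e
      proof -
        have "ball w (\<rho> w) \<inter> cball z \<eta> = {}" using \<eta>(2)[OF w] ball_subset_cball by blast
        then show ?thesis using bspec[OF A'(4) that] by blast
      qed
      then show ?thesis using tame_at_cong[of V E pos A w "\<rho> w" A'] \<rho>[OF w] by blast
    qed
    have "?U A' \<subseteq> ?U A - {z}"
      using A'(2) Xt pres unfolding T_def by blast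
    moreover have "z \<in> ?U A" "finite (?U A)" using z fin by auto
    ultimately have "card (?U A') < card (?U A)"
      using card_mono[of "?U A - {z}" "?U A'"] card_Diff1_less[of "?U A" z] by (meson finite_Diff le_less_trans)
    then obtain A'' where "arc_drawing V E pos A''" "card (crossings V E pos A'') = card (crossings V E pos A')"
       "\<forall>z\<in>crossings V E pos A''. \<exists>\<epsilon>. tame_at V E pos A'' z \<epsilon>"
      using less.hyps[OF _ A'(1)] less.prems(2) eq by metis
    then show ?thesis using eq by auto
  qed
qed

text \<open>Once the crossings are tame, the vertices are treated one after the other, each in a
  disk so small that tame crossings and finished stars are not touched.\<close>

lemma star_normal:
  assumes dr: "arc_drawing V E pos A" and min: "\<And>A'. arc_drawing V E pos A' \<Longrightarrow> card (crossings V E pos A) \<le> card (crossings V E pos A')"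
    and S: "S \<subseteq> V"
  shows "\<exists>A'. arc_drawing V E pos A' \<and> card (crossings V E pos A') = card (crossings V E pos A) \<and>
     (\<forall>z\<in>crossings V E pos A'. \<exists>\<epsilon>. tame_at V E pos A' z \<epsilon>) \<and> (\<forall>v\<in>S. \<exists>\<epsilon> d. star_at E pos A' v \<epsilon> d)"
proof -
  have "finite S" using S arc_drawingD(1)[OF dr] finite_subset by blast
  then show ?thesis using S
  proof (induction S rule: finite_induct)
    case empty
    then show ?case using tame_normal[OF dr min] by blast
  next
    case (insert v S)
    then obtain B where B: "arc_drawing V E pos B" "card (crossings V E pos B) = card (crossings V E pos A)"
      "\<forall>z\<in>crossings V E pos B. \<exists>\<epsilon>. tame_at V E pos B z \<epsilon>" "\<forall>v\<in>S. \<exists>\<epsilon> d. star_at E pos B v \<epsilon> d" by auto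
    let ?X = "crossings V E pos B" and ?p = "pos v"
    have fin: "finite ?X" using arc_drawingD(7)[OF B(1)] .
    have vV: "v \<in> V" using insert by auto
    have "\<forall>w\<in>?X. \<exists>\<epsilon>>0. \<epsilon> < dist ?p w \<and> tame_at V E pos B w \<epsilon>"
    proof
      fix w assume w: "w \<in> ?X"
      then obtain \<epsilon> where e: "tame_at V E pos B w \<epsilon>" using B by blast
      have "w \<noteq> ?p" using w vV unfolding crossings_def by auto
      moreover have "0 < \<epsilon>" using e unfolding tame_at_def by simp
      moreover from calculation have "0 < dist ?p w" by simp
      ultimately have "0 < min \<epsilon> (dist ?p w / 2)" "min \<epsilon> (dist ?p w / 2) < dist ?p w" by (simp_all add: min_less_iff_disj)
      then show "\<exists>\<epsilon>>0. \<epsilon> < dist ?p w \<and> tame_at V E pos B w \<epsilon>"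
        using tame_at_mono[OF e, of "min \<epsilon> (dist ?p w / 2)"] min.cobounded1[of \<epsilon> "dist ?p w / 2"] by blast
    qed
    then obtain \<rho> where \<rho>: "\<And>w. w \<in> ?X \<Longrightarrow> 0 < \<rho> w \<and> \<rho> w < dist ?p w \<and> tame_at V E pos B w (\<rho> w)" by metis
    have "\<forall>w\<in>S. \<exists>\<epsilon> d. 0 < \<epsilon> \<and> \<epsilon> < dist ?p (pos w) \<and> star_at E pos B w \<epsilon> d"
    proof
      fix w assume w: "w \<in> S"
      then obtain \<epsilon> d where e: "star_at E pos B w \<epsilon> d" using B by blast
      have "pos w \<noteq> ?p" using w vV insert arc_drawingD(4)[OF B(1)] by (metis inj_onD insert_subset subsetD)
      moreover have "0 < \<epsilon>" using e unfolding star_at_def by simp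
      moreover from calculation have "0 < dist ?p (pos w)" by simp
      ultimately have "0 < min \<epsilon> (dist ?p (pos w) / 2)" "min \<epsilon> (dist ?p (pos w) / 2) < dist ?p (pos w)"
        by (simp_all add: min_less_iff_disj)
      then show "\<exists>\<epsilon> d. 0 < \<epsilon> \<and> \<epsilon> < dist ?p (pos w) \<and> star_at E pos B w \<epsilon> d"
        using star_at_mono[OF e, of "min \<epsilon> (dist ?p (pos w) / 2)"] min.cobounded1[of \<epsilon> "dist ?p (pos w) / 2"] by blast
    qed
    then obtain \<sigma> d where \<sigma>: "\<And>w. w \<in> S \<Longrightarrow> 0 < \<sigma> w \<and> \<sigma> w < dist ?p (pos w) \<and> star_at E pos B w (\<sigma> w) (d w)" by metis
    have "\<exists>\<epsilon>>0. \<epsilon> \<le> 1 \<and> (\<forall>C\<in>(\<lambda>w. cball w (\<rho> w)) ` ?X \<union> (\<lambda>w. cball (pos w) (\<sigma> w)) ` S. C \<inter> cball ?p \<epsilon> = {})"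
    proof (intro finite_avoid)
      fix C assume "C \<in> (\<lambda>w. cball w (\<rho> w)) ` ?X \<union> (\<lambda>w. cball (pos w) (\<sigma> w)) ` S"
      then consider w where "w \<in> ?X" "C = cball w (\<rho> w)" | w where "w \<in> S" "C = cball (pos w) (\<sigma> w)" by blast
      then show "closed C" "?p \<notin> C"
        by (cases; use \<rho> \<sigma> in \<open>force simp: dist_commute\<close>)+
    qed (use fin insert(1) in auto)
    then obtain \<eta> where \<eta>0: "0 < \<eta>" "\<forall>C\<in>(\<lambda>w. cball w (\<rho> w)) ` ?X \<union> (\<lambda>w. cball (pos w) (\<sigma> w)) ` S. C \<inter> cball ?p \<eta> = {}"
      by (elim exE conjE) (rule that; assumption)
    have \<eta>: "0 < \<eta>" "\<And>w. w \<in> ?X \<Longrightarrow> cball w (\<rho> w) \<inter> cball ?p \<eta> = {}" "\<And>w. w \<in> S \<Longrightarrow> cball (pos w) (\<sigma> w) \<inter> cball ?p \<eta> = {}"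
      using \<eta>0(1) bspec[OF \<eta>0(2) UnI1[OF imageI]] bspec[OF \<eta>0(2) UnI2[OF imageI]] by simp_all
    obtain B' \<epsilon> dv where B': "arc_drawing V E pos B'" "crossings V E pos B' \<subseteq> ?X" "star_at E pos B' v \<epsilon> dv"
      "\<forall>e\<in>E. B' e - cball ?p \<eta> = B e - cball ?p \<eta>"
      using star_step[OF B(1) vV \<eta>(1)] by (elim exE conjE) (rule that; assumption)
    have same: "B' e \<inter> C = B e \<inter> C" if "e \<in> E" "C \<inter> cball ?p \<eta> = {}" for e C using bspec[OF B'(4) that(1)] that(2) by blast
    have "card (crossings V E pos B') \<le> card ?X" using B'(2) fin by (rule card_mono[rotated])
    then have "card (crossings V E pos B') = card (crossings V E pos A)" using min[OF B'(1)] B(2) by simp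
    moreover have "\<exists>\<epsilon>. tame_at V E pos B' w \<epsilon>" if "w \<in> crossings V E pos B'" for w
    proof -
      have w: "w \<in> ?X" using that B'(2) by blast
      have "ball w (\<rho> w) \<inter> cball ?p \<eta> = {}" using \<eta>(2)[OF w] ball_subset_cball by blast
      then show ?thesis using tame_at_cong[of V E pos B w "\<rho> w" B'] \<rho>[OF w] same by blast
    qed
    moreover have "\<exists>\<epsilon> d. star_at E pos B' w \<epsilon> d" if "w \<in> insert v S" for w
    proof (cases "w = v")
      case True then show ?thesis using B'(3) by blast
    next
      case False
      then have w: "w \<in> S" using that by simp
      then show ?thesis using star_at_cong[of E pos B w "\<sigma> w" "d w" B'] \<sigma>[OF w] same \<eta>(3)[OF w] by blast
    qed
    ultimately show ?case using B'(1) by blast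
  qed
qed

section \<open>Jordan curves in straightened drawings\<close>

lemma cis_eq_close: assumes "cis a = cis b" "\<bar>a - b\<bar> < 2 * pi" shows "a = b"
proof -
  have "sin a = sin b \<and> cos a = cos b" using assms(1) by (metis cis.simps)
  then obtain n :: int where n: "a = b + 2 * pi * n" using sin_cos_eq_iff by blast
  then have "\<bar>2 * pi * n\<bar> < 2 * pi" using assms(2) by simp
  then have "\<bar>real_of_int n\<bar> < 1" by (simp add: abs_mult)
  then show ?thesis using n by simp
qed

locale straight_drawing =
  fixes V :: "'a set" and E :: "'a set set" and pos :: "'a \<Rightarrow> complex" and A :: "'a set \<Rightarrow> complex set"
    and rad :: "'a \<Rightarrow> real" and dir :: "'a \<Rightarrow> 'a \<Rightarrow> complex"
  assumes dr: "arc_drawing V E pos A"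
    and star: "v \<in> V \<Longrightarrow> star_at E pos A v (rad v) (dir v)"
    and rad_less: "v \<in> V \<Longrightarrow> w \<in> V \<Longrightarrow> v \<noteq> w \<Longrightarrow> rad v < dist (pos v) (pos w)"
    and tame: "z \<in> crossings V E pos A \<Longrightarrow> \<exists>\<epsilon>. tame_at V E pos A z \<epsilon>"
begin

lemmas D = arc_drawingD[OF dr]
lemmas De = arc_drawing_edge[OF dr]

definition cross :: "'a set \<Rightarrow> 'a set \<Rightarrow> bool" where
  "cross e f \<longleftrightarrow> e \<in> E \<and> f \<in> E \<and> e \<noteq> f \<and> (\<exists>z\<in>crossings V E pos A. z \<in> A e \<and> z \<in> A f)"

definition cr :: "'a set \<Rightarrow> nat" where "cr e = card (crossings V E pos A \<inter> A e)"

definition ang :: "'a \<Rightarrow> 'a \<Rightarrow> real" where "ang v w = Arg2pi (dir v w)"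

definition curve :: "'a set set \<Rightarrow> complex set" where "curve C = \<Union>(A ` C)"

text \<open>A point on the straight initial piece of \<open>vw\<close>. It stands for the beginning
  of the edge, so that starting into the inside of a curve becomes the membership of one
  point.\<close>

definition germ :: "'a \<Rightarrow> 'a \<Rightarrow> complex" where "germ v w = pos v + of_real (rad v / 2) * dir v w"

definition gs :: "'a set set \<Rightarrow> 'a \<Rightarrow> 'a \<Rightarrow> bool" where "gs C v w \<longleftrightarrow> germ v w \<in> inside (curve C)"

definition vin :: "'a set set \<Rightarrow> 'a \<Rightarrow> bool" where "vin C v \<longleftrightarrow> pos v \<in> inside (curve C)"

lemma rad_pos: "v \<in> V \<Longrightarrow> 0 < rad v"
  using star unfolding star_at_def by blast

lemma dir_norm: "{v, w} \<in> E \<Longrightarrow> norm (dir v w) = 1"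
  using star[of v] De(1)[of v w] unfolding star_at_def by blast

lemma dir_cis: "{v, w} \<in> E \<Longrightarrow> dir v w = cis (ang v w)"
  using Arg2pi_eq[of "dir v w"] dir_norm[of v w] unfolding ang_def by (simp add: cis_conv_exp mult.commute)

lemma radius: "{v, w} \<in> E \<Longrightarrow> A {v, w} \<inter> cball (pos v) (rad v) = {pos v + of_real t * dir v w | t. 0 \<le> t \<and> t \<le> rad v}"
  using star[of v] De(1)[of v w] unfolding star_at_def by blast

lemma ball_empty: "v \<in> V \<Longrightarrow> e \<in> E \<Longrightarrow> v \<notin> e \<Longrightarrow> A e \<inter> cball (pos v) (rad v) = {}"
  using star[of v] unfolding star_at_def by blast

lemma edge_other: assumes "e \<in> E" "v \<in> e" obtains w where "e = {v, w}" "w \<noteq> v"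
  using arc_drawing_edgeE[OF dr assms(1)] assms(2) by (metis doubleton_eq_iff insertE singletonD)

lemma crossing_iff: "e \<in> E \<Longrightarrow> f \<in> E \<Longrightarrow> e \<noteq> f \<Longrightarrow> z \<in> A e \<Longrightarrow> z \<in> A f \<Longrightarrow> z \<notin> pos ` V \<Longrightarrow> z \<in> crossings V E pos A"
  unfolding crossings_def by blast

lemma crossingE: assumes "z \<in> crossings V E pos A" shows "z \<notin> pos ` V"
  using assms unfolding crossings_def by blast

lemma meet_vertex:
  assumes "e \<in> E" "f \<in> E" "e \<noteq> f" "\<not> cross e f" "z \<in> A e" "z \<in> A f"
  obtains v where "v \<in> e" "v \<in> f" "z = pos v" "v \<in> V"
proof -
  have "z \<in> pos ` V" using crossing_iff[OF assms(1-3,5,6)] assms unfolding cross_def by blast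
  then obtain v where v: "v \<in> V" "z = pos v" by blast
  then have "v \<in> e" "v \<in> f" using D(6) assms by blast+
  then show ?thesis using that v by blast
qed

lemma ang_range: "0 \<le> ang v w" "ang v w < 2 * pi"
  unfolding ang_def using Arg2pi_ge_0 Arg2pi_lt_2pi by auto

text \<open>Two edges leaving \<open>v\<close> in the same direction would share a segment, hence
  have infinitely many crossings.\<close>

lemma dir_inj: assumes "{v, x} \<in> E" "{v, y} \<in> E" "dir v x = dir v y" shows "x = y"
proof (rule ccontr)
  assume "x \<noteq> y"
  then have ne: "{v, x} \<noteq> {v, y}" by (auto simp: doubleton_eq_iff)
  have v: "v \<in> V" using De(1) assms(1) .
  let ?S = "(\<lambda>t. pos v + of_real t * dir v x) ` {0<..rad v}"
  have inj: "inj_on (\<lambda>t. pos v + of_real t * dir v x) {0<..rad v}"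
  proof -
    have "dir v x \<noteq> 0" using dir_norm[OF assms(1)] by auto
    then show ?thesis by (auto simp: inj_on_def)
  qed
  have "?S \<subseteq> A {v, x} \<inter> cball (pos v) (rad v)" "?S \<subseteq> A {v, y} \<inter> cball (pos v) (rad v)"
    unfolding radius[OF assms(1)] radius[OF assms(2)] assms(3) by force+
  then have "?S - pos ` V \<subseteq> crossings V E pos A" using crossing_iff[OF assms(1,2) ne] by blast
  then have "finite (?S - pos ` V)" using D(7) finite_subset by blast
  then have "finite ?S" using D(1) by simp
  then have "finite {0<..rad v}" using finite_imageD inj by blast
  then show False using rad_pos[OF v] infinite_Ioc[of 0 "rad v"] by blast
qed

lemma ang_inj: "{v, x} \<in> E \<Longrightarrow> {v, y} \<in> E \<Longrightarrow> ang v x = ang v y \<Longrightarrow> x = y"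
  using dir_inj dir_cis by metis

lemma ball_no_crossing:
  assumes v: "v \<in> V" and e: "e \<in> E" "f \<in> E" "e \<noteq> f" "z \<in> A e" "z \<in> A f" "z \<in> cball (pos v) (rad v)"
  shows "z = pos v"
proof -
  have "v \<in> e" "v \<in> f" using ball_empty[OF v] e by blast+
  then obtain x y where xy: "e = {v, x}" "f = {v, y}" using edge_other e by metis
  then have "x \<noteq> y" using e by auto
  obtain s where s: "0 \<le> s" "z = pos v + of_real s * dir v x" using radius[of v x] e xy by blast
  obtain t where t: "0 \<le> t" "z = pos v + of_real t * dir v y" using radius[of v y] e xy by blast
  have eq: "of_real s * dir v x = of_real t * dir v y" using s t by simp
  then have "norm (of_real s * dir v x) = norm (of_real t * dir v y)" by simp
  then have "s = t" using dir_norm e xy s t by (simp add: norm_mult)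
  then have "s = 0" using eq dir_inj[of v x y] e xy \<open>x \<noteq> y\<close> by auto
  then show ?thesis using s by simp
qed

lemma germ_in: assumes "{v, w} \<in> E"
  shows "germ v w \<in> A {v, w}" "germ v w \<noteq> pos v" "germ v w \<noteq> pos w" "germ v w \<in> cball (pos v) (rad v)"
proof -
  have v: "v \<in> V" "w \<in> V" "v \<noteq> w" using De[OF assms] by auto
  have "germ v w \<in> A {v, w} \<inter> cball (pos v) (rad v)"
    unfolding radius[OF assms] germ_def using rad_pos[OF v(1)] by (intro CollectI exI[of _ "rad v / 2"]) auto
  then show "germ v w \<in> A {v, w}" "germ v w \<in> cball (pos v) (rad v)" by auto
  then show "germ v w \<noteq> pos w" using rad_less[OF v] by auto
  show "germ v w \<noteq> pos v" unfolding germ_def using rad_pos[OF v(1)] dir_norm[OF assms] by auto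
qed

definition simple_cycle :: "'a list \<Rightarrow> bool" where
  "simple_cycle vs \<longleftrightarrow> 3 \<le> length vs \<and> distinct vs \<and> cycle_edges vs \<subseteq> E \<and>
     (\<forall>e\<in>cycle_edges vs. \<forall>f\<in>cycle_edges vs. \<not> cross e f)"

lemma path_edges_sub: "e \<in> path_edges vs \<Longrightarrow> e \<subseteq> set vs"
  by (induction vs rule: path_edges.induct) auto

lemma path_arc:
  assumes "2 \<le> length vs" "distinct vs" "path_edges vs \<subseteq> E" "\<forall>e\<in>path_edges vs. \<forall>f\<in>path_edges vs. \<not> cross e f"
  shows "arc_image (curve (path_edges vs)) (pos (hd vs)) (pos (last vs))"
  using assms
proof (induction vs rule: path_edges.induct)
  case (1 x y zs)
  have xy: "{x, y} \<in> E" using 1 by auto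
  show ?case
  proof (cases zs)
    case Nil
    then show ?thesis using D(5)[OF xy] by (simp add: curve_def)
  next
    case (Cons z ws)
    then have IH: "arc_image (curve (path_edges (y # zs))) (pos y) (pos (last (y # zs)))" using 1 by auto
    have "A {x, y} \<inter> curve (path_edges (y # zs)) \<subseteq> {pos y}"
    proof
      fix p assume p: "p \<in> A {x, y} \<inter> curve (path_edges (y # zs))"
      then obtain f where f: "f \<in> path_edges (y # zs)" "p \<in> A f" unfolding curve_def by auto
      have xf: "x \<notin> f" using path_edges_sub[OF f(1)] 1 by auto
      then have "{x, y} \<noteq> f" by auto
      moreover have "\<not> cross {x, y} f" "f \<in> E" using 1 f by auto
      ultimately obtain v where "v \<in> {x, y}" "v \<in> f" "p = pos v"
        using meet_vertex[of "{x, y}" f p] xy p f by blast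
      then show "p \<in> {pos y}" using xf by auto
    qed
    from arc_image_join[OF D(5)[OF xy] IH this]
    show ?thesis by (simp add: curve_def)
  qed
qed auto

text \<open>All edges but the closing one form an arc. The closing edge meets it only at the two
  ends, because edges of the cycle do not cross each other.\<close>

lemma cycle_loop:
  assumes "simple_cycle vs"
  obtains g where "simple_path g" "pathfinish g = pathstart g" "path_image g = curve (cycle_edges vs)"
proof -
  have c: "3 \<le> length vs" "distinct vs" "cycle_edges vs \<subseteq> E" "\<forall>e\<in>cycle_edges vs. \<forall>f\<in>cycle_edges vs. \<not> cross e f"
    using assms unfolding simple_cycle_def by auto
  obtain x y z zs where vs: "vs = x # y # z # zs" using c(1) by (auto simp: Suc_le_length_iff numeral_eq_Suc)
  let ?l = "last vs"
  have "?l \<in> set (z # zs)" unfolding vs by (metis last_ConsR last_in_set list.distinct(1))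
  then have l: "?l \<noteq> x" "?l \<noteq> y" using c(2) unfolding vs by auto
  have sub: "path_edges vs \<subseteq> cycle_edges vs" "{?l, x} \<in> cycle_edges vs" unfolding cycle_edges_def vs by auto
  have "arc_image (curve (path_edges vs)) (pos x) (pos ?l)"
  proof -
    have "arc_image (curve (path_edges vs)) (pos (hd vs)) (pos ?l)"
      by (rule path_arc) (use c sub in auto)
    then show ?thesis unfolding vs by simp
  qed
  moreover have "arc_image (A {?l, x}) (pos ?l) (pos x)" using D(5) c(3) sub by blast
  moreover have "curve (path_edges vs) \<inter> A {?l, x} \<subseteq> {pos x, pos ?l}"
  proof
    fix p assume p: "p \<in> curve (path_edges vs) \<inter> A {?l, x}"
    then obtain f where f: "f \<in> path_edges vs" "p \<in> A f" unfolding curve_def by auto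
    have "f \<noteq> {?l, x}"
    proof
      assume eq: "f = {?l, x}"
      have "f = {x, y} \<or> f \<in> path_edges (y # z # zs)" using f(1) unfolding vs by simp
      then show False
      proof
        assume "f = {x, y}" then show False using eq l by (auto simp: doubleton_eq_iff)
      next
        assume "f \<in> path_edges (y # z # zs)"
        then have "x \<in> set (y # z # zs)" using path_edges_sub eq by blast
        then show False using c(2) unfolding vs by auto
      qed
    qed
    moreover have "f \<in> cycle_edges vs" using f(1) sub(1) by blast
    then have "f \<in> E" "{?l, x} \<in> E" "\<not> cross f {?l, x}" using c(3,4) sub(2) by blast+
    moreover have "p \<in> A {?l, x}" using p by blast
    ultimately obtain v where "v \<in> {?l, x}" "p = pos v" using meet_vertex[of f "{?l, x}" p] f(2) by metis
    then show "p \<in> {pos x, pos ?l}" by auto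
  qed
  ultimately obtain g h where g: "arc g" "path_image g = curve (path_edges vs)" "pathstart g = pos x" "pathfinish g = pos ?l"
    and h: "arc h" "path_image h = A {?l, x}" "pathstart h = pos ?l" "pathfinish h = pos x"
    and i: "path_image g \<inter> path_image h \<subseteq> {pathstart g, pathstart h}"
    unfolding arc_image_def by metis
  have "simple_path (g +++ h)" using simple_path_join_loop[of g h] g h i by auto
  moreover have "path_image (g +++ h) = curve (cycle_edges vs)"
  proof -
    have "path_image (g +++ h) = curve (path_edges vs) \<union> A {?l, x}" using g h by (simp add: path_image_join)
    also have "\<dots> = curve (cycle_edges vs)" unfolding curve_def cycle_edges_def vs by auto
    finally show ?thesis .
  qed
  moreover have "pathfinish (g +++ h) = pathstart (g +++ h)" using g h by simp
  ultimately show ?thesis using that by blast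
qed

lemma cycle_Jordan:
  assumes "simple_cycle vs"
  defines "K \<equiv> curve (cycle_edges vs)"
  shows "open (inside K)" "open (outside K)" "inside K \<inter> outside K = {}" "inside K \<union> outside K = - K"
    "frontier (inside K) = K" "frontier (outside K) = K"
proof -
  obtain g where g: "simple_path g" "pathfinish g = pathstart g" "path_image g = K"
    using cycle_loop[OF assms(1)] unfolding K_def .
  from Jordan_inside_outside[OF g(1,2)] g(3)
  show "open (inside K)" "open (outside K)" "inside K \<inter> outside K = {}" "inside K \<union> outside K = - K"
    "frontier (inside K) = K" "frontier (outside K) = K" by auto
qed

lemma same_side:
  assumes "simple_cycle vs" "connected S" "S \<inter> curve (cycle_edges vs) = {}" "x \<in> S" "y \<in> S"
  shows "x \<in> inside (curve (cycle_edges vs)) \<longleftrightarrow> y \<in> inside (curve (cycle_edges vs))"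
proof -
  note J = cycle_Jordan[OF assms(1)]
  have "S \<subseteq> inside (curve (cycle_edges vs)) \<union> outside (curve (cycle_edges vs))" using J(4) assms(3) by blast
  then have "inside (curve (cycle_edges vs)) \<inter> S = {} \<or> outside (curve (cycle_edges vs)) \<inter> S = {}"
    using connectedD[OF assms(2) J(1,2)] J(3) by blast
  then show ?thesis using assms(4,5) J(3,4) assms(3) by blast
qed

text \<open>By the Jordan curve theorem every point of the curve is in the frontier of both sides,
  so both sides are met near \<open>z\<close>. Two connected sets that cover a neighbourhood of
  \<open>z\<close> off the curve must then lie on different sides.\<close>

lemma opposite_sides:
  assumes c: "simple_cycle vs" and z: "z \<in> curve (cycle_edges vs)" and e: "0 < \<epsilon>"
    and S: "connected S" "S \<inter> curve (cycle_edges vs) = {}" and T: "connected T" "T \<inter> curve (cycle_edges vs) = {}"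
    and cover: "ball z \<epsilon> - curve (cycle_edges vs) \<subseteq> S \<union> T" and x: "x \<in> S" and y: "y \<in> T"
  shows "x \<in> inside (curve (cycle_edges vs)) \<longleftrightarrow> y \<notin> inside (curve (cycle_edges vs))"
proof -
  let ?K = "curve (cycle_edges vs)"
  note J = cycle_Jordan[OF c]
  have "z \<in> closure (inside ?K)" "z \<in> closure (outside ?K)" using z J(5,6) unfolding frontier_def by blast+
  then obtain p q where p: "p \<in> inside ?K" "p \<in> ball z \<epsilon>" and q: "q \<in> outside ?K" "q \<in> ball z \<epsilon>"
    using e by (metis closure_approachable dist_commute mem_ball)
  have "p \<in> S \<union> T" "q \<in> S \<union> T" "q \<notin> inside ?K" using p q cover J(3,4) by blast+
  then show ?thesis
    using same_side[OF c S, of x] same_side[OF c T, of y] x y p(1) by blast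
qed

lemma cycle_vertex: "simple_cycle vs \<Longrightarrow> e \<in> cycle_edges vs \<Longrightarrow> e \<subseteq> set vs"
proof -
  assume c: "simple_cycle vs" "e \<in> cycle_edges vs"
  then have "vs \<noteq> []" unfolding simple_cycle_def by auto
  then have "{last vs, hd vs} \<subseteq> set vs" by simp
  then show ?thesis using c(2) path_edges_sub[of e vs] unfolding cycle_edges_def by (metis insertE)
qed

lemma gs_vin:
  assumes c: "simple_cycle vs" and v: "v \<notin> set vs" "{v, w} \<in> E"
  shows "gs (cycle_edges vs) v w = vin (cycle_edges vs) v"
proof -
  have vV: "v \<in> V" using De(1)[OF v(2)] .
  have "cball (pos v) (rad v) \<inter> curve (cycle_edges vs) = {}"
    using ball_empty[OF vV] cycle_vertex[OF c] v(1) c unfolding curve_def simple_cycle_def by blast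
  moreover have "pos v \<in> cball (pos v) (rad v)" using rad_pos[OF vV] by simp
  ultimately show ?thesis unfolding gs_def vin_def
    using same_side[OF c _ _ germ_in(4)[OF v(2)]] convex_cball convex_connected by blast
qed

lemma gs_nocross:
  assumes c: "simple_cycle vs" and e: "{v, w} \<in> E" "{v, w} \<notin> cycle_edges vs" "\<forall>f\<in>cycle_edges vs. \<not> cross {v, w} f"
  shows "gs (cycle_edges vs) v w = gs (cycle_edges vs) w v"
proof -
  let ?S = "A {v, w} - {pos v, pos w}"
  have "connected ?S" by (rule arc_image_open_connected[OF D(5)[OF e(1)]])
  moreover have "?S \<inter> curve (cycle_edges vs) = {}"
  proof -
    have False if z: "z \<in> ?S" "f \<in> cycle_edges vs" "z \<in> A f" for z f
    proof -
      have "f \<in> E" "f \<noteq> {v, w}" using z(2) e(2) c unfolding simple_cycle_def by auto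
      then obtain x where "x \<in> {v, w}" "z = pos x" using meet_vertex[of "{v, w}" f z] e z by blast
      then show False using z by auto
    qed
    then show ?thesis unfolding curve_def by blast
  qed
  moreover have "germ v w \<in> ?S" using germ_in[OF e(1)] by blast
  moreover have "germ w v \<in> ?S" using germ_in[of w v] e(1) by (simp add: insert_commute)
  ultimately show ?thesis unfolding gs_def using same_side[OF c] by blast
qed

text \<open>Within the disk at \<open>v\<close> the curve consists of the radii towards
  \<open>p\<close> and \<open>q\<close>. They bound two open sectors, connected as images of
  rectangles in polar coordinates, and \<open>opposite_sides\<close> puts these on different sides.
  It remains to see which germ lies in which sector.\<close>

lemma sector_sides:
  assumes c: "simple_cycle (v # p # vs)" and q: "q = last (p # vs)"
    and x: "{v, x} \<in> E" "{v, y} \<in> E" "x \<noteq> p" "y \<noteq> p" "x \<noteq> q" "y \<noteq> q"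
  shows "(gs (cycle_edges (v # p # vs)) v x = gs (cycle_edges (v # p # vs)) v y)
     \<longleftrightarrow> \<not> sepr (ang v p) (ang v q) (ang v x) (ang v y)"
proof -
  let ?C = "cycle_edges (v # p # vs)" let ?K = "curve ?C"
  have cc: "distinct (v # p # vs)" "?C \<subseteq> E" "vs \<noteq> []" using c unfolding simple_cycle_def by (auto simp: Suc_le_length_iff)
  have vp: "{v, p} \<in> ?C" "{v, q} \<in> ?C" unfolding cycle_edges_def q by (auto simp: insert_commute)
  have vpE: "{v, p} \<in> E" "{v, q} \<in> E" using vp cc by auto
  have "q \<in> set vs" unfolding q using cc(3) by simp
  then have pq: "p \<noteq> q" using cc(1) by auto
  have vV: "v \<in> V" using De(1)[OF x(1)] .
  have only: "e = {v, p} \<or> e = {v, q}" if "e \<in> ?C" "v \<in> e" for e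
  proof -
    have "e = {last (v # p # vs), v} \<or> e = {v, p} \<or> e \<in> path_edges (p # vs)" using that unfolding cycle_edges_def by simp
    moreover have "e \<notin> path_edges (p # vs)" using path_edges_sub[of e "p # vs"] that cc by auto
    ultimately show ?thesis unfolding q by (auto simp: insert_commute)
  qed
  define lo hi where "lo = min (ang v p) (ang v q)" and "hi = max (ang v p) (ang v q)"
  have angs: "ang v p \<noteq> ang v q" using ang_inj[OF vpE] pq by blast
  have lohi: "0 \<le> lo" "lo < hi" "hi < 2 * pi" "{lo, hi} = {ang v p, ang v q}"
    using ang_range[of v p] ang_range[of v q] angs unfolding lo_def hi_def by (auto simp: min_def max_def)
  define P where "P = (\<lambda>(t, \<phi>). pos v + of_real t * cis \<phi>)"
  define S where "S = P ` ({0<..<rad v} \<times> {lo<..<hi})"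
  \<comment> \<open>This sector may contain the direction zero; angles up to
    \<open>lo + 2 * pi\<close> describe it by one interval.\<close>
  define T where "T = P ` ({0<..<rad v} \<times> {hi<..<lo + 2 * pi})"
  have contP: "continuous_on X P" for X unfolding P_def cis_conv_exp case_prod_unfold by (intro continuous_intros)
  have conn: "connected S" "connected T" unfolding S_def T_def
    by (rule connected_continuous_image[OF contP]; intro connected_Times; simp)+
  have offK: "P (t, \<phi>) \<notin> ?K" if t: "0 < t" "t < rad v" and ph: "\<phi> \<noteq> ang v p" "\<phi> \<noteq> ang v q" "\<bar>\<phi> - ang v p\<bar> < 2 * pi" "\<bar>\<phi> - ang v q\<bar> < 2 * pi" for t \<phi>
  proof
    assume "P (t, \<phi>) \<in> ?K"
    then obtain e where e: "e \<in> ?C" "P (t, \<phi>) \<in> A e" unfolding curve_def by auto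
    have b: "P (t, \<phi>) \<in> cball (pos v) (rad v)" unfolding P_def using t by (simp add: dist_norm norm_mult)
    then have "v \<in> e" using ball_empty[OF vV, of e] e cc by blast
    then obtain w where w: "w \<in> {p, q}" "e = {v, w}" using only[OF e(1)] by blast
    then have wE: "{v, w} \<in> E" using vpE by auto
    obtain s where s: "0 \<le> s" "P (t, \<phi>) = pos v + of_real s * dir v w" using radius[OF wE] e b w by blast
    then have eq: "of_real t * cis \<phi> = of_real s * cis (ang v w)" unfolding P_def using dir_cis[OF wE] by simp
    then have "norm (of_real t * cis \<phi>) = norm (of_real s * cis (ang v w))" by simp
    then have "s = t" using s t by (simp add: norm_mult)
    then have "cis \<phi> = cis (ang v w)" using eq t by simp
    then show False using cis_eq_close[of \<phi> "ang v w"] ph w by auto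
  qed
  have S0: "S \<inter> ?K = {}"
  proof -
    have "P (t, \<phi>) \<notin> ?K" if "t \<in> {0<..<rad v}" "\<phi> \<in> {lo<..<hi}" for t \<phi>
      using offK[of t \<phi>] that lohi ang_range[of v p] ang_range[of v q] unfolding lo_def hi_def by (auto simp: min_def max_def split: if_splits)
    then show ?thesis unfolding S_def by blast
  qed
  have T0: "T \<inter> ?K = {}"
  proof -
    have "P (t, \<phi>) \<notin> ?K" if "t \<in> {0<..<rad v}" "\<phi> \<in> {hi<..<lo + 2 * pi}" for t \<phi>
      using offK[of t \<phi>] that lohi ang_range[of v p] ang_range[of v q] unfolding lo_def hi_def by (auto simp: min_def max_def split: if_splits)
    then show ?thesis unfolding T_def by blast
  qed
  have radK: "pos v + of_real t * cis \<theta> \<in> ?K" if "\<theta> \<in> {ang v p, ang v q}" "0 \<le> t" "t \<le> rad v" for t \<theta>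
  proof -
    obtain w where w: "w \<in> {p, q}" "\<theta> = ang v w" using \<open>\<theta> \<in> {ang v p, ang v q}\<close> by auto
    then have wE: "{v, w} \<in> E" "{v, w} \<in> ?C" using vpE vp by auto
    have "pos v + of_real t * cis \<theta> \<in> A {v, w} \<inter> cball (pos v) (rad v)"
      unfolding radius[OF wE(1)] dir_cis[OF wE(1)] w(2) using \<open>0 \<le> t\<close> \<open>t \<le> rad v\<close> by blast
    then show ?thesis unfolding curve_def using wE(2) by blast
  qed
  have cover: "ball (pos v) (rad v) - ?K \<subseteq> S \<union> T"
  proof
    fix z assume z: "z \<in> ball (pos v) (rad v) - ?K"
    define t \<phi> where "t = norm (z - pos v)" and "\<phi> = Arg2pi (z - pos v)"
    have zP: "z = P (t, \<phi>)" unfolding P_def t_def \<phi>_def using Arg2pi_eq[of "z - pos v"] by (simp add: cis_conv_exp mult.commute)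
    have t: "0 \<le> t" "t < rad v" using z unfolding t_def by (auto simp: dist_norm norm_minus_commute)
    have ph: "0 \<le> \<phi>" "\<phi> < 2 * pi" unfolding \<phi>_def using Arg2pi_ge_0 Arg2pi_lt_2pi by auto
    have "t \<noteq> 0"
    proof
      assume "t = 0"
      then have "z = pos v + of_real 0 * cis (ang v p)" using zP unfolding P_def by simp
      moreover have "pos v + of_real 0 * cis (ang v p) \<in> ?K" using radK[of "ang v p" 0] t by simp
      ultimately show False using z by blast
    qed
    then have t0: "0 < t" using t by simp
    have "\<phi> \<noteq> lo" "\<phi> \<noteq> hi" using radK[of \<phi> t] z zP t lohi(4) unfolding P_def by auto
    then consider "lo < \<phi> \<and> \<phi> < hi" | "hi < \<phi>" | "\<phi> < lo" by linarith
    then show "z \<in> S \<union> T"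
    proof cases
      case 1 then show ?thesis unfolding S_def zP using t0 t by auto
    next
      case 2 then show ?thesis unfolding T_def zP using t0 t ph lohi by auto
    next
      case 3
      have "z = P (t, \<phi> + 2 * pi)" using zP unfolding P_def by (simp add: cis_mult[symmetric])
      then show ?thesis unfolding T_def using 3 t0 t ph lohi by auto
    qed
  qed
  have zK: "pos v \<in> ?K" using radK[of "ang v p" 0] rad_pos[OF vV] by simp
  let ?in = "\<lambda>w. lo < ang v w \<and> ang v w < hi"
  have mem: "if ?in w then germ v w \<in> S else germ v w \<in> T" if w: "{v, w} \<in> E" "w \<noteq> p" "w \<noteq> q" for w
  proof -
    have g: "germ v w = P (rad v / 2, ang v w)" "germ v w = P (rad v / 2, ang v w + 2 * pi)"
      unfolding germ_def P_def using dir_cis[OF w(1)] by (auto simp: cis_mult[symmetric])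
    have "ang v w \<noteq> ang v p" "ang v w \<noteq> ang v q" using ang_inj w vpE by blast+
    then have "ang v w \<noteq> lo" "ang v w \<noteq> hi" using lohi(4) by auto
    then consider "?in w" | "hi < ang v w" | "ang v w < lo" by linarith
    then show ?thesis
    proof cases
      case 1 then show ?thesis unfolding S_def g(1) using rad_pos[OF vV] by auto
    next
      case 2 then show ?thesis unfolding T_def g(1) using rad_pos[OF vV] ang_range[of v w] lohi by auto
    next
      case 3 then show ?thesis unfolding T_def g(2) using rad_pos[OF vV] ang_range[of v w] lohi by auto
    qed
  qed
  have sepin: "sepr (ang v p) (ang v q) (ang v x) (ang v y) \<longleftrightarrow> ?in x \<noteq> ?in y"
    using ang_inj[of v x p] ang_inj[of v x q] ang_inj[of v y p] ang_inj[of v y q] x vpE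
    unfolding sepr_def lo_def hi_def by (auto simp: min_def max_def)
  have opp: "a \<in> inside ?K \<longleftrightarrow> b \<notin> inside ?K" if "a \<in> S" "b \<in> T" for a b
    by (rule opposite_sides[OF c zK rad_pos[OF vV] conn(1) S0 conn(2) T0 cover that])
  have sS: "a \<in> inside ?K \<longleftrightarrow> b \<in> inside ?K" if "a \<in> S" "b \<in> S" for a b by (rule same_side[OF c conn(1) S0 that])
  have sT: "a \<in> inside ?K \<longleftrightarrow> b \<in> inside ?K" if "a \<in> T" "b \<in> T" for a b by (rule same_side[OF c conn(2) T0 that])
  have gx: "(if ?in x then germ v x \<in> S else germ v x \<in> T)" "(if ?in y then germ v y \<in> S else germ v y \<in> T)"
    using mem[OF x(1,3,5)] mem[OF x(2,4,6)] by blast+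
  show ?thesis
  proof (cases "?in x"; cases "?in y")
    assume "?in x" "?in y"
    then show ?thesis using gx sS[of "germ v x" "germ v y"] unfolding sepin gs_def by metis
  next
    assume "?in x" "\<not> ?in y"
    then show ?thesis using gx opp[of "germ v x" "germ v y"] unfolding sepin gs_def by metis
  next
    assume "\<not> ?in x" "?in y"
    then show ?thesis using gx opp[of "germ v y" "germ v x"] unfolding sepin gs_def by metis
  next
    assume "\<not> ?in x" "\<not> ?in y"
    then show ?thesis using gx sT[of "germ v x" "germ v y"] unfolding sepin gs_def by metis
  qed
qed

text \<open>Near the crossing the curve is a line, and the two half disks that it bounds lie on
  different sides of the curve. The edge changes from one half disk to the other at
  \<open>z\<close>, and each of its two parts stays off the curve elsewhere, apart from the ends of
  the edge.\<close>

lemma gs_onecross: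
  assumes c: "simple_cycle vs" and e: "{v, w} \<in> E" "{v, w} \<notin> cycle_edges vs"
    and f: "f \<in> cycle_edges vs" "cross {v, w} f" "cr f \<le> 1" "\<forall>g\<in>cycle_edges vs. g \<noteq> f \<longrightarrow> \<not> cross {v, w} g"
  shows "gs (cycle_edges vs) v w \<noteq> gs (cycle_edges vs) w v"
proof -
  let ?C = "cycle_edges vs" let ?K = "curve ?C"
  have CE: "?C \<subseteq> E" using c unfolding simple_cycle_def by auto
  obtain z where z: "z \<in> crossings V E pos A" "z \<in> A {v, w}" "z \<in> A f" using f(2) unfolding cross_def by blast
  have fE: "f \<in> E" "f \<noteq> {v, w}" using f CE e by auto
  have zV: "z \<notin> pos ` V" using crossingE[OF z(1)] .
  have vV: "v \<in> V" "w \<in> V" using De[OF e(1)] by auto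
  have zvw: "z \<noteq> pos v" "z \<noteq> pos w" using zV vV by auto
  have uniq: "x = z" if "x \<in> crossings V E pos A" "x \<in> A f" for x
  proof -
    have "finite (crossings V E pos A \<inter> A f)" using D(7) by simp
    then have "\<forall>a\<in>crossings V E pos A \<inter> A f. \<forall>b\<in>crossings V E pos A \<inter> A f. a = b"
      using f(3) card_le_Suc0_iff_eq unfolding cr_def by fastforce
    then show ?thesis using that z by blast
  qed
  have offK: "x \<notin> ?K" if x: "x \<in> A {v, w}" "x \<noteq> pos v" "x \<noteq> pos w" "x \<noteq> z" for x
  proof
    assume "x \<in> ?K"
    then obtain g where g: "g \<in> ?C" "x \<in> A g" unfolding curve_def by auto
    have gE: "g \<in> E" "g \<noteq> {v, w}" using g CE e by auto
    show False
    proof (cases "g = f")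
      case True
      have "x \<notin> pos ` V"
      proof
        assume "x \<in> pos ` V"
        then obtain y where "y \<in> V" "x = pos y" by blast
        then show False using D(6)[OF e(1), of y] x by auto
      qed
      then have "x \<in> crossings V E pos A" using crossing_iff[OF e(1) gE(1)] gE x g by blast
      then show False using uniq True g x by blast
    next
      case False
      then obtain y where "y \<in> {v, w}" "x = pos y" using meet_vertex[OF e(1) gE(1)] gE f(4) g x by metis
      then show False using x by auto
    qed
  qed
  obtain \<epsilon> where te: "tame_at V E pos A z \<epsilon>" using tame[OF z(1)] by blast
  obtain e0 f0 d1 d2 where t: "0 < \<epsilon>" "pos ` V \<inter> ball z \<epsilon> = {}" "e0 \<in> E" "f0 \<in> E" "e0 \<noteq> f0" "Im (d1 * cnj d2) \<noteq> 0"
     "A e0 \<inter> ball z \<epsilon> = range (\<lambda>t. z + of_real t * d1) \<inter> ball z \<epsilon>"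
     "A f0 \<inter> ball z \<epsilon> = range (\<lambda>t. z + of_real t * d2) \<inter> ball z \<epsilon>" "\<forall>g\<in>E - {e0, f0}. A g \<inter> ball z \<epsilon> = {}"
    by (rule tame_atE[OF te])
  have zb: "z \<in> ball z \<epsilon>" using t(1) by simp
  have "{v, w} \<in> {e0, f0}" "f \<in> {e0, f0}" using t(9) e(1) fE(1) z zb by blast+
  then have "(e0 = {v, w} \<and> f0 = f) \<or> (e0 = f \<and> f0 = {v, w})" using fE(2) t(5) by auto
  moreover have "Im (d2 * cnj d1) \<noteq> 0" using t(6) by (simp add: algebra_simps)
  ultimately have "\<exists>dE dF. Im (dE * cnj dF) \<noteq> 0 \<and> A {v, w} \<inter> ball z \<epsilon> = range (\<lambda>t. z + of_real t * dE) \<inter> ball z \<epsilon> \<and>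
      A f \<inter> ball z \<epsilon> = range (\<lambda>t. z + of_real t * dF) \<inter> ball z \<epsilon>"
    using t(6-8) by blast
  then obtain dE dF where dd: "Im (dE * cnj dF) \<noteq> 0" and
      lE: "A {v, w} \<inter> ball z \<epsilon> = range (\<lambda>t. z + of_real t * dE) \<inter> ball z \<epsilon>" and
      lF: "A f \<inter> ball z \<epsilon> = range (\<lambda>t. z + of_real t * dF) \<inter> ball z \<epsilon>" by blast
  have oth: "A g \<inter> ball z \<epsilon> = {}" if "g \<in> E" "g \<noteq> {v, w}" "g \<noteq> f" for g
    using t(9) that \<open>{v, w} \<in> {e0, f0}\<close> \<open>f \<in> {e0, f0}\<close> fE(2) by blast
  have Kb: "?K \<inter> ball z \<epsilon> = A f \<inter> ball z \<epsilon>"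
  proof
    show "?K \<inter> ball z \<epsilon> \<subseteq> A f \<inter> ball z \<epsilon>"
    proof
      fix x assume x: "x \<in> ?K \<inter> ball z \<epsilon>"
      then obtain g where g: "g \<in> ?C" "x \<in> A g" unfolding curve_def by auto
      have "g = f" using oth[of g] g x CE e(2) by blast
      then show "x \<in> A f \<inter> ball z \<epsilon>" using g x by blast
    qed
    show "A f \<inter> ball z \<epsilon> \<subseteq> ?K \<inter> ball z \<epsilon>" unfolding curve_def using f(1) by blast
  qed
  \<comment> \<open>The normal of the direction \<open>dF\<close>, so \<open>inner a\<close> tells
    the two half disks apart.\<close>
  define a where "a = Complex (- Im dF) (Re dF)"
  have ina: "inner a x = Im (x * cnj dF)" for x unfolding a_def inner_complex_def by (simp add: algebra_simps)
  have dF0: "dF \<noteq> 0" using dd by auto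
  define Hp where "Hp = ball z \<epsilon> \<inter> {x. inner a x > inner a z}"
  define Hm where "Hm = ball z \<epsilon> \<inter> {x. inner a x < inner a z}"
  have conn: "connected Hp" "connected Hm" unfolding Hp_def Hm_def
    by (intro convex_connected convex_Int convex_ball convex_halfspace_gt convex_halfspace_lt)+
  have line0: "inner a x = inner a z" if "x \<in> A f \<inter> ball z \<epsilon>" for x
  proof -
    obtain s where "x = z + of_real s * dF" using \<open>x \<in> A f \<inter> ball z \<epsilon>\<close> lF by blast
    then have "inner a x = inner a z + s * inner a dF" by (simp add: inner_add_right scaleR_conv_of_real[symmetric])
    moreover have "inner a dF = 0" unfolding ina by (simp add: algebra_simps)
    ultimately show ?thesis by simp
  qed
  have H0: "Hp \<inter> ?K = {}" "Hm \<inter> ?K = {}" using Kb line0 unfolding Hp_def Hm_def by fastforce+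
  have cover: "ball z \<epsilon> - ?K \<subseteq> Hp \<union> Hm"
  proof
    fix x assume x: "x \<in> ball z \<epsilon> - ?K"
    have "inner a x \<noteq> inner a z"
    proof
      assume eq: "inner a x = inner a z"
      have "Im ((x - z) * cnj dF) = 0" using eq unfolding ina by (simp add: algebra_simps)
      then have "(x - z) * cnj dF \<in> \<real>" by (simp add: complex_is_Real_iff)
      then obtain k where k: "(x - z) * cnj dF = of_real k" by (auto elim: Reals_cases)
      have "(x - z) * (cnj dF * dF) = of_real k * dF" using k by (simp add: mult.assoc[symmetric])
      moreover have "cnj dF * dF = of_real ((norm dF)\<^sup>2)" using complex_norm_square[of dF] by (simp add: mult.commute)
      ultimately have "(x - z) * of_real ((norm dF)\<^sup>2) = of_real k * dF" by metis
      moreover have "x - z = (x - z) * of_real ((norm dF)\<^sup>2) / of_real ((norm dF)\<^sup>2)" using dF0 by simp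
      ultimately have "x - z = of_real (k / (norm dF)\<^sup>2) * dF" by simp
      then have "x = z + of_real (k / (norm dF)\<^sup>2) * dF" by (simp add: algebra_simps)
      then have "x \<in> A f \<inter> ball z \<epsilon>" using lF x by blast
      then show False using Kb x by blast
    qed
    then show "x \<in> Hp \<union> Hm" using x unfolding Hp_def Hm_def by auto
  qed
  have zK: "z \<in> ?K" using z(3) f(1) unfolding curve_def by blast
  have opp: "x \<in> inside ?K \<longleftrightarrow> y \<notin> inside ?K" if "x \<in> Hp" "y \<in> Hm" for x y
    by (rule opposite_sides[OF c zK t(1) conn(1) H0(1) conn(2) H0(2) cover that])
  obtain S1 S2 where S: "arc_image S1 (pos v) z" "arc_image S2 z (pos w)" "S1 \<union> S2 = A {v, w}" "S1 \<inter> S2 = {z}"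
    using arc_image_split[OF D(5)[OF e(1)] z(2) zvw] by blast
  \<comment> \<open>The straight piece at \<open>v\<close> is connected and avoids \<open>z\<close>,
    so it lies in the part of the edge that ends at \<open>v\<close>. The statement is general in
    order to serve both ends.\<close>
  have germS: "germ v w \<in> T1 - {pos v, z}"
    if T: "arc_image T1 (pos v) z" "arc_image T2 z (pos w)" "T1 \<union> T2 = A {v, w}" "T1 \<inter> T2 = {z}" "{v, w} \<in> E" "z \<in> A {v, w}" "z \<noteq> pos v" for T1 T2 v w
  proof -
    have v: "v \<in> V" using De(1)[OF T(5)] .
    let ?R = "A {v, w} \<inter> cball (pos v) (rad v)"
    have R: "?R = (\<lambda>t. pos v + of_real t * dir v w) ` {0..rad v}" unfolding radius[OF T(5)] by auto
    have "connected ?R" unfolding R by (intro connected_continuous_image continuous_intros) simp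
    moreover have "z \<notin> cball (pos v) (rad v)"
    proof -
      obtain g where "g \<in> E" "g \<noteq> {v, w}" "z \<in> A g" using z(1) unfolding crossings_def by blast
      then show ?thesis using ball_no_crossing[OF v T(5), of g z] T(6,7) by blast
    qed
    then have "?R \<subseteq> T1 \<union> T2 - {z}" using T(3) by blast
    ultimately have "?R \<subseteq> T1 \<or> ?R \<subseteq> T2" using arc_image_connected_subset[OF T(1,2,4)] by blast
    moreover have "pos v \<in> ?R" using De(5)[OF T(5)] rad_pos[OF v] by simp
    moreover have "pos v \<notin> T2" using arc_image_ends(1)[OF T(1)] T(4,7) by (metis Int_iff singletonD)
    ultimately have "?R \<subseteq> T1" by blast
    then show ?thesis using germ_in[OF T(5)] \<open>z \<notin> cball (pos v) (rad v)\<close> by blast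
  qed
  have g1: "germ v w \<in> S1 - {pos v, z}" using germS[OF S e(1) z(2) zvw(1)] .
  have g2: "germ w v \<in> S2 - {pos w, z}"
    using germS[OF arc_image_sym[OF S(2)] arc_image_sym[OF S(1)], unfolded insert_commute[of w v]] S(3,4) e(1) z(2) zvw(2) by (simp add: Un_commute Int_commute)
  have pv: "pos v \<notin> S2" "pos w \<notin> S1" using arc_image_ends(1)[OF S(1)] arc_image_ends(2)[OF S(2)] S(4) zvw by (metis Int_iff singletonD)+
  have P1: "connected (S1 - {pos v, z})" "(S1 - {pos v, z}) \<inter> ?K = {}"
    using arc_image_open_connected[OF S(1)] offK S(3) pv(2) by blast+
  have P2: "connected (S2 - {pos w, z})" "(S2 - {pos w, z}) \<inter> ?K = {}"
    using arc_image_open_connected[OF arc_image_sym[OF S(2)]] offK S(3) pv(1) by blast+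
  have pb: "pos v \<notin> ball z \<epsilon>" "pos w \<notin> ball z \<epsilon>" using t(2) vV by blast+
  have near: "\<exists>x. x \<in> T \<and> x \<noteq> z \<and> x \<in> ball z \<epsilon>" if "connected T" "z \<in> T" "y \<in> T" "y \<noteq> z" for T y
  proof -
    have "z islimpt T" by (rule connected_imp_perfect[OF that(1,2)]) (use that in auto)
    then show ?thesis using t(1) unfolding islimpt_approachable by (metis dist_commute mem_ball)
  qed
  have "\<exists>x. x \<in> S1 \<and> x \<noteq> z \<and> x \<in> ball z \<epsilon>" "\<exists>x. x \<in> S2 \<and> x \<noteq> z \<and> x \<in> ball z \<epsilon>"
    using near[OF arc_image_ends(5,2,1)[OF S(1)]] near[OF arc_image_ends(5,1,2)[OF S(2)]] zvw by auto
  then obtain x1 x2 where x: "x1 \<in> S1" "x1 \<noteq> z" "x1 \<in> ball z \<epsilon>" "x2 \<in> S2" "x2 \<noteq> z" "x2 \<in> ball z \<epsilon>" by blast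
  obtain t1 where t1: "x1 = z + of_real t1 * dE" using lE x S(3) by blast
  obtain t2 where t2: "x2 = z + of_real t2 * dE" using lE x S(3) by blast
  have tn: "t1 \<noteq> 0" "t2 \<noteq> 0" using t1 t2 x by auto
  \<comment> \<open>If both points were on the same ray from \<open>z\<close>, the segment between
    them would be a piece of the edge that avoids \<open>z\<close> but joins its two parts.\<close>
  have opposite: "t1 * t2 < 0"
  proof (rule ccontr)
    assume "\<not> t1 * t2 < 0"
    then have same: "0 < t1 * t2" using tn by (simp add: less_le)
    let ?R = "closed_segment x1 x2"
    have "?R \<subseteq> ball z \<epsilon>" using x(3,6) by (simp add: closed_segment_subset)
    moreover have "y \<in> range (\<lambda>t. z + of_real t * dE) \<and> y \<noteq> z" if "y \<in> ?R" for y
    proof -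
      obtain s where s: "0 \<le> s" "s \<le> 1" "y = (1 - s) *\<^sub>R x1 + s *\<^sub>R x2" using \<open>y \<in> ?R\<close> unfolding closed_segment_def by blast
      have y: "y = z + of_real ((1 - s) * t1 + s * t2) * dE" unfolding s(3) t1 t2 by (simp add: scaleR_conv_of_real algebra_simps)
      have "(1 - s) * t1 + s * t2 \<noteq> 0"
      proof (cases "t1 > 0")
        case True
        then have "t2 > 0" using same by (simp add: zero_less_mult_iff)
        then show ?thesis using True s by (smt (verit) mult_nonneg_nonneg mult_pos_pos)
      next
        case False
        then have "t1 < 0" "t2 < 0" using same tn by (auto simp: zero_less_mult_iff)
        then show ?thesis using s by (smt (verit) mult_nonneg_nonpos mult_pos_neg)
      qed
      moreover have "dE \<noteq> 0" using dd by auto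
      ultimately have "of_real ((1 - s) * t1 + s * t2) * dE \<noteq> 0" by (metis mult_eq_0_iff of_real_eq_0_iff)
      then have "y \<noteq> z" using y by (metis add_cancel_left_right)
      then show ?thesis using y by blast
    qed
    ultimately have "?R \<subseteq> S1 \<union> S2 - {z}" using lE S(3) by blast
    then have "?R \<subseteq> S1 \<or> ?R \<subseteq> S2" using arc_image_connected_subset[OF S(1,2,4) connected_segment(1)] by blast
    then show False using x S(4) by auto
  qed
  have ix: "inner a (z + of_real s * dE) - inner a z = s * Im (dE * cnj dF)" for s
    unfolding ina by (simp add: algebra_simps)
  have "(x1 \<in> Hp \<and> x2 \<in> Hm) \<or> (x1 \<in> Hm \<and> x2 \<in> Hp)"
  proof -
    have "(t1 * Im (dE * cnj dF) > 0 \<and> t2 * Im (dE * cnj dF) < 0) \<or> (t1 * Im (dE * cnj dF) < 0 \<and> t2 * Im (dE * cnj dF) > 0)"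
      using opposite dd by (auto simp: mult_less_0_iff zero_less_mult_iff)
    then have "(inner a x1 > inner a z \<and> inner a x2 < inner a z) \<or> (inner a x1 < inner a z \<and> inner a x2 > inner a z)"
      using ix[of t1] ix[of t2] unfolding t1[symmetric] t2[symmetric] by auto
    then show ?thesis unfolding Hp_def Hm_def using x by auto
  qed
  then have o: "x1 \<in> inside ?K \<longleftrightarrow> x2 \<notin> inside ?K" using opp by blast
  have "x1 \<in> S1 - {pos v, z}" "x2 \<in> S2 - {pos w, z}" using x pb by auto
  then have "germ v w \<in> inside ?K \<longleftrightarrow> x1 \<in> inside ?K" "germ w v \<in> inside ?K \<longleftrightarrow> x2 \<in> inside ?K"
    using same_side[OF c P1 g1] same_side[OF c P2 g2] by blast+
  then show ?thesis unfolding gs_def using o by blast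
qed

lemma cross_sym: "cross e f \<Longrightarrow> cross f e" unfolding cross_def by blast

lemma cross_cr: "cross e f \<Longrightarrow> 1 \<le> cr e"
  unfolding cross_def cr_def using D(7) by (auto simp: Suc_le_eq card_gt_0_iff)

lemma cross_cr2:
  assumes "cross e f" "cross e g" "f \<noteq> g" shows "2 \<le> cr e"
proof -
  obtain z where z: "z \<in> crossings V E pos A" "z \<in> A e" "z \<in> A f" using assms unfolding cross_def by blast
  obtain y where y: "y \<in> crossings V E pos A" "y \<in> A e" "y \<in> A g" using assms unfolding cross_def by blast
  have "z \<noteq> y"
  proof
    assume "z = y"
    then have "z \<in> A e \<inter> A f \<inter> A g" using z y by auto
    then have "z \<in> pos ` V" using D(8)[of e f g] assms unfolding cross_def by blast
    then show False using crossingE z by blast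
  qed
  then have "card {z, y} = 2" by simp
  moreover have "card {z, y} \<le> cr e" unfolding cr_def using z y D(7) by (intro card_mono) auto
  ultimately show ?thesis by simp
qed

end

section \<open>Triangle-to-star surgery\<close>

definition delta_Y_edges :: "'a set \<Rightarrow> 'a \<Rightarrow> 'a set set \<Rightarrow> 'a set set" where
  "delta_Y_edges T u E = (E - {e. e \<subseteq> T \<and> card e = 2}) \<union> {{u, t} | t. t \<in> T}"

text \<open>The new vertex is put at \<open>z0\<close> on \<open>vp\<close>, whose parts become
  \<open>uv\<close> and \<open>up\<close>; \<open>uq\<close> follows \<open>B\<close>, while
  \<open>vq\<close> and \<open>pq\<close> disappear. A crossing of the new drawing either lies on
  \<open>B\<close>, and then belongs to \<open>Y\<close>, or is an old crossing of two surviving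
  edges, with the two parts counted as \<open>vp\<close>. The hypothesis \<open>one\<close> prevents
  triple points on \<open>B\<close>.\<close>

lemma delta_surgery:
  assumes dr: "arc_drawing V E pos A"
    and tri: "{v, p} \<in> E" "{v, q} \<in> E" "{p, q} \<in> E" and u: "u \<notin> V"
    and z0: "z0 \<notin> pos ` V"
    and S: "arc_image Sv (pos v) z0" "arc_image Sp z0 (pos p)" "Sv \<union> Sp = A {v, p}" "Sv \<inter> Sp = {z0}"
    and B: "arc_image B z0 (pos q)"
    and F: "F = E - {{v, p}, {v, q}, {p, q}}"
    and z0F: "\<And>e. e \<in> F \<Longrightarrow> z0 \<notin> A e"
    and BV: "\<And>x. x \<in> V \<Longrightarrow> pos x \<in> B \<Longrightarrow> x = q"
    and Y: "finite Y" "\<And>y e. y \<in> B \<Longrightarrow> y \<noteq> z0 \<Longrightarrow> y \<notin> pos ` V \<Longrightarrow> e \<in> insert {v, p} F \<Longrightarrow> y \<in> A e \<Longrightarrow> y \<in> Y"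
    and one: "\<And>y e f. y \<in> B \<Longrightarrow> y \<noteq> z0 \<Longrightarrow> y \<notin> pos ` V \<Longrightarrow> e \<in> insert {v, p} F \<Longrightarrow> f \<in> insert {v, p} F \<Longrightarrow>
        y \<in> A e \<Longrightarrow> y \<in> A f \<Longrightarrow> e = f"
  shows "\<exists>pos' A'. arc_drawing (insert u V) (delta_Y_edges {v, p, q} u E) pos' A' \<and>
     crossings (insert u V) (delta_Y_edges {v, p, q} u E) pos' A' \<subseteq>
       Y \<union> {z \<in> crossings V E pos A. z \<noteq> z0 \<and> (\<exists>e\<in>insert {v, p} F. \<exists>f\<in>insert {v, p} F. e \<noteq> f \<and> z \<in> A e \<and> z \<in> A f)}"
proof -
  note D = arc_drawingD[OF dr]
  let ?V = "insert u V" and ?E = "delta_Y_edges {v, p, q} u E"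
  have vV: "v \<in> V" "p \<in> V" "q \<in> V" and ne: "v \<noteq> p" "v \<noteq> q" "p \<noteq> q"
    using arc_drawing_edge[OF dr tri(1)] arc_drawing_edge[OF dr tri(2)] arc_drawing_edge[OF dr tri(3)] by auto
  have un: "u \<noteq> v" "u \<noteq> p" "u \<noteq> q" using u vV by auto
  have two: "{e. e \<subseteq> {v, p, q} \<and> card e = 2} = {{v, p}, {v, q}, {p, q}}"
  proof (intro set_eqI iffI)
    fix e assume "e \<in> {e. e \<subseteq> {v, p, q} \<and> card e = 2}"
    then obtain a b where "e = {a, b}" "a \<noteq> b" "a \<in> {v, p, q}" "b \<in> {v, p, q}" by (auto simp: card_2_iff)
    then show "e \<in> {{v, p}, {v, q}, {p, q}}" by (auto simp: insert_commute)
  qed (use ne in auto)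
  have E': "?E = F \<union> {{u, v}, {u, p}, {u, q}}" unfolding delta_Y_edges_def two F by auto
  have uF: "u \<notin> e" if "e \<in> F" for e using that D(2)[of e] u unfolding F by auto
  have FE: "e \<in> E" if "e \<in> insert {v, p} F" for e using that tri unfolding F by auto
  define pos' where "pos' = pos(u := z0)"
  define A' where "A' = A({u, v} := Sv, {u, p} := Sp, {u, q} := B)"
  have pos'V: "pos' x = pos x" if "x \<in> V" for x using that u unfolding pos'_def by auto
  have pos'u: "pos' u = z0" unfolding pos'_def by simp
  have imV: "pos' ` ?V = insert z0 (pos ` V)" using pos'V pos'u by auto
  have dd: "{u, v} \<noteq> {u, p}" "{u, v} \<noteq> {u, q}" "{u, p} \<noteq> {u, q}" using ne by (auto simp: doubleton_eq_iff)
  have A'n: "A' {u, v} = Sv" "A' {u, p} = Sp" "A' {u, q} = B" unfolding A'_def using dd by auto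
  have A'F: "A' e = A e" if "e \<in> F" for e using uF[OF that] unfolding A'_def by auto
  have Ssub: "Sv \<subseteq> A {v, p}" "Sp \<subseteq> A {v, p}" using S(3) by auto
  \<comment> \<open>Sends an edge of the new drawing to the old edge that carries it; both parts go
    back to \<open>vp\<close>. The edge \<open>uq\<close> has no carrier and is always treated
    apart.\<close>
  define par where "par e = (if u \<in> e then {v, p} else e)" for e :: "'a set"
  have par: "par e \<in> insert {v, p} F \<and> A' e \<subseteq> A (par e)" if "e \<in> ?E" "e \<noteq> {u, q}" for e
    using that uF A'F A'n Ssub unfolding E' par_def by auto
  have parne: "par e \<noteq> par f" if ef: "e \<in> ?E" "f \<in> ?E" "e \<noteq> {u, q}" "f \<noteq> {u, q}" "e \<noteq> f" "z \<in> A' e" "z \<in> A' f" "z \<noteq> z0" for e f z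
  proof
    assume eq: "par e = par f"
    have vpF: "{v, p} \<notin> F" unfolding F by simp
    have "e \<in> F \<or> e \<in> {{u, v}, {u, p}}" "f \<in> F \<or> f \<in> {{u, v}, {u, p}}"
      using ef(1-4) unfolding E' by (metis UnE insertE insertI1 insertI2 singletonD)+
    then consider "e \<in> F" "f \<in> F" | "e \<in> F" "f \<in> {{u, v}, {u, p}}" | "e \<in> {{u, v}, {u, p}}" "f \<in> F"
      | "e \<in> {{u, v}, {u, p}}" "f \<in> {{u, v}, {u, p}}" by fast
    then show False
    proof cases
      case 1 then show False using eq uF ef(5) unfolding par_def by auto
    next
      case 2 then show False using eq uF[of e] vpF unfolding par_def by auto
    next
      case 3 then show False using eq uF[of f] vpF unfolding par_def by auto
    next
      case 4
      then have "z \<in> Sv \<inter> Sp" using ef(5-7) A'n by auto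
      then show False using S(4) ef(8) by auto
    qed
  qed
  let ?X = "{z \<in> crossings V E pos A. z \<noteq> z0 \<and> (\<exists>e\<in>insert {v, p} F. \<exists>f\<in>insert {v, p} F. e \<noteq> f \<and> z \<in> A e \<and> z \<in> A f)}"
  have cross: "crossings ?V ?E pos' A' \<subseteq> Y \<union> ?X"
  proof
    fix z assume "z \<in> crossings ?V ?E pos' A'"
    then obtain e f where ef: "z \<notin> pos' ` ?V" "e \<in> ?E" "f \<in> ?E" "e \<noteq> f" "z \<in> A' e" "z \<in> A' f" unfolding crossings_def by auto
    have z: "z \<noteq> z0" "z \<notin> pos ` V" using ef(1) unfolding imV by auto
    show "z \<in> Y \<union> ?X"
    proof (cases "e = {u, q} \<or> f = {u, q}")
      case True
      then have "\<exists>g\<in>?E. g \<noteq> {u, q} \<and> z \<in> B \<and> z \<in> A' g" using ef A'n(3) by metis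
      then obtain g where g: "g \<in> ?E" "g \<noteq> {u, q}" "z \<in> B" "z \<in> A' g" by blast
      then have "z \<in> Y" using par[OF g(1,2)] Y(2)[OF g(3) z, of "par g"] by blast
      then show ?thesis by simp
    next
      case False
      then have p: "par e \<in> insert {v, p} F" "z \<in> A (par e)" "par f \<in> insert {v, p} F" "z \<in> A (par f)" using par[of e] par[of f] ef by auto
      have ne: "par e \<noteq> par f" using parne[of e f z] ef False z by auto
      have "z \<in> crossings V E pos A" unfolding crossings_def
        using z(2) FE[OF p(1)] FE[OF p(3)] ne p(2,4) by blast
      then have "z \<in> ?X" using z(1) p ne by blast
      then show ?thesis by simp
    qed
  qed
  have arcs: "arc_image (A' {x, y}) (pos' x) (pos' y)" if xy: "{x, y} \<in> ?E" for x y
  proof -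
    have new: "arc_image (A' {u, t}) (pos' u) (pos' t)" if "t \<in> {v, p, q}" for t
      using that A'n S(1,2) B arc_image_sym pos'u pos'V vV by auto
    consider "{x, y} \<in> F" | t where "t \<in> {v, p, q}" "{x, y} = {u, t}" using xy unfolding E' by blast
    then show ?thesis
    proof cases
      case 1
      then have "{x, y} \<in> E" "x \<in> V" "y \<in> V" using FE[of "{x, y}"] arc_drawing_edge[OF dr, of x y] by auto
      then show ?thesis using A'F[OF 1] D(5)[of x y] pos'V by simp
    next
      case 2
      then have "(x = u \<and> y = t) \<or> (x = t \<and> y = u)" by (auto simp: doubleton_eq_iff)
      then show ?thesis using new[OF 2(1)] arc_image_sym by (auto simp: insert_commute)
    qed
  qed
  have vertex: "x \<in> e" if ex: "e \<in> ?E" "x \<in> ?V" "pos' x \<in> A' e" for e x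
  proof (cases "e \<in> F")
    case True
    have "x \<noteq> u" using z0F[OF True] ex(3) A'F[OF True] pos'u by auto
    then have "x \<in> V" using ex(2) by simp
    then show ?thesis using D(6)[of e x] FE[of e] True ex(3) A'F[OF True] pos'V by auto
  next
    case False
    then consider "e = {u, v}" | "e = {u, p}" | "e = {u, q}" using ex(1) unfolding E' by blast
    then show ?thesis
    proof cases
      case 1
      show ?thesis
      proof (cases "x = u")
        case False
        then have x: "x \<in> V" "pos x \<in> Sv" using ex 1 A'n pos'V by auto
        then have "x \<in> {v, p}" using D(6)[OF tri(1)] Ssub by blast
        moreover have "x \<noteq> p" using x(2) arc_image_ends(2)[OF S(2)] S(4) z0 vV by (metis Int_iff image_eqI singletonD)
        ultimately show ?thesis using 1 by auto
      qed (use 1 in auto)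
    next
      case 2
      show ?thesis
      proof (cases "x = u")
        case False
        then have x: "x \<in> V" "pos x \<in> Sp" using ex 2 A'n pos'V by auto
        then have "x \<in> {v, p}" using D(6)[OF tri(1)] Ssub by blast
        moreover have "x \<noteq> v" using x(2) arc_image_ends(1)[OF S(1)] S(4) z0 vV by (metis Int_iff image_eqI singletonD)
        ultimately show ?thesis using 2 by auto
      qed (use 2 in auto)
    next
      case 3
      then show ?thesis using ex BV[of x] A'n pos'V by (cases "x = u") auto
    qed
  qed
  have "arc_drawing ?V ?E pos' A'" unfolding arc_drawing_def
  proof (intro conjI ballI allI impI)
    show "finite ?V" using D(1) by simp
    show "inj_on pos' ?V"
    proof (rule inj_onI)
      fix x y assume xy: "x \<in> ?V" "y \<in> ?V" "pos' x = pos' y"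
      show "x = y"
      proof (cases "x = u \<or> y = u")
        case True then show ?thesis using xy pos'u pos'V z0 by (metis image_eqI insertE)
      next
        case False then show ?thesis using xy pos'V D(4) by (metis inj_onD insertE)
      qed
    qed
    show "finite (crossings ?V ?E pos' A')" by (rule finite_subset[OF cross]) (use Y(1) D(7) in auto)
    fix e assume e: "e \<in> ?E"
    show "e \<subseteq> ?V" "card e = 2" using e D(2)[of e] D(3)[of e] FE[of e] vV un unfolding E' by auto
  next
    fix e f g assume h: "e \<in> ?E" "f \<in> ?E" "g \<in> ?E" "e \<noteq> f" "f \<noteq> g" "e \<noteq> g"
    show "A' e \<inter> A' f \<inter> A' g \<subseteq> pos' ` ?V"
    proof (rule ccontr)
      assume "\<not> ?thesis"
      then obtain z where z: "z \<in> A' e" "z \<in> A' f" "z \<in> A' g" "z \<notin> pos' ` ?V" by blast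
      then have zz: "z \<noteq> z0" "z \<notin> pos ` V" unfolding imV by auto
      have up: "par a \<in> E \<and> z \<in> A (par a)" if "a \<in> ?E" "a \<noteq> {u, q}" "z \<in> A' a" for a
        using par[OF that(1,2)] FE[of "par a"] that(3) by (meson subsetD)
      have two': False if k: "a \<in> ?E" "b \<in> ?E" "a \<noteq> {u, q}" "b \<noteq> {u, q}" "a \<noteq> b" "z \<in> A' a" "z \<in> A' b" "z \<in> B" for a b
        using one[OF k(8) zz, of "par a" "par b"] par[OF k(1,3)] par[OF k(2,4)] parne[OF k(1-7) zz(1)] k by blast
      show False
      proof (cases "{u, q} \<in> {e, f, g}")
        case True
        then consider "e = {u, q}" | "f = {u, q}" | "g = {u, q}" by blast
        then show False
          by cases (use two'[of f g] two'[of e g] two'[of e f] h z A'n(3) in auto)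
      next
        case False
        then have n: "e \<noteq> {u, q}" "f \<noteq> {u, q}" "g \<noteq> {u, q}" by auto
        have "par e \<noteq> par f" "par f \<noteq> par g" "par e \<noteq> par g"
          using parne[of e f z] parne[of f g z] parne[of e g z] h n z zz by auto
        moreover have "par e \<in> E" "par f \<in> E" "par g \<in> E" "z \<in> A (par e) \<inter> A (par f) \<inter> A (par g)"
          using up[OF h(1) n(1) z(1)] up[OF h(2) n(2) z(2)] up[OF h(3) n(3) z(3)] by simp_all
        ultimately have "z \<in> pos ` V" using D(8)[of "par e" "par f" "par g"] by (meson subsetD)
        then show False using zz(2) by simp
      qed
    qed
  qed (use arcs vertex in auto)
  then show ?thesis using cross by (intro exI[of _ pos'] exI[of _ A'] conjI)
qed

text \<open>The new vertex is placed at the crossing \<open>z\<close> itself. The edge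
  \<open>vp\<close> and the part of \<open>vq\<close> beyond \<open>z\<close> form the star, so
  \<open>z\<close> stops being a crossing and no new one arises.\<close>

lemma delta_uncross:
  assumes dr: "arc_drawing V E pos A" and tri: "{v, p} \<in> E" "{v, q} \<in> E" "{p, q} \<in> E" and u: "u \<notin> V"
    and z: "z \<in> crossings V E pos A" "z \<in> A {v, p}" "z \<in> A {v, q}"
  shows "\<exists>pos' A'. arc_drawing (insert u V) (delta_Y_edges {v, p, q} u E) pos' A' \<and>
     card (crossings (insert u V) (delta_Y_edges {v, p, q} u E) pos' A') < card (crossings V E pos A)"
proof -
  note D = arc_drawingD[OF dr]
  have vV: "v \<in> V" "p \<in> V" "q \<in> V" and ne: "v \<noteq> p" "v \<noteq> q" "p \<noteq> q"
    using arc_drawing_edge[OF dr tri(1)] arc_drawing_edge[OF dr tri(2)] arc_drawing_edge[OF dr tri(3)] by auto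
  have zV: "z \<notin> pos ` V" using z unfolding crossings_def by auto
  have zn: "z \<noteq> pos v" "z \<noteq> pos p" "z \<noteq> pos q" using zV vV by auto
  obtain Sv Sp where S: "arc_image Sv (pos v) z" "arc_image Sp z (pos p)" "Sv \<union> Sp = A {v, p}" "Sv \<inter> Sp = {z}"
    using arc_image_split[OF D(5)[OF tri(1)] z(2) zn(1,2)] by blast
  obtain T B where T: "arc_image T (pos v) z" "arc_image B z (pos q)" "T \<union> B = A {v, q}" "T \<inter> B = {z}"
    using arc_image_split[OF D(5)[OF tri(2)] z(3) zn(1,3)] by blast
  define F where "F = E - {{v, p}, {v, q}, {p, q}}"
  let ?X = "crossings V E pos A"
  have Bs: "B \<subseteq> A {v, q}" using T(3) by auto
  have d1: "{v, p} \<noteq> {v, q}" using ne by (auto simp: doubleton_eq_iff)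
  have Fq: "e \<in> E \<and> e \<noteq> {v, q}" if "e \<in> insert {v, p} F" for e using that d1 tri unfolding F_def by auto
  have "\<exists>pos' A'. arc_drawing (insert u V) (delta_Y_edges {v, p, q} u E) pos' A' \<and>
     crossings (insert u V) (delta_Y_edges {v, p, q} u E) pos' A' \<subseteq>
       (?X - {z}) \<union> {x \<in> ?X. x \<noteq> z \<and> (\<exists>e\<in>insert {v, p} F. \<exists>f\<in>insert {v, p} F. e \<noteq> f \<and> x \<in> A e \<and> x \<in> A f)}"
  proof (rule delta_surgery[OF dr tri u zV S T(2) F_def])
    show "z \<notin> A e" if "e \<in> F" for e
    proof
      assume ze: "z \<in> A e"
      have e: "e \<in> E" "{v, q} \<noteq> e" "{v, p} \<noteq> e" using that unfolding F_def by auto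
      have "z \<in> A {v, p} \<inter> A {v, q} \<inter> A e" using ze z by simp
      then show False using D(8)[OF tri(1,2) e(1) d1 e(2,3)] zV by (meson subsetD)
    qed
    show "x = q" if x: "x \<in> V" "pos x \<in> B" for x
    proof -
      have "x \<in> {v, q}" using D(6)[OF tri(2) x(1)] x(2) Bs by blast
      moreover have "x \<noteq> v" using x(2) arc_image_ends(1)[OF T(1)] T(4) zn(1) by (metis Int_iff singletonD)
      ultimately show ?thesis by auto
    qed
    show "finite (?X - {z})" using D(7) by simp
    show "y \<in> ?X - {z}" if "y \<in> B" "y \<noteq> z" "y \<notin> pos ` V" "e \<in> insert {v, p} F" "y \<in> A e" for y e
    proof -
      have e: "e \<in> E" "e \<noteq> {v, q}" "y \<in> A {v, q}" using Fq[OF that(4)] that(1) Bs by auto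
      have "y \<in> ?X" unfolding crossings_def using e tri(2) that(3,5) by (intro CollectI conjI bexI[of _ e] bexI[of _ "{v, q}"])
      then show ?thesis using that(2) by simp
    qed
    show "e = f" if y: "y \<in> B" "y \<noteq> z" "y \<notin> pos ` V" "e \<in> insert {v, p} F" "f \<in> insert {v, p} F" "y \<in> A e" "y \<in> A f" for y e f
    proof (rule ccontr)
      assume ef: "e \<noteq> f"
      have e: "e \<in> E" "e \<noteq> {v, q}" "f \<in> E" "f \<noteq> {v, q}" using Fq[OF y(4)] Fq[OF y(5)] by auto
      have "y \<in> A e \<inter> A f \<inter> A {v, q}" using y(1,6,7) Bs by auto
      then show False using D(8)[OF e(1,3) tri(2) ef e(4,2)] y(3) by (meson subsetD)
    qed
  qed
  then obtain pos' A' where dr': "arc_drawing (insert u V) (delta_Y_edges {v, p, q} u E) pos' A'"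
    and sub0: "crossings (insert u V) (delta_Y_edges {v, p, q} u E) pos' A' \<subseteq>
       (?X - {z}) \<union> {x \<in> ?X. x \<noteq> z \<and> (\<exists>e\<in>insert {v, p} F. \<exists>f\<in>insert {v, p} F. e \<noteq> f \<and> x \<in> A e \<and> x \<in> A f)}"
    by (elim exE conjE) (rule that; assumption)
  have sub: "crossings (insert u V) (delta_Y_edges {v, p, q} u E) pos' A' \<subseteq> ?X - {z}"
    by (rule subset_trans[OF sub0]) blast
  have "card (crossings (insert u V) (delta_Y_edges {v, p, q} u E) pos' A') \<le> card (?X - {z})"
    using sub D(7) by (intro card_mono) auto
  also have "\<dots> < card ?X" using z(1) D(7) by (intro card_Diff1_less)
  finally show ?thesis using dr' by (intro exI[of _ pos'] exI[of _ A'] conjI)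
qed

lemma circle_arc:
  fixes c :: complex
  assumes "0 < \<rho>" "\<alpha> < \<beta>" "\<beta> < \<alpha> + 2 * pi"
  shows "arc_image ((\<lambda>\<phi>. c + of_real \<rho> * cis \<phi>) ` {\<alpha>..\<beta>}) (c + of_real \<rho> * cis \<alpha>) (c + of_real \<rho> * cis \<beta>)"
proof -
  define g where "g t = c + of_real \<rho> * cis (\<alpha> + t * (\<beta> - \<alpha>))" for t
  have "inj_on g {0..1}"
  proof (rule inj_onI)
    fix s t assume st: "s \<in> {0..1}" "t \<in> {0..1}" "g s = g t"
    then have "cis (\<alpha> + s * (\<beta> - \<alpha>)) = cis (\<alpha> + t * (\<beta> - \<alpha>))" using assms unfolding g_def by simp
    moreover have "\<bar>(\<alpha> + s * (\<beta> - \<alpha>)) - (\<alpha> + t * (\<beta> - \<alpha>))\<bar> < 2 * pi"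
    proof -
      have "(\<alpha> + s * (\<beta> - \<alpha>)) - (\<alpha> + t * (\<beta> - \<alpha>)) = (s - t) * (\<beta> - \<alpha>)" by (simp add: algebra_simps)
      moreover have "\<bar>(s - t) * (\<beta> - \<alpha>)\<bar> \<le> 1 * \<bar>\<beta> - \<alpha>\<bar>" unfolding abs_mult using st by (intro mult_right_mono) auto
      ultimately show ?thesis using assms by simp
    qed
    ultimately have "\<alpha> + s * (\<beta> - \<alpha>) = \<alpha> + t * (\<beta> - \<alpha>)" by (rule cis_eq_close)
    then show "s = t" using assms by simp
  qed
  moreover have "continuous_on {0..1} g" unfolding g_def cis_conv_exp by (intro continuous_intros)
  ultimately have "arc g" unfolding arc_def path_def by simp
  moreover have "path_image g = (\<lambda>\<phi>. c + of_real \<rho> * cis \<phi>) ` {\<alpha>..\<beta>}"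
  proof -
    have "(\<lambda>t. \<alpha> + t * (\<beta> - \<alpha>)) ` {0..1} = {\<alpha>..\<beta>}"
    proof (intro set_eqI iffI)
      fix x assume x: "x \<in> {\<alpha>..\<beta>}"
      show "x \<in> (\<lambda>t. \<alpha> + t * (\<beta> - \<alpha>)) ` {0..1}"
        by (rule image_eqI[of _ _ "(x - \<alpha>) / (\<beta> - \<alpha>)"]) (use x assms in \<open>auto simp: field_simps\<close>)
    next
      fix x assume "x \<in> (\<lambda>t. \<alpha> + t * (\<beta> - \<alpha>)) ` {0..1}"
      then obtain t where t: "0 \<le> t" "t \<le> 1" "x = \<alpha> + t * (\<beta> - \<alpha>)" by auto
      have le: "t * (\<beta> - \<alpha>) \<le> 1 * (\<beta> - \<alpha>)" using t assms by (intro mult_right_mono) auto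
      have ge: "0 \<le> t * (\<beta> - \<alpha>)" using t assms by simp
      have "\<alpha> \<le> x" using ge t(3) by linarith
      moreover have "x \<le> \<beta>" using le t(3) by (simp add: algebra_simps)
      ultimately show "x \<in> {\<alpha>..\<beta>}" by simp
    qed
    then show ?thesis unfolding path_image_def g_def by (metis (no_types, lifting) image_cong image_image)
  qed
  moreover have "pathstart g = c + of_real \<rho> * cis \<alpha>" "pathfinish g = c + of_real \<rho> * cis \<beta>"
    unfolding pathstart_def pathfinish_def g_def by auto
  ultimately show ?thesis unfolding arc_image_def by blast
qed

context straight_drawing
begin

text \<open>The circle has half the radius of the star at \<open>v\<close>, so each edge at
  \<open>v\<close> meets it exactly in its germ. The edge \<open>vw\<close> selects the sector that
  the route avoids. The crossings gained are germs of edges in \<open>N\<close>, and all crossings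
  on \<open>pq\<close> are lost.\<close>

lemma delta_corner:
  assumes tri: "{v, p} \<in> E" "{v, q} \<in> E" "{p, q} \<in> E" and u: "u \<notin> V"
    and w: "{v, w} \<in> E" "w \<noteq> p" "w \<noteq> q"
  defines "N \<equiv> {e. {v, e} \<in> E \<and> e \<noteq> p \<and> e \<noteq> q \<and> sepr (ang v p) (ang v q) (ang v e) (ang v w)}"
  shows "\<exists>pos' A'. arc_drawing (insert u V) (delta_Y_edges {v, p, q} u E) pos' A' \<and>
     card (crossings (insert u V) (delta_Y_edges {v, p, q} u E) pos' A') + cr {p, q} \<le> card (crossings V E pos A) + card N"
proof -
  have vV: "v \<in> V" "p \<in> V" "q \<in> V" and ne: "v \<noteq> p" "v \<noteq> q" "p \<noteq> q" using De[OF tri(1)] De[OF tri(2)] De[OF tri(3)] by auto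
  have finN: "finite N" by (rule finite_subset[OF _ D(1)]) (use De(2) in \<open>auto simp: N_def\<close>)
  define lo hi where "lo = min (ang v p) (ang v q)" and "hi = max (ang v p) (ang v q)"
  have angs: "ang v p \<noteq> ang v q" using ang_inj[OF tri(1,2)] ne by blast
  have lohi: "0 \<le> lo" "lo < hi" "hi < 2 * pi" "{lo, hi} = {ang v p, ang v q}"
    using ang_range[of v p] ang_range[of v q] angs unfolding lo_def hi_def by (auto simp: min_def max_def)
  let ?in = "\<lambda>w. lo < ang v w \<and> ang v w < hi"
  have anne: "ang v e \<noteq> lo \<and> ang v e \<noteq> hi" if "{v, e} \<in> E" "e \<noteq> p" "e \<noteq> q" for e
    using ang_inj[OF that(1) tri(1)] ang_inj[OF that(1) tri(2)] that lohi(4) by auto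
  have inN: "e \<in> N" if e: "{v, e} \<in> E" "e \<noteq> p" "e \<noteq> q" "?in e \<noteq> ?in w" for e
    unfolding N_def sepr_def using e by (auto simp: lo_def hi_def min_def max_def split: if_splits)
  \<comment> \<open>Bounds of the sector avoiding \<open>w\<close>. If \<open>w\<close> lies between
    \<open>lo\<close> and \<open>hi\<close>, the route goes the other way round, from
    \<open>hi\<close> to \<open>lo + 2 * pi\<close>.\<close>
  define \<alpha> \<beta> where "\<alpha> = (if ?in w then hi else lo)" and "\<beta> = (if ?in w then lo + 2 * pi else hi)"
  have ab: "\<alpha> < \<beta>" "\<beta> < \<alpha> + 2 * pi" unfolding \<alpha>_def \<beta>_def using lohi by auto
  define \<rho> where "\<rho> = rad v / 2"
  have \<rho>: "0 < \<rho>" "\<rho> \<le> rad v" using rad_pos[OF vV(1)] unfolding \<rho>_def by auto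
  define \<Gamma> where "\<Gamma> = (\<lambda>\<phi>. pos v + of_real \<rho> * cis \<phi>) ` {\<alpha>..\<beta>}"
  have germ: "germ v x = pos v + of_real \<rho> * cis (ang v x)" if "{v, x} \<in> E" for x
    unfolding germ_def \<rho>_def using dir_cis[OF that] by simp
  have "cis \<beta> = cis (if ?in w then lo else hi)" unfolding \<beta>_def by (simp add: cis_mult[symmetric])
  then have "{cis \<alpha>, cis \<beta>} = {cis lo, cis hi}" unfolding \<alpha>_def by auto
  also have "\<dots> = cis ` {lo, hi}" by auto
  also have "\<dots> = {cis (ang v p), cis (ang v q)}" unfolding lohi(4) by auto
  finally have "(cis \<alpha> = cis (ang v p) \<and> cis \<beta> = cis (ang v q)) \<or> (cis \<alpha> = cis (ang v q) \<and> cis \<beta> = cis (ang v p))"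
    by (auto simp: doubleton_eq_iff)
  then have \<Gamma>: "arc_image \<Gamma> (germ v p) (germ v q)"
  proof
    assume "cis \<alpha> = cis (ang v p) \<and> cis \<beta> = cis (ang v q)"
    then show ?thesis using circle_arc[OF \<rho>(1) ab, of "pos v"] unfolding \<Gamma>_def germ[OF tri(1)] germ[OF tri(2)] by metis
  next
    assume "cis \<alpha> = cis (ang v q) \<and> cis \<beta> = cis (ang v p)"
    then show ?thesis using arc_image_sym[OF circle_arc[OF \<rho>(1) ab, of "pos v"]]
      unfolding \<Gamma>_def germ[OF tri(1)] germ[OF tri(2)] by metis
  qed
  have \<Gamma>b: "dist (pos v) y = \<rho>" if "y \<in> \<Gamma>" for y
    using that \<rho>(1) unfolding \<Gamma>_def by (auto simp: dist_norm norm_mult)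
  then have \<Gamma>c: "y \<in> cball (pos v) (rad v)" if "y \<in> \<Gamma>" for y using that \<rho>(2) by force
  have \<Gamma>e: "\<exists>x. e = {v, x} \<and> y = germ v x \<and> (x = p \<or> x = q \<or> x \<in> N)" if y: "y \<in> \<Gamma>" "e \<in> E" "y \<in> A e" for y e
  proof -
    have "v \<in> e" using ball_empty[OF vV(1) y(2)] \<Gamma>c[OF y(1)] y(3) by blast
    then obtain x where x: "e = {v, x}" using edge_other[OF y(2)] by blast
    then have xE: "{v, x} \<in> E" using y by simp
    obtain s where s: "0 \<le> s" "y = pos v + of_real s * dir v x" using radius[OF xE] y x \<Gamma>c[OF y(1)] by blast
    have "dist (pos v) y = s" unfolding s(2) using s(1) dir_norm[OF xE] by (simp add: dist_norm norm_mult)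
    then have "s = \<rho>" using \<Gamma>b[OF y(1)] by simp
    then have yg: "y = germ v x" using s(2) unfolding germ_def \<rho>_def by metis
    obtain \<phi> where ph: "\<alpha> \<le> \<phi>" "\<phi> \<le> \<beta>" "y = pos v + of_real \<rho> * cis \<phi>" using y(1) unfolding \<Gamma>_def by auto
    then have cs: "cis \<phi> = cis (ang v x)" using yg germ[OF xE] \<rho>(1) by simp
    have "x \<in> N" if xn: "x \<noteq> p" "x \<noteq> q"
    proof (cases "?in w")
      case True
      \<comment> \<open>Angles from one full turn on are reduced by \<open>2 * pi\<close> before
        they are compared with \<open>ang v x\<close>.\<close>
      have "\<not> ?in x"
      proof (cases "\<phi> < 2 * pi")
        case a: True
        have "\<phi> = ang v x" using cis_eq_close[OF cs] a ph lohi ang_range[of v x] True unfolding \<alpha>_def by auto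
        then show ?thesis using ph True unfolding \<alpha>_def by auto
      next
        case b: False
        have "cis (\<phi> - 2 * pi) = cis (ang v x)" using cs by (simp add: cis_divide[symmetric])
        then have "\<phi> - 2 * pi = ang v x" using cis_eq_close[of "\<phi> - 2 * pi" "ang v x"] b ph lohi ang_range[of v x] True unfolding \<beta>_def by auto
        then show ?thesis using ph True unfolding \<beta>_def by auto
      qed
      then show ?thesis using inN[OF xE xn] True by blast
    next
      case False
      have "\<phi> = ang v x" using cis_eq_close[OF cs] ph lohi ang_range[of v x] False unfolding \<alpha>_def \<beta>_def by auto
      then have "?in x" using ph False anne[OF xE xn] unfolding \<alpha>_def \<beta>_def by auto
      then show ?thesis using inN[OF xE xn] False by blast
    qed
    then show ?thesis using x yg by blast
  qed
  let ?z0 = "germ v p" and ?z1 = "germ v q"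
  note g0 = germ_in[OF tri(1)] and g1 = germ_in[OF tri(2)]
  obtain Sv Sp where S: "arc_image Sv (pos v) ?z0" "arc_image Sp ?z0 (pos p)" "Sv \<union> Sp = A {v, p}" "Sv \<inter> Sp = {?z0}"
    using arc_image_split[OF D(5)[OF tri(1)] g0(1-3)] by blast
  obtain T1 T2 where T: "arc_image T1 (pos v) ?z1" "arc_image T2 ?z1 (pos q)" "T1 \<union> T2 = A {v, q}" "T1 \<inter> T2 = {?z1}"
    using arc_image_split[OF D(5)[OF tri(2)] g1(1-3)] by blast
  have T2: "T2 \<subseteq> A {v, q}" using T(3) by auto
  have "\<Gamma> \<inter> T2 \<subseteq> {?z1}"
  proof
    fix y assume "y \<in> \<Gamma> \<inter> T2"
    then obtain x where "{v, q} = {v, x}" "y = germ v x" using \<Gamma>e[of y "{v, q}"] tri(2) T2 by blast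
    then show "y \<in> {?z1}" by (auto simp: doubleton_eq_iff)
  qed
  then have B: "arc_image (\<Gamma> \<union> T2) ?z0 (pos q)" by (rule arc_image_join[OF \<Gamma> T(2)])
  define F where "F = E - {{v, p}, {v, q}, {p, q}}"
  let ?X = "crossings V E pos A"
  have d1: "{v, p} \<noteq> {v, q}" "{v, p} \<noteq> {p, q}" "{v, q} \<noteq> {p, q}" using ne by (auto simp: doubleton_eq_iff)
  have Fq: "e \<in> E \<and> e \<noteq> {v, q} \<and> e \<noteq> {p, q}" if "e \<in> insert {v, p} F" for e using that d1 tri unfolding F_def by auto
  have vert: "pos x \<notin> cball (pos v) (rad v)" if "x \<in> V" "x \<noteq> v" for x using rad_less[OF vV(1) that(1)] that(2) by auto
  have z0V: "?z0 \<notin> pos ` V"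
  proof
    assume "?z0 \<in> pos ` V"
    then obtain x where "x \<in> V" "?z0 = pos x" by blast
    then show False using vert[of x] g0(2,4) by metis
  qed
  have "\<exists>pos' A'. arc_drawing (insert u V) (delta_Y_edges {v, p, q} u E) pos' A' \<and>
     crossings (insert u V) (delta_Y_edges {v, p, q} u E) pos' A' \<subseteq>
       (germ v ` N \<union> (?X - A {p, q})) \<union> {x \<in> ?X. x \<noteq> ?z0 \<and> (\<exists>e\<in>insert {v, p} F. \<exists>f\<in>insert {v, p} F. e \<noteq> f \<and> x \<in> A e \<and> x \<in> A f)}"
  proof (rule delta_surgery[OF dr tri u z0V S B F_def])
    show "?z0 \<notin> A e" if "e \<in> F" for e
    proof
      assume "?z0 \<in> A e"
      moreover have "e \<in> E" "e \<noteq> {v, p}" using that unfolding F_def by auto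
      ultimately have "?z0 = pos v" using ball_no_crossing[OF vV(1) tri(1), of e] g0(1,4) by blast
      then show False using g0 by simp
    qed
    show "x = q" if x: "x \<in> V" "pos x \<in> \<Gamma> \<union> T2" for x
    proof (cases "pos x \<in> \<Gamma>")
      case True
      then have "x = v" using vert[OF x(1)] \<Gamma>c by blast
      then show ?thesis using \<Gamma>b[OF True] \<rho>(1) by simp
    next
      case False
      then have "pos x \<in> T2" using x by simp
      then have "x \<in> {v, q}" using D(6)[OF tri(2) x(1)] T2 by blast
      moreover have "x \<noteq> v" using \<open>pos x \<in> T2\<close> arc_image_ends(1)[OF T(1)] T(4) g1(2) by (metis Int_iff singletonD)
      ultimately show ?thesis by auto
    qed
    show "finite (germ v ` N \<union> (?X - A {p, q}))" using finN D(7) by simp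
    show "y \<in> germ v ` N \<union> (?X - A {p, q})"
      if y: "y \<in> \<Gamma> \<union> T2" "y \<noteq> ?z0" "y \<notin> pos ` V" "e \<in> insert {v, p} F" "y \<in> A e" for y e
    proof (cases "y \<in> \<Gamma>")
      case True
      obtain x where x: "e = {v, x}" "y = germ v x" "x = p \<or> x = q \<or> x \<in> N" using \<Gamma>e[OF True _ y(5)] Fq[OF y(4)] by blast
      then have "x \<in> N" using y(2) Fq[OF y(4)] by auto
      then show ?thesis using x by blast
    next
      case False
      then have yq: "y \<in> A {v, q}" using y(1) T2 by blast
      have e: "e \<in> E" "e \<noteq> {v, q}" "e \<noteq> {p, q}" using Fq[OF y(4)] by auto
      have "y \<in> ?X" using crossing_iff[OF e(1) tri(2) e(2) y(5) yq y(3)] .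
      moreover have "y \<notin> A {p, q}" using D(8)[OF e(1) tri(2,3) e(2) d1(3) e(3)] y(3,5) yq by blast
      ultimately show ?thesis by blast
    qed
    show "e = f" if y: "y \<in> \<Gamma> \<union> T2" "y \<noteq> ?z0" "y \<notin> pos ` V" "e \<in> insert {v, p} F" "f \<in> insert {v, p} F" "y \<in> A e" "y \<in> A f" for y e f
    proof (rule ccontr)
      assume ef: "e \<noteq> f"
      show False
      proof (cases "y \<in> \<Gamma>")
        case True
        then have "y = pos v" using ball_no_crossing[OF vV(1), of e f y] Fq[OF y(4)] Fq[OF y(5)] ef y(6,7) \<Gamma>c by blast
        then show False using y(3) vV by blast
      next
        case False
        then have yq: "y \<in> A {v, q}" using y(1) T2 by blast
        then show False using D(8)[of e f "{v, q}"] Fq[OF y(4)] Fq[OF y(5)] tri(2) ef y(3,6,7) by blast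
      qed
    qed
  qed
  then obtain pos' A' where dr': "arc_drawing (insert u V) (delta_Y_edges {v, p, q} u E) pos' A'"
    and sub: "crossings (insert u V) (delta_Y_edges {v, p, q} u E) pos' A' \<subseteq>
       (germ v ` N \<union> (?X - A {p, q})) \<union> {x \<in> ?X. x \<noteq> ?z0 \<and> (\<exists>e\<in>insert {v, p} F. \<exists>f\<in>insert {v, p} F. e \<noteq> f \<and> x \<in> A e \<and> x \<in> A f)}"
    by (elim exE conjE) (rule that; assumption)
  have off: "x \<notin> A {p, q}" if x: "x \<in> ?X" "e \<in> insert {v, p} F" "f \<in> insert {v, p} F" "e \<noteq> f" "x \<in> A e" "x \<in> A f" for x e f
  proof
    assume "x \<in> A {p, q}"
    then have m: "x \<in> A e \<inter> A f \<inter> A {p, q}" using x(5,6) by simp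
    have e: "e \<in> E" "e \<noteq> {p, q}" "f \<in> E" "f \<noteq> {p, q}" using Fq[OF x(2)] Fq[OF x(3)] by auto
    show False using D(8)[OF e(1,3) tri(3) x(4) e(4,2)] m crossingE[OF x(1)] by (meson subsetD)
  qed
  have "{x \<in> ?X. x \<noteq> ?z0 \<and> (\<exists>e\<in>insert {v, p} F. \<exists>f\<in>insert {v, p} F. e \<noteq> f \<and> x \<in> A e \<and> x \<in> A f)} \<subseteq> ?X - A {p, q}"
  proof
    fix x assume x: "x \<in> {x \<in> ?X. x \<noteq> ?z0 \<and> (\<exists>e\<in>insert {v, p} F. \<exists>f\<in>insert {v, p} F. e \<noteq> f \<and> x \<in> A e \<and> x \<in> A f)}"
    then have xX: "x \<in> ?X" by simp
    from x obtain e f where "e \<in> insert {v, p} F" "f \<in> insert {v, p} F" "e \<noteq> f" "x \<in> A e" "x \<in> A f"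
      unfolding mem_Collect_eq by (elim conjE bexE) (rule that; assumption)
    then show "x \<in> ?X - A {p, q}" using off[OF xX] xX by simp
  qed
  from subset_trans[OF this Un_upper2]
  have "{x \<in> ?X. x \<noteq> ?z0 \<and> (\<exists>e\<in>insert {v, p} F. \<exists>f\<in>insert {v, p} F. e \<noteq> f \<and> x \<in> A e \<and> x \<in> A f)}
    \<subseteq> germ v ` N \<union> (?X - A {p, q})" .
  then have "crossings (insert u V) (delta_Y_edges {v, p, q} u E) pos' A' \<subseteq> germ v ` N \<union> (?X - A {p, q})"
    using sub by (simp only: Un_absorb2)
  then have "card (crossings (insert u V) (delta_Y_edges {v, p, q} u E) pos' A') \<le> card (germ v ` N \<union> (?X - A {p, q}))"
    using finN D(7) by (intro card_mono) auto
  also have "\<dots> \<le> card (germ v ` N) + card (?X - A {p, q})" by (rule card_Un_le)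
  also have "\<dots> \<le> card N + card (?X - A {p, q})" using card_image_le[OF finN] by simp
  finally have "card (crossings (insert u V) (delta_Y_edges {v, p, q} u E) pos' A') \<le> card N + card (?X - A {p, q})" .
  moreover have "card (?X - A {p, q}) + cr {p, q} = card ?X"
    unfolding cr_def using D(7) by (metis Int_Diff_Un Int_Diff_disjoint add.commute card_Un_disjoint finite_Diff finite_Int)
  ultimately have "card (crossings (insert u V) (delta_Y_edges {v, p, q} u E) pos' A') + cr {p, q} \<le> card ?X + card N"
    by linarith
  then show ?thesis using dr' by (intro exI[of _ pos'] exI[of _ A'] conjI)
qed

end

section \<open>Topological drawings and arc drawings\<close>

definition edge_point :: "'a \<Rightarrow> 'a \<Rightarrow> real \<Rightarrow> 'a \<Rightarrow> real" where
  "edge_point p q t = (\<lambda>v. if v = p then 1 - t else if v = q then t else 0)"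

definition supp :: "('a \<Rightarrow> real) \<Rightarrow> 'a set" where "supp x = {v. x v \<noteq> 0}"

definition fin_graph :: "'a ugraph \<Rightarrow> bool" where
  "fin_graph G \<longleftrightarrow> finite (vertices G) \<and> (\<forall>e\<in>edges G. e \<subseteq> vertices G \<and> card e = 2)"

lemma realization_iff:
  "x \<in> realization G \<longleftrightarrow> (\<forall>v. 0 \<le> x v) \<and> supp x \<in> (\<lambda>v. {v}) ` vertices G \<union> edges G \<and> sum x (supp x) = 1"
  unfolding realization_def supp_def by simp

lemma supp_vertex_point: "supp (vertex_point v) = {v}"
  unfolding supp_def vertex_point_def by (auto simp: indicator_def)

lemma vertex_point_realization: "v \<in> vertices G \<Longrightarrow> vertex_point v \<in> realization G"
  unfolding realization_iff supp_vertex_point by (simp add: vertex_point_def indicator_def)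

lemma realization_vertex:
  assumes "x \<in> realization G" "supp x = {v}" shows "x = vertex_point v"
proof
  fix w
  have "x v = 1" using assms unfolding realization_iff by simp
  moreover have "w \<noteq> v \<Longrightarrow> x w = 0" using assms(2) unfolding supp_def by auto
  ultimately show "x w = vertex_point v w" unfolding vertex_point_def by (simp add: indicator_def)
qed

lemma vertex_point_inj: "vertex_point v = vertex_point w \<Longrightarrow> v = w"
  using supp_vertex_point by (metis singleton_inject)

lemma edge_point_ends: "p \<noteq> q \<Longrightarrow> edge_point p q 0 = vertex_point p" "p \<noteq> q \<Longrightarrow> edge_point p q 1 = vertex_point q"
  unfolding edge_point_def vertex_point_def by (auto simp: indicator_def fun_eq_iff)

lemma supp_edge_point: "p \<noteq> q \<Longrightarrow> 0 < t \<Longrightarrow> t < 1 \<Longrightarrow> supp (edge_point p q t) = {p, q}"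
  unfolding supp_def edge_point_def by auto

lemma edge_point_realization:
  assumes "{p, q} \<in> edges G" "p \<noteq> q" "p \<in> vertices G" "q \<in> vertices G" "0 \<le> t" "t \<le> 1"
  shows "edge_point p q t \<in> realization G" "supp (edge_point p q t) \<subseteq> {p, q}"
proof -
  consider "t = 0" | "t = 1" | "0 < t" "t < 1" using assms by linarith
  then show "edge_point p q t \<in> realization G"
  proof cases
    case 1 then show ?thesis using edge_point_ends(1)[OF assms(2)] vertex_point_realization[OF assms(3)] by simp
  next
    case 2 then show ?thesis using edge_point_ends(2)[OF assms(2)] vertex_point_realization[OF assms(4)] by simp
  next
    case 3
    have "sum (edge_point p q t) {p, q} = 1" using assms(2) unfolding edge_point_def by simp
    then show ?thesis unfolding realization_iff supp_edge_point[OF assms(2) 3] using assms 3 by (auto simp: edge_point_def)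
  qed
  show "supp (edge_point p q t) \<subseteq> {p, q}" unfolding supp_def edge_point_def by (auto split: if_splits)
qed

lemma realization_edge:
  assumes x: "x \<in> realization G" and s: "supp x \<subseteq> {p, q}" and pq: "p \<noteq> q"
  shows "x = edge_point p q (x q)" "0 \<le> x q" "x q \<le> 1" "x p + x q = 1"
proof -
  have nn: "\<And>v. 0 \<le> x v" and sm: "sum x (supp x) = 1" using x unfolding realization_iff by auto
  have "sum x (supp x) = sum x {p, q}" by (rule sum.mono_neutral_left) (use s in \<open>auto simp: supp_def\<close>)
  then show one: "x p + x q = 1" using sm pq by simp
  then show "0 \<le> x q" "x q \<le> 1" using nn[of p] nn[of q] by auto
  show "x = edge_point p q (x q)"
  proof
    fix v show "x v = edge_point p q (x q) v" using s one unfolding edge_point_def supp_def by auto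
  qed
qed

lemma continuous_edge_point: "continuous_on S (edge_point p q)"
proof (rule continuous_on_coordinatewise_then_product)
  fix i show "continuous_on S (\<lambda>x. edge_point p q x i)"
    unfolding edge_point_def by (cases "i = p"; cases "i = q") (auto intro!: continuous_intros)
qed

lemma supp_cases:
  assumes "fin_graph G" "x \<in> realization G"
  obtains v where "v \<in> vertices G" "supp x = {v}" "x = vertex_point v" | "supp x \<in> edges G"
  using assms realization_vertex[OF assms(2)] unfolding realization_iff by blast

text \<open>The image of an edge may cross itself, so an arc with the same ends is chosen inside it.
  Crossings of these arcs are multiple points of the drawing, and since all of those are double
  points, no three arcs pass through one of them.\<close>

lemma drawing_to_arcs:
  assumes G: "fin_graph G" and f: "is_drawing G f"
  shows "\<exists>pos A. arc_drawing (vertices G) (edges G) pos A \<and>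
    card (crossings (vertices G) (edges G) pos A) \<le> card (multiple_points G f)"
proof -
  let ?V = "vertices G" and ?E = "edges G" and ?R = "realization G"
  have finV: "finite ?V" and E: "\<And>e. e \<in> ?E \<Longrightarrow> e \<subseteq> ?V" "\<And>e. e \<in> ?E \<Longrightarrow> card e = 2" using G unfolding fin_graph_def by auto
  have cont: "continuous_on ?R f" and finM: "finite (multiple_points G f)"
    and tr: "\<And>z. z \<in> multiple_points G f \<Longrightarrow> transversal_double_point G f z"
    and vm: "\<And>v. v \<in> ?V \<Longrightarrow> f (vertex_point v) \<notin> multiple_points G f" using f unfolding is_drawing_def by auto
  define pos where "pos v = f (vertex_point v)" for v
  have multI: "z \<in> multiple_points G f" if "x \<in> ?R" "y \<in> ?R" "x \<noteq> y" "f x = z" "f y = z" for x y z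
    using that unfolding multiple_points_def by blast
  have vuniq: "x = vertex_point v" if "x \<in> ?R" "v \<in> ?V" "f x = pos v" for x v
    using multI[OF that(1) vertex_point_realization[OF that(2)]] vm[OF that(2)] that(3) unfolding pos_def by metis
  have inj: "inj_on pos ?V"
  proof (rule inj_onI)
    fix v w assume vw: "v \<in> ?V" "w \<in> ?V" "pos v = pos w"
    then have "vertex_point v = vertex_point w" using vuniq[OF vertex_point_realization[OF vw(1)] vw(2)] unfolding pos_def by simp
    then show "v = w" by (rule vertex_point_inj)
  qed
  have "\<forall>e\<in>?E. \<exists>S. (\<forall>p q. e = {p, q} \<longrightarrow> arc_image S (pos p) (pos q)) \<and> S \<subseteq> f ` {x \<in> ?R. supp x \<subseteq> e}"
  proof
    fix e assume e: "e \<in> ?E"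
    obtain p q where pq: "e = {p, q}" "p \<noteq> q" using E(2)[OF e] by (auto simp: card_2_iff)
    have V: "p \<in> ?V" "q \<in> ?V" using E(1)[OF e] pq by auto
    have pqE: "{p, q} \<in> ?E" using e pq by simp
    define g where "g = f \<circ> edge_point p q"
    have im: "edge_point p q ` {0..1} \<subseteq> {x \<in> ?R. supp x \<subseteq> e}"
    proof
      fix x assume "x \<in> edge_point p q ` {0..1}"
      then obtain t where t: "0 \<le> t" "t \<le> 1" "x = edge_point p q t" by auto
      show "x \<in> {x \<in> ?R. supp x \<subseteq> e}" using edge_point_realization[OF pqE pq(2) V t(1,2)] t(3) pq(1) by simp
    qed
    have "path g" unfolding path_def g_def
      by (rule continuous_on_compose[OF continuous_edge_point]) (use im in \<open>auto intro: continuous_on_subset[OF cont]\<close>)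
    moreover have gs: "pathstart g = pos p" "pathfinish g = pos q"
      unfolding pathstart_def pathfinish_def g_def pos_def using edge_point_ends[OF pq(2)] by auto
    moreover have "pos p \<noteq> pos q" using inj V pq(2) by (auto simp: inj_on_def)
    ultimately obtain h where h: "arc h" "path_image h \<subseteq> path_image g" "pathstart h = pos p" "pathfinish h = pos q"
      using path_contains_arc by metis
    have a: "arc_image (path_image h) (pos p) (pos q)" unfolding arc_image_def using h by blast
    have "path_image g \<subseteq> f ` {x \<in> ?R. supp x \<subseteq> e}" unfolding path_image_def g_def image_comp[symmetric] using im by (rule image_mono)
    then have "path_image h \<subseteq> f ` {x \<in> ?R. supp x \<subseteq> e}" using h(2) by blast
    moreover have "arc_image (path_image h) (pos p') (pos q')" if "e = {p', q'}" for p' q'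
      using that a arc_image_sym[OF a] pq(1) by (auto simp: doubleton_eq_iff)
    ultimately show "\<exists>S. (\<forall>p q. e = {p, q} \<longrightarrow> arc_image S (pos p) (pos q)) \<and> S \<subseteq> f ` {x \<in> ?R. supp x \<subseteq> e}" by blast
  qed
  then obtain A where A: "\<And>e p q. e \<in> ?E \<Longrightarrow> e = {p, q} \<Longrightarrow> arc_image (A e) (pos p) (pos q)"
    "\<And>e. e \<in> ?E \<Longrightarrow> A e \<subseteq> f ` {x \<in> ?R. supp x \<subseteq> e}" by metis
  have pre: "\<exists>x\<in>?R. supp x = e \<and> f x = z" if z: "e \<in> ?E" "z \<in> A e" "z \<notin> pos ` ?V" for e z
  proof -
    obtain x where x: "x \<in> ?R" "supp x \<subseteq> e" "f x = z" using A(2)[OF z(1)] z(2) by blast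
    have "supp x = e"
    proof (rule supp_cases[OF G x(1)])
      fix v assume "v \<in> ?V" "x = vertex_point v"
      then show ?thesis using x(3) z(3) unfolding pos_def by blast
    next
      assume "supp x \<in> ?E"
      then show ?thesis using x(2) E(2) z(1) by (metis card_subset_eq card_ge_0_finite zero_less_numeral)
    qed
    then show ?thesis using x by blast
  qed
  have cm: "z \<in> multiple_points G f" if z: "e \<in> ?E" "g \<in> ?E" "e \<noteq> g" "z \<in> A e" "z \<in> A g" "z \<notin> pos ` ?V" for e g z
  proof -
    obtain x where x: "x \<in> ?R" "supp x = e" "f x = z" using pre z by blast
    obtain y where y: "y \<in> ?R" "supp y = g" "f y = z" using pre z by blast
    have "x \<noteq> y" using x y z(3) by auto
    then show ?thesis using multI x y by blast
  qed
  then have sub: "crossings ?V ?E pos A \<subseteq> multiple_points G f" unfolding crossings_def by blast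
  have "arc_drawing ?V ?E pos A" unfolding arc_drawing_def
  proof (intro conjI ballI allI impI)
    fix e v assume h: "e \<in> ?E" "v \<in> ?V" "pos v \<in> A e"
    obtain x where x: "x \<in> ?R" "supp x \<subseteq> e" "f x = pos v" using subsetD[OF A(2)[OF h(1)] h(3)] by auto
    have "x = vertex_point v" using vuniq[OF x(1) h(2) x(3)] .
    then show "v \<in> e" using x(2) supp_vertex_point[of v] by simp
  next
    fix e g h assume h: "e \<in> ?E" "g \<in> ?E" "h \<in> ?E" "e \<noteq> g" "g \<noteq> h" "e \<noteq> h"
    show "A e \<inter> A g \<inter> A h \<subseteq> pos ` ?V"
    proof (rule ccontr)
      assume "\<not> ?thesis"
      then obtain z where z: "z \<in> A e" "z \<in> A g" "z \<in> A h" "z \<notin> pos ` ?V" by blast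
      obtain x where x: "x \<in> ?R" "supp x = e" "f x = z" using pre z h by blast
      obtain y where y: "y \<in> ?R" "supp y = g" "f y = z" using pre z h by blast
      obtain w where w: "w \<in> ?R" "supp w = h" "f w = z" using pre z h by blast
      have "transversal_double_point G f z" using tr cm h z by blast
      then obtain a b where "{u \<in> ?R. f u = z} = {a, b}" unfolding transversal_double_point_def by blast
      then have "x \<in> {a, b}" "y \<in> {a, b}" "w \<in> {a, b}" using x y w by blast+
      then have "x = y \<or> y = w \<or> x = w" by auto
      then show False using x y w h by auto
    qed
  next
    show "finite (crossings ?V ?E pos A)" by (rule finite_subset[OF sub finM])
    show "arc_image (A {v, w}) (pos v) (pos w)" if "{v, w} \<in> ?E" for v w by (rule A(1)[OF that refl])
  qed (use finV E inj in auto)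
  moreover have "card (crossings ?V ?E pos A) \<le> card (multiple_points G f)" using sub finM by (rule card_mono[rotated])
  ultimately show ?thesis by blast
qed

section \<open>From tame arc drawings back to topological drawings\<close>

lemma parallelogram_chart:
  fixes z d1 d2 :: complex
  assumes d: "Im (d1 * cnj d2) \<noteq> 0" and e: "0 < \<epsilon>"
  obtains U h k where "open U" "z \<in> U" "U \<subseteq> ball z \<epsilon>" "homeomorphism U UNIV h k" "h z = 0"
    "h ` (range (\<lambda>t. z + of_real t * d1) \<inter> U) = {w. Im w = 0}" "h ` (range (\<lambda>t. z + of_real t * d2) \<inter> U) = {w. Re w = 0}"
proof -
  define \<Delta> where "\<Delta> = Im (d1 * cnj d2)"
  have \<Delta>: "\<Delta> \<noteq> 0" using d unfolding \<Delta>_def .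
  \<comment> \<open>Cramer's rule for the coordinates of \<open>w - z\<close> in the basis
    \<open>d1\<close>, \<open>d2\<close>. A parallelogram is a product of intervals in these
    coordinates, and each interval is stretched onto the whole line to give the chart.\<close>
  define s where "s w = Im ((w - z) * cnj d2) / \<Delta>" for w
  define t where "t w = - Im ((w - z) * cnj d1) / \<Delta>" for w
  define P where "P a b = z + of_real a * d1 + of_real b * d2" for a b
  have sP: "s (P a b) = a" for a b
  proof -
    have "Im ((P a b - z) * cnj d2) = a * \<Delta>" unfolding P_def \<Delta>_def by (simp add: algebra_simps)
    then show ?thesis unfolding s_def using \<Delta> by simp
  qed
  have tP: "t (P a b) = b" for a b
  proof -
    have "Im ((P a b - z) * cnj d1) = - b * \<Delta>" unfolding P_def \<Delta>_def by (simp add: algebra_simps)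
    then show ?thesis unfolding t_def using \<Delta> by simp
  qed
  have Pst: "P (s w) (t w) = w" for w
  proof -
    have D: "\<Delta> = Im d1 * Re d2 - Re d1 * Im d2" unfolding \<Delta>_def by simp
    have "\<Delta> * Re (P (s w) (t w) - z) = Im ((w - z) * cnj d2) * Re d1 - Im ((w - z) * cnj d1) * Re d2"
      unfolding P_def s_def t_def using \<Delta> by (simp add: distrib_left) (simp add: left_diff_distrib)?
    also have "\<dots> = \<Delta> * Re (w - z)" unfolding D by (simp add: algebra_simps)
    finally have 1: "Re (P (s w) (t w) - z) = Re (w - z)" using \<Delta> by simp
    have "\<Delta> * Im (P (s w) (t w) - z) = Im ((w - z) * cnj d2) * Im d1 - Im ((w - z) * cnj d1) * Im d2"
      unfolding P_def s_def t_def using \<Delta> by (simp add: distrib_left) (simp add: left_diff_distrib)?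
    also have "\<dots> = \<Delta> * Im (w - z)" unfolding D by (simp add: algebra_simps)
    finally have 2: "Im (P (s w) (t w) - z) = Im (w - z)" using \<Delta> by simp
    from 1 2 show ?thesis by (simp add: complex_eq_iff)
  qed
  \<comment> \<open>Small enough for the parallelogram to fit into the ball by the triangle
    inequality; the added 1 makes the estimate strict.\<close>
  define \<eta> where "\<eta> = \<epsilon> / (norm d1 + norm d2 + 1)"
  have \<eta>: "0 < \<eta>" "\<eta> * (norm d1 + norm d2) < \<epsilon>"
  proof -
    have p: "0 < norm d1 + norm d2 + 1" by (smt (verit) norm_ge_zero)
    then show "0 < \<eta>" unfolding \<eta>_def using e by simp
    have "\<eta> * (norm d1 + norm d2 + 1) = \<epsilon>" unfolding \<eta>_def using p by simp
    then show "\<eta> * (norm d1 + norm d2) < \<epsilon>" using \<open>0 < \<eta>\<close> by (simp add: distrib_left)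
  qed
  define U where "U = {w. \<bar>s w\<bar> < \<eta> \<and> \<bar>t w\<bar> < \<eta>}"
  have cs: "continuous_on X s" "continuous_on X t" for X unfolding s_def t_def using \<Delta> by (intro continuous_intros; simp)+
  have oU: "open U" unfolding U_def by (intro open_Collect_conj open_Collect_less continuous_intros cs)
  have zU: "z \<in> U" unfolding U_def s_def t_def using \<eta> by simp
  have Ub: "U \<subseteq> ball z \<epsilon>"
  proof
    fix w assume w: "w \<in> U"
    have "w - z = of_real (s w) * d1 + of_real (t w) * d2" using Pst[of w] unfolding P_def by (simp add: algebra_simps)
    then have "norm (w - z) \<le> \<bar>s w\<bar> * norm d1 + \<bar>t w\<bar> * norm d2" by (metis norm_mult norm_of_real norm_triangle_ineq)
    also have "\<dots> \<le> \<eta> * norm d1 + \<eta> * norm d2" using w unfolding U_def by (intro add_mono mult_right_mono) auto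
    also have "\<dots> < \<epsilon>" using \<eta>(2) by (simp add: distrib_left)
    finally show "w \<in> ball z \<epsilon>" by (simp add: dist_norm norm_minus_commute)
  qed
  define \<phi> where "\<phi> r = r / (\<eta> - \<bar>r\<bar>)" for r
  define \<psi> where "\<psi> r = \<eta> * r / (1 + \<bar>r\<bar>)" for r
  have \<psi>b: "\<bar>\<psi> r\<bar> < \<eta>" for r
  proof -
    have "\<bar>\<psi> r\<bar> = \<eta> * (\<bar>r\<bar> / (1 + \<bar>r\<bar>))" unfolding \<psi>_def using \<eta> by (simp add: abs_mult)
    also have "\<dots> < \<eta> * 1" using \<eta> by (intro mult_strict_left_mono) auto
    finally show ?thesis by simp
  qed
  have \<phi>\<psi>: "\<phi> (\<psi> r) = r" for r
  proof -
    have p: "0 < 1 + \<bar>r\<bar>" by simp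
    have "\<bar>\<psi> r\<bar> = \<eta> * \<bar>r\<bar> / (1 + \<bar>r\<bar>)" unfolding \<psi>_def using \<eta> by (simp add: abs_mult)
    then have "\<eta> - \<bar>\<psi> r\<bar> = \<eta> / (1 + \<bar>r\<bar>)" using p by (simp add: field_simps)
    then show ?thesis unfolding \<phi>_def using \<eta> p by (simp add: \<psi>_def)
  qed
  have \<psi>\<phi>: "\<psi> (\<phi> r) = r" if "\<bar>r\<bar> < \<eta>" for r
  proof -
    have p: "0 < \<eta> - \<bar>r\<bar>" using that by simp
    have "\<bar>\<phi> r\<bar> = \<bar>r\<bar> / (\<eta> - \<bar>r\<bar>)" unfolding \<phi>_def using p by simp
    then have "1 + \<bar>\<phi> r\<bar> = \<eta> / (\<eta> - \<bar>r\<bar>)" using p by (simp add: field_simps)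
    then show ?thesis unfolding \<psi>_def using \<eta> p by (simp add: \<phi>_def)
  qed
  define h where "h w = Complex (\<phi> (s w)) (\<phi> (t w))" for w
  define k where "k c = P (\<psi> (Re c)) (\<psi> (Im c))" for c
  have hom: "homeomorphism U UNIV h k"
  proof (rule homeomorphismI)
    have "continuous_on U (\<lambda>w. \<phi> (s w))" "continuous_on U (\<lambda>w. \<phi> (t w))" unfolding \<phi>_def
      by (intro continuous_intros cs; force simp: U_def)+
    then show "continuous_on U h" unfolding h_def Complex_eq by (intro continuous_intros)
    have "1 + \<bar>r\<bar> \<noteq> 0" for r :: real using abs_ge_zero[of r] by linarith
    then show "continuous_on UNIV k" unfolding k_def P_def \<psi>_def by (intro continuous_intros) auto
    show "k ` UNIV \<subseteq> U" unfolding k_def U_def using sP tP \<psi>b by auto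
    show "k (h w) = w" if "w \<in> U" for w using that \<psi>\<phi> Pst unfolding k_def h_def U_def by simp
    show "h (k c) = c" for c unfolding k_def h_def using sP tP \<phi>\<psi> by (simp add: complex_eq_iff)
  qed auto
  have hz: "h z = 0" unfolding h_def s_def t_def \<phi>_def by (simp add: complex_eq_iff)
  have kU: "k c \<in> U" for c unfolding k_def U_def using sP tP \<psi>b by auto
  have hk: "h (k c) = c" for c unfolding k_def h_def using sP tP \<phi>\<psi> by (simp add: complex_eq_iff)
  have l1: "h ` (range (\<lambda>t. z + of_real t * d1) \<inter> U) = {w. Im w = 0}"
  proof (intro set_eqI iffI)
    fix c assume "c \<in> h ` (range (\<lambda>t. z + of_real t * d1) \<inter> U)"
    then obtain a where "c = h (z + of_real a * d1)" by blast
    moreover have "z + of_real a * d1 = P a 0" unfolding P_def by simp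
    ultimately show "c \<in> {w. Im w = 0}" using tP[of a 0] unfolding h_def \<phi>_def by simp
  next
    fix c assume "c \<in> {w. Im w = 0}"
    then have "k c = z + of_real (\<psi> (Re c)) * d1" unfolding k_def P_def \<psi>_def by simp
    then have "k c \<in> range (\<lambda>t. z + of_real t * d1) \<inter> U" using kU by blast
    then show "c \<in> h ` (range (\<lambda>t. z + of_real t * d1) \<inter> U)" using hk[of c] by (metis image_eqI)
  qed
  have l2: "h ` (range (\<lambda>t. z + of_real t * d2) \<inter> U) = {w. Re w = 0}"
  proof (intro set_eqI iffI)
    fix c assume "c \<in> h ` (range (\<lambda>t. z + of_real t * d2) \<inter> U)"
    then obtain a where "c = h (z + of_real a * d2)" by blast
    moreover have "z + of_real a * d2 = P 0 a" unfolding P_def by simp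
    ultimately show "c \<in> {w. Re w = 0}" using sP[of 0 a] unfolding h_def \<phi>_def by simp
  next
    fix c assume "c \<in> {w. Re w = 0}"
    then have "k c = z + of_real (\<psi> (Im c)) * d2" unfolding k_def P_def \<psi>_def by simp
    then have "k c \<in> range (\<lambda>t. z + of_real t * d2) \<inter> U" using kU by blast
    then show "c \<in> h ` (range (\<lambda>t. z + of_real t * d2) \<inter> U)" using hk[of c] by (metis image_eqI)
  qed
  show ?thesis by (rule that[OF oU zU Ub hom hz l1 l2])
qed

text \<open>On each closed edge the map follows a parametrization of the arc, with the coordinate at
  \<open>Q e\<close> as parameter. Continuity is glued from finitely many closed pieces, and at a
  crossing the two lines of a tame point provide the chart required for transversality.\<close>

lemma arcs_to_drawing:
  fixes G :: "'a ugraph"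
  assumes G: "fin_graph G" and dr: "arc_drawing (vertices G) (edges G) pos A"
    and tame: "\<And>z. z \<in> crossings (vertices G) (edges G) pos A \<Longrightarrow> \<exists>\<epsilon>. tame_at (vertices G) (edges G) pos A z \<epsilon>"
  shows "\<exists>f. is_drawing G f \<and> multiple_points G f = crossings (vertices G) (edges G) pos A"
proof -
  let ?V = "vertices G" and ?E = "edges G" and ?R = "realization G"
  let ?X = "crossings ?V ?E pos A"
  note D = arc_drawingD[OF dr]
  have "\<forall>e\<in>?E. \<exists>p q g. e = {p, q} \<and> p \<noteq> q \<and> arc g \<and> path_image g = A e \<and> pathstart g = pos p \<and> pathfinish g = pos q"
  proof
    fix e assume e: "e \<in> ?E"
    obtain p q where pq: "e = {p, q}" "p \<noteq> q" using arc_drawing_edgeE[OF dr e] .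
    have "arc_image (A e) (pos p) (pos q)" using D(5)[of p q] e unfolding pq(1) by simp
    then obtain g where "arc g" "path_image g = A e" "pathstart g = pos p" "pathfinish g = pos q"
      unfolding arc_image_def by (elim exE conjE) (rule that; assumption)
    with pq show "\<exists>p q g. e = {p, q} \<and> p \<noteq> q \<and> arc g \<and> path_image g = A e \<and> pathstart g = pos p \<and> pathfinish g = pos q"
      by blast
  qed
  from bchoice[OF this] obtain P where P: "\<forall>e\<in>?E. \<exists>q g. e = {P e, q} \<and> P e \<noteq> q \<and> arc g \<and> path_image g = A e \<and>
     pathstart g = pos (P e) \<and> pathfinish g = pos q" ..
  from bchoice[OF P] obtain Q where Q: "\<forall>e\<in>?E. \<exists>g. e = {P e, Q e} \<and> P e \<noteq> Q e \<and> arc g \<and> path_image g = A e \<and>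
     pathstart g = pos (P e) \<and> pathfinish g = pos (Q e)" ..
  from bchoice[OF Q] obtain g where g: "\<forall>e\<in>?E. e = {P e, Q e} \<and> P e \<noteq> Q e \<and> arc (g e) \<and> path_image (g e) = A e \<and>
     pathstart (g e) = pos (P e) \<and> pathfinish (g e) = pos (Q e)" ..
  have PQ: "e = {P e, Q e} \<and> P e \<noteq> Q e \<and> arc (g e) \<and> path_image (g e) = A e \<and>
     pathstart (g e) = pos (P e) \<and> pathfinish (g e) = pos (Q e)" if "e \<in> ?E" for e
    using bspec[OF g that] .
  have ends: "P e \<in> ?V" "Q e \<in> ?V" if "e \<in> ?E" for e using D(2)[OF that] PQ[OF that] by auto
  have g01: "g e 0 = pos (P e)" "g e 1 = pos (Q e)" if "e \<in> ?E" for e using PQ[OF that] unfolding pathstart_def pathfinish_def by auto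
  have ginj: "inj_on (g e) {0..1}" and gcont: "continuous_on {0..1} (g e)" if "e \<in> ?E" for e
    using PQ[OF that] unfolding arc_def path_def by auto
  \<comment> \<open>A point that is not inside an edge has a singleton support, and
    \<open>THE\<close> picks its vertex.\<close>
  define f where "f x = (if supp x \<in> ?E then g (supp x) (x (Q (supp x))) else pos (THE v. supp x = {v}))" for x
  have nE: "{v} \<notin> ?E" for v using D(3)[of "{v}"] by auto
  have fv: "f (vertex_point v) = pos v" for v unfolding f_def supp_vertex_point using nE by simp
  have seg: "f x = g e (x (Q e)) \<and> 0 \<le> x (Q e) \<and> x (Q e) \<le> 1 \<and> x = edge_point (P e) (Q e) (x (Q e))"
    if e: "e \<in> ?E" and x: "x \<in> ?R" "supp x \<subseteq> e" for e x
  proof -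
    have pq: "e = {P e, Q e}" "P e \<noteq> Q e" using PQ[OF e] by auto
    have x': "supp x \<subseteq> {P e, Q e}" using x(2) pq(1) by simp
    note r = realization_edge[OF x(1) x' pq(2)]
    have "f x = g e (x (Q e))"
    proof (rule supp_cases[OF G x(1)])
      fix v assume v: "supp x = {v}" "x = vertex_point v"
      then consider "v = P e" | "v = Q e" using x' by auto
      then show ?thesis
      proof cases
        case 1
        then have "x (Q e) = 0" using v pq(2) by (simp add: vertex_point_def indicator_def)
        then show ?thesis using v 1 fv g01[OF e] by simp
      next
        case 2
        then have "x (Q e) = 1" using v by (simp add: vertex_point_def indicator_def)
        then show ?thesis using v 2 fv g01[OF e] by simp
      qed
    next
      assume s: "supp x \<in> ?E"
      then have "supp x = e" using x(2) D(3)[OF s] D(3)[OF e] by (metis card_subset_eq card_ge_0_finite zero_less_numeral)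
      then show ?thesis unfolding f_def using e by simp
    qed
    then show ?thesis using r by simp
  qed
  have open_edge: "f x \<in> A e \<and> f x \<notin> pos ` ?V" if e: "e \<in> ?E" and x: "x \<in> ?R" "supp x = e" for e x
  proof -
    have s: "f x = g e (x (Q e))" "0 \<le> x (Q e)" "x (Q e) \<le> 1" using seg[OF e x(1)] x(2) by auto
    have in01: "x (Q e) \<in> {0..1}" using s by simp
    have fA: "f x \<in> A e" using s PQ[OF e] in01 unfolding path_image_def by (metis image_eqI)
    have pq: "e = {P e, Q e}" "P e \<noteq> Q e" using PQ[OF e] by auto
    have "P e \<in> supp x" "Q e \<in> supp x" using x(2) pq(1) by auto
    then have nz: "x (Q e) \<noteq> 0" "x (P e) \<noteq> 0" unfolding supp_def by auto
    have "supp x \<subseteq> {P e, Q e}" using x(2) pq(1) by simp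
    then have "x (Q e) \<noteq> 1" using realization_edge(4)[OF x(1) _ pq(2)] nz by auto
    have "f x \<notin> pos ` ?V"
    proof
      assume "f x \<in> pos ` ?V"
      then obtain v where v: "v \<in> ?V" "f x = pos v" by blast
      then have "v \<in> e" using D(6)[OF e v(1)] fA by simp
      then have "v = P e \<or> v = Q e" using pq(1) by blast
      then have "g e (x (Q e)) = g e 0 \<or> g e (x (Q e)) = g e 1" using v s g01[OF e] by auto
      then have "x (Q e) = 0 \<or> x (Q e) = 1" using ginj[OF e] in01 unfolding inj_on_def by auto
      then show False using nz \<open>x (Q e) \<noteq> 1\<close> by simp
    qed
    then show ?thesis using fA by simp
  qed
  have edge_inj: "x = y" if "e \<in> ?E" "x \<in> ?R" "y \<in> ?R" "supp x = e" "supp y = e" "f x = f y" for e x y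
  proof -
    note sx = seg[OF that(1,2)] and sy = seg[OF that(1,3)]
    have "x (Q e) = y (Q e)" using ginj[OF that(1)] sx sy that unfolding inj_on_def by auto
    then show ?thesis using sx sy that(4,5) by (metis order_refl)
  qed
  have onto: "\<exists>x\<in>?R. supp x = e \<and> f x = z" if e: "e \<in> ?E" and z: "z \<in> A e" "z \<notin> pos ` ?V" for e z
  proof -
    have pq: "e = {P e, Q e}" "P e \<noteq> Q e" using PQ[OF e] by auto
    obtain t where t: "t \<in> {0..1}" "z = g e t" using z(1) PQ[OF e] unfolding path_image_def by (metis imageE)
    have "t \<noteq> 0" "t \<noteq> 1" using t z(2) g01[OF e] ends[OF e] by auto
    then have t01: "0 < t" "t < 1" using t by auto
    let ?x = "edge_point (P e) (Q e) t"
    have s: "supp ?x = e" using supp_edge_point[OF pq(2) t01] pq(1) by simp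
    have x: "?x \<in> ?R" by (rule edge_point_realization(1)) (use pq e ends[OF e] t01 in auto)
    have "?x (Q e) = t" using pq(2) unfolding edge_point_def by simp
    then have "f ?x = z" using s e t unfolding f_def by simp
    then show ?thesis using s x by blast
  qed
  have mult: "multiple_points G f = ?X"
  proof (intro set_eqI iffI)
    fix z assume "z \<in> multiple_points G f"
    then obtain x y where xy: "x \<in> ?R" "y \<in> ?R" "x \<noteq> y" "f x = z" "f y = z" unfolding multiple_points_def by blast
    show "z \<in> ?X"
    proof (rule supp_cases[OF G xy(1)]; rule supp_cases[OF G xy(2)])
      fix v w assume "v \<in> ?V" "x = vertex_point v" "w \<in> ?V" "y = vertex_point w"
      then have "v = w" using xy fv D(4) by (metis inj_onD)
      then show ?thesis using xy(3) \<open>x = vertex_point v\<close> \<open>y = vertex_point w\<close> by simp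
    next
      fix v assume "v \<in> ?V" "x = vertex_point v" "supp y \<in> ?E"
      then show ?thesis using open_edge[OF _ xy(2)] xy fv by (metis image_eqI)
    next
      fix w assume "supp x \<in> ?E" "w \<in> ?V" "y = vertex_point w"
      then show ?thesis using open_edge[OF _ xy(1)] xy fv by (metis image_eqI)
    next
      assume s: "supp x \<in> ?E" "supp y \<in> ?E"
      have "supp x \<noteq> supp y" using edge_inj[OF s(1) xy(1,2)] xy by auto
      then show ?thesis unfolding crossings_def using s open_edge[OF s(1) xy(1)] open_edge[OF s(2) xy(2)] xy(4,5)
        by (intro CollectI conjI bexI[of _ "supp x"] bexI[of _ "supp y"]) auto
    qed
  next
    fix z assume "z \<in> ?X"
    then obtain e e' where e: "z \<notin> pos ` ?V" "e \<in> ?E" "e' \<in> ?E" "e \<noteq> e'" "z \<in> A e" "z \<in> A e'" unfolding crossings_def by blast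
    obtain x where x: "x \<in> ?R" "supp x = e" "f x = z" using onto[OF e(2) e(5) e(1)] by blast
    obtain y where y: "y \<in> ?R" "supp y = e'" "f y = z" using onto[OF e(3) e(6) e(1)] by blast
    have "x \<noteq> y" using x y e(4) by auto
    then show "z \<in> multiple_points G f" unfolding multiple_points_def using x y by blast
  qed
  define S where "S e = {x \<in> ?R. supp x \<subseteq> e}" for e
  have Sclosed: "closed (S e)" if e: "e \<in> ?E" for e
  proof -
    have pq: "e = {P e, Q e}" "P e \<noteq> Q e" using PQ[OF e] by auto
    have "S e = (\<Inter>v. {x. 0 \<le> x v}) \<inter> (\<Inter>v\<in>- e. {x. x v = 0}) \<inter> {x. x (P e) + x (Q e) = 1}"
    proof (intro set_eqI iffI)
      fix x assume "x \<in> S e"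
      then have x: "x \<in> ?R" "supp x \<subseteq> e" unfolding S_def by auto
      then have "x (P e) + x (Q e) = 1" using realization_edge(4)[OF x(1) _ pq(2)] pq(1) by simp
      moreover have "\<And>v. 0 \<le> x v" using x(1) unfolding realization_iff by simp
      moreover have "\<And>v. v \<notin> e \<Longrightarrow> x v = 0" using x(2) unfolding supp_def by auto
      ultimately show "x \<in> (\<Inter>v. {x. 0 \<le> x v}) \<inter> (\<Inter>v\<in>- e. {x. x v = 0}) \<inter> {x. x (P e) + x (Q e) = 1}" by simp
    next
      fix x :: "'a \<Rightarrow> real" assume "x \<in> (\<Inter>v. {x. 0 \<le> x v}) \<inter> (\<Inter>v\<in>- e. {x. x v = 0}) \<inter> {x. x (P e) + x (Q e) = 1}"
      then have x: "\<And>v. 0 \<le> x v" "\<And>v. v \<notin> e \<Longrightarrow> x v = 0" "x (P e) + x (Q e) = 1" by auto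
      have "x v = edge_point (P e) (Q e) (x (Q e)) v" for v
        using x(2)[of v] x(3) pq(1) unfolding edge_point_def by (cases "v = P e"; cases "v = Q e") auto
      then have eq: "x = edge_point (P e) (Q e) (x (Q e))" by (rule ext)
      have "edge_point (P e) (Q e) (x (Q e)) \<in> ?R"
        by (rule edge_point_realization(1)) (use pq e ends[OF e] x(1)[of "P e"] x(1)[of "Q e"] x(3) in auto)
      then have "x \<in> ?R" using eq by simp
      then show "x \<in> S e" unfolding S_def supp_def using x(2) by auto
    qed
    moreover have c: "continuous_on UNIV (\<lambda>x::'a \<Rightarrow> real. x v)" for v by simp
    have "closed {x::'a \<Rightarrow> real. 0 \<le> x v}" "closed {x::'a \<Rightarrow> real. x v = 0}" for v
      by (intro closed_Collect_le closed_Collect_eq c continuous_on_const)+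
    moreover have "closed {x::'a \<Rightarrow> real. x (P e) + x (Q e) = 1}"
      by (intro closed_Collect_eq continuous_on_add c continuous_on_const)
    ultimately show ?thesis by (auto intro!: closed_Int closed_INT)
  qed
  have Scont: "continuous_on (S e) f" if e: "e \<in> ?E" for e
  proof -
    have "continuous_on (S e) (\<lambda>x. x (Q e))" by (rule continuous_on_subset[of UNIV]) auto
    then have "continuous_on (S e) (\<lambda>x. g e (x (Q e)))"
      by (rule continuous_on_compose2[OF gcont[OF e]]) (use seg[OF e] in \<open>auto simp: S_def\<close>)
    then show ?thesis by (rule continuous_on_eq) (use seg[OF e] in \<open>auto simp: S_def\<close>)
  qed
  \<comment> \<open>The vertices are listed as pieces of their own because some may be
    isolated.\<close>
  have Rcov: "?R = \<Union>(S ` ?E) \<union> vertex_point ` ?V"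
  proof (intro set_eqI iffI)
    fix x assume x: "x \<in> ?R"
    show "x \<in> \<Union>(S ` ?E) \<union> vertex_point ` ?V"
      by (rule supp_cases[OF G x]) (use x in \<open>auto simp: S_def\<close>)
  qed (auto simp: S_def vertex_point_realization)
  have vclosed: "closed {vertex_point v}" for v :: 'a
  proof -
    have "{vertex_point v} = (\<Inter>w. {x. x w = vertex_point v w})" by (auto simp: fun_eq_iff)
    moreover have "closed {x::'a \<Rightarrow> real. x w = vertex_point v w}" for w
      by (intro closed_Collect_eq continuous_on_const) simp
    ultimately show ?thesis by (auto intro!: closed_INT)
  qed
  have cont: "continuous_on ?R f"
  proof -
    let ?U = "\<lambda>i. case i of Inl e \<Rightarrow> S e | Inr v \<Rightarrow> {vertex_point v}"
    have "continuous_on (\<Union>i\<in>Inl ` ?E \<union> Inr ` ?V. ?U i) f"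
      by (rule continuous_on_closed_Union) (use D(1,9) Sclosed Scont vclosed in auto)
    moreover have "(\<Union>i\<in>Inl ` ?E \<union> Inr ` ?V. ?U i) = ?R" unfolding Rcov by auto
    ultimately show ?thesis by simp
  qed
  have trans: "transversal_double_point G f z" if z: "z \<in> ?X" for z
  proof -
    obtain \<epsilon> where te: "tame_at ?V ?E pos A z \<epsilon>" using tame[OF z] by blast
    obtain e e' d1 d2 where t: "0 < \<epsilon>" "pos ` ?V \<inter> ball z \<epsilon> = {}" "e \<in> ?E" "e' \<in> ?E" "e \<noteq> e'" "Im (d1 * cnj d2) \<noteq> 0"
       "A e \<inter> ball z \<epsilon> = range (\<lambda>t. z + of_real t * d1) \<inter> ball z \<epsilon>"
       "A e' \<inter> ball z \<epsilon> = range (\<lambda>t. z + of_real t * d2) \<inter> ball z \<epsilon>" "\<forall>g\<in>?E - {e, e'}. A g \<inter> ball z \<epsilon> = {}"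
      by (rule tame_atE[OF te])
    obtain U h k where U: "open U" "z \<in> U" "U \<subseteq> ball z \<epsilon>" "homeomorphism U UNIV h k" "h z = 0"
      "h ` (range (\<lambda>t. z + of_real t * d1) \<inter> U) = {w. Im w = 0}" "h ` (range (\<lambda>t. z + of_real t * d2) \<inter> U) = {w. Re w = 0}"
      using parallelogram_chart[OF t(6,1), of z] .
    have zV: "z \<notin> pos ` ?V" using z unfolding crossings_def by blast
    have zb: "z \<in> ball z \<epsilon>" using t(1) by simp
    have "z = z + of_real 0 * d1" "z = z + of_real 0 * d2" by auto
    then have zA: "z \<in> A e" "z \<in> A e'" using t(7,8) zb by blast+
    have UA: "A e \<inter> U = range (\<lambda>t. z + of_real t * d1) \<inter> U" "A e' \<inter> U = range (\<lambda>t. z + of_real t * d2) \<inter> U" using t(7,8) U(3) by blast+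
    obtain x where x: "x \<in> ?R" "supp x = e" "f x = z" using onto[OF t(3) zA(1) zV] by blast
    obtain y where y: "y \<in> ?R" "supp y = e'" "f y = z" using onto[OF t(4) zA(2) zV] by blast
    have pre: "supp w = e \<or> supp w = e'" if w: "w \<in> ?R" "f w \<in> U" for w
    proof (rule supp_cases[OF G w(1)])
      fix v assume "v \<in> ?V" "w = vertex_point v"
      then show ?thesis using w(2) fv t(2) U(3) by blast
    next
      assume s: "supp w \<in> ?E"
      then have "f w \<in> A (supp w)" using open_edge[OF s w(1)] by simp
      then show ?thesis using t(9) s w(2) U(3) by blast
    qed
    have xy: "{w \<in> ?R. f w = z} = {x, y}"
    proof (intro set_eqI iffI)
      fix w assume w: "w \<in> {w \<in> ?R. f w = z}"
      then have "supp w = e \<or> supp w = e'" using pre U(2) by blast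
      then show "w \<in> {x, y}" using edge_inj[OF t(3), of w x] edge_inj[OF t(4), of w y] x y w by auto
    qed (use x y in auto)
    \<comment> \<open>The branches for transversality. They are open, because points supported on
      the whole edge are those with both end coordinates nonzero.\<close>
    define B where "B e = {w \<in> ?R. f w \<in> U \<and> supp w = e}" for e
    have Bopen: "openin (top_of_set ?R) (B e)" if e: "e \<in> ?E" for e
    proof -
      have pq: "e = {P e, Q e}" using PQ[OF e] by auto
      have "openin (top_of_set ?R) (?R \<inter> f -` U)" using cont U(1) by (simp add: continuous_openin_preimage_gen)
      moreover have "open {w::'a \<Rightarrow> real. w (P e) \<noteq> 0 \<and> w (Q e) \<noteq> 0}"
        by (intro open_Collect_conj open_Collect_neq continuous_on_const) auto
      ultimately have "openin (top_of_set ?R) ((?R \<inter> f -` U) \<inter> {w. w (P e) \<noteq> 0 \<and> w (Q e) \<noteq> 0})" by (rule openin_Int_open)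
      moreover have "(?R \<inter> f -` U) \<inter> {w. w (P e) \<noteq> 0 \<and> w (Q e) \<noteq> 0} = B e"
      proof -
        have "supp w = e" if w: "w \<in> ?R" "w (P e) \<noteq> 0" "w (Q e) \<noteq> 0" for w
        proof -
          have "{P e, Q e} \<subseteq> supp w" using w(2,3) unfolding supp_def by auto
          then have sub: "e \<subseteq> supp w" using pq by metis
          show ?thesis
          proof (rule supp_cases[OF G w(1)])
            fix v assume "supp w = {v}"
            then have "card e \<le> card {v}" using sub by (intro card_mono) auto
            then show ?thesis using D(3)[OF e] by simp
          next
            assume s: "supp w \<in> ?E"
            then show ?thesis using sub D(3)[OF s] D(3)[OF e] by (metis card_subset_eq card_ge_0_finite zero_less_numeral)
          qed
        qed
        moreover have "w (P e) \<noteq> 0 \<and> w (Q e) \<noteq> 0" if "supp w = e" for w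
        proof -
          have "P e \<in> supp w" "Q e \<in> supp w" using that pq by blast+
          then show ?thesis unfolding supp_def by simp
        qed
        ultimately show ?thesis unfolding B_def by blast
      qed
      ultimately show ?thesis by simp
    qed
    have fB: "f ` B e = A e \<inter> U" if e: "e \<in> ?E" for e
    proof (intro set_eqI iffI)
      fix w assume "w \<in> f ` B e"
      then show "w \<in> A e \<inter> U" using open_edge[OF e] unfolding B_def by blast
    next
      fix w assume w: "w \<in> A e \<inter> U"
      then have "w \<notin> pos ` ?V" using t(2) U(3) by blast
      then obtain a where "a \<in> ?R" "supp a = e" "f a = w" using onto[OF e] w by blast
      then show "w \<in> f ` B e" unfolding B_def using w by blast
    qed
    have im: "h ` f ` B e = {w. Im w = 0}" "h ` f ` B e' = {w. Re w = 0}" unfolding fB[OF t(3)] fB[OF t(4)] UA U(6,7) by auto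
    have xB: "x \<in> B e" "y \<in> B e'" unfolding B_def using x y U(2) by auto
    have dis: "B e \<inter> B e' = {}" unfolding B_def using t(5) by auto
    have un: "{w \<in> ?R. f w \<in> U} = B e \<union> B e'" unfolding B_def using pre by blast
    have ne: "x \<noteq> y" using x y t(5) by auto
    show ?thesis unfolding transversal_double_point_def
      by (rule exI[of _ x], rule exI[of _ y], intro conjI, fact ne, fact xy,
          rule exI[of _ U], rule exI[of _ "B e"], rule exI[of _ "B e'"], rule exI[of _ h], rule exI[of _ k], intro conjI)
         (fact U(1,2,4,5) Bopen[OF t(3)] Bopen[OF t(4)] xB dis un im)+
  qed
  have "is_drawing G f" unfolding is_drawing_def mult
    using cont D(7) trans fv by (auto simp: crossings_def)
  then show ?thesis using mult by blast
qed

section \<open>Straight-line drawings\<close>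

text \<open>The equation with the normal \<open>\<i> * (b - a)\<close> describes the line through
  \<open>a\<close> and \<open>b\<close>, and finitely many lines form a negligible set.\<close>

lemma exists_off_lines:
  fixes L :: "(complex \<times> complex) set"
  assumes "finite L" "\<And>a b. (a, b) \<in> L \<Longrightarrow> a \<noteq> b"
  shows "\<exists>z. \<forall>(a, b)\<in>L. inner (\<i> * (b - a)) z \<noteq> inner (\<i> * (b - a)) a"
proof -
  let ?l = "\<lambda>(a, b). {z :: complex. inner (\<i> * (b - a)) z = inner (\<i> * (b - a)) a}"
  have "negligible (\<Union>(?l ` L))"
  proof (rule negligible_Union)
    fix S assume "S \<in> ?l ` L"
    then obtain a b where ab: "(a, b) \<in> L" and S: "S = {z. inner (\<i> * (b - a)) z = inner (\<i> * (b - a)) a}" by auto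
    have "\<i> * (b - a) \<noteq> 0" using assms(2)[OF ab] by simp
    then show "negligible S" unfolding S by (intro negligible_hyperplane) simp
  qed (use assms(1) in simp)
  then have "\<Union>(?l ` L) \<noteq> UNIV" using non_negligible_UNIV by metis
  then obtain z where "z \<notin> \<Union>(?l ` L)" by blast
  then show ?thesis by (intro exI[of _ z]) auto
qed

lemma inner_rot_self: "inner (\<i> * d) d = (0::real)" for d :: complex
  by (simp add: inner_complex_def)

lemma segment_param: "y \<in> closed_segment a b \<Longrightarrow> \<exists>s. y = a + of_real s * (b - a)" for a b y :: complex
  unfolding closed_segment_def by (auto simp: scaleR_conv_of_real algebra_simps)

lemma inner_rot_scale: "inner (\<i> * (of_real s * d)) w = s * inner (\<i> * d) w" for d w :: complex
  by (simp add: inner_complex_def algebra_simps)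

lemma inner_segment:
  fixes a b y :: complex
  assumes "y \<in> closed_segment a b" shows "inner (\<i> * (b - a)) y = inner (\<i> * (b - a)) a"
proof -
  obtain s where "y = a + of_real s * (b - a)" using segment_param[OF assms] by blast
  then have "y = a + s *\<^sub>R (b - a)" by (simp add: scaleR_conv_of_real)
  then have "inner (\<i> * (b - a)) y = inner (\<i> * (b - a)) a + s * inner (\<i> * (b - a)) (b - a)"
    by (simp only: inner_add_right inner_scaleR_right)
  then show ?thesis by (simp only: inner_rot_self)
qed

lemma collinear_end:
  fixes c p z :: complex
  assumes "c \<in> closed_segment p z" shows "inner (\<i> * (c - p)) z = inner (\<i> * (c - p)) p"
proof -
  obtain s where s: "c = p + of_real s * (z - p)" using segment_param[OF assms] by blast
  then have c: "c - p = of_real s * (z - p)" by simp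
  have "inner (\<i> * (z - p)) z - inner (\<i> * (z - p)) p = inner (\<i> * (z - p)) (z - p)" by (simp only: inner_diff_right)
  then have "inner (\<i> * (z - p)) z = inner (\<i> * (z - p)) p" using inner_rot_self[of "z - p"] by simp
  then show ?thesis unfolding c inner_rot_scale by simp
qed

lemma two_spokes:
  fixes p q z y :: complex
  assumes "y \<in> closed_segment z p" "y \<in> closed_segment z q" "y \<noteq> z"
  shows "inner (\<i> * (q - p)) z = inner (\<i> * (q - p)) p"
proof -
  obtain s where s: "y = z + of_real s * (p - z)" using segment_param[OF assms(1)] by blast
  obtain t where t: "y = z + of_real t * (q - z)" using segment_param[OF assms(2)] by blast
  have t0: "t \<noteq> 0" using t assms(3) by auto
  have "of_real t * (q - z) = of_real s * (p - z)" using s t by simp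
  then have "q - z = of_real (s / t) * (p - z)" using t0 by (simp add: field_simps)
  then have "q - p = of_real (s / t - 1) * (p - z)" by (simp add: algebra_simps)
  then have "inner (\<i> * (q - p)) (p - z) = (s / t - 1) * inner (\<i> * (p - z)) (p - z)" by (simp only: inner_rot_scale)
  then have "inner (\<i> * (q - p)) (p - z) = 0" by (simp only: inner_rot_self)
  then show ?thesis by (simp add: inner_diff_right)
qed

lemma finite_segment_inter:
  fixes p q r z :: complex
  assumes "inner (\<i> * (r - q)) z \<noteq> inner (\<i> * (r - q)) q"
  shows "finite (closed_segment z p \<inter> closed_segment q r)"
proof -
  let ?n = "\<i> * (r - q)"
  define \<alpha> where "\<alpha> = inner ?n z - inner ?n q"
  define \<beta> where "\<beta> = inner ?n (p - z)"
  have "closed_segment z p \<inter> closed_segment q r \<subseteq> (\<lambda>s. z + of_real s * (p - z)) ` {- \<alpha> / \<beta>}"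
  proof
    fix y assume y: "y \<in> closed_segment z p \<inter> closed_segment q r"
    obtain s where s: "y = z + of_real s * (p - z)" using segment_param y by blast
    have "inner ?n y = inner ?n q" using inner_segment y by blast
    moreover have "y = z + s *\<^sub>R (p - z)" using s by (simp add: scaleR_conv_of_real)
    then have "inner ?n y = inner ?n z + s * \<beta>" unfolding \<beta>_def by (simp only: inner_add_right inner_scaleR_right)
    ultimately have eq: "\<alpha> + s * \<beta> = 0" unfolding \<alpha>_def by simp
    have "\<alpha> \<noteq> 0" using assms unfolding \<alpha>_def by simp
    then have "\<beta> \<noteq> 0" using eq by auto
    then have "s = - \<alpha> / \<beta>" using eq by (simp add: field_simps)
    then show "y \<in> (\<lambda>s. z + of_real s * (p - z)) ` {- \<alpha> / \<beta>}" using s by blast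
  qed
  then show ?thesis using finite_subset by blast
qed

text \<open>Each new vertex is placed off all lines through two of the earlier vertices and
  crossings. Its edges then meet each other only at the new vertex, meet every old edge in finitely
  many points, and contain no earlier vertex or crossing except their own end; so no triple points
  arise.\<close>

lemma straight_complete:
  assumes "finite V"
  shows "\<exists>pos. arc_drawing V {e. e \<subseteq> V \<and> card e = 2} pos (\<lambda>e. convex hull (pos ` e))"
  using assms
proof (induction V rule: finite_induct)
  case empty
  have "{e :: 'a set. e \<subseteq> {} \<and> card e = 2} = {}" by auto
  then show ?case unfolding arc_drawing_def crossings_def by auto
next
  case (insert x V)
  let ?K = "\<lambda>V :: 'a set. {e. e \<subseteq> V \<and> card e = 2}"
  obtain pos where dr: "arc_drawing V (?K V) pos (\<lambda>e. convex hull (pos ` e))" using insert.IH by blast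
  note D = arc_drawingD[OF dr]
  let ?X = "crossings V (?K V) pos (\<lambda>e. convex hull (pos ` e))"
  let ?P = "pos ` V \<union> ?X"
  \<comment> \<open>The pairs \<open>(a, a + 1)\<close> add a horizontal line through every point,
    which keeps the new vertex away from the points themselves.\<close>
  let ?L = "{(a, b) \<in> ?P \<times> ?P. a \<noteq> b} \<union> (\<lambda>a. (a, a + 1)) ` ?P"
  have fP: "finite ?P" using D(1,7) by simp
  have "finite ?L" by (intro finite_UnI finite_imageI fP finite_subset[OF _ finite_cartesian_product[OF fP fP]]) auto
  moreover have "a \<noteq> b" if "(a, b) \<in> ?L" for a b using that by auto
  ultimately have "\<exists>z. \<forall>(a, b)\<in>?L. inner (\<i> * (b - a)) z \<noteq> inner (\<i> * (b - a)) a" by (rule exists_off_lines)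
  then obtain z where z0: "\<forall>(a, b)\<in>?L. inner (\<i> * (b - a)) z \<noteq> inner (\<i> * (b - a)) a" ..
  have z: "inner (\<i> * (b - a)) z \<noteq> inner (\<i> * (b - a)) a" if "(a, b) \<in> ?L" for a b using bspec[OF z0 that] by simp
  have off: "inner (\<i> * (b - a)) z \<noteq> inner (\<i> * (b - a)) a" if "a \<in> ?P" "b \<in> ?P" "a \<noteq> b" for a b
    by (rule z) (use that in blast)
  have zP: "z \<notin> ?P"
  proof
    assume "z \<in> ?P"
    then have "inner (\<i> * ((z + 1) - z)) z \<noteq> inner (\<i> * ((z + 1) - z)) z" by (intro z) blast
    then show False by simp
  qed
  define pos' where "pos' = pos(x := z)"
  let ?A = "\<lambda>e. convex hull (pos ` e)" and ?A' = "\<lambda>e. convex hull (pos' ` e)"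
  have pV: "pos' v = pos v" if "v \<in> V" for v
    using insert.hyps that unfolding pos'_def by auto
  have px: "pos' x = z" unfolding pos'_def by simp
  have imV: "pos' ` e = pos ` e" if "e \<subseteq> V" for e using pV that by (intro image_cong) auto
  have AV: "?A' e = ?A e" if "e \<in> ?K V" for e using imV that by simp
  have hull2: "?A' {v, w} = closed_segment (pos' v) (pos' w)" for v w by (simp add: segment_convex_hull)
  have Ax: "?A' {x, p} = closed_segment z (pos p)" if "p \<in> V" for p using hull2[of x p] px pV[OF that] by simp
  have edge: "e \<in> ?K V \<or> (\<exists>p\<in>V. e = {x, p})" if "e \<in> ?K (insert x V)" for e
  proof (cases "x \<in> e")
    case True
    obtain v w where vw: "e = {v, w}" "v \<noteq> w" using \<open>e \<in> ?K (insert x V)\<close> by (auto simp: card_2_iff)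
    then show ?thesis using that True by (cases "x = v") (auto simp: insert_commute)
  qed (use that in auto)
  have off2: "inner (\<i> * (pos q - pos p)) z \<noteq> inner (\<i> * (pos q - pos p)) (pos p)" if "p \<in> V" "q \<in> V" "p \<noteq> q" for p q
    using off[of "pos p" "pos q"] that D(4) by (auto simp: inj_on_def)
  have inj: "inj_on pos' (insert x V)"
  proof -
    have "inj_on pos' V" using D(4) pV by (simp add: inj_on_def)
    moreover have "pos' x \<notin> pos' ` V" using zP px imV[of V] by auto
    ultimately show ?thesis by (simp add: insert.hyps)
  qed
  have arcs: "arc_image (?A' {v, w}) (pos' v) (pos' w)" if "{v, w} \<in> ?K (insert x V)" for v w
  proof -
    have "v \<in> insert x V" "w \<in> insert x V" "v \<noteq> w" using that by auto
    then have "pos' v \<noteq> pos' w" using inj by (auto simp: inj_on_def)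
    then show ?thesis unfolding hull2 by (rule arc_image_segment)
  qed
  have newnew: "?A' {x, p} \<inter> ?A' {x, q} \<subseteq> {z}" if "p \<in> V" "q \<in> V" "p \<noteq> q" for p q
  proof
    fix y assume "y \<in> ?A' {x, p} \<inter> ?A' {x, q}"
    then have "y \<in> closed_segment z (pos p)" "y \<in> closed_segment z (pos q)" using Ax that by auto
    then show "y \<in> {z}" using two_spokes[of y z "pos p" "pos q"] off2[OF that] by auto
  qed
  have zold: "z \<notin> ?A' e" if "e \<in> ?K V" for e
  proof
    assume z: "z \<in> ?A' e"
    obtain q r where qr: "e = {q, r}" "q \<noteq> r" using \<open>e \<in> ?K V\<close> by (auto simp: card_2_iff)
    then have V: "q \<in> V" "r \<in> V" using that by auto
    have "z \<in> closed_segment (pos q) (pos r)" using z hull2[of q r] V pV unfolding qr by simp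
    then show False using inner_segment off2[OF V qr(2)] by blast
  qed
  have newold: "finite (?A' {x, p} \<inter> ?A' e)" if "p \<in> V" "e \<in> ?K V" for p e
  proof -
    obtain q r where qr: "e = {q, r}" "q \<noteq> r" using \<open>e \<in> ?K V\<close> by (auto simp: card_2_iff)
    then have V: "q \<in> V" "r \<in> V" using \<open>e \<in> ?K V\<close> by auto
    have "?A' e = closed_segment (pos q) (pos r)" using hull2[of q r] V pV unfolding qr by simp
    then show ?thesis unfolding Ax[OF \<open>p \<in> V\<close>] using finite_segment_inter[OF off2[OF V qr(2)]] by simp
  qed
  have onx: "c = pos p" if "c \<in> ?A' {x, p}" "c \<in> ?P" "p \<in> V" for c p
  proof (rule ccontr)
    assume n: "c \<noteq> pos p"
    have "c \<in> closed_segment (pos p) z" using that Ax by (simp add: closed_segment_commute)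
    then show False using collinear_end off[of "pos p" c] that n by blast
  qed
  have vert: "v \<in> e" if e: "e \<in> ?K (insert x V)" and v: "v \<in> insert x V" "pos' v \<in> ?A' e" for e v
    using edge[OF e]
  proof
    assume eV: "e \<in> ?K V"
    have "v \<noteq> x" using zold[OF eV] v px by auto
    then have "v \<in> V" "pos v \<in> ?A e" using v pV AV[OF eV] by auto
    then show ?thesis using D(6)[OF eV] by blast
  next
    assume "\<exists>p\<in>V. e = {x, p}"
    then obtain p where p: "p \<in> V" "e = {x, p}" by blast
    show ?thesis
    proof (cases "v = x")
      case False
      then have vV: "v \<in> V" using v by auto
      then have "pos v = pos p" using onx[of "pos v" p] p v pV by auto
      then have "v = p" using D(4) vV p by (auto simp: inj_on_def)
      then show ?thesis using p by auto
    qed (use p in auto)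
  qed
  let ?X' = "crossings (insert x V) (?K (insert x V)) pos' ?A'"
  have X': "?X' \<subseteq> ?X \<union> (\<Union>(p, e)\<in>V \<times> ?K V. ?A' {x, p} \<inter> ?A' e)"
  proof
    fix y assume y: "y \<in> ?X'"
    then obtain e f where ef: "e \<in> ?K (insert x V)" "f \<in> ?K (insert x V)" "e \<noteq> f" "y \<in> ?A' e" "y \<in> ?A' f"
      unfolding crossings_def by blast
    have yV: "y \<notin> pos ` V" "y \<noteq> z" using y px imV[of V] unfolding crossings_def by auto
    consider "e \<in> ?K V" "f \<in> ?K V" | p where "p \<in> V" "e = {x, p}" "f \<in> ?K V"
      | p where "p \<in> V" "f = {x, p}" "e \<in> ?K V" | p q where "p \<in> V" "q \<in> V" "e = {x, p}" "f = {x, q}"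
      using edge[OF ef(1)] edge[OF ef(2)] by blast
    then show "y \<in> ?X \<union> (\<Union>(p, e)\<in>V \<times> ?K V. ?A' {x, p} \<inter> ?A' e)"
    proof cases
      case 1
      then have "y \<in> ?A e" "y \<in> ?A f" using ef AV by auto
      then have "y \<in> ?X" unfolding crossings_def using 1 ef(3) yV(1) by blast
      then show ?thesis by blast
    next
      case (2 p)
      then have "(p, f) \<in> V \<times> ?K V" "y \<in> ?A' {x, p} \<inter> ?A' f" using ef by auto
      then show ?thesis by blast
    next
      case (3 p)
      then have "(p, e) \<in> V \<times> ?K V" "y \<in> ?A' {x, p} \<inter> ?A' e" using ef by auto
      then show ?thesis by blast
    next
      case (4 p q)
      then have "y \<in> {z}" using newnew[of p q] ef by blast
      then show ?thesis using yV by blast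
    qed
  qed
  have "finite (?K V)" using D(9) .
  then have finX: "finite ?X'" using D(1,7) newold by (intro finite_subset[OF X']) auto
  have triple: "y \<in> pos' ` insert x V"
    if e: "e \<in> ?K (insert x V)" "f \<in> ?K (insert x V)" "g \<in> ?K (insert x V)" "e \<noteq> f" "f \<noteq> g" "e \<noteq> g"
      and y: "y \<in> ?A' e" "y \<in> ?A' f" "y \<in> ?A' g" for e f g y
  proof -
    have zin: "z \<in> pos' ` insert x V" and im: "pos ` V \<subseteq> pos' ` insert x V" using px imV[of V] by auto
    have two: ?thesis if "p \<in> V" "q \<in> V" "{x, p} \<noteq> {x, q}" "y \<in> ?A' {x, p}" "y \<in> ?A' {x, q}" for p q
    proof -
      have "p \<noteq> q" using that by auto
      then have "y = z" using newnew[of p q] that by blast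
      then show ?thesis using zin by simp
    qed
    have one: ?thesis if "p \<in> V" "h \<in> ?K V" "k \<in> ?K V" "h \<noteq> k" "y \<in> ?A' {x, p}" "y \<in> ?A' h" "y \<in> ?A' k" for p h k
    proof (rule ccontr)
      assume n: "\<not> ?thesis"
      then have yV: "y \<notin> pos ` V" using im by blast
      have "y \<in> ?A h" "y \<in> ?A k" using that AV by auto
      then have "y \<in> ?X" unfolding crossings_def using that(2-4) yV by blast
      then have "y = pos p" using onx[of y p] that by blast
      then show False using yV that by blast
    qed
    have none: ?thesis if "e \<in> ?K V" "f \<in> ?K V" "g \<in> ?K V"
      using D(8)[OF that e(4-6)] AV that y im by blast
    show ?thesis using edge[OF e(1)] edge[OF e(2)] edge[OF e(3)]
    proof (elim disjE bexE, goal_cases)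
      case 1 then show ?case by (rule none)
    next
      case (2 p) show ?case by (rule one[OF 2(3,1,2) e(4)]) (use y 2(4) in simp_all)
    next
      case (3 p) show ?case by (rule one[OF 3(3,1,2) e(6)]) (use y 3(4) in simp_all)
    next
      case (4 p q) show ?case by (rule two[OF 4(2,4)]) (use y e(5) 4(3,5) in simp_all)
    next
      case (5 p) show ?case by (rule one[OF 5(3,1,2) e(5)]) (use y 5(4) in simp_all)
    next
      case (6 p q) show ?case by (rule two[OF 6(2,4)]) (use y e(6) 6(3,5) in simp_all)
    next
      case (7 p q) show ?case by (rule two[OF 7(2,4)]) (use y e(4) 7(3,5) in simp_all)
    next
      case (8 p q r) show ?case by (rule two[OF 8(1,3)]) (use y e(4) 8(2,4) in simp_all)
    qed
  qed
  have "arc_drawing (insert x V) (?K (insert x V)) pos' ?A'"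
    unfolding arc_drawing_def
  proof (intro conjI ballI allI impI subsetI)
    fix e f g y assume "e \<in> ?K (insert x V)" "f \<in> ?K (insert x V)" "g \<in> ?K (insert x V)" "e \<noteq> f" "f \<noteq> g" "e \<noteq> g"
      "y \<in> ?A' e \<inter> ?A' f \<inter> ?A' g"
    then show "y \<in> pos' ` insert x V" using triple[of e f g y] by blast
  qed (use insert.hyps inj arcs vert finX in auto)
  then show ?case by blast
qed

lemma arc_drawing_subset:
  assumes dr: "arc_drawing V E pos A" and "E' \<subseteq> E" shows "arc_drawing V E' pos A"
proof -
  have "crossings V E' pos A \<subseteq> crossings V E pos A" using assms(2) unfolding crossings_def by blast
  then have fin: "finite (crossings V E' pos A)" using arc_drawingD(7)[OF dr] finite_subset by blast
  note D = arc_drawingD[OF dr]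
  have E: "e \<in> E" if "e \<in> E'" for e using assms(2) that by blast
  show ?thesis unfolding arc_drawing_def
  proof (intro conjI ballI allI impI)
    fix e f g assume e: "e \<in> E'" "f \<in> E'" "g \<in> E'" "e \<noteq> f" "f \<noteq> g" "e \<noteq> g"
    show "A e \<inter> A f \<inter> A g \<subseteq> pos ` V" by (rule D(8)[OF E[OF e(1)] E[OF e(2)] E[OF e(3)] e(4-6)])
  next
    fix e v assume "e \<in> E'" "v \<in> V" "pos v \<in> A e"
    then show "v \<in> e" using D(6)[OF E] by blast
  next
    fix e assume "e \<in> E'"
    then show "e \<subseteq> V" "card e = 2" using D(2,3)[OF E] by blast+
  next
    fix v w assume "{v, w} \<in> E'"
    then show "arc_image (A {v, w}) (pos v) (pos w)" using D(5)[OF E] by blast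
  qed (use fin D(1,4) in auto)
qed

text \<open>For an involution the drawing can be pulled back along \<open>\<sigma>\<close> itself
  instead of its inverse. Transpositions suffice for the symmetries needed.\<close>

lemma arc_drawing_transport:
  fixes \<sigma> :: "'a \<Rightarrow> 'a"
  assumes dr: "arc_drawing V E pos A" and inv: "\<And>x. \<sigma> (\<sigma> x) = x"
  shows "arc_drawing (\<sigma> ` V) ((`) \<sigma> ` E) (\<lambda>x. pos (\<sigma> x)) (\<lambda>e. A (\<sigma> ` e))"
    "crossings (\<sigma> ` V) ((`) \<sigma> ` E) (\<lambda>x. pos (\<sigma> x)) (\<lambda>e. A (\<sigma> ` e)) = crossings V E pos A"
proof -
  note D = arc_drawingD[OF dr]
  have inv2: "\<sigma> ` \<sigma> ` e = e" for e using inv by (auto simp: image_iff)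
  have inj: "inj \<sigma>" using inv by (metis injI)
  have pimg: "(\<lambda>x. pos (\<sigma> x)) ` \<sigma> ` V = pos ` V" using inv by (auto simp: image_iff)
  have mem: "e \<in> (`) \<sigma> ` E \<longleftrightarrow> \<sigma> ` e \<in> E" for e using inv2 by (metis imageE image_eqI)
  show X: "crossings (\<sigma> ` V) ((`) \<sigma> ` E) (\<lambda>x. pos (\<sigma> x)) (\<lambda>e. A (\<sigma> ` e)) = crossings V E pos A"
  proof (rule set_eqI)
    fix z
    have "(\<exists>e\<in>(`) \<sigma> ` E. \<exists>f\<in>(`) \<sigma> ` E. e \<noteq> f \<and> z \<in> A (\<sigma> ` e) \<and> z \<in> A (\<sigma> ` f)) \<longleftrightarrow>
      (\<exists>e\<in>E. \<exists>f\<in>E. \<sigma> ` e \<noteq> \<sigma> ` f \<and> z \<in> A e \<and> z \<in> A f)" by (simp add: inv2)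
    also have "\<dots> \<longleftrightarrow> (\<exists>e\<in>E. \<exists>f\<in>E. e \<noteq> f \<and> z \<in> A e \<and> z \<in> A f)" using inj by (simp add: inj_image_eq_iff)
    finally show "z \<in> crossings (\<sigma> ` V) ((`) \<sigma> ` E) (\<lambda>x. pos (\<sigma> x)) (\<lambda>e. A (\<sigma> ` e)) \<longleftrightarrow> z \<in> crossings V E pos A"
      unfolding crossings_def mem_Collect_eq pimg by simp
  qed
  show "arc_drawing (\<sigma> ` V) ((`) \<sigma> ` E) (\<lambda>x. pos (\<sigma> x)) (\<lambda>e. A (\<sigma> ` e))"
    unfolding arc_drawing_def
  proof (intro conjI ballI allI impI subsetI)
    show "finite (\<sigma> ` V)" using D(1) by simp
    show "inj_on (\<lambda>x. pos (\<sigma> x)) (\<sigma> ` V)" using D(4) by (auto simp: inj_on_def inv)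
    show "finite (crossings (\<sigma> ` V) ((`) \<sigma> ` E) (\<lambda>x. pos (\<sigma> x)) (\<lambda>e. A (\<sigma> ` e)))" unfolding X by (rule D(7))
  next
    fix e assume "e \<in> (`) \<sigma> ` E"
    then obtain e0 where e0: "e0 \<in> E" "e = \<sigma> ` e0" by blast
    then show "card e = 2" using D(3)[OF e0(1)] card_image[OF inj_on_subset[OF inj subset_UNIV, of e0]] by simp
    fix x assume "x \<in> e" then show "x \<in> \<sigma> ` V" using D(2)[OF e0(1)] e0 by blast
  next
    fix v w assume "{v, w} \<in> (`) \<sigma> ` E"
    then have "{\<sigma> v, \<sigma> w} \<in> E" using mem[of "{v, w}"] by simp
    then show "arc_image (A (\<sigma> ` {v, w})) (pos (\<sigma> v)) (pos (\<sigma> w))" using D(5) by simp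
  next
    fix e v assume "e \<in> (`) \<sigma> ` E" "v \<in> \<sigma> ` V" "pos (\<sigma> v) \<in> A (\<sigma> ` e)"
    then have "\<sigma> ` e \<in> E" "\<sigma> v \<in> V" "pos (\<sigma> v) \<in> A (\<sigma> ` e)" using mem inv by auto
    then have "\<sigma> v \<in> \<sigma> ` e" using D(6) by blast
    then show "v \<in> e" using inj by (simp add: inj_image_mem_iff)
  next
    fix e f g z assume "e \<in> (`) \<sigma> ` E" "f \<in> (`) \<sigma> ` E" "g \<in> (`) \<sigma> ` E" "e \<noteq> f" "f \<noteq> g" "e \<noteq> g"
      "z \<in> A (\<sigma> ` e) \<inter> A (\<sigma> ` f) \<inter> A (\<sigma> ` g)"
    then have "\<sigma> ` e \<in> E" "\<sigma> ` f \<in> E" "\<sigma> ` g \<in> E" "\<sigma> ` e \<noteq> \<sigma> ` f" "\<sigma> ` f \<noteq> \<sigma> ` g" "\<sigma> ` e \<noteq> \<sigma> ` g"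
      "z \<in> A (\<sigma> ` e) \<inter> A (\<sigma> ` f) \<inter> A (\<sigma> ` g)"
      using mem inj by (simp_all add: inj_image_eq_iff)
    then show "z \<in> (\<lambda>x. pos (\<sigma> x)) ` \<sigma> ` V" unfolding pimg using D(8) by blast
  qed
qed

section \<open>Crossing numbers\<close>

text \<open>Among all arc systems with the given vertex positions one with the fewest crossings is
  chosen; by minimality it can be made tame.\<close>

lemma tame_representative:
  assumes dr: "arc_drawing V E pos A"
  shows "\<exists>A'. arc_drawing V E pos A' \<and> card (crossings V E pos A') \<le> card (crossings V E pos A) \<and>
     (\<forall>z\<in>crossings V E pos A'. \<exists>\<epsilon>. tame_at V E pos A' z \<epsilon>)"
proof -
  obtain B where B: "arc_drawing V E pos B"
    "\<And>A'. arc_drawing V E pos A' \<Longrightarrow> card (crossings V E pos B) \<le> card (crossings V E pos A')"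
    using ex_has_least_nat[of "arc_drawing V E pos" A "\<lambda>A'. card (crossings V E pos A')"] dr by blast
  obtain A' where A': "arc_drawing V E pos A'" "card (crossings V E pos A') = card (crossings V E pos B)"
    "\<forall>z\<in>crossings V E pos A'. \<exists>\<epsilon>. tame_at V E pos A' z \<epsilon>" using tame_normal[OF B] by blast
  have "card (crossings V E pos A') \<le> card (crossings V E pos A)" using B(2)[OF dr] A'(2) by simp
  then show ?thesis using A' by blast
qed

lemma drawing_of_arcs:
  assumes "fin_graph G" "arc_drawing (vertices G) (edges G) pos A"
  shows "\<exists>f. is_drawing G f \<and> card (multiple_points G f) \<le> card (crossings (vertices G) (edges G) pos A)"
proof -
  obtain A' where A': "arc_drawing (vertices G) (edges G) pos A'"
    "card (crossings (vertices G) (edges G) pos A') \<le> card (crossings (vertices G) (edges G) pos A)"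
    "\<forall>z\<in>crossings (vertices G) (edges G) pos A'. \<exists>\<epsilon>. tame_at (vertices G) (edges G) pos A' z \<epsilon>"
    using tame_representative[OF assms(2)] by blast
  obtain f where "is_drawing G f" "multiple_points G f = crossings (vertices G) (edges G) pos A'"
    using arcs_to_drawing[OF assms(1) A'(1)] A'(3) by blast
  then show ?thesis using A'(2) by auto
qed

lemma crossing_number_le:
  assumes "fin_graph G" "arc_drawing (vertices G) (edges G) pos A"
  shows "crossing_number G \<le> card (crossings (vertices G) (edges G) pos A)"
proof -
  obtain f where f: "is_drawing G f" "card (multiple_points G f) \<le> card (crossings (vertices G) (edges G) pos A)"
    using drawing_of_arcs[OF assms] by blast
  have "crossing_number G \<le> card (multiple_points G f)"
    unfolding crossing_number_def by (rule Least_le) (use f in blast)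
  then show ?thesis using f(2) by simp
qed

text \<open>The \<open>LEAST\<close> in \<open>crossing_number\<close> says something only if a
  drawing exists, and straight lines provide one. An optimal drawing then yields arcs with no more
  crossings, while \<open>crossing_number_le\<close> excludes fewer.\<close>

lemma crossing_number_attained:
  assumes G: "fin_graph G"
  shows "\<exists>pos A. arc_drawing (vertices G) (edges G) pos A \<and> card (crossings (vertices G) (edges G) pos A) = crossing_number G"
proof -
  have fin: "finite (vertices G)" and sub: "edges G \<subseteq> {e. e \<subseteq> vertices G \<and> card e = 2}"
    using G unfolding fin_graph_def by auto
  obtain pos where "arc_drawing (vertices G) {e. e \<subseteq> vertices G \<and> card e = 2} pos (\<lambda>e. convex hull (pos ` e))"
    using straight_complete[OF fin] by blast
  then have "arc_drawing (vertices G) (edges G) pos (\<lambda>e. convex hull (pos ` e))" using sub by (rule arc_drawing_subset)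
  then obtain f0 where "is_drawing G f0" using drawing_of_arcs[OF G] by blast
  then have "\<exists>k f. is_drawing G f \<and> card (multiple_points G f) = k" by blast
  then have "\<exists>f. is_drawing G f \<and> card (multiple_points G f) = crossing_number G"
    unfolding crossing_number_def by (rule LeastI_ex)
  then obtain f where f: "is_drawing G f" "card (multiple_points G f) = crossing_number G" by blast
  obtain p A where pA: "arc_drawing (vertices G) (edges G) p A"
    "card (crossings (vertices G) (edges G) p A) \<le> card (multiple_points G f)" using drawing_to_arcs[OF G f(1)] by blast
  then have "card (crossings (vertices G) (edges G) p A) = crossing_number G"
    using crossing_number_le[OF G pA(1)] f(2) by simp
  then show ?thesis using pA(1) by blast
qed

lemma straight_optimal:
  assumes G: "fin_graph G"
  shows "\<exists>pos A rad dir. straight_drawing (vertices G) (edges G) pos A rad dir \<and>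
     card (crossings (vertices G) (edges G) pos A) = crossing_number G"
proof -
  let ?V = "vertices G" and ?E = "edges G"
  obtain pos B where B: "arc_drawing ?V ?E pos B" "card (crossings ?V ?E pos B) = crossing_number G"
    using crossing_number_attained[OF G] by blast
  have "card (crossings ?V ?E pos B) \<le> card (crossings ?V ?E pos A')" if "arc_drawing ?V ?E pos A'" for A'
    using crossing_number_le[OF G that] B(2) by simp
  from star_normal[OF B(1) this order_refl] obtain A where A: "arc_drawing ?V ?E pos A"
    "card (crossings ?V ?E pos A) = crossing_number G" "\<forall>z\<in>crossings ?V ?E pos A. \<exists>\<epsilon>. tame_at ?V ?E pos A z \<epsilon>"
    "\<forall>v\<in>?V. \<exists>\<epsilon> d. star_at ?E pos A v \<epsilon> d" using B(2) by auto
  obtain \<epsilon> dir where star: "\<And>v. v \<in> ?V \<Longrightarrow> star_at ?E pos A v (\<epsilon> v) (dir v)" using A(4) by metis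
  \<comment> \<open>The 1 keeps the set nonempty when there is a single vertex; half of the minimum
    leaves other vertices outside the disk.\<close>
  define m where "m v = Min (insert 1 ((\<lambda>w. dist (pos v) (pos w)) ` (?V - {v})))" for v
  define rad where "rad v = min (\<epsilon> v) (m v / 2)" for v
  have fin: "finite ?V" using arc_drawingD(1)[OF A(1)] .
  have m0: "0 < m v" if "v \<in> ?V" for v
    using that fin arc_drawingD(4)[OF A(1)] unfolding m_def by (auto simp: inj_on_def)
  have rpos: "0 < rad v" if "v \<in> ?V" for v
    using m0[OF that] star[OF that] unfolding rad_def star_at_def by simp
  have "straight_drawing ?V ?E pos A rad dir"
  proof
    show "arc_drawing ?V ?E pos A" by (rule A(1))
    show "star_at ?E pos A v (rad v) (dir v)" if "v \<in> ?V" for v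
      by (rule star_at_mono[OF star[OF that] rpos[OF that]]) (simp add: rad_def)
    show "rad v < dist (pos v) (pos w)" if vw: "v \<in> ?V" "w \<in> ?V" "v \<noteq> w" for v w
    proof -
      have "m v \<le> dist (pos v) (pos w)" unfolding m_def using vw fin by (intro Min_le) auto
      then show ?thesis using m0[OF vw(1)] unfolding rad_def by linarith
    qed
    show "\<exists>\<epsilon>. tame_at ?V ?E pos A z \<epsilon>" if "z \<in> crossings ?V ?E pos A" for z using A(3) that by blast
  qed
  then show ?thesis using A(2) by blast
qed

section \<open>The graphs produced by the two moves\<close>

lemma edges_delta_Y: "edges (delta_Y T v G) = delta_Y_edges T v (edges G)"
  unfolding delta_Y_def delta_Y_edges_def by simp

lemma Y_edges_complete:
  assumes "T \<subseteq> V" "u \<notin> V" shows "edges (delta_Y T u (complete_graph V)) = Y_edges T (V - T) u"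
proof (intro equalityI subsetI)
  fix e assume e: "e \<in> edges (delta_Y T u (complete_graph V))"
  show "e \<in> Y_edges T (V - T) u"
  proof (cases "e \<in> {{u, t} | t. t \<in> T}")
    case False
    then have "e \<subseteq> V" "card e = 2" "\<not> e \<subseteq> T" using e unfolding delta_Y_def complete_graph_def by auto
    then obtain x y where xy: "e = {x, y}" "x \<noteq> y" "x \<in> V" "y \<in> V" "x \<notin> T \<or> y \<notin> T" by (auto simp: card_2_iff)
    consider "x \<in> T" "y \<in> V - T" | "y \<in> T" "x \<in> V - T" | "x \<in> V - T" "y \<in> V - T" using xy by blast
    then show ?thesis
    proof cases
      case 1 then show ?thesis unfolding Y_edges_def xy(1) by blast
    next
      case 2
      have "{x, y} = {y, x}" by (rule insert_commute)
      then show ?thesis unfolding Y_edges_def xy(1) using 2 by blast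
    next
      case 3 then show ?thesis unfolding Y_edges_def xy(1) using xy(2) by blast
    qed
  qed (simp add: Y_edges_def)
next
  fix e assume "e \<in> Y_edges T (V - T) u"
  then consider x y where "e = {x, y}" "x \<in> V - T" "y \<in> V - T" "x \<noteq> y"
    | s x where "e = {s, x}" "s \<in> T" "x \<in> V - T" | s where "e = {u, s}" "s \<in> T"
    unfolding Y_edges_def by blast
  then show "e \<in> edges (delta_Y T u (complete_graph V))"
    using assms by cases (auto simp: delta_Y_def complete_graph_def card_2_iff)
qed

lemma fin_graph_delta_Y:
  assumes "fin_graph G" "T \<subseteq> vertices G" "v \<notin> vertices G" shows "fin_graph (delta_Y T v G)"
proof -
  have "card {v, t} = 2" if "t \<in> T" for t
  proof -
    have "v \<noteq> t" using that assms(2,3) by blast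
    then show ?thesis by simp
  qed
  then show ?thesis using assms unfolding fin_graph_def delta_Y_def by auto
qed

lemma fin_graph_complete: "finite V \<Longrightarrow> fin_graph (complete_graph V)"
  unfolding fin_graph_def complete_graph_def by simp

text \<open>The symmetries of the \<open>Y\<close> graph act transitively on the triangles \<open>{s, x, y}\<close> with one vertex
  in \<open>D\<close> and two in \<open>W\<close>, so all second moves give isomorphic graphs.\<close>

lemma delta_Y_edges_transpose:
  assumes ab: "{a, b} \<subseteq> D \<or> {a, b} \<subseteq> W" and disj: "D \<inter> W = {}" and u: "u \<notin> D \<union> W" "u' \<notin> D \<union> W"
  shows "(`) (Transposition.transpose a b) ` delta_Y_edges T u' (Y_edges D W u) =
     delta_Y_edges (Transposition.transpose a b ` T) u' (Y_edges D W u)"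
proof -
  let ?\<sigma> = "Transposition.transpose a b"
  have inv2: "?\<sigma> ` ?\<sigma> ` e = e" for e by (simp add: image_image)
  have inj: "inj ?\<sigma>" by (metis injI transpose_involutory)
  have D: "?\<sigma> s \<in> D" if "s \<in> D" for s using that ab disj by (auto simp: Transposition.transpose_def)
  have W: "?\<sigma> s \<in> W" if "s \<in> W" for s using that ab disj by (auto simp: Transposition.transpose_def)
  have uu: "?\<sigma> u = u" "?\<sigma> u' = u'" using ab u by (auto simp: Transposition.transpose_def)
  have Y: "?\<sigma> ` e \<in> Y_edges D W u" if "e \<in> Y_edges D W u" for e
  proof -
    consider x y where "e = {x, y}" "x \<in> W" "y \<in> W" "x \<noteq> y"
      | s x where "e = {s, x}" "s \<in> D" "x \<in> W" | s where "e = {u, s}" "s \<in> D"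
      using \<open>e \<in> Y_edges D W u\<close> unfolding Y_edges_def by blast
    then show ?thesis
    proof cases
      case (1 x y)
      have "?\<sigma> x \<noteq> ?\<sigma> y" using 1(4) by (metis transpose_involutory)
      then show ?thesis unfolding 1(1) Y_edges_def using W[OF 1(2)] W[OF 1(3)] by auto
    next
      case (2 s x)
      then show ?thesis unfolding 2(1) Y_edges_def using D[OF 2(2)] W[OF 2(3)] by auto
    next
      case (3 s)
      then show ?thesis unfolding 3(1) Y_edges_def using D[OF 3(2)] uu by auto
    qed
  qed
  have sub: "?\<sigma> ` e \<in> delta_Y_edges (?\<sigma> ` S) u' (Y_edges D W u)" if e: "e \<in> delta_Y_edges S u' (Y_edges D W u)" for e S
  proof (cases "e \<in> {{u', t} | t. t \<in> S}")
    case True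
    then obtain t where "e = {u', t}" "t \<in> S" by blast
    then have "?\<sigma> ` e = {u', ?\<sigma> t}" "?\<sigma> t \<in> ?\<sigma> ` S" using uu by auto
    then show ?thesis unfolding delta_Y_edges_def by blast
  next
    case False
    then have e: "e \<in> Y_edges D W u" "\<not> (e \<subseteq> S \<and> card e = 2)" using e unfolding delta_Y_edges_def by auto
    have "card (?\<sigma> ` e) = card e" using inj by (meson card_image inj_on_subset subset_UNIV)
    moreover have "?\<sigma> ` e \<subseteq> ?\<sigma> ` S \<longleftrightarrow> e \<subseteq> S" using inj by (simp add: inj_image_subset_iff)
    ultimately show ?thesis unfolding delta_Y_edges_def using Y[OF e(1)] e(2) by simp
  qed
  show ?thesis
  proof (intro equalityI subsetI)
    fix e assume "e \<in> (`) ?\<sigma> ` delta_Y_edges T u' (Y_edges D W u)"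
    then show "e \<in> delta_Y_edges (?\<sigma> ` T) u' (Y_edges D W u)" using sub by auto
  next
    fix e assume "e \<in> delta_Y_edges (?\<sigma> ` T) u' (Y_edges D W u)"
    then have "?\<sigma> ` e \<in> delta_Y_edges T u' (Y_edges D W u)" using sub[of e "?\<sigma> ` T"] unfolding inv2 by simp
    then show "e \<in> (`) ?\<sigma> ` delta_Y_edges T u' (Y_edges D W u)" using inv2[of e] by (metis image_eqI)
  qed
qed

lemma drawable_transpose:
  assumes ab: "{a, b} \<subseteq> D \<or> {a, b} \<subseteq> W" and disj: "D \<inter> W = {}" and u: "u \<notin> D \<union> W" "u' \<notin> D \<union> W"
    and dr: "arc_drawing (insert u' (insert u (D \<union> W))) (delta_Y_edges T u' (Y_edges D W u)) pos A"
  shows "\<exists>pos' A'. arc_drawing (insert u' (insert u (D \<union> W))) (delta_Y_edges (Transposition.transpose a b ` T) u' (Y_edges D W u)) pos' A' \<and>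
     crossings (insert u' (insert u (D \<union> W))) (delta_Y_edges (Transposition.transpose a b ` T) u' (Y_edges D W u)) pos' A' =
     crossings (insert u' (insert u (D \<union> W))) (delta_Y_edges T u' (Y_edges D W u)) pos A"
proof -
  let ?\<sigma> = "Transposition.transpose a b" and ?V = "insert u' (insert u (D \<union> W))"
  have "?\<sigma> ` ?V \<subseteq> ?V" using ab u by (auto simp: Transposition.transpose_def)
  moreover have "?\<sigma> ` ?\<sigma> ` ?V = ?V" by (simp add: image_image)
  ultimately have V: "?\<sigma> ` ?V = ?V" by (metis image_mono subset_antisym)
  have "?\<sigma> (?\<sigma> x) = x" for x by simp
  from arc_drawing_transport[OF dr this] show ?thesis
    unfolding V delta_Y_edges_transpose[OF ab disj u] by blast
qed

lemma drawable_triangle: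
  assumes disj: "D \<inter> W = {}" and u: "u \<notin> D \<union> W" "u' \<notin> D \<union> W"
    and s: "s \<in> D" "s' \<in> D" and x: "x \<in> W" "y \<in> W" "x \<noteq> y" and x': "x' \<in> W" "y' \<in> W" "x' \<noteq> y'"
    and dr: "arc_drawing (insert u' (insert u (D \<union> W))) (delta_Y_edges {s, x, y} u' (Y_edges D W u)) pos A"
  shows "\<exists>pos' A'. arc_drawing (insert u' (insert u (D \<union> W))) (delta_Y_edges {s', x', y'} u' (Y_edges D W u)) pos' A' \<and>
     crossings (insert u' (insert u (D \<union> W))) (delta_Y_edges {s', x', y'} u' (Y_edges D W u)) pos' A' =
     crossings (insert u' (insert u (D \<union> W))) (delta_Y_edges {s, x, y} u' (Y_edges D W u)) pos A"
proof -
  let ?V = "insert u' (insert u (D \<union> W))" and ?E = "\<lambda>T. delta_Y_edges T u' (Y_edges D W u)"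
  have T1: "Transposition.transpose s s' ` {s, x, y} = {s', x, y}"
    using s x disj by (auto simp: Transposition.transpose_def)
  \<comment> \<open>Exchanging \<open>x\<close> and \<open>x'\<close> displaces \<open>y\<close>
    exactly if \<open>y = x'\<close>, so its image has to be tracked.\<close>
  define y1 where "y1 = Transposition.transpose x x' y"
  have y1: "y1 \<in> W" "y1 \<noteq> x'" using x x' unfolding y1_def by (auto simp: Transposition.transpose_def)
  have T2: "Transposition.transpose x x' ` {s', x, y} = {s', x', y1}"
    using s x x' disj unfolding y1_def by (auto simp: Transposition.transpose_def)
  have T3: "Transposition.transpose y1 y' ` {s', x', y1} = {s', x', y'}"
    using s x' y1 disj by (auto simp: Transposition.transpose_def)
  have "{s, s'} \<subseteq> D \<or> {s, s'} \<subseteq> W" using s by blast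
  from drawable_transpose[OF this disj u dr] obtain p1 A1
    where 1: "arc_drawing ?V (?E {s', x, y}) p1 A1" "crossings ?V (?E {s', x, y}) p1 A1 = crossings ?V (?E {s, x, y}) pos A"
    unfolding T1 by blast
  have "{x, x'} \<subseteq> D \<or> {x, x'} \<subseteq> W" using x x' by blast
  from drawable_transpose[OF this disj u 1(1)] obtain p2 A2
    where 2: "arc_drawing ?V (?E {s', x', y1}) p2 A2" "crossings ?V (?E {s', x', y1}) p2 A2 = crossings ?V (?E {s', x, y}) p1 A1"
    unfolding T2 by blast
  have "{y1, y'} \<subseteq> D \<or> {y1, y'} \<subseteq> W" using x' y1 by blast
  from drawable_transpose[OF this disj u 2(1)] obtain p3 A3
    where 3: "arc_drawing ?V (?E {s', x', y'}) p3 A3" "crossings ?V (?E {s', x', y'}) p3 A3 = crossings ?V (?E {s', x', y1}) p2 A2"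
    unfolding T3 by blast
  show ?thesis using 1(2) 2(2) 3 by metis
qed

theorem theorem2:
  fixes V :: "'a set" and n :: nat and \<delta> \<delta>' :: "'a set" and u u' :: 'a
    and G1 G2 :: "'a ugraph"
  assumes "n \<ge> 7"
    and "finite V" and "card V = n"
    and "three_cycle (complete_graph V) \<delta>"
    and "u \<notin> V"
    and "G1 = delta_Y \<delta> u (complete_graph V)"
    and "three_cycle (complete_graph V) \<delta>'"
    and "card (\<delta> \<inter> \<delta>') = 1"
    and "u' \<notin> vertices G1"
    and "G2 = delta_Y \<delta>' u' G1"
  shows "crossing_number G2 < crossing_number G1"
proof (rule ccontr)
  assume "\<not> ?thesis"
  then have le: "crossing_number G1 \<le> crossing_number G2" by simp
  define W where "W = V - \<delta>"
  have \<delta>: "\<delta> \<subseteq> V" "card \<delta> = 3" "\<delta>' \<subseteq> V" "card \<delta>' = 3" using assms(4,7) unfolding three_cycle_def complete_graph_def by auto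
  have fin: "finite \<delta>" "finite \<delta>'" "finite W" using \<delta> assms(2) finite_subset unfolding W_def by auto
  have VW: "V = \<delta> \<union> W" "\<delta> \<inter> W = {}" using \<delta> unfolding W_def by auto
  have "card W = n - 3" unfolding W_def using \<delta> fin assms(3) by (simp add: card_Diff_subset)
  then have W4: "4 \<le> card W" using assms(1) by simp
  obtain a where a: "\<delta> \<inter> \<delta>' = {a}" using assms(8) by (auto simp: card_1_singleton_iff)
  have "a \<in> \<delta>'" using a by blast
  then have "card (\<delta>' - {a}) = 2" using \<delta>(4) fin(2) by (simp add: card_Diff_singleton)
  then obtain d e where de: "\<delta>' - {a} = {d, e}" "d \<noteq> e" by (auto simp: card_2_iff)
  have \<delta>': "\<delta>' = {a, d, e}" "a \<in> \<delta>" "d \<in> W" "e \<in> W"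
    using a de \<delta> unfolding W_def by blast+
  have V1: "vertices G1 = insert u (\<delta> \<union> W)" unfolding assms(6) delta_Y_def complete_graph_def using VW by simp
  have E1: "edges G1 = Y_edges \<delta> W u" unfolding assms(6) W_def by (rule Y_edges_complete[OF \<delta>(1) assms(5)])
  have V2: "vertices G2 = insert u' (insert u (\<delta> \<union> W))" unfolding assms(10) delta_Y_def using V1 by simp
  have E2: "edges G2 = delta_Y_edges {a, d, e} u' (Y_edges \<delta> W u)" unfolding assms(10) edges_delta_Y E1 \<delta>'(1) ..
  have un: "u \<notin> \<delta> \<union> W" "u' \<notin> \<delta> \<union> W" using assms(5,9) V1 VW by auto
  have u'1: "u' \<notin> vertices G1" by (rule assms(9))
  have G1: "fin_graph G1" unfolding assms(6)
    by (intro fin_graph_delta_Y fin_graph_complete assms(2)) (use \<delta> assms(5) in \<open>auto simp: complete_graph_def\<close>)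
  have G2: "fin_graph G2" unfolding assms(10)
    by (intro fin_graph_delta_Y G1 u'1) (use \<delta>(3) V1 VW in auto)
  obtain pos A rad dir where sd: "straight_drawing (vertices G1) (edges G1) pos A rad dir"
    and opt: "card (crossings (vertices G1) (edges G1) pos A) = crossing_number G1" using straight_optimal[OF G1] by blast
  interpret S: straight_drawing "vertices G1" "edges G1" pos A rad dir by (rule sd)
  let ?X = "crossings (vertices G1) (edges G1) pos A"
  have edge: "{v, w} \<in> edges G1" if "s \<in> \<delta>" "x \<in> W" "y \<in> W" "x \<noteq> y" "v \<in> {s, x, y}" "w \<in> {s, x, y}" "v \<noteq> w" for s x y v w
  proof -
    have "{s, x} \<in> edges G1" "{s, y} \<in> edges G1" "{x, y} \<in> edges G1" unfolding E1 Y_edges_def using that by blast+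
    then show ?thesis using that(5-7) by (auto simp: insert_commute)
  qed
  \<comment> \<open>The surgery produces drawings for a move on any triangle with one vertex in
    \<open>\<delta>\<close>. By symmetry such a drawing carries over to \<open>G2\<close>, which by
    assumption needs at least as many crossings as \<open>G1\<close>.\<close>
  have lower: "card ?X \<le> card (crossings (insert u' (vertices G1)) (delta_Y_edges {v, p, q} u' (edges G1)) pos' A')"
    if t: "s \<in> \<delta>" "x \<in> W" "y \<in> W" "x \<noteq> y" "{v, p, q} = {s, x, y}"
      and dr: "arc_drawing (insert u' (vertices G1)) (delta_Y_edges {v, p, q} u' (edges G1)) pos' A'" for v p q s x y pos' A'
  proof -
    note dr' = dr[unfolded V1 E1 t(5)]
    from drawable_triangle[OF VW(2) un t(1) \<delta>'(2) t(2-4) \<delta>'(3,4) de(2) dr']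
    obtain p2 A2 where 2: "arc_drawing (vertices G2) (edges G2) p2 A2"
      "crossings (vertices G2) (edges G2) p2 A2 = crossings (insert u' (vertices G1)) (delta_Y_edges {v, p, q} u' (edges G1)) pos' A'"
      unfolding V1 V2 E1 E2 t(5) by blast
    show ?thesis using crossing_number_le[OF G2 2(1)] 2(2) le opt by simp
  qed
  have tri: "v \<noteq> p \<and> v \<noteq> q \<and> p \<noteq> q" if "s \<in> \<delta>" "x \<in> W" "y \<in> W" "x \<noteq> y" "{v, p, q} = {s, x, y}" for v p q s x y
  proof -
    have "s \<noteq> x" "s \<noteq> y" using that VW(2) by auto
    then have "card {v, p, q} = 3" using that(4,5) by simp
    then show ?thesis by (auto simp: card_insert_if split: if_splits)
  qed
  have corner: "S.cr {p, q} \<le> card {e. {v, e} \<in> edges G1 \<and> e \<noteq> p \<and> e \<noteq> q \<and> sepr (S.ang v p) (S.ang v q) (S.ang v e) (S.ang v w)}"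
    if t: "s \<in> \<delta>" "x \<in> W" "y \<in> W" "x \<noteq> y" "{v, p, q} = {s, x, y}" and w: "{v, w} \<in> edges G1" "w \<noteq> p" "w \<noteq> q"
    for v p q w s x y
  proof -
    have mem: "v \<in> {s, x, y}" "p \<in> {s, x, y}" "q \<in> {s, x, y}" using t(5) by blast+
    have ne: "v \<noteq> p" "v \<noteq> q" "p \<noteq> q" using tri[OF t] by auto
    have ed: "{v, p} \<in> edges G1" "{v, q} \<in> edges G1" "{p, q} \<in> edges G1"
      using edge[OF t(1-4) mem(1,2) ne(1)] edge[OF t(1-4) mem(1,3) ne(2)] edge[OF t(1-4) mem(2,3) ne(3)] by auto
    from S.delta_corner[OF ed u'1 w] obtain pos' A' where
      "arc_drawing (insert u' (vertices G1)) (delta_Y_edges {v, p, q} u' (edges G1)) pos' A'"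
      and le: "card (crossings (insert u' (vertices G1)) (delta_Y_edges {v, p, q} u' (edges G1)) pos' A') + S.cr {p, q}
        \<le> card ?X + card {e. {v, e} \<in> edges G1 \<and> e \<noteq> p \<and> e \<noteq> q \<and> sepr (S.ang v p) (S.ang v q) (S.ang v e) (S.ang v w)}" by blast
    from lower[OF t this(1)] le show ?thesis by linarith
  qed
  have nocross: "\<not> S.cross {v, p} {v, q}"
    if t: "s \<in> \<delta>" "x \<in> W" "y \<in> W" "x \<noteq> y" "{v, p, q} = {s, x, y}" for v p q s x y
  proof
    assume "S.cross {v, p} {v, q}"
    then obtain z where z: "z \<in> ?X" "z \<in> A {v, p}" "z \<in> A {v, q}" unfolding S.cross_def by blast
    have mem: "v \<in> {s, x, y}" "p \<in> {s, x, y}" "q \<in> {s, x, y}" using t(5) by blast+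
    have ne: "v \<noteq> p" "v \<noteq> q" "p \<noteq> q" using tri[OF t] by auto
    have ed: "{v, p} \<in> edges G1" "{v, q} \<in> edges G1" "{p, q} \<in> edges G1"
      using edge[OF t(1-4) mem(1,2) ne(1)] edge[OF t(1-4) mem(1,3) ne(2)] edge[OF t(1-4) mem(2,3) ne(3)] by auto
    from delta_uncross[OF S.dr ed u'1 z] obtain pos' A' where
      "arc_drawing (insert u' (vertices G1)) (delta_Y_edges {v, p, q} u' (edges G1)) pos' A'"
      and less: "card (crossings (insert u' (vertices G1)) (delta_Y_edges {v, p, q} u' (edges G1)) pos' A') < card ?X" by blast
    from lower[OF t this(1)] less show False by linarith
  qed
  \<comment> \<open>The predicate of the locale comes with its defined parameters expanded; folding
    recovers \<open>edges G1\<close> and \<open>S.simple_cycle\<close>.\<close>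
  have "rotation_drawing \<delta> W u S.cr S.cross S.ang S.gs S.vin"
    unfolding rotation_drawing_def E1[symmetric] S.simple_cycle_def[symmetric]
  proof (intro conjI allI impI)
    show "card \<delta> = 3" "finite W" "4 \<le> card W" "\<delta> \<inter> W = {}" "u \<notin> \<delta>" "u \<notin> W" using \<delta> fin W4 VW un by auto
    show "S.cross f e" if "S.cross e f" for e f by (rule S.cross_sym[OF that])
    show "\<not> S.cross e e" for e by (simp add: S.cross_def)
    show "1 \<le> S.cr e" if "S.cross e f" for e f by (rule S.cross_cr[OF that])
    show "2 \<le> S.cr e" if "S.cross e f" "S.cross e g" "f \<noteq> g" for e f g by (rule S.cross_cr2[OF that])
    show "x = y" if "{v, x} \<in> edges G1" "{v, y} \<in> edges G1" "S.ang v x = S.ang v y" for v x y by (rule S.ang_inj[OF that])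
    show "0 \<le> S.ang v x" "S.ang v x < 2 * pi" for v x by (rule S.ang_range)+
    show "S.cr {p, q} \<le> card {e. {v, e} \<in> edges G1 \<and> e \<noteq> p \<and> e \<noteq> q \<and> sepr (S.ang v p) (S.ang v q) (S.ang v e) (S.ang v w)}"
      if t: "s \<in> \<delta>" "x \<in> W" "y \<in> W" "x \<noteq> y" "{v, p, q} = {s, x, y}" "{v, w} \<in> edges G1" "w \<noteq> p" "w \<noteq> q"
      for v p q w s x y by (rule corner[OF t])
    show "\<not> S.cross {v, p} {v, q}" if t: "s \<in> \<delta>" "x \<in> W" "y \<in> W" "x \<noteq> y" "{v, p, q} = {s, x, y}" for v p q s x y
      by (rule nocross[OF t])
    show "S.gs (cycle_edges vs) v w = S.vin (cycle_edges vs) v" if "S.simple_cycle vs" "v \<notin> set vs" "{v, w} \<in> edges G1" for vs v w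
      by (rule S.gs_vin[OF that])
    show "(S.gs (cycle_edges (v # p # vs)) v x = S.gs (cycle_edges (v # p # vs)) v y) =
        (\<not> sepr (S.ang v p) (S.ang v (last (p # vs))) (S.ang v x) (S.ang v y))"
      if "S.simple_cycle (v # p # vs)" "{v, x} \<in> edges G1" "{v, y} \<in> edges G1" "x \<noteq> p" "y \<noteq> p"
        "x \<noteq> last (p # vs)" "y \<noteq> last (p # vs)" for v p vs x y
      by (rule S.sector_sides[OF that(1) refl that(2-7)])
    show "S.gs (cycle_edges vs) v w = S.gs (cycle_edges vs) w v"
      if "S.simple_cycle vs" "{v, w} \<in> edges G1" "{v, w} \<notin> cycle_edges vs" "\<forall>f\<in>cycle_edges vs. \<not> S.cross {v, w} f" for vs v w
      by (rule S.gs_nocross[OF that])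
    show "S.gs (cycle_edges vs) v w \<noteq> S.gs (cycle_edges vs) w v"
      if "S.simple_cycle vs" "{v, w} \<in> edges G1" "{v, w} \<notin> cycle_edges vs" "f \<in> cycle_edges vs" "S.cross {v, w} f"
        "S.cr f \<le> 1" "\<forall>g\<in>cycle_edges vs. g \<noteq> f \<longrightarrow> \<not> S.cross {v, w} g" for vs v w f
      by (rule S.gs_onecross[OF that])
  qed
  then show False by (rule rotation_drawing.contradiction)
qed

end
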